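(* Let $d,m\in\mathbb{N}$ with $d\ge 2$, let $\Omega\subset\mathbb{R}^d$ be an open, bounded Lipschitz domain, and let $E_\epsilon^{\mathcal{A}}(\chi;F)$ be the energy associated (see context) with the generalized Saint-Venant operator $\mathcal{A}(D)$ of order $m$ acting on $\mathrm{Sym}(\mathbb{R}^d;m)$-valued fields. Then the following hold. (1) (Sharp scaling bounds for $d=2$, $\lambda=\frac12$.) Let $d=2$ and $\Omega=(0,1)^2$. Let $A,B\in\mathrm{Sym}(\mathbb{R}^2;m)$ satisfy $A-B=e_1^{\odot l_1}\odot e_2^{\odot l_2}$ with integers $l_1,l_2\ge 0$, $l_1+l_2=m$, let $F=\frac12A+\frac12B$ and $L:=\max\{l_1,l_2\}$. Then there exist constants $C>1$ and $\epsilon_0>0$ (depending on $m$) such that for any $\epsilon\in(0,\epsilon_0)$ $$C^{-1}\epsilon^{\frac{2L}{2L+1}}\le\inf_{\chi\in BV(\Omega;\{A,B\})}E_\epsilon^{\mathcal{A}}(\chi;F)\le C\epsilon^{\frac{2L}{2L+1}}.$$ (2) (Lower scaling bounds for $d\ge2$.) Let $A,B\in\mathrm{Sym}(\mathbb{R}^d;m)$ satisfy $A-B=e_1^{\odot l_1}\odot e_2^{\odot l_2}\odot\cdots\odot e_d^{\odot l_d}$ with integers $l_j\ge0$, $\sum_{j=1}^d l_j=m$, let $\lambda\in(0,1)$, $F_\lambda:=\lambda A+(1-\lambda)B$ and $L:=\max_{j\in\{1,\dots,d\}}l_j$. Then there exist $C>0$ (depending on $d,m,\Omega$) and $\epsilon_0>0$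 (depending on $d,m,\Omega,\lambda$) such that for any $\epsilon\in(0,\epsilon_0)$ $$C\min\{1-\lambda,\lambda\}^2\,\epsilon^{\frac{2L}{2L+1}}\le\inf_{\chi\in BV(\Omega;\{A,B\})}E_\epsilon^{\mathcal{A}}(\chi;F_\lambda).$$
   Context: $T^m(\mathbb{R}^d)=(\mathbb{R}^d)^{\otimes m}$ is the space of $m$-tensors and $\mathrm{Sym}(\mathbb{R}^d;m)\subset T^m(\mathbb{R}^d)$ the subspace of symmetric $m$-tensors (with the Euclidean norm); $e_1,\dots,e_d$ is the canonical basis of $\mathbb{R}^d$. For vectors, $v^1\odot\dots\odot v^m:=\frac1{m!}\sum_{\tau\in\mathfrak{S}_m}v^{\tau(1)}\otimes\dots\otimes v^{\tau(m)}$, and $e_k^{\odot j}$ is the symmetric product of $j$ copies of $e_k$ (factors with exponent $0$ are omitted). The generalized Saint-Venant operator $\mathcal{A}(D)$ maps $u:\mathbb{R}^d\to\mathrm{Sym}(\mathbb{R}^d;m)$ to the $T^{2m}(\mathbb{R}^d)$-valued field $$[\mathcal{A}(D)u]_{i_1j_1\dots i_mj_m}=\alpha_{i_1j_1}\circ\dots\circ\alpha_{i_mj_m}\big(\partial^m_{j_1\dots j_m}u_{i_1\dots i_m}\big),$$ where $\alpha_{i_kj_k}$ is antisymmetrization in the pair of indices $i_k,j_k$ (half of the expression minus the expression with $i_k$ and $j_k$ exchanged). It is extended to distributions by duality. For $F\in\mathrm{Sym}(\mathbb{R}^d;m)$ let $$\mathcal{D}_F:=\{u\in L^2_{loc}(\mathbb{R}^d;\mathrm{Sym}(\mathbb{R}^d;m)):\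 \mathcal{A}(D)u=0\text{ in }\mathcal{D}'(\mathbb{R}^d),\ u=F\text{ in }\mathbb{R}^d\setminus\overline\Omega\},$$ and for $\epsilon>0$ and $\chi\in BV(\Omega;\{A,B\})$ ($BV$ functions with values in $\{A,B\}$) let $$E_\epsilon^{\mathcal{A}}(\chi;F):=\inf_{u\in\mathcal{D}_F}\int_\Omega|u-\chi|^2\,dx+\epsilon\int_\Omega|\nabla\chi|,$$ where $\int_\Omega|\nabla\chi|$ is the total variation of the distributional gradient of $\chi$ in $\Omega$. *)

theory Defs
  imports "HOL-Analysis.Analysis"
begin

text \<open>
  The order \<open>m\<close> and the dimension \<open>d\<close> are cardinalities of finite, linearly ordered index types
  \<open>'m\<close> and \<open>'d\<close>. An \<open>m\<close>-tensor is a vector indexed by the multi-indices \<open>(i\<^sub>1, ..., i\<^sub>m)\<close>, i.e. by the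
  functions \<open>'m \<Rightarrow> 'd\<close>, so its library norm is the Euclidean norm.
\<close>

type_synonym ('m, 'd) tensor = "real ^ ('m \<Rightarrow> 'd)"

definition Sym :: "('m::finite, 'd::finite) tensor set" where
  "Sym = {T. \<forall>\<tau>. \<tau> permutes UNIV \<longrightarrow> (\<forall>i. T $ (i \<circ> \<tau>) = T $ i)}"

definition tensor_prod :: "('m::finite \<Rightarrow> real ^ 'd) \<Rightarrow> ('m, 'd::finite) tensor" where
  "tensor_prod v = (\<chi> i. \<Prod>k\<in>UNIV. v k $ i k)"

definition sym_prod :: "('m::finite \<Rightarrow> real ^ 'd) \<Rightarrow> ('m, 'd::finite) tensor" where
  "sym_prod v = (1 / fact CARD('m)) *\<^sub>R (\<Sum>\<tau> | \<tau> permutes UNIV. tensor_prod (v \<circ> \<tau>))"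

text \<open>
  \<open>basis_factors l\<close> lists \<open>l\<^sub>1\<close> copies of \<open>e\<^sub>1\<close>, then \<open>l\<^sub>2\<close> copies of \<open>e\<^sub>2\<close>, and so on. If the exponents add
  up to \<open>m\<close>, the factor at position \<open>k\<close> is the entry with index \<open>card {..<k}\<close>, and \<open>sym_basis_prod l\<close>
  is the symmetric product of all of them. By symmetry it does not depend on the orders on \<open>'m\<close>, \<open>'d\<close>.
\<close>

definition basis_factors :: "('d \<Rightarrow> nat) \<Rightarrow> (real ^ 'd::{finite,linorder}) list" where
  "basis_factors l = concat (map (\<lambda>a. replicate (l a) (axis a 1)) (sorted_list_of_set UNIV))"

definition sym_basis_prod ::
  "('d \<Rightarrow> nat) \<Rightarrow> ('m::{finite,linorder}, 'd::{finite,linorder}) tensor" where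
  "sym_basis_prod l = sym_prod (\<lambda>k. basis_factors l ! card {..<k})"

definition partial :: "'d \<Rightarrow> (real ^ 'd::finite \<Rightarrow> real) \<Rightarrow> real ^ 'd \<Rightarrow> real" where
  "partial a f x = frechet_derivative f (at x) (axis a 1)"

definition partials :: "'d list \<Rightarrow> (real ^ 'd::finite \<Rightarrow> real) \<Rightarrow> real ^ 'd \<Rightarrow> real" where
  "partials = foldr partial"

text \<open>All iterated partial derivatives being differentiable means being of class \<open>C\<^sup>\<infinity>\<close>.\<close>

definition test_functions :: "(real ^ 'd::finite) set \<Rightarrow> (real ^ 'd \<Rightarrow> real) set" where
  "test_functions \<Omega> = {\<phi>. (\<forall>as x. partials as \<phi> differentiable (at x)) \<and>
     (\<exists>K. compact K \<and> K \<subseteq> \<Omega> \<and> (\<forall>x. x \<notin> K \<longrightarrow> \<phi> x = 0))}"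

text \<open>
  A \<open>2m\<close>-tensor is written as a function of \<open>(i\<^sub>1, ..., i\<^sub>m)\<close> and \<open>(j\<^sub>1, ..., j\<^sub>m)\<close>; \<open>antisym k\<close> is the
  antisymmetrization in the pair \<open>i\<^sub>k, j\<^sub>k\<close>.
\<close>

definition antisym ::
  "'m \<Rightarrow> (('m \<Rightarrow> 'd) \<Rightarrow> ('m \<Rightarrow> 'd) \<Rightarrow> real) \<Rightarrow> ('m \<Rightarrow> 'd) \<Rightarrow> ('m \<Rightarrow> 'd) \<Rightarrow> real" where
  "antisym k G i j = (G i j - G (i(k := j k)) (j(k := i k))) / 2"

text \<open>The distribution \<open>\<partial>\<^sup>m u\<^sub>i / \<partial>x\<^sub>j\<^sub>1 ... \<partial>x\<^sub>j\<^sub>m\<close> applied to the test function \<open>\<phi>\<close>.\<close>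

definition distr_deriv ::
  "(real ^ 'd \<Rightarrow> ('m::{finite,linorder}, 'd::finite) tensor) \<Rightarrow> (real ^ 'd \<Rightarrow> real)
    \<Rightarrow> ('m \<Rightarrow> 'd) \<Rightarrow> ('m \<Rightarrow> 'd) \<Rightarrow> real" where
  "distr_deriv u \<phi> i j = (-1) ^ CARD('m) *
     (LINT x|lebesgue. u x $ i * partials (map j (sorted_list_of_set UNIV)) \<phi> x)"

text \<open>The distribution \<open>[\<A>(D)u]\<close> with indices \<open>i\<^sub>1 j\<^sub>1 ... i\<^sub>m j\<^sub>m\<close> applied to \<open>\<phi>\<close>.\<close>

definition saint_venant ::
  "(real ^ 'd \<Rightarrow> ('m::{finite,linorder}, 'd::finite) tensor) \<Rightarrow> (real ^ 'd \<Rightarrow> real)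
    \<Rightarrow> ('m \<Rightarrow> 'd) \<Rightarrow> ('m \<Rightarrow> 'd) \<Rightarrow> real" where
  "saint_venant u \<phi> = foldr antisym (sorted_list_of_set UNIV) (distr_deriv u \<phi>)"

definition L2_loc :: "(real ^ 'd::finite \<Rightarrow> 'a::euclidean_space) set" where
  "L2_loc = {u. u \<in> borel_measurable lebesgue \<and>
     (\<forall>K. compact K \<longrightarrow> set_integrable lebesgue K (\<lambda>x. (norm (u x))\<^sup>2))}"

definition admissible ::
  "(real ^ 'd) set \<Rightarrow> ('m, 'd) tensor
    \<Rightarrow> (real ^ 'd \<Rightarrow> ('m::{finite,linorder}, 'd::finite) tensor) set" where
  "admissible \<Omega> F = {u \<in> L2_loc. (\<forall>x. u x \<in> Sym) \<and>
     (\<forall>\<phi> \<in> test_functions UNIV. \<forall>i j. saint_venant u \<phi> i j = 0) \<and>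
     (AE x in lebesgue. x \<notin> closure \<Omega> \<longrightarrow> u x = F)}"

text \<open>
  Total variation in \<open>\<Omega>\<close> of the distributional gradient, with the Euclidean norm on \<open>\<real>\<^sup>n \<otimes> \<real>\<^sup>d\<close>.
  Negative integrals are truncated by \<open>ennreal\<close>, which is harmless since \<open>\<psi> = 0\<close> competes.
\<close>

definition total_variation ::
  "(real ^ 'd::finite) set \<Rightarrow> (real ^ 'd \<Rightarrow> real ^ 'n::finite) \<Rightarrow> ennreal" where
  "total_variation \<Omega> f =
     (SUP \<psi> \<in> {\<psi> :: real ^ 'd \<Rightarrow> (real ^ 'd) ^ 'n.
         (\<forall>i a. (\<lambda>x. \<psi> x $ i $ a) \<in> test_functions \<Omega>) \<and> (\<forall>x. norm (\<psi> x) \<le> 1)}.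
       ennreal (LINT x:\<Omega>|lebesgue.
         (\<Sum>i\<in>UNIV. f x $ i * (\<Sum>a\<in>UNIV. partial a (\<lambda>y. \<psi> y $ i $ a) x))))"

text \<open>Functions on \<open>\<Omega>\<close> are total functions whose values outside \<open>\<Omega>\<close> are ignored.\<close>

definition BV :: "(real ^ 'd::finite) set \<Rightarrow> (real ^ 'n) set \<Rightarrow> (real ^ 'd \<Rightarrow> real ^ 'n::finite) set" where
  "BV \<Omega> S = {f. (\<forall>x\<in>\<Omega>. f x \<in> S) \<and> set_integrable lebesgue \<Omega> f \<and> total_variation \<Omega> f < \<infinity>}"

definition energy ::
  "(real ^ 'd) set \<Rightarrow> real \<Rightarrow> (real ^ 'd \<Rightarrow> ('m, 'd) tensor)
    \<Rightarrow> ('m::{finite,linorder}, 'd::finite) tensor \<Rightarrow> ennreal" where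
  "energy \<Omega> eps chi F =
     (INF u \<in> admissible \<Omega> F. (\<integral>\<^sup>+x\<in>\<Omega>. (ennreal ((norm (u x - chi x))\<^sup>2)) \<partial>lebesgue))
       + ennreal eps * total_variation \<Omega> chi"

text \<open>
  Locally, after a rotation taking the last coordinate axis to \<open>\<nu>\<close>, the set is the subgraph of a
  Lipschitz function of the remaining coordinates \<open>x - (x \<bullet> \<nu>) \<nu>\<close>. Connectedness is not required.
\<close>

definition lipschitz_domain :: "('a::euclidean_space) set \<Rightarrow> bool" where
  "lipschitz_domain \<Omega> \<longleftrightarrow> open \<Omega> \<and> \<Omega> \<noteq> {} \<and>
     (\<forall>p \<in> frontier \<Omega>. \<exists>r > 0. \<exists>\<nu> M. \<exists>g :: 'a \<Rightarrow> real. norm \<nu> = 1 \<and> M-lipschitz_on UNIV g \<and>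
        \<Omega> \<inter> ball p r = {x \<in> ball p r. x \<bullet> \<nu> < g (x - (x \<bullet> \<nu>) *\<^sub>R \<nu>)})"

end

theory Submission
  imports Defs "HOL-Computational_Algebra.Polynomial"
begin

text \<open>
  Write \<open>D = A - B\<close>. A phase field \<open>\<chi>\<close> with values in \<open>{A, B}\<close> has the form \<open>F + f D\<close> with a scalar \<open>f\<close>
  that takes the values \<open>1 - \<lambda>\<close> and \<open>-\<lambda>\<close>, and \<open>D = e\<^sub>1\<^bsup>\<odot>l\<^sub>1\<^esup> \<odot> ... \<odot> e\<^sub>d\<^bsup>\<odot>l\<^sub>d\<^esup>\<close> has nonzero components exactly at
  the indices in which each \<open>c\<close> occurs \<open>l\<^sub>c\<close> times.

  Lower bound. Every admissible \<open>u\<close> equals \<open>F\<close> outside the closure of the domain, whose boundary is negligible, so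
  testing the Saint-Venant equation is testing an identity for \<open>u - F\<close> on the domain
  (\<open>admissible_identity\<close>). For directions \<open>a \<noteq> b\<close> pair an index \<open>i\<close> of \<open>D\<close> with the index \<open>j\<close> that has
  \<open>b\<close> where \<open>i\<close> has \<open>a\<close>, and \<open>a\<close> elsewhere. All components that enter with \<open>D \<noteq> 0\<close> have the same sign, so \<open>f\<close>
  tested with \<open>\<partial>\<^sub>a\<^bsup>m-l\<^sub>a\<^esup> \<partial>\<^sub>b\<^bsup>l\<^sub>a\<^esup> \<Phi>\<close> is bounded by the elastic distance \<open>\<surd>E\<close> times the derivatives of order \<open>m\<close> of \<open>\<Phi>\<close>
  (\<open>elastic_estimate\<close>). Instead of Fourier multipliers, dyadic kernels are used: a kernel \<open>r\<close> of mass one is chosen such that the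
  difference of two consecutive dilations is an \<open>m\<close>-th derivative (\<open>exists_moment_kernel\<close>). Hence the difference of
  two consecutive product kernels is a sum of blocks, each of which is an \<open>m\<close>-th derivative in one direction
  \<open>a\<close>. Of these, \<open>m - l\<^sub>a\<close> derivatives are used up by the equation, and the remaining \<open>l\<^sub>a \<le> L\<close> derivatives cost \<open>2\<^bsup>nL\<^esup>\<close>
  at scale \<open>2\<^bsup>-n\<^esup>\<close> (\<open>block_estimate\<close>). The total variation \<open>V\<close> bounds the same block by \<open>2\<^bsup>-n\<^esup> V\<close>
  (\<open>surface_estimate\<close>). Summing the first bound over coarse scales and the second over fine scales against a
  continuous weight that approximates the sign of \<open>f\<close> gives
  \<open>min \<lambda> (1 - \<lambda>) \<le> C (2\<^bsup>nL\<^esup> \<surd>E + 2\<^bsup>-n\<^esup> V)\<close> for all large \<open>n\<close> (\<open>coercivity\<close>), and \<open>2\<^bsup>-n\<^esup> \<approx> \<epsilon>\<^bsup>1/(2L+1)\<^esup>\<close> gives the scaling.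

  Upper bound in two dimensions. Let \<open>a\<close> be the index with \<open>l\<^sub>a = L\<close>. The field
  \<open>u = F + p D + (-1)\<^bsup>L+1\<^esup> q e\<^sub>b\<^bsup>\<odot>m\<^esup>\<close> satisfies the Saint-Venant equation as soon as \<open>\<partial>\<^sub>b\<^sup>L p = \<partial>\<^sub>a\<^sup>L q\<close>
  (\<open>saint_venant_field\<close>). The coefficient \<open>p\<close> takes the values \<open>1/2\<close> and \<open>-1/2\<close> in rows of cells, which double in
  number from strip to strip towards the sides \<open>x\<^sub>b = 0\<close> and \<open>x\<^sub>b = 1\<close>, and is closed to zero in a thin last strip. Each cell carries a
  Thue-Morse sign pattern; its moments of order below \<open>L\<close> vanish, and this makes the corrector \<open>q\<close> vanish outside the
  cell. The pattern moves between the rows along smooth interfaces, which is why \<open>q\<close> can be written down explicitly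
  (\<open>compat_interface\<close>). A strip of height \<open>H\<close> with cells of width \<open>w\<close> costs the elastic energy \<open>H (w/H)\<^bsup>2L\<^esup>\<close> and the
  surface \<open>1 + H/w\<close> up to constants. For \<open>2\<^sup>M\<close> cells in the first row, heights proportional to \<open>(\<rho>/2)\<^sup>n\<close> with
  \<open>\<rho>\<^bsup>2L\<^esup> = 1/2\<close>, and about \<open>2LM\<close> strips, these sum up to \<open>2\<^bsup>-2LM\<^esup>\<close> and \<open>2\<^sup>M\<close>, up to constants (\<open>strip_sums\<close>). The energy is thus at
  most \<open>C (2\<^bsup>-2LM\<^esup> + \<epsilon> 2\<^sup>M)\<close>, and \<open>2\<^bsup>-M\<^esup> \<approx> \<epsilon>\<^bsup>1/(2L+1)\<^esup>\<close> gives the scaling.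
\<close>

section \<open>Smooth functions of one variable\<close>

text \<open>Functions of class \<open>C\<^sup>\<infinity>\<close> on the line, in terms of the total function \<open>deriv\<close>.\<close>

definition smooth :: "(real \<Rightarrow> real) \<Rightarrow> bool" where
  "smooth g \<longleftrightarrow> (\<forall>n t. (deriv ^^ n) g differentiable (at t))"

lemma smooth_DERIV: "smooth g \<Longrightarrow> (g has_field_derivative deriv g t) (at t)"
  unfolding smooth_def by (metis funpow_0 DERIV_deriv_iff_real_differentiable)

lemma deriv_eqI: "(\<And>t. (f has_field_derivative f' t) (at t)) \<Longrightarrow> deriv f = f'"
  using DERIV_imp_deriv by blast

lemma smooth_deriv: "smooth g \<Longrightarrow> smooth (deriv g)"
  unfolding smooth_def by (metis funpow_Suc_right o_apply)

lemma smooth_funpow: "smooth g \<Longrightarrow> smooth ((deriv ^^ n) g)"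
  by (induction n) (auto intro: smooth_deriv)

lemma DERIV_funpow: "smooth g \<Longrightarrow> ((deriv ^^ n) g has_field_derivative (deriv ^^ Suc n) g t) (at t)"
  using smooth_DERIV[OF smooth_funpow, of g n t] by simp

lemma smooth_continuous: "smooth g \<Longrightarrow> continuous_on S g"
  by (meson DERIV_isCont continuous_at_imp_continuous_on smooth_DERIV)

lemma funpow_continuous: "smooth g \<Longrightarrow> continuous_on S ((deriv ^^ n) g)"
  by (intro smooth_continuous smooth_funpow)

lemma deriv_funpow_Suc: "(deriv ^^ Suc n) g = (deriv ^^ n) (deriv g)"
  by (simp add: funpow_swap1)

text \<open>Smoothness by coinduction: a class of functions that is closed under differentiation
  consists of smooth functions.\<close>

lemma smooth_coinduct:
  assumes "X g" and "\<And>g. X g \<Longrightarrow> \<exists>g'. X g' \<and> (\<forall>t. (g has_field_derivative g' t) (at t))"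
  shows "smooth g"
proof -
  have step: "X (deriv g)" if "X g" for g
  proof -
    from assms(2)[OF that] obtain g' where "X g'" "\<forall>t. (g has_field_derivative g' t) (at t)" by blast
    moreover from this have "deriv g = g'" using DERIV_imp_deriv by blast
    ultimately show ?thesis by simp
  qed
  have "X ((deriv ^^ n) g)" for n by (induction n) (auto simp: assms(1) step)
  with assms(2) show ?thesis unfolding smooth_def by (metis real_differentiable_def)
qed

inductive smooth_generated :: "(real \<Rightarrow> real) \<Rightarrow> bool" where
  "smooth f \<Longrightarrow> smooth_generated f"
| "smooth_generated f \<Longrightarrow> smooth_generated g \<Longrightarrow> smooth_generated (\<lambda>t. f t + g t)"
| "smooth_generated f \<Longrightarrow> smooth_generated g \<Longrightarrow> smooth_generated (\<lambda>t. f t * g t)"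

lemma smooth_generated_DERIV:
  "smooth_generated f \<Longrightarrow> \<exists>f'. smooth_generated f' \<and> (\<forall>t. (f has_field_derivative f' t) (at t))"
proof (induction rule: smooth_generated.induct)
  case (1 f)
  then show ?case using smooth_DERIV smooth_deriv smooth_generated.intros(1) by blast
next
  case (2 f g)
  then obtain f' g' where "smooth_generated f'" "\<forall>t. (f has_field_derivative f' t) (at t)"
     "smooth_generated g'" "\<forall>t. (g has_field_derivative g' t) (at t)" by blast
  then show ?case
    by (intro exI[of _ "\<lambda>t. f' t + g' t"]) (auto intro: smooth_generated.intros derivative_intros)
next
  case (3 f g)
  then obtain f' g' where *: "smooth_generated f'" "\<forall>t. (f has_field_derivative f' t) (at t)"
     "smooth_generated g'" "\<forall>t. (g has_field_derivative g' t) (at t)" by blast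
  have "smooth_generated (\<lambda>t. f' t * g t + f t * g' t)"
    using 3 * by (intro smooth_generated.intros(2,3))
  moreover have "\<forall>t. ((\<lambda>t. f t * g t) has_field_derivative f' t * g t + f t * g' t) (at t)"
    using * by (auto intro!: derivative_eq_intros)
  ultimately show ?case by blast
qed

lemma smooth_generated_imp_smooth: "smooth_generated f \<Longrightarrow> smooth f"
  by (rule smooth_coinduct[of smooth_generated]) (auto intro: smooth_generated_DERIV)

lemma smooth_add: "smooth f \<Longrightarrow> smooth g \<Longrightarrow> smooth (\<lambda>t. f t + g t)"
  using smooth_generated_imp_smooth smooth_generated.intros(1,2) by metis

lemma smooth_mult: "smooth f \<Longrightarrow> smooth g \<Longrightarrow> smooth (\<lambda>t. f t * g t)"
  using smooth_generated_imp_smooth smooth_generated.intros(1,3) by metis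

lemma smooth_const: "smooth (\<lambda>t. c)"
proof (rule smooth_coinduct[of "\<lambda>g. \<exists>c. g = (\<lambda>t. c)"])
  fix g :: "real \<Rightarrow> real" assume "\<exists>c. g = (\<lambda>t. c)"
  then have "\<forall>t. (g has_field_derivative 0) (at t)" by auto
  then show "\<exists>g'. (\<exists>c. g' = (\<lambda>t. c)) \<and> (\<forall>t. (g has_field_derivative g' t) (at t))"
    by (intro exI[of _ "\<lambda>t. 0"]) auto
qed auto

lemma smooth_cmult: "smooth f \<Longrightarrow> smooth (\<lambda>t. c * f t)"
  by (intro smooth_mult smooth_const)

lemma smooth_diff: "smooth f \<Longrightarrow> smooth g \<Longrightarrow> smooth (\<lambda>t. f t - g t)"
  using smooth_add[OF _ smooth_cmult[of g "-1"], of f] by simp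

lemma smooth_sum: "(\<And>i. i \<in> I \<Longrightarrow> smooth (f i)) \<Longrightarrow> smooth (\<lambda>t. \<Sum>i\<in>I. f i t)"
  by (induction I rule: infinite_finite_induct) (auto intro: smooth_const smooth_add)

lemma smooth_power: "smooth f \<Longrightarrow> smooth (\<lambda>t. f t ^ n)"
  by (induction n) (auto intro: smooth_const smooth_mult)

lemma smooth_affine:
  assumes "smooth f" shows "smooth (\<lambda>t. f (a * t + b))"
proof (rule smooth_coinduct[of "\<lambda>g. \<exists>f c. smooth f \<and> g = (\<lambda>t. c * f (a * t + b))"])
  show "\<exists>f' c. smooth f' \<and> (\<lambda>t. f (a * t + b)) = (\<lambda>t. c * f' (a * t + b))"
    using assms by (intro exI[of _ f] exI[of _ 1]) auto
next
  fix g assume "\<exists>f c. smooth f \<and> g = (\<lambda>t. c * f (a * t + b))"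
  then obtain f c where f: "smooth f" and g: "g = (\<lambda>t. c * f (a * t + b))" by blast
  have "(g has_field_derivative (c * a) * deriv f (a * t + b)) (at t)" for t
    unfolding g by (rule derivative_eq_intros DERIV_chain'[OF _ smooth_DERIV[OF f]] | simp)+
  then show "\<exists>g'. (\<exists>f c. smooth f \<and> g' = (\<lambda>t. c * f (a * t + b))) \<and>
      (\<forall>t. (g has_field_derivative g' t) (at t))"
    using smooth_deriv[OF f] by (intro exI[of _ "\<lambda>t. (c * a) * deriv f (a * t + b)"]) blast
qed

lemma funpow_deriv_affine:
  assumes "smooth f"
  shows "(deriv ^^ n) (\<lambda>t. f (a * t + b)) = (\<lambda>t. a ^ n * (deriv ^^ n) f (a * t + b))"
proof (induction n)
  case (Suc n)
  have "((\<lambda>t. a ^ n * (deriv ^^ n) f (a * t + b)) has_field_derivative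
      a ^ Suc n * (deriv ^^ Suc n) f (a * t + b)) (at t)" for t
    by (rule derivative_eq_intros DERIV_chain'[OF _ DERIV_funpow[OF assms]] | simp)+
  then show ?case using Suc by (simp add: deriv_eqI)
qed simp

lemma funpow_deriv_add:
  assumes "smooth f" "smooth g"
  shows "(deriv ^^ n) (\<lambda>t. f t + g t) = (\<lambda>t. (deriv ^^ n) f t + (deriv ^^ n) g t)"
proof (induction n)
  case (Suc n)
  have "((\<lambda>t. (deriv ^^ n) f t + (deriv ^^ n) g t) has_field_derivative
      (deriv ^^ Suc n) f t + (deriv ^^ Suc n) g t) (at t)" for t
    by (intro derivative_intros DERIV_funpow assms)
  then show ?case using Suc by (simp add: deriv_eqI)
qed simp

lemma funpow_deriv_cmult:
  assumes "smooth f"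
  shows "(deriv ^^ n) (\<lambda>t. c * f t) = (\<lambda>t. c * (deriv ^^ n) f t)"
proof (induction n)
  case (Suc n)
  have "((\<lambda>t. c * (deriv ^^ n) f t) has_field_derivative c * (deriv ^^ Suc n) f t) (at t)" for t
    by (rule derivative_eq_intros DERIV_funpow assms | simp)+
  then show ?case using Suc by (simp add: deriv_eqI)
qed simp

lemma funpow_deriv_diff:
  assumes "smooth f" "smooth g"
  shows "(deriv ^^ n) (\<lambda>t. f t - g t) = (\<lambda>t. (deriv ^^ n) f t - (deriv ^^ n) g t)"
  using funpow_deriv_add[OF assms(1) smooth_cmult[OF assms(2)], of n "-1"]
    funpow_deriv_cmult[OF assms(2), of n "-1"] by simp

lemma funpow_deriv_const: "(deriv ^^ Suc n) (\<lambda>t. c :: real) = (\<lambda>t. 0)"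
  by (induction n) auto

lemma funpow_deriv_const0: "(deriv ^^ n) (\<lambda>t. 0 :: real) = (\<lambda>t. 0)"
  by (cases n) (auto simp only: funpow_deriv_const funpow_0)

lemma funpow_deriv_sum:
  assumes "\<And>i. i \<in> I \<Longrightarrow> smooth (f i)"
  shows "(deriv ^^ n) (\<lambda>t. \<Sum>i\<in>I. f i t) = (\<lambda>t. \<Sum>i\<in>I. (deriv ^^ n) (f i) t)"
  using assms
  by (induction I rule: infinite_finite_induct)
    (auto simp: funpow_deriv_const0 funpow_deriv_add smooth_sum)

text \<open>Derivatives are determined locally.\<close>

lemma funpow_deriv_cong_open:
  assumes "smooth f" "smooth g" "open U" "\<And>t. t \<in> U \<Longrightarrow> f t = g t" "t \<in> U"
  shows "(deriv ^^ n) f t = (deriv ^^ n) g t"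
  using assms(5)
proof (induction n arbitrary: t)
  case (Suc n)
  have "((deriv ^^ n) g has_field_derivative (deriv ^^ Suc n) f t) (at t)"
    by (rule has_field_derivative_transform_within_open[OF DERIV_funpow[OF assms(1)] assms(3) Suc.prems])
       (use Suc.IH in auto)
  then show ?case using DERIV_funpow[OF assms(2), of n t] DERIV_unique by blast
qed (use assms in auto)

text \<open>The functions \<open>p(1/t) exp(-1/t)\<close>, extended by zero to \<open>t \<le> 0\<close>, form a class closed under
  differentiation.\<close>

definition exp_flat :: "real poly \<Rightarrow> real \<Rightarrow> real" where
  "exp_flat p t = (if t > 0 then poly p (1 / t) * exp (- (1 / t)) else 0)"

lemma poly_exp_tendsto_0: "((\<lambda>u::real. u ^ k * poly p u * exp (- u)) \<longlongrightarrow> 0) at_top"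
proof (induction p arbitrary: k)
  case 0 then show ?case by simp
next
  case (pCons a p)
  have 1: "((\<lambda>u::real. u ^ k * exp (- u)) \<longlongrightarrow> 0) at_top"
    using tendsto_power_div_exp_0[of k] by (simp add: exp_minus field_simps)
  have "((\<lambda>u::real. a * (u ^ k * exp (- u)) + u ^ Suc k * poly p u * exp (- u)) \<longlongrightarrow> a * 0 + 0) at_top"
    by (intro tendsto_intros 1 pCons)
  then show ?case by (simp add: algebra_simps)
qed

lemma exp_flat_DERIV:
  "(exp_flat p has_field_derivative exp_flat ([:0, 0, 1:] * (p - pderiv p)) t) (at t)"
proof -
  consider "t > 0" | "t < 0" | "t = 0" by linarith
  then show ?thesis
  proof cases
    case 1
    have 1: "((\<lambda>t. 1 / t) has_field_derivative - (1 / t\<^sup>2)) (at t)"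
      using \<open>t > 0\<close> by (auto intro!: derivative_eq_intros simp: power2_eq_square)
    have "((\<lambda>t. poly p (1 / t) * exp (- (1 / t))) has_field_derivative
        poly p (1 / t) * (exp (- (1 / t)) * - (- (1 / t\<^sup>2)))
          + poly (pderiv p) (1 / t) * - (1 / t\<^sup>2) * exp (- (1 / t))) (at t)"
      using DERIV_mult[OF DERIV_chain2[OF poly_DERIV 1] DERIV_fun_exp[OF DERIV_minus[OF 1]]]
      by (simp add: add.commute mult.commute)
    also have "poly p (1 / t) * (exp (- (1 / t)) * - (- (1 / t\<^sup>2)))
          + poly (pderiv p) (1 / t) * - (1 / t\<^sup>2) * exp (- (1 / t))
        = exp_flat ([:0, 0, 1:] * (p - pderiv p)) t"
      using \<open>t > 0\<close> by (simp add: exp_flat_def power2_eq_square algebra_simps)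
    finally have "((\<lambda>t. poly p (1 / t) * exp (- (1 / t))) has_field_derivative
        exp_flat ([:0, 0, 1:] * (p - pderiv p)) t) (at t)" .
    then show ?thesis
      by (rule has_field_derivative_transform_within_open[where S = "{0<..}"])
         (use \<open>t > 0\<close> in \<open>auto simp: exp_flat_def\<close>)
  next
    case 2
    have "((\<lambda>t. 0) has_field_derivative exp_flat ([:0, 0, 1:] * (p - pderiv p)) t) (at t)"
      using 2 by (auto simp: exp_flat_def)
    then show ?thesis
      by (rule has_field_derivative_transform_within_open[where S = "{..<0}"])
         (use 2 in \<open>auto simp: exp_flat_def\<close>)
  next
    case 3
    have "((\<lambda>h. exp_flat p h / h) \<longlongrightarrow> 0) (at_left 0)"
      by (rule tendsto_eventually) (auto simp: eventually_at_filter exp_flat_def)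
    moreover have "((\<lambda>h. exp_flat p h / h) \<longlongrightarrow> 0) (at_right 0)"
    proof -
      have "((\<lambda>h. (inverse h) ^ 1 * poly p (inverse h) * exp (- inverse h)) \<longlongrightarrow> 0) (at_right (0::real))"
        by (rule filterlim_compose[OF poly_exp_tendsto_0 filterlim_inverse_at_top_right])
      moreover have "\<forall>\<^sub>F h in at_right (0::real).
          (inverse h) ^ 1 * poly p (inverse h) * exp (- inverse h) = exp_flat p h / h"
        by (auto simp: eventually_at_filter exp_flat_def field_simps)
      ultimately show ?thesis by (rule Lim_transform_eventually)
    qed
    ultimately have "((\<lambda>h. exp_flat p h / h) \<longlongrightarrow> 0) (at 0)"
      by (simp add: filterlim_at_split)
    then show ?thesis using 3 by (simp add: DERIV_def exp_flat_def)
  qed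
qed

lemma smooth_exp_flat: "smooth (exp_flat p)"
  by (rule smooth_coinduct[of "\<lambda>g. \<exists>p. g = exp_flat p"]) (use exp_flat_DERIV in auto)

text \<open>Smooth functions supported in \<open>[-R, R]\<close>.\<close>

definition compact_smooth :: "real \<Rightarrow> (real \<Rightarrow> real) \<Rightarrow> bool" where
  "compact_smooth R g \<longleftrightarrow> smooth g \<and> (\<forall>t. t \<notin> {-R..R} \<longrightarrow> g t = 0)"

lemma compact_smooth_smooth: "compact_smooth R g \<Longrightarrow> smooth g"
  by (simp add: compact_smooth_def)

lemma compact_smooth_zero: "compact_smooth R g \<Longrightarrow> t \<notin> {-R..R} \<Longrightarrow> g t = 0"
  by (simp add: compact_smooth_def)

lemma compact_smooth_mono: "compact_smooth R g \<Longrightarrow> R \<le> R' \<Longrightarrow> compact_smooth R' g"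
  by (auto simp: compact_smooth_def)

lemma compact_smooth_deriv: "compact_smooth R g \<Longrightarrow> compact_smooth R (deriv g)"
proof -
  assume g: "compact_smooth R g"
  have "deriv g t = 0" if "t \<notin> {-R..R}" for t
    using funpow_deriv_cong_open[of g "\<lambda>t. 0" "- {-R..R}" t 1] g that
    by (auto simp: compact_smooth_def smooth_const open_Compl)
  with g show ?thesis by (auto simp: compact_smooth_def smooth_deriv)
qed

lemma compact_smooth_funpow: "compact_smooth R g \<Longrightarrow> compact_smooth R ((deriv ^^ n) g)"
  by (induction n) (auto intro: compact_smooth_deriv)

lemma compact_smooth_diff: "compact_smooth R f \<Longrightarrow> compact_smooth R g \<Longrightarrow> compact_smooth R (\<lambda>t. f t - g t)"
  by (auto simp: compact_smooth_def smooth_diff)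
lemma compact_smooth_cmult: "compact_smooth R f \<Longrightarrow> compact_smooth R (\<lambda>t. c * f t)"
  by (auto simp: compact_smooth_def smooth_cmult)

lemma compact_smooth_integrable: "compact_smooth R g \<Longrightarrow> integrable lborel g"
proof -
  assume g: "compact_smooth R g"
  have "set_integrable lborel {-R..R} g"
    using g by (intro borel_integrable_atLeastAtMost')
      (auto simp: compact_smooth_def smooth_continuous)
  moreover have "(\<lambda>t. indicator {-R..R} t *\<^sub>R g t) = g"
    using g by (auto simp: compact_smooth_def indicator_def fun_eq_iff)
  ultimately show ?thesis by (simp add: set_integrable_def)
qed

text \<open>The \<open>L\<^sup>1\<close> norm on the line.\<close>

definition L1 :: "(real \<Rightarrow> real) \<Rightarrow> real" where
  "L1 g = (LINT t|lborel. \<bar>g t\<bar>)"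

lemma L1_nonneg: "0 \<le> L1 g" by (simp add: L1_def)

lemma L1_triangle:
  assumes "compact_smooth R f" "compact_smooth R g"
  shows "L1 (\<lambda>t. f t - g t) \<le> L1 f + L1 g"
proof -
  have "L1 (\<lambda>t. f t - g t) \<le> (LINT t|lborel. \<bar>f t\<bar> + \<bar>g t\<bar>)"
    unfolding L1_def using assms[THEN compact_smooth_integrable]
    by (intro integral_mono) auto
  also have "\<dots> = L1 f + L1 g"
    unfolding L1_def using assms[THEN compact_smooth_integrable] by simp
  finally show ?thesis .
qed

lemma L1_affine: "c \<noteq> 0 \<Longrightarrow> L1 (\<lambda>t. f (c * t + b)) = L1 f / \<bar>c\<bar>"
  using lborel_integral_real_affine[of c "\<lambda>t. \<bar>f t\<bar>" b] by (simp add: L1_def add.commute)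

lemma L1_cmult: "L1 (\<lambda>t. c * f t) = \<bar>c\<bar> * L1 f"
  by (simp add: L1_def abs_mult)

lemma compact_smooth_set_integrable:
  "compact_smooth R g \<Longrightarrow> S \<in> sets lborel \<Longrightarrow> set_integrable lborel S g"
  unfolding set_integrable_def by (intro integrable_mult_indicator compact_smooth_integrable)

lemma compact_smooth_primitive:
  assumes g: "compact_smooth R g"
  shows "((\<lambda>t. LINT s:{..t}|lborel. g s) has_field_derivative g t) (at t)"
proof -
  define G where "G = (\<lambda>t. LINT s:{..t}|lborel. g s)"
  define a where "a = min t (-R) - 1"
  have sm: "smooth g" using g by (simp add: compact_smooth_def)
  note int = compact_smooth_set_integrable[OF g]
  have 0: "G a = 0"
    unfolding G_def set_lebesgue_integral_def
    by (rule integral_eq_zero_AE) (use g in \<open>auto intro!: AE_I2 simp: a_def compact_smooth_def indicator_def min_def split: if_splits\<close>)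
  have split: "G u = (LBINT s=a..u. g s)" if "a \<le> u" for u
  proof -
    have "G u = (LINT s:{..a} \<union> {a<..u}|lborel. g s)"
      unfolding G_def using that by (intro arg_cong[where f = "\<lambda>S. LINT s:S|lborel. g s"]) auto
    also have "\<dots> = G a + (LINT s:{a<..u}|lborel. g s)"
      unfolding G_def by (intro set_integral_Un int) auto
    also have "(LINT s:{a<..u}|lborel. g s) = (LBINT s=a..u. g s)"
      using that by (simp add: interval_integral_Ioc)
    finally show ?thesis using 0 by simp
  qed
  have "((\<lambda>u. LBINT s=a..u. g s) has_field_derivative g t) (at t within {a..t+1})"
    unfolding has_real_derivative_iff_has_vector_derivative
    by (rule interval_integral_FTC2[of a a "t+1"]) (auto simp: a_def intro: smooth_continuous[OF sm])
  then have "((\<lambda>u. LBINT s=a..u. g s) has_field_derivative g t) (at t within {a<..<t+1})"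
    by (rule DERIV_subset) auto
  then have "((\<lambda>u. LBINT s=a..u. g s) has_field_derivative g t) (at t)"
    by (subst (asm) at_within_open) (auto simp: a_def)
  then have "(G has_field_derivative g t) (at t)"
  proof (rule has_field_derivative_transform_within_open[where S = "{a<..<t+1}"])
    show "(LBINT s=a..u. g s) = G u" if "u \<in> {a<..<t+1}" for u
      using split[of u] that by simp
  qed (auto simp: a_def)
  then show ?thesis by (simp add: G_def)
qed

lemma compact_smooth_primitive_smooth:
  assumes g: "compact_smooth R g"
  shows "smooth (\<lambda>t. LINT s:{..t}|lborel. g s)"
  by (rule smooth_coinduct[of "\<lambda>h. h = (\<lambda>t. LINT s:{..t}|lborel. g s) \<or> smooth h"])
     (use compact_smooth_primitive[OF g] compact_smooth_smooth[OF g] smooth_DERIV smooth_deriv in blast)+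

lemma compact_smooth_primitive_left:
  assumes "compact_smooth R g" "t < -R" shows "(LINT s:{..t}|lborel. g s) = 0"
  unfolding set_lebesgue_integral_def
  by (rule integral_eq_zero_AE) (use assms in \<open>auto intro!: AE_I2 simp: compact_smooth_def indicator_def\<close>)

lemma compact_smooth_primitive_right:
  assumes "compact_smooth R g" "t \<ge> R" shows "(LINT s:{..t}|lborel. g s) = (LINT s|lborel. g s)"
  unfolding set_lebesgue_integral_def
  by (intro Bochner_Integration.integral_cong)
     (use assms in \<open>auto simp: compact_smooth_def indicator_def\<close>)

text \<open>Antiderivatives of functions of mean zero have compact support.\<close>

lemma compact_smooth_antideriv:
  assumes g: "compact_smooth R g" and mean: "(LINT t|lborel. g t) = 0" and R: "0 \<le> R"
  obtains G where "compact_smooth R G" "deriv G = g" "L1 G \<le> 2 * R * L1 g"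
proof -
  define G where "G = (\<lambda>t. LINT s:{..t}|lborel. g s)"
  have G: "compact_smooth R G"
    using compact_smooth_primitive_smooth[OF g] compact_smooth_primitive_left[OF g]
      compact_smooth_primitive_right[OF g] mean
    by (auto simp: compact_smooth_def not_le G_def)
  have bd: "\<bar>G t\<bar> \<le> L1 g" for t
  proof -
    have "\<bar>G t\<bar> \<le> (LINT s|lborel. \<bar>indicator {..t} s *\<^sub>R g s\<bar>)"
      unfolding G_def set_lebesgue_integral_def by (rule integral_abs_bound)
    also have "\<dots> \<le> (LINT s|lborel. \<bar>g s\<bar>)"
      using compact_smooth_set_integrable[OF g, of "{..t}"] compact_smooth_integrable[OF g]
      unfolding set_integrable_def
      by (intro integral_mono) (auto simp: indicator_def)
    finally show ?thesis by (simp add: L1_def)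
  qed
  have "L1 G \<le> (LINT t|lborel. indicator {-R..R} t * L1 g)"
    unfolding L1_def[of G]
  proof (rule integral_mono)
    show "integrable lborel (\<lambda>t. indicator {-R..R} t * L1 g)"
      by (intro integrable_mult_left integrable_real_indicator)
         (auto simp: emeasure_lborel_Icc_eq)
  qed (use compact_smooth_integrable[OF G] bd G in \<open>auto simp: indicator_def compact_smooth_def\<close>)
  also have "\<dots> = 2 * R * L1 g" using R by simp
  finally show ?thesis
    using that[OF G deriv_eqI] compact_smooth_primitive[OF g] by (simp add: G_def)
qed

text \<open>A nonnegative bump on \<open>(0, 1)\<close> of mass one.\<close>

lemma exists_bump:
  obtains \<beta> where "smooth \<beta>" "\<And>t. \<beta> t \<ge> 0" "\<And>t. t \<notin> {0..1} \<Longrightarrow> \<beta> t = 0" "(LINT t|lborel. \<beta> t) = 1"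
proof -
  define h where "h = (\<lambda>t. exp_flat 1 t * exp_flat 1 ((-1) * t + 1))"
  have sm: "smooth h" unfolding h_def by (intro smooth_mult smooth_affine smooth_exp_flat)
  have nn: "h t \<ge> 0" for t by (auto simp: h_def exp_flat_def)
  have out: "h t = 0" if "t \<notin> {0..1}" for t using that by (auto simp: h_def exp_flat_def)
  have h: "compact_smooth 1 h" using sm out by (auto simp: compact_smooth_def)
  have "(LINT t|lborel. h t) \<noteq> 0"
  proof
    assume "(LINT t|lborel. h t) = 0"
    then have "AE t in lborel. h t = 0"
      using nn compact_smooth_integrable[OF h] by (subst (asm) integral_nonneg_eq_0_iff_AE) auto
    then obtain t where "t \<in> {0<..<1}" "h t = 0"
    proof -
      assume ae: "AE t in lborel. h t = 0"
      have "\<exists>t. t \<in> {0<..<1} \<and> h t = 0"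
      proof (rule ccontr)
        assume "\<not> (\<exists>t. t \<in> {0<..<1} \<and> h t = 0)"
        with ae have "AE t in lborel. t \<notin> {0<..<1::real}" by (auto elim!: eventually_mono)
        then have "{0<..<1::real} \<in> null_sets lborel"
          using AE_iff_null_sets[of "{0<..<1::real}" lborel] by simp
        then have "emeasure lborel {0<..<1::real} = 0" by blast
        then show False by simp
      qed
      with that show ?thesis by blast
    qed
    then show False by (auto simp: h_def exp_flat_def)
  qed
  moreover define I where "I = (LINT t|lborel. h t)"
  ultimately have I: "I > 0" using nn by (simp add: order_less_le integral_nonneg)
  show ?thesis
  proof (rule that)
    show "smooth (\<lambda>t. (1 / I) * h t)" by (rule smooth_cmult[OF sm])
  qed (use nn out I in \<open>auto simp: I_def[symmetric]\<close>)
qed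

text \<open>A smooth monotone step from \<open>0\<close> to \<open>1\<close>.\<close>

lemma exists_smooth_step:
  obtains S where "smooth S" "mono S" "\<And>t. t \<le> 0 \<Longrightarrow> S t = 0" "\<And>t. t \<ge> 1 \<Longrightarrow> S t = 1"
proof -
  obtain \<beta> where \<beta>: "smooth \<beta>" "\<And>t. \<beta> t \<ge> 0" "\<And>t. t \<notin> {0..1} \<Longrightarrow> \<beta> t = 0" "(LINT t|lborel. \<beta> t) = 1"
    by (rule exists_bump) blast
  have cs: "compact_smooth 1 \<beta>" using \<beta> by (auto simp: compact_smooth_def)
  define S where "S = (\<lambda>t. LINT s:{..t}|lborel. \<beta> s)"
  have d: "(S has_field_derivative \<beta> t) (at t)" for t
    unfolding S_def by (rule compact_smooth_primitive[OF cs])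
  show ?thesis
  proof (rule that)
    show "smooth S" unfolding S_def by (rule compact_smooth_primitive_smooth[OF cs])
    show "mono S"
    proof (rule monoI)
      fix x y :: real assume "x \<le> y"
      then show "S x \<le> S y"
        by (rule DERIV_nonneg_imp_nondecreasing) (use d \<beta>(2) in blast)
    qed
    show "S t = 1" if "t \<ge> 1" for t
      using compact_smooth_primitive_right[OF cs that] \<beta>(4) by (simp add: S_def)
    show "S t = 0" if "t \<le> 0" for t
      unfolding S_def set_lebesgue_integral_def
    proof (rule integral_eq_zero_AE)
      have "AE s in lborel. s \<noteq> (0::real)" by (rule AE_lborel_singleton)
      then show "AE s in lborel. indicator {..t} s *\<^sub>R \<beta> s = 0"
        by eventually_elim (use \<beta>(3) that in \<open>auto simp: indicator_def\<close>)
    qed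
  qed
qed

section \<open>A family of kernels whose differences are high derivatives\<close>

lemma compact_smooth_scale2:
  assumes "compact_smooth R g" "R \<ge> 0" "a \<ge> 1"
  shows "compact_smooth R (\<lambda>t. c * g (a * t))"
proof -
  have "smooth (\<lambda>t. c * g (a * t + 0))"
    using assms by (intro smooth_cmult smooth_affine compact_smooth_smooth)
  moreover have "a * t \<notin> {-R..R}" if "t \<notin> {-R..R}" for t
  proof -
    have "\<bar>t\<bar> > R" using that by auto
    also have "\<bar>t\<bar> \<le> a * \<bar>t\<bar>" using assms by (simp add: mult_le_cancel_right1)
    also have "\<dots> = \<bar>a * t\<bar>" using assms by (simp add: abs_mult)
    finally show ?thesis by auto
  qed
  ultimately show ?thesis using assms by (auto simp: compact_smooth_def)
qed

lemma exists_antideriv_of_dilation_difference: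
  assumes g: "compact_smooth R g" and R: "R \<ge> 0"
  obtains G where "compact_smooth R G" "deriv G = (\<lambda>t. 2 * g (2 * t) - g t)"
proof -
  have cs: "compact_smooth R (\<lambda>t. 2 * g (2 * t))" by (rule compact_smooth_scale2) (use g R in auto)
  have cs2: "compact_smooth R (\<lambda>t. 2 * g (2 * t) - g t)" by (intro compact_smooth_diff cs g)
  have "(LINT t|lborel. 2 * g (2 * t) - g t) = (LINT t|lborel. 2 * g (2 * t)) - (LINT t|lborel. g t)"
    using compact_smooth_integrable[OF cs] compact_smooth_integrable[OF g] by simp
  also have "\<dots> = 0" using lborel_integral_real_affine[of 2 g 0] by simp
  finally show ?thesis using compact_smooth_antideriv[OF cs2 _ R] that by blast
qed

text \<open>A kernel of mass one whose difference with its rescaling by \<open>1/2\<close> is an \<open>m\<close>-th derivative.\<close>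

lemma exists_moment_kernel:
  assumes "m \<ge> 1"
  shows "\<exists>r \<kappa>. compact_smooth 1 r \<and> compact_smooth 1 \<kappa> \<and> (LINT t|lborel. r t) = 1 \<and>
     (\<forall>t. 2 * r (2 * t) - r t = (deriv ^^ m) \<kappa> t)"
  using assms
proof (induction m rule: nat_induct_at_least)
  case base
  obtain \<beta> where \<beta>: "smooth \<beta>" "\<And>t. t \<notin> {0..1} \<Longrightarrow> \<beta> t = 0" "(LINT t|lborel. \<beta> t) = 1"
    by (rule exists_bump) blast
  then have cs: "compact_smooth 1 \<beta>" by (auto simp: compact_smooth_def)
  obtain G where "compact_smooth 1 G" "deriv G = (\<lambda>t. 2 * \<beta> (2 * t) - \<beta> t)"
    by (rule exists_antideriv_of_dilation_difference[OF cs]) auto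
  with cs \<beta>(3) show ?case by (intro exI[of _ \<beta>] exI[of _ G]) auto
next
  case (Suc m)
  then obtain r \<kappa> where r: "compact_smooth 1 r" and k: "compact_smooth 1 \<kappa>"
    and one: "(LINT t|lborel. r t) = 1" and eq: "\<And>t. 2 * r (2 * t) - r t = (deriv ^^ m) \<kappa> t" by blast
  define q :: real where "q = 1 / 2 ^ m"
  have q: "q < 1" "q > 0" using \<open>1 \<le> m\<close> by (auto simp: q_def)
  obtain G where G: "compact_smooth 1 G" and dG: "deriv G = (\<lambda>t. 2 * \<kappa> (2 * t) - \<kappa> t)"
    by (rule exists_antideriv_of_dilation_difference[OF k]) auto
  define r' where "r' = (\<lambda>t. (1 / (1 - q)) * (2 * r (2 * t) - q * r t))"
  define \<kappa>' where "\<kappa>' = (\<lambda>t. (q / (1 - q)) * G t)"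
  have sm: "smooth \<kappa>" "smooth G" using k G by (auto intro: compact_smooth_smooth)
  have 1: "compact_smooth 1 (\<lambda>t. 2 * r (2 * t))" by (rule compact_smooth_scale2) (use r in auto)
  have "compact_smooth 1 r'" unfolding r'_def
    by (intro compact_smooth_cmult compact_smooth_diff 1 r)
  moreover have "compact_smooth 1 \<kappa>'" unfolding \<kappa>'_def by (intro compact_smooth_cmult G)
  moreover have "(LINT t|lborel. r' t) = 1"
  proof -
    have "(LINT t|lborel. r' t) = (1 / (1 - q)) * ((LINT t|lborel. 2 * r (2 * t)) - q * (LINT t|lborel. r t))"
      unfolding r'_def using compact_smooth_integrable[OF 1] compact_smooth_integrable[OF r] by simp
    also have "(LINT t|lborel. 2 * r (2 * t)) = 1"
      using lborel_integral_real_affine[of 2 r 0] one by simp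
    finally show ?thesis using q one by simp
  qed
  moreover have "2 * r' (2 * t) - r' t = (deriv ^^ Suc m) \<kappa>' t" for t
  proof -
    have "(deriv ^^ Suc m) \<kappa>' t = (q / (1 - q)) * (deriv ^^ m) (deriv G) t"
      unfolding \<kappa>'_def by (simp only: funpow_deriv_cmult[OF sm(2)] deriv_funpow_Suc)
    also have "deriv G = (\<lambda>t. 2 * \<kappa> (2 * t + 0) - \<kappa> t)" by (simp add: dG)
    also have "(deriv ^^ m) \<dots> t = 2 * (2 ^ m * (deriv ^^ m) \<kappa> (2 * t)) - (deriv ^^ m) \<kappa> t"
      by (simp only: funpow_deriv_diff[OF smooth_cmult[OF smooth_affine[OF sm(1)]] sm(1)]
        funpow_deriv_cmult[OF smooth_affine[OF sm(1)]] funpow_deriv_affine[OF sm(1)]) simp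
    also have "q * (2 * (2 ^ m * (deriv ^^ m) \<kappa> (2 * t)) - (deriv ^^ m) \<kappa> t)
        = 2 * (deriv ^^ m) \<kappa> (2 * t) - q * (deriv ^^ m) \<kappa> t"
      by (simp add: q_def field_simps)
    then have "(q / (1 - q)) * (2 * (2 ^ m * (deriv ^^ m) \<kappa> (2 * t)) - (deriv ^^ m) \<kappa> t)
        = (2 * (deriv ^^ m) \<kappa> (2 * t) - q * (deriv ^^ m) \<kappa> t) / (1 - q)"
      by simp
    also have "\<dots> = 2 * r' (2 * t) - r' t"
      by (simp add: r'_def eq[symmetric] diff_divide_distrib add_divide_distrib right_diff_distrib)
    finally show ?thesis by simp
  qed
  ultimately show ?case by blast
qed

text \<open>The \<open>L\<^sup>1\<close>-normalized dilation by \<open>2\<^sup>n\<close>.\<close>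

definition dilate :: "nat \<Rightarrow> (real \<Rightarrow> real) \<Rightarrow> real \<Rightarrow> real" where
  "dilate n g = (\<lambda>t. 2 ^ n * g (2 ^ n * t))"

lemma dilate_smooth: "smooth g \<Longrightarrow> smooth (dilate n g)"
  using smooth_cmult[OF smooth_affine[of g "2 ^ n" 0]] by (simp add: dilate_def)

lemma dilate_compact_smooth: "compact_smooth R g \<Longrightarrow> R \<ge> 0 \<Longrightarrow> compact_smooth R (dilate n g)"
  unfolding dilate_def by (intro compact_smooth_scale2) auto

lemma dilate_support: "compact_smooth R g \<Longrightarrow> \<bar>t\<bar> > R / 2 ^ n \<Longrightarrow> dilate n g t = 0"
  by (auto simp: dilate_def compact_smooth_def field_simps abs_if split: if_splits)

lemma dilate_0: "dilate 0 g = g" by (simp add: dilate_def)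

lemma funpow_deriv_dilate:
  "smooth g \<Longrightarrow> (deriv ^^ k) (dilate n g) = (\<lambda>t. 2 ^ (n * k) * dilate n ((deriv ^^ k) g) t)"
  using funpow_deriv_cmult[OF smooth_affine[of g "2 ^ n" 0], of k "2 ^ n"]
    funpow_deriv_affine[of g k "2 ^ n" 0]
  by (simp add: dilate_def power_mult mult.left_commute)

lemma L1_dilate: "L1 (dilate n g) = L1 g"
  using L1_affine[of "2 ^ n" g 0] by (simp add: dilate_def L1_cmult)

lemma L1_funpow_deriv_dilate:
  "smooth g \<Longrightarrow> L1 ((deriv ^^ k) (dilate n g)) = 2 ^ (n * k) * L1 ((deriv ^^ k) g)"
  by (simp add: funpow_deriv_dilate L1_cmult L1_dilate)

lemma integral_dilate: "(LINT t|lborel. dilate n g t) = (LINT t|lborel. g t)"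
  using lborel_integral_real_affine[of "2 ^ n" g 0] by (simp add: dilate_def)

lemma dilate_Suc: "dilate (Suc n) g t - dilate n g t = dilate n (\<lambda>t. 2 * g (2 * t) - g t) t"
  by (simp add: dilate_def algebra_simps)

lemma dilate_difference:
  assumes "\<And>t. 2 * r (2 * t) - r t = (deriv ^^ m) \<kappa> t" "smooth \<kappa>"
  shows "dilate (Suc n) r t - dilate n r t = (deriv ^^ m) (\<lambda>t. (1 / 2 ^ (n * m)) * dilate n \<kappa> t) t"
  unfolding dilate_Suc assms(1)
  by (simp only: funpow_deriv_cmult[OF dilate_smooth[OF assms(2)]] funpow_deriv_dilate[OF assms(2)]) simp

text \<open>Iterated primitives on a bounded interval that are still compactly supported: a far translate
  is subtracted before each integration. Derivatives of order \<open>k\<close> of the primitive of order \<open>l\<close> cost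
  \<open>k - l\<close> derivatives, with truncated subtraction.\<close>

lemma exists_local_primitive:
  assumes "R \<ge> 0"
  shows "\<exists>C R'. C \<ge> 1 \<and> R' \<ge> 0 \<and> (\<forall>g. compact_smooth R g \<longrightarrow>
    (\<exists>G. compact_smooth R' G \<and> (\<forall>t\<in>{-T<..<T}. (deriv ^^ l) G t = g t) \<and>
       (\<forall>k. L1 ((deriv ^^ k) G) \<le> C * L1 ((deriv ^^ (k - l)) g))))"
proof (induction l)
  case 0
  show ?case using assms by (rule_tac exI[of _ 1], rule_tac exI[of _ R]) auto
next
  case (Suc l)
  then obtain C R' where C: "C \<ge> 1" "R' \<ge> 0" and IH: "\<And>g. compact_smooth R g \<Longrightarrow>
    \<exists>G. compact_smooth R' G \<and> (\<forall>t\<in>{-T<..<T}. (deriv ^^ l) G t = g t) \<and>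
       (\<forall>k. L1 ((deriv ^^ k) G) \<le> C * L1 ((deriv ^^ (k - l)) g))" by blast
  define \<tau> where "\<tau> = max 0 T + R'"
  define R2 where "R2 = R' + \<tau>"
  have R2: "R2 \<ge> R'" "R2 \<ge> 0" and tau: "\<tau> \<ge> R'" using C by (auto simp: R2_def \<tau>_def)
  define C' where "C' = C * max 2 (4 * R2)"
  have C': "C' \<ge> 1"
    using mult_mono[of 1 C 1 "max 2 (4 * R2)"] C by (auto simp: C'_def)
  show ?case
  proof (rule exI[of _ C'], rule exI[of _ R2], intro conjI allI impI)
    fix g assume g: "compact_smooth R g"
    from IH[OF g] obtain G0 where G0: "compact_smooth R' G0"
      and eq: "\<And>t. t\<in>{-T<..<T} \<Longrightarrow> (deriv ^^ l) G0 t = g t"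
      and L: "\<And>k. L1 ((deriv ^^ k) G0) \<le> C * L1 ((deriv ^^ (k - l)) g)" by blast
    have sm0: "smooth G0" using G0 by (rule compact_smooth_smooth)
    define h where "h = (\<lambda>t. G0 t - G0 (1 * t + (- \<tau>)))"
    have G02: "compact_smooth R2 G0" using G0 R2(1) by (rule compact_smooth_mono)
    have shift: "compact_smooth R2 (\<lambda>t. G0 (1 * t + (- \<tau>)))"
      unfolding compact_smooth_def
      by (intro conjI smooth_affine sm0) (use compact_smooth_zero[OF G0] tau C in \<open>auto simp: R2_def\<close>)
    have h: "compact_smooth R2 h"
      unfolding h_def by (rule compact_smooth_diff[OF G02 shift])
    have "(LINT t|lborel. h t) = (LINT t|lborel. G0 t) - (LINT t|lborel. G0 (1 * t + (- \<tau>)))"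
      unfolding h_def using compact_smooth_integrable[OF G02] compact_smooth_integrable[OF shift] by simp
    also have "(LINT t|lborel. G0 (1 * t + (- \<tau>))) = (LINT t|lborel. G0 t)"
      using lborel_integral_real_affine[of 1 G0 "-\<tau>"] by (simp add: add.commute)
    finally have mean: "(LINT t|lborel. h t) = 0" by simp
    obtain G where G: "compact_smooth R2 G" and dG: "deriv G = h" and LG: "L1 G \<le> 2 * R2 * L1 h"
      using compact_smooth_antideriv[OF h mean R2(2)] by blast
    have Lh: "L1 ((deriv ^^ k) h) \<le> 2 * L1 ((deriv ^^ k) G0)" for k
    proof -
      have "(deriv ^^ k) h = (\<lambda>t. (deriv ^^ k) G0 t - (deriv ^^ k) (\<lambda>t. G0 (1 * t + (- \<tau>))) t)"
        unfolding h_def by (rule funpow_deriv_diff[OF sm0 smooth_affine[OF sm0]])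
      then have "L1 ((deriv ^^ k) h) \<le> L1 ((deriv ^^ k) G0) + L1 ((deriv ^^ k) (\<lambda>t. G0 (1 * t + (- \<tau>))))"
        using L1_triangle[OF compact_smooth_funpow[OF G02] compact_smooth_funpow[OF shift], of k k] by simp
      also have "L1 ((deriv ^^ k) (\<lambda>t. G0 (1 * t + (- \<tau>)))) = L1 ((deriv ^^ k) G0)"
        unfolding funpow_deriv_affine[OF sm0] using L1_affine[of 1 "(deriv ^^ k) G0" "-\<tau>"] by simp
      finally show ?thesis by simp
    qed
    have "(deriv ^^ Suc l) G t = g t" if t: "t \<in> {-T<..<T}" for t
    proof -
      have "(deriv ^^ Suc l) G t = (deriv ^^ l) h t" by (simp only: deriv_funpow_Suc dG)
      also have "\<dots> = (deriv ^^ l) G0 t"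
      proof (rule funpow_deriv_cong_open[OF compact_smooth_smooth[OF h] sm0, of "{-T<..<T}"])
        show "h s = G0 s" if "s \<in> {-T<..<T}" for s
          using that compact_smooth_zero[OF G0, of "1 * s + (- \<tau>)"] by (auto simp: h_def \<tau>_def)
      qed (use t in auto)
      finally show ?thesis using eq[OF t] by simp
    qed
    moreover have "L1 ((deriv ^^ k) G) \<le> C' * L1 ((deriv ^^ (k - Suc l)) g)" for k
    proof (cases k)
      case 0
      have "L1 G \<le> 2 * R2 * (2 * (C * L1 g))"
      proof -
        have "L1 h \<le> 2 * (C * L1 g)" using Lh[of 0] L[of 0] by simp
        from mult_left_mono[OF this, of "2 * R2"] R2 LG show ?thesis by linarith
      qed
      also have "\<dots> \<le> C' * L1 g"
        using mult_right_mono[OF mult_left_mono[of "4 * R2" "max 2 (4 * R2)" C] L1_nonneg[of g]] C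
        by (simp add: C'_def mult_ac)
      finally show ?thesis using 0 by simp
    next
      case (Suc k')
      have "L1 ((deriv ^^ k) G) = L1 ((deriv ^^ k') h)" unfolding Suc by (simp only: deriv_funpow_Suc dG)
      also have "\<dots> \<le> 2 * (C * L1 ((deriv ^^ (k' - l)) g))" using Lh[of k'] L[of k'] by linarith
      also have "\<dots> \<le> C' * L1 ((deriv ^^ (k' - l)) g)"
        using mult_right_mono[OF mult_left_mono[of 2 "max 2 (4 * R2)" C] L1_nonneg[of "(deriv ^^ (k' - l)) g"]] C
        by (simp add: C'_def mult_ac)
      finally show ?thesis using Suc by simp
    qed
    ultimately show "\<exists>G. compact_smooth R2 G \<and> (\<forall>t\<in>{-T<..<T}. (deriv ^^ Suc l) G t = g t) \<and>
       (\<forall>k. L1 ((deriv ^^ k) G) \<le> C' * L1 ((deriv ^^ (k - Suc l)) g))" using G by blast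
  qed (use C' R2 in auto)
qed

section \<open>Products of functions of one variable, and their convolutions\<close>

text \<open>The product of functions of the single coordinates.\<close>

definition tens :: "('d \<Rightarrow> real \<Rightarrow> real) \<Rightarrow> real ^ 'd::finite \<Rightarrow> real" where
  "tens \<Phi> x = (\<Prod>c\<in>UNIV. \<Phi> c (x $ c))"

lemma Basis_vec_eq: "(Basis :: (real ^ 'd::finite) set) = (\<lambda>c. axis c 1) ` UNIV"
  by (auto simp: Basis_vec_def)

lemma inj_axis: "inj (\<lambda>c::'d::finite. axis c (1::real))"
  by (auto simp: inj_on_def axis_eq_axis)

lemma tens_integral:
  fixes \<Phi> :: "'d::finite \<Rightarrow> real \<Rightarrow> real"
  assumes "\<And>c. integrable lborel (\<Phi> c)"
  shows "integrable lborel (tens \<Phi>)" "(LINT x|lborel. tens \<Phi> x) = (\<Prod>c\<in>UNIV. LINT t|lborel. \<Phi> c t)"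
proof -
  interpret product_sigma_finite "\<lambda>_::real ^ 'd. lborel :: real measure" ..
  define \<Psi> :: "real ^ 'd \<Rightarrow> real \<Rightarrow> real" where "\<Psi> b = \<Phi> (inv (\<lambda>c. axis c 1) b)" for b
  have \<Psi>: "\<Psi> (axis c 1) = \<Phi> c" for c by (simp add: \<Psi>_def inv_f_f[OF inj_axis])
  have int: "integrable lborel (\<Psi> b)" for b using assms by (simp add: \<Psi>_def)
  have tens_eq: "tens \<Phi> x = (\<Prod>b\<in>Basis. \<Psi> b (x \<bullet> b))" for x :: "real ^ 'd"
    unfolding Basis_vec_eq by (subst prod.reindex[OF inj_axis]) (simp add: \<Psi> tens_def inner_axis)
  have comb: "(\<Sum>b\<in>Basis. f b *\<^sub>R b) \<bullet> b = f b" if "b \<in> Basis" for f and b :: "real ^ 'd"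
    using that by (simp add: inner_sum_left_Basis)
  have meas: "tens \<Phi> \<in> borel_measurable borel"
    unfolding tens_eq[abs_def] using int by (intro borel_measurable_prod) auto
  have "integrable (\<Pi>\<^sub>M b\<in>Basis. lborel) (\<lambda>f. \<Prod>b\<in>Basis. \<Psi> b (f b))"
    by (rule product_integrable_prod) (auto simp: int)
  then have "integrable (\<Pi>\<^sub>M b\<in>Basis. lborel) (\<lambda>f. tens \<Phi> (\<Sum>b\<in>Basis. f b *\<^sub>R b))"
    unfolding tens_eq by (rule Bochner_Integration.integrable_cong[THEN iffD1, rotated 2]) (auto simp: comb)
  then show "integrable lborel (tens \<Phi>)"
    by (subst lborel_eq, subst integrable_distr_eq) (use meas in auto)
  have "(LINT x|lborel. tens \<Phi> x) = integral\<^sup>L (\<Pi>\<^sub>M b\<in>Basis. lborel) (\<lambda>f. tens \<Phi> (\<Sum>b\<in>Basis. f b *\<^sub>R b))"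
    by (subst lborel_eq, subst integral_distr) (use meas in auto)
  also have "\<dots> = integral\<^sup>L (\<Pi>\<^sub>M b\<in>Basis. lborel) (\<lambda>f. \<Prod>b\<in>Basis. \<Psi> b (f b))"
    unfolding tens_eq by (intro Bochner_Integration.integral_cong refl prod.cong) (simp add: comb)
  also have "\<dots> = (\<Prod>b\<in>Basis. LINT t|lborel. \<Psi> b t)"
    by (rule product_integral_prod) (auto simp: int)
  also have "\<dots> = (\<Prod>c\<in>UNIV. LINT t|lborel. \<Phi> c t)"
    unfolding Basis_vec_eq by (subst prod.reindex[OF inj_axis]) (simp add: \<Psi>)
  finally show "(LINT x|lborel. tens \<Phi> x) = (\<Prod>c\<in>UNIV. LINT t|lborel. \<Phi> c t)" .
qed

lemma tens_reflected_integral: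
  fixes \<Phi> :: "'d::finite \<Rightarrow> real \<Rightarrow> real"
  assumes "\<And>c. integrable lborel (\<Phi> c)"
  shows "integrable lborel (\<lambda>y. tens \<Phi> (x - y))"
    "(LINT y|lborel. tens \<Phi> (x - y)) = (\<Prod>c\<in>UNIV. LINT t|lborel. \<Phi> c t)"
proof -
  let ?\<Psi> = "\<lambda>c t. \<Phi> c (x $ c + (-1) * t)"
  have eq: "tens \<Phi> (x - y) = tens ?\<Psi> y" for y by (simp add: tens_def)
  have "integrable lborel (?\<Psi> c)" for c
    by (rule lborel_integrable_real_affine[OF assms]) simp
  moreover have "(LINT t|lborel. ?\<Psi> c t) = (LINT t|lborel. \<Phi> c t)" for c
    using lborel_integral_real_affine[of "-1" "\<Phi> c" "x $ c"] by simp
  ultimately show "integrable lborel (\<lambda>y. tens \<Phi> (x - y))"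
    "(LINT y|lborel. tens \<Phi> (x - y)) = (\<Prod>c\<in>UNIV. LINT t|lborel. \<Phi> c t)"
    using tens_integral[of ?\<Psi>] by (simp_all only: eq)
qed

lemma tens_abs: "\<bar>tens \<Phi> x\<bar> = tens (\<lambda>c t. \<bar>\<Phi> c t\<bar>) x"
  by (simp add: tens_def abs_prod)

lemma tens_has_derivative:
  assumes "\<And>c. smooth (\<Phi> c)"
  shows "(tens \<Phi> has_derivative (\<lambda>v. \<Sum>c\<in>UNIV. v $ c * tens (\<Phi>(c := deriv (\<Phi> c))) x)) (at x)"
proof -
  have 1: "((\<lambda>x. \<Phi> c (x $ c)) has_derivative (\<lambda>v. v $ c * deriv (\<Phi> c) (x $ c))) (at x)" for c
  proof -
    have "(\<Phi> c has_derivative (\<lambda>h. h * deriv (\<Phi> c) (x $ c))) (at (x $ c))"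
      using smooth_DERIV[OF assms] unfolding has_field_derivative_def
      by (rule has_derivative_eq_rhs) (auto simp: mult.commute)
    then show ?thesis
      using has_derivative_compose[OF bounded_linear_imp_has_derivative[OF bounded_linear_vec_nth[of c]]] by blast
  qed
  have "((\<lambda>x. \<Prod>c\<in>UNIV. \<Phi> c (x $ c)) has_derivative
      (\<lambda>v. \<Sum>c\<in>UNIV. (v $ c * deriv (\<Phi> c) (x $ c)) * (\<Prod>j\<in>UNIV - {c}. \<Phi> j (x $ j)))) (at x)"
    by (rule has_derivative_prod[OF 1])
  moreover have "tens (\<Phi>(c := deriv (\<Phi> c))) x = deriv (\<Phi> c) (x $ c) * (\<Prod>j\<in>UNIV - {c}. \<Phi> j (x $ j))" for c
    unfolding tens_def by (subst prod.remove[of _ c]) (auto intro!: prod.cong)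
  ultimately show ?thesis by (simp add: tens_def[abs_def] mult.assoc)
qed

lemma tens_continuous: "(\<And>c. smooth (\<Phi> c)) \<Longrightarrow> continuous_on S (tens \<Phi>)"
  by (meson continuous_at_imp_continuous_on has_derivative_continuous tens_has_derivative)

lemma smooth_fun_upd_deriv: "(\<And>c. smooth (\<Phi> c)) \<Longrightarrow> smooth ((\<Phi>(a := deriv (\<Phi> a))) c)"
  by (simp add: smooth_deriv)

text \<open>Continuous weights supported in a box, with values in \<open>[-1, 1]\<close>.\<close>

definition weight :: "real ^ 'd::finite \<Rightarrow> real ^ 'd \<Rightarrow> (real ^ 'd \<Rightarrow> real) \<Rightarrow> bool" where
  "weight p q \<sigma> \<longleftrightarrow> continuous_on UNIV \<sigma> \<and> (\<forall>x. \<bar>\<sigma> x\<bar> \<le> 1) \<and> (\<forall>x. x \<notin> cbox p q \<longrightarrow> \<sigma> x = 0)"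

text \<open>Convolution of a weight with a kernel.\<close>

definition conv :: "(real ^ 'd::finite \<Rightarrow> real) \<Rightarrow> (real ^ 'd \<Rightarrow> real) \<Rightarrow> real ^ 'd \<Rightarrow> real" where
  "conv \<sigma> \<Psi> x = (LINT y|lborel. \<sigma> y * \<Psi> (x - y))"

lemma conv_integrable:
  assumes "weight p q \<sigma>" "continuous_on UNIV \<Psi>"
  shows "integrable lborel (\<lambda>y. \<sigma> y * \<Psi> (x - y))"
    "((\<lambda>y. \<sigma> y * \<Psi> (x - y)) has_integral conv \<sigma> \<Psi> x) (cbox p q)"
proof -
  have "continuous_on (cbox p q) \<sigma>"
    using assms(1) continuous_on_subset unfolding weight_def by blast
  moreover have "continuous_on (cbox p q) (\<lambda>y. \<Psi> (x - y))"
    by (rule continuous_on_compose2[OF assms(2)]) (auto intro!: continuous_intros)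
  ultimately have c: "continuous_on (cbox p q) (\<lambda>y. \<sigma> y * \<Psi> (x - y))"
    by (rule continuous_on_mult)
  have "set_integrable lborel (cbox p q) (\<lambda>y. \<sigma> y * \<Psi> (x - y))"
    unfolding set_integrable_def by (rule borel_integrable_compact[OF compact_cbox c])
  moreover have "(\<lambda>y. indicator (cbox p q) y *\<^sub>R (\<sigma> y * \<Psi> (x - y))) = (\<lambda>y. \<sigma> y * \<Psi> (x - y))"
    using assms(1) by (auto simp: weight_def indicator_def fun_eq_iff)
  ultimately show 1: "integrable lborel (\<lambda>y. \<sigma> y * \<Psi> (x - y))" by (simp add: set_integrable_def)
  have "((\<lambda>y. \<sigma> y * \<Psi> (x - y)) has_integral conv \<sigma> \<Psi> x) UNIV"
    unfolding conv_def by (rule has_integral_integral_lborel[OF 1])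
  moreover have "(\<lambda>y. if y \<in> cbox p q then \<sigma> y * \<Psi> (x - y) else 0) = (\<lambda>y. \<sigma> y * \<Psi> (x - y))"
    using assms(1) by (auto simp: weight_def fun_eq_iff)
  ultimately show "((\<lambda>y. \<sigma> y * \<Psi> (x - y)) has_integral conv \<sigma> \<Psi> x) (cbox p q)"
    by (subst has_integral_restrict_UNIV[symmetric]) simp
qed

lemma conv_partial:
  fixes \<sigma> :: "real ^ 'd::finite \<Rightarrow> real"
  assumes w: "weight p q \<sigma>" and sm: "\<And>c. smooth (\<Phi> c)"
  shows "conv \<sigma> (tens \<Phi>) differentiable (at x)"
    "partial a (conv \<sigma> (tens \<Phi>)) x = conv \<sigma> (tens (\<Phi>(a := deriv (\<Phi> a)))) x"
proof -
  define D where "D = (\<lambda>x y v. \<sigma> y * (\<Sum>c\<in>UNIV. v $ c * tens (\<Phi>(c := deriv (\<Phi> c))) (x - y)))"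
  define fx where "fx = (\<lambda>x y. Blinfun (D x y))"
  have der: "((\<lambda>x. \<sigma> y * tens \<Phi> (x - y)) has_derivative D x y) (at x)" for x y
  proof -
    have "((\<lambda>x. x - y) has_derivative (\<lambda>v. v)) (at x)" by (auto intro!: derivative_eq_intros)
    from has_derivative_compose[OF this tens_has_derivative[of \<Phi>]] sm
    have "((\<lambda>x. tens \<Phi> (x - y)) has_derivative
      (\<lambda>v. \<Sum>c\<in>UNIV. v $ c * tens (\<Phi>(c := deriv (\<Phi> c))) (x - y))) (at x)" by blast
    then show ?thesis unfolding D_def by (rule has_derivative_mult_right)
  qed
  have bl: "blinfun_apply (fx x y) = D x y" for x y
    unfolding fx_def by (rule bounded_linear_Blinfun_apply[OF has_derivative_bounded_linear[OF der]])
  have smu: "smooth ((\<Phi>(c := deriv (\<Phi> c))) c')" for c c' by (rule smooth_fun_upd_deriv[OF sm])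
  have \<sigma>: "continuous_on S \<sigma>" for S
    using w by (auto simp: weight_def intro: continuous_on_subset)
  have cont: "continuous_on (UNIV \<times> cbox p q) (\<lambda>(x, y). fx x y)"
    unfolding case_prod_beta
  proof (rule continuous_on_blinfun_componentwise)
    fix v :: "real ^ 'd"
    let ?Z = "(UNIV :: (real ^ 'd) set) \<times> cbox p q"
    have "continuous_on ?Z (\<lambda>z. \<sigma> (snd z))"
      by (rule continuous_on_compose2[OF \<sigma>[of UNIV]]) (auto intro!: continuous_intros)
    moreover have "continuous_on ?Z (\<lambda>z. tens (\<Phi>(c := deriv (\<Phi> c))) (fst z - snd z))" for c
      by (rule continuous_on_compose2[OF tens_continuous[OF smu, of UNIV]]) (auto intro!: continuous_intros)
    ultimately show "continuous_on ?Z (\<lambda>z. blinfun_apply (fx (fst z) (snd z)) v)"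
      unfolding bl D_def by (intro continuous_on_mult continuous_on_sum continuous_on_const)
  qed
  have "((\<lambda>x. integral (cbox p q) (\<lambda>y. \<sigma> y * tens \<Phi> (x - y))) has_derivative
      blinfun_apply (integral (cbox p q) (fx x))) (at x within UNIV)"
    by (rule leibniz_rule[OF _ _ cont])
       (use der has_integral_integrable[OF conv_integrable(2)[OF w tens_continuous[OF sm]]] in \<open>auto simp: bl\<close>)
  moreover have "integral (cbox p q) (\<lambda>y. \<sigma> y * tens \<Phi> (x - y)) = conv \<sigma> (tens \<Phi>) x" for x
    by (rule integral_unique[OF conv_integrable(2)[OF w tens_continuous[OF sm]]])
  ultimately have hd: "(conv \<sigma> (tens \<Phi>) has_derivative blinfun_apply (integral (cbox p q) (fx x))) (at x)"
    by simp
  then show "conv \<sigma> (tens \<Phi>) differentiable (at x)" by (rule differentiableI)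
  have int: "fx x integrable_on cbox p q"
  proof (rule integrable_continuous)
    show "continuous_on (cbox p q) (fx x)"
    proof -
      have "continuous_on (cbox p q) (\<lambda>y. (x, y))" by (intro continuous_intros)
      from continuous_on_compose2[OF cont this] show ?thesis by (simp add: image_subset_iff)
    qed
  qed
  have "partial a (conv \<sigma> (tens \<Phi>)) x = blinfun_apply (integral (cbox p q) (fx x)) (axis a 1)"
    unfolding partial_def using frechet_derivative_at[OF hd] by simp
  also have "\<dots> = integral (cbox p q) (\<lambda>y. blinfun_apply (fx x y) (axis a 1))"
    using integral_linear[OF int blinfun.bounded_linear_left] by (simp add: o_def)
  also have "(\<lambda>y. blinfun_apply (fx x y) (axis a 1)) = (\<lambda>y. \<sigma> y * tens (\<Phi>(a := deriv (\<Phi> a))) (x - y))"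
  proof
    fix y
    have "(\<Sum>c\<in>UNIV. axis a 1 $ c * tens (\<Phi>(c := deriv (\<Phi> c))) (x - y))
        = (\<Sum>c\<in>UNIV. if c = a then tens (\<Phi>(c := deriv (\<Phi> c))) (x - y) else 0)"
      by (intro sum.cong) (auto simp: axis_def)
    then show "blinfun_apply (fx x y) (axis a 1) = \<sigma> y * tens (\<Phi>(a := deriv (\<Phi> a))) (x - y)"
      by (simp add: bl D_def)
  qed
  also have "integral (cbox p q) \<dots> = conv \<sigma> (tens (\<Phi>(a := deriv (\<Phi> a)))) x"
    by (rule integral_unique[OF conv_integrable(2)[OF w tens_continuous[OF smu]]])
  finally show "partial a (conv \<sigma> (tens \<Phi>)) x = conv \<sigma> (tens (\<Phi>(a := deriv (\<Phi> a)))) x" .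
qed

lemma conv_partials:
  assumes w: "weight p q \<sigma>" and sm: "\<And>c. smooth (\<Phi> c)"
  shows "partials as (conv \<sigma> (tens \<Phi>)) = conv \<sigma> (tens (\<lambda>c. (deriv ^^ count_list as c) (\<Phi> c)))"
proof (induction as)
  case Nil then show ?case by (simp add: partials_def)
next
  case (Cons a as)
  have "partials (a # as) (conv \<sigma> (tens \<Phi>)) = partial a (partials as (conv \<sigma> (tens \<Phi>)))"
    by (simp add: partials_def)
  also have "\<dots> = conv \<sigma> (tens ((\<lambda>c. (deriv ^^ count_list as c) (\<Phi> c))(a := deriv ((deriv ^^ count_list as a) (\<Phi> a)))))"
    unfolding Cons by (rule ext) (rule conv_partial(2)[OF w smooth_funpow[OF sm]])
  also have "(\<lambda>c. (deriv ^^ count_list as c) (\<Phi> c))(a := deriv ((deriv ^^ count_list as a) (\<Phi> a)))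
      = (\<lambda>c. (deriv ^^ count_list (a # as) c) (\<Phi> c))"
    by (auto simp: fun_eq_iff)
  finally show ?case .
qed

lemma conv_test_function:
  assumes w: "weight p q \<sigma>" and cs: "\<And>c. compact_smooth R (\<Phi> c)"
    and K: "\<And>x y. y \<in> cbox p q \<Longrightarrow> (\<And>c. \<Phi> c ((x - y) $ c) \<noteq> 0) \<Longrightarrow> x \<in> K" "compact K" "K \<subseteq> \<Omega>"
  shows "conv \<sigma> (tens \<Phi>) \<in> test_functions \<Omega>"
proof -
  have sm: "smooth (\<Phi> c)" for c using cs compact_smooth_smooth by blast
  have "conv \<sigma> (tens \<Phi>) x = 0" if "x \<notin> K" for x
  proof -
    have 0: "\<sigma> y * tens \<Phi> (x - y) = 0" for y
    proof (cases "y \<in> cbox p q")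
      case True
      have "\<exists>c. \<Phi> c ((x - y) $ c) = 0"
      proof (rule ccontr)
        assume "\<not> (\<exists>c. \<Phi> c ((x - y) $ c) = 0)"
        then have "x \<in> K" by (intro K(1)[OF True]) auto
        with \<open>x \<notin> K\<close> show False ..
      qed
      then obtain c where "\<Phi> c ((x - y) $ c) = 0" ..
      then show ?thesis unfolding tens_def by (auto intro!: prod_zero)
    qed (use w in \<open>auto simp: weight_def\<close>)
    show ?thesis unfolding conv_def 0 by simp
  qed
  moreover have "partials as (conv \<sigma> (tens \<Phi>)) differentiable (at x)" for as x
    unfolding conv_partials[OF w sm] by (rule conv_partial(1)[OF w smooth_funpow[OF sm]])
  ultimately show ?thesis using K(2,3) unfolding test_functions_def by blast
qed

lemma conv_bound:
  assumes w: "weight p q \<sigma>" and cs: "\<And>c. compact_smooth R (\<Phi> c)"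
  shows "\<bar>conv \<sigma> (tens \<Phi>) x\<bar> \<le> (\<Prod>c\<in>UNIV. L1 (\<Phi> c))"
proof -
  let ?A = "\<lambda>c t. \<bar>\<Phi> c t\<bar>"
  have sm: "smooth (\<Phi> c)" for c using cs compact_smooth_smooth by blast
  have i: "integrable lborel (?A c)" for c using compact_smooth_integrable[OF cs] by auto
  note shift = tens_reflected_integral[OF i]
  have "\<bar>conv \<sigma> (tens \<Phi>) x\<bar> \<le> (LINT y|lborel. \<bar>\<sigma> y * tens \<Phi> (x - y)\<bar>)"
    unfolding conv_def by (rule integral_abs_bound)
  also have "\<dots> \<le> (LINT y|lborel. tens ?A (x - y))"
  proof (rule integral_mono)
    show "\<bar>\<sigma> y * tens \<Phi> (x - y)\<bar> \<le> tens ?A (x - y)" for y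
      unfolding tens_abs[symmetric] abs_mult using w mult_right_mono[of "\<bar>\<sigma> y\<bar>" 1 "\<bar>tens \<Phi> (x - y)\<bar>"]
      by (simp add: weight_def)
  qed (use conv_integrable(1)[OF w tens_continuous[OF sm]] shift(1) in auto)
  also have "\<dots> = (\<Prod>c\<in>UNIV. L1 (\<Phi> c))"
    using shift(2) by (simp add: L1_def)
  finally show ?thesis .
qed

section \<open>Test functions\<close>

lemma partials_Cons: "partials (a # as) \<phi> = partial a (partials as \<phi>)"
  by (simp add: partials_def)

lemma partials_append: "partials (as @ bs) \<phi> = partials as (partials bs \<phi>)"
  by (simp add: partials_def)

lemma partials_Nil: "partials [] \<phi> = \<phi>"
  by (simp add: partials_def)

lemma test_function_differentiable:
  "\<phi> \<in> test_functions \<Omega> \<Longrightarrow> partials as \<phi> differentiable (at x)"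
  by (simp add: test_functions_def)

lemma test_function_has_derivative:
  assumes "\<phi> \<in> test_functions \<Omega>"
  shows "(\<phi> has_derivative frechet_derivative \<phi> (at x)) (at x)"
  using test_function_differentiable[OF assms, of "[]" x]
  by (simp add: partials_Nil frechet_derivative_works)

lemma partial_zero_off_compact:
  assumes "compact K" "\<And>x. x \<notin> K \<Longrightarrow> \<phi> x = 0" "x \<notin> K"
  shows "partial a \<phi> x = 0"
proof -
  have "(\<phi> has_derivative (\<lambda>_. 0)) (at x)"
    by (rule has_derivative_transform_within_open[of "\<lambda>_. 0" _ _ _ "- K"])
       (use assms in \<open>auto intro: compact_imp_closed\<close>)
  then show ?thesis by (simp add: partial_def frechet_derivative_at[symmetric])
qed

lemma test_function_partial:
  assumes "\<phi> \<in> test_functions \<Omega>" shows "partial a \<phi> \<in> test_functions \<Omega>"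
proof -
  obtain K where K: "compact K" "K \<subseteq> \<Omega>" "\<And>x. x \<notin> K \<Longrightarrow> \<phi> x = 0"
    using assms by (auto simp: test_functions_def)
  have "partials as (partial a \<phi>) differentiable (at x)" for as x
    using test_function_differentiable[OF assms, of "as @ [a]"]
    by (simp add: partials_append partials_Cons partials_Nil)
  moreover have "\<forall>x. x \<notin> K \<longrightarrow> partial a \<phi> x = 0"
    using partial_zero_off_compact[of K \<phi>] K(1,3) by simp
  ultimately show ?thesis using K(1,2) unfolding test_functions_def mem_Collect_eq by metis
qed

lemma test_function_partials: "\<phi> \<in> test_functions \<Omega> \<Longrightarrow> partials as \<phi> \<in> test_functions \<Omega>"
  by (induction as) (auto simp: partials_Nil partials_Cons test_function_partial)

lemma test_function_continuous: "\<phi> \<in> test_functions \<Omega> \<Longrightarrow> continuous_on S \<phi>"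
  by (meson continuous_at_imp_continuous_on has_derivative_continuous test_function_has_derivative)

lemma test_function_support:
  assumes "\<phi> \<in> test_functions \<Omega>"
  obtains K where "compact K" "K \<subseteq> \<Omega>" "\<And>x. x \<notin> K \<Longrightarrow> \<phi> x = 0"
  using assms by (auto simp: test_functions_def)

lemma test_functions_mono: "\<Omega> \<subseteq> \<Omega>' \<Longrightarrow> test_functions \<Omega> \<subseteq> test_functions \<Omega>'"
  unfolding test_functions_def by blast

lemma test_function_bounded:
  assumes "\<phi> \<in> test_functions \<Omega>"
  obtains B where "B \<ge> 0" "\<And>x. \<bar>\<phi> x\<bar> \<le> B"
proof -
  obtain K where K: "compact K" "\<And>x. x \<notin> K \<Longrightarrow> \<phi> x = 0"
    using test_function_support[OF assms] by metis
  have "bounded (\<phi> ` K)"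
    by (intro compact_imp_bounded compact_continuous_image test_function_continuous[OF assms] K)
  then obtain B where "\<And>x. x \<in> K \<Longrightarrow> \<bar>\<phi> x\<bar> \<le> B" by (auto simp: bounded_iff)
  then have "\<bar>\<phi> x\<bar> \<le> max 0 B" for x using K(2)[of x] by (cases "x \<in> K") (auto simp: le_max_iff_disj)
  with that[of "max 0 B"] show ?thesis by simp
qed

lemma test_function_integrable:
  assumes "\<phi> \<in> test_functions \<Omega>" shows "integrable lborel \<phi>"
proof -
  obtain K where K: "compact K" "\<And>x. x \<notin> K \<Longrightarrow> \<phi> x = 0"
    using test_function_support[OF assms] by metis
  have "integrable lborel (\<lambda>x. indicator K x *\<^sub>R \<phi> x)"
    by (rule borel_integrable_compact[OF K(1) test_function_continuous[OF assms]])
  also have "(\<lambda>x. indicator K x *\<^sub>R \<phi> x) = \<phi>" using K(2) by (auto simp: indicator_def fun_eq_iff)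
  finally show ?thesis .
qed

lemma test_function_measurable[measurable]:
  "\<phi> \<in> test_functions \<Omega> \<Longrightarrow> \<phi> \<in> borel_measurable borel"
  by (rule borel_measurable_continuous_onI[OF test_function_continuous])

lemma test_function_along_line:
  assumes "\<phi> \<in> test_functions \<Omega>"
  shows "((\<lambda>t. \<phi> (x + t *\<^sub>R axis a 1)) has_field_derivative partial a \<phi> (x + t *\<^sub>R axis a 1)) (at t)"
proof -
  have "((\<lambda>t. x + t *\<^sub>R axis a 1) has_derivative (\<lambda>h. h *\<^sub>R axis a 1)) (at t)"
    by (auto intro!: derivative_eq_intros)
  note * = has_derivative_compose[OF this test_function_has_derivative[OF assms]]
  have "linear (frechet_derivative \<phi> (at y))" for y
    using has_derivative_linear[OF test_function_has_derivative[OF assms]] .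
  then have "(\<lambda>h. frechet_derivative \<phi> (at y) (h *\<^sub>R axis a 1)) = (\<lambda>h. partial a \<phi> y * h)" for y
    by (simp add: partial_def linear_scale mult.commute)
  with * show ?thesis by (simp add: has_field_derivative_def)
qed

text \<open>The integral of a partial derivative vanishes: differentiate the translation invariance of
  the integral.\<close>

lemma test_function_integral_partial:
  fixes \<phi> :: "real ^ 'd::finite \<Rightarrow> real"
  assumes \<phi>: "\<phi> \<in> test_functions \<Omega>"
  shows "(LINT x|lborel. partial a \<phi> x) = 0"
proof -
  let ?e = "axis a 1 :: real ^ 'd"
  obtain K where K: "compact K" "\<And>x. x \<notin> K \<Longrightarrow> \<phi> x = 0"
    using test_function_support[OF \<phi>] by metis
  from compact_imp_bounded[OF K(1)] obtain R where R: "\<And>x. x \<in> K \<Longrightarrow> norm x \<le> R"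
    by (auto simp: bounded_iff)
  obtain B where B: "\<And>x. \<bar>partial a \<phi> x\<bar> \<le> B" "B \<ge> 0"
    using test_function_bounded[OF test_function_partial[OF \<phi>]] by metis
  define \<tau> where "\<tau> n = inverse (real (Suc n))" for n
  have \<tau>: "0 < \<tau> n" "\<tau> n \<le> 1" for n by (auto simp: \<tau>_def field_simps)
  define h where "h n x = (\<phi> (x + \<tau> n *\<^sub>R ?e) - \<phi> x) / \<tau> n" for n x
  have tr: "integrable lborel (\<lambda>x. \<phi> (x + v))" "(LINT x|lborel. \<phi> (x + v)) = (LINT x|lborel. \<phi> x)" for v
  proof -
    have d: "distr lborel borel ((+) v) = lborel" by (rule lborel_distr_plus)
    have i: "integrable (distr lborel borel ((+) v)) \<phi>" unfolding d by (rule test_function_integrable[OF \<phi>])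
    show "integrable lborel (\<lambda>x. \<phi> (x + v))"
      using i by (subst (asm) integrable_distr_eq) (use \<phi> in \<open>auto simp: add.commute\<close>)
    have "(LINT x|distr lborel borel ((+) v). \<phi> x) = (LINT x|lborel. \<phi> (v + x))"
      by (rule integral_distr) (use \<phi> in auto)
    then show "(LINT x|lborel. \<phi> (x + v)) = (LINT x|lborel. \<phi> x)" unfolding d by (simp add: add.commute)
  qed
  have zero: "(LINT x|lborel. h n x) = 0" for n
    unfolding h_def using tr test_function_integrable[OF \<phi>] by simp
  have "(\<lambda>n. LINT x|lborel. h n x) \<longlonglongrightarrow> (LINT x|lborel. partial a \<phi> x)"
  proof (rule integral_dominated_convergence)
    show "integrable lborel (\<lambda>x. B * indicator (cball 0 (R + 1)) x :: real)"
      using emeasure_bounded_finite[OF bounded_cball] by (intro integrable_mult_right integrable_real_indicator) auto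
    show "h n \<in> borel_measurable lborel" for n
      unfolding h_def[abs_def] using \<phi> by measurable
    show "partial a \<phi> \<in> borel_measurable lborel" using test_function_partial[OF \<phi>, of a] by measurable
    have "(\<lambda>n. h n x) \<longlonglongrightarrow> partial a \<phi> x" for x
    proof -
      have "((\<lambda>t. (\<phi> (x + t *\<^sub>R ?e) - \<phi> x) / t) \<longlongrightarrow> partial a \<phi> x) (at 0)"
        using test_function_along_line[OF \<phi>, of x a 0] by (simp add: DERIV_def)
      moreover have "filterlim \<tau> (at 0) sequentially"
        unfolding \<tau>_def filterlim_at
        using LIMSEQ_inverse_real_of_nat by (auto simp: lim_sequentially)
      ultimately show ?thesis unfolding h_def by (rule filterlim_compose)
    qed
    then show "AE x in lborel. (\<lambda>n. h n x) \<longlonglongrightarrow> partial a \<phi> x" by simp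
    have "norm (h n x) \<le> B * indicator (cball 0 (R + 1)) x" for n x
    proof (cases "x \<in> cball 0 (R + 1)")
      case True
      have "\<exists>z>0. z < \<tau> n \<and> \<phi> (x + \<tau> n *\<^sub>R ?e) - \<phi> (x + 0 *\<^sub>R ?e) = (\<tau> n - 0) * partial a \<phi> (x + z *\<^sub>R ?e)"
        using MVT2[OF \<tau>(1), of n "\<lambda>t. \<phi> (x + t *\<^sub>R ?e)" "\<lambda>t. partial a \<phi> (x + t *\<^sub>R ?e)"]
          test_function_along_line[OF \<phi>] by blast
      then obtain z where "\<phi> (x + \<tau> n *\<^sub>R ?e) - \<phi> x = \<tau> n * partial a \<phi> (x + z *\<^sub>R ?e)" by auto
      then have "h n x = partial a \<phi> (x + z *\<^sub>R ?e)" using \<tau>(1)[of n] by (simp add: h_def)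
      then show ?thesis using True B by simp
    next
      case False
      then have n: "norm x > R + 1" by simp
      have "norm (x + \<tau> n *\<^sub>R ?e) \<ge> norm x - norm (\<tau> n *\<^sub>R ?e)" by (metis norm_diff_ineq)
      also have "norm (\<tau> n *\<^sub>R ?e) = \<tau> n" using \<tau>(1)[of n] by simp
      finally have "norm (x + \<tau> n *\<^sub>R ?e) > R" using n \<tau>(2)[of n] by linarith
      then have "x + \<tau> n *\<^sub>R ?e \<notin> K" "x \<notin> K" using R n by fastforce+
      then show ?thesis using K(2) B(2) by (simp add: h_def)
    qed
    then show "AE x in lborel. norm (h n x) \<le> B * indicator (cball 0 (R + 1)) x" for n by simp
  qed
  then show ?thesis unfolding zero using LIMSEQ_unique tendsto_const by blast
qed

section \<open>Index combinatorics\<close>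

text \<open>\<open>flip S i j\<close> takes the entries of \<open>j\<close> at the positions in \<open>S\<close> and those of \<open>i\<close> elsewhere.\<close>

definition flip :: "'m set \<Rightarrow> ('m \<Rightarrow> 'd) \<Rightarrow> ('m \<Rightarrow> 'd) \<Rightarrow> 'm \<Rightarrow> 'd" where
  "flip S i j = (\<lambda>k. if k \<in> S then j k else i k)"

text \<open>Expanding all antisymmetrizations gives an alternating sum over the sets of exchanged positions.\<close>

lemma foldr_antisym:
  assumes "distinct ks"
  shows "foldr antisym ks G i j =
    (1 / 2 ^ length ks) * (\<Sum>S\<in>Pow (set ks). (-1) ^ card S * G (flip S i j) (flip S j i))"
  using assms
proof (induction ks arbitrary: i j)
  case Nil then show ?case by (simp add: flip_def)
next
  case (Cons k ks)
  let ?H = "\<lambda>i j S. (-1) ^ card S * G (flip S i j) (flip S j i)"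
  have k: "k \<notin> set ks" and d: "distinct ks" using Cons.prems by auto
  have sw: "(\<Sum>S\<in>Pow (set ks). ?H (i(k := j k)) (j(k := i k)) S)
      = - (\<Sum>S\<in>insert k ` Pow (set ks). ?H i j S)"
  proof -
    have "inj_on (insert k) (Pow (set ks))" using k by (auto simp: inj_on_def)
    then have "(\<Sum>S\<in>insert k ` Pow (set ks). ?H i j S) = (\<Sum>S\<in>Pow (set ks). ?H i j (insert k S))"
      by (rule sum.reindex_cong) auto
    also have "\<dots> = (\<Sum>S\<in>Pow (set ks). - ?H (i(k := j k)) (j(k := i k)) S)"
    proof (rule sum.cong[OF refl])
      fix S assume S: "S \<in> Pow (set ks)"
      then have "k \<notin> S" "finite S" using k finite_subset by auto
      moreover from this have "flip (insert k S) i j = flip S (i(k := j k)) (j(k := i k))"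
        "flip (insert k S) j i = flip S (j(k := i k)) (i(k := j k))"
        by (auto simp: flip_def fun_eq_iff)
      ultimately show "?H i j (insert k S) = - ?H (i(k := j k)) (j(k := i k)) S" by simp
    qed
    finally show ?thesis by (simp add: sum_negf)
  qed
  have "foldr antisym (k # ks) G i j
      = (1 / 2 ^ length (k # ks)) * ((\<Sum>S\<in>Pow (set ks). ?H i j S) + (\<Sum>S\<in>insert k ` Pow (set ks). ?H i j S))"
  proof -
    have "foldr antisym (k # ks) G i j = (foldr antisym ks G i j - foldr antisym ks G (i(k := j k)) (j(k := i k))) / 2"
      by (simp add: antisym_def)
    then show ?thesis unfolding Cons.IH[OF d] sw by (simp add: field_simps)
  qed
  also have "(\<Sum>S\<in>Pow (set ks). ?H i j S) + (\<Sum>S\<in>insert k ` Pow (set ks). ?H i j S) = (\<Sum>S\<in>Pow (set (k # ks)). ?H i j S)"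
    unfolding list.set Pow_insert using k by (intro sum.union_disjoint[symmetric]) auto
  finally show ?case .
qed

lemma saint_venant_eq:
  fixes u :: "real ^ 'd \<Rightarrow> ('m::{finite,linorder}, 'd::finite) tensor"
  shows "saint_venant u \<phi> i j = (1 / (-2) ^ CARD('m)) * (\<Sum>S\<in>UNIV. (-1) ^ card S *
    (LINT x|lebesgue. u x $ flip S i j * partials (map (flip S j i) (sorted_list_of_set UNIV)) \<phi> x))"
proof -
  have "saint_venant u \<phi> i j = (1 / 2 ^ CARD('m)) * (\<Sum>S\<in>UNIV. (-1) ^ card S * distr_deriv u \<phi> (flip S i j) (flip S j i))"
    unfolding saint_venant_def by (subst foldr_antisym) auto
  also have "\<dots> = (1 / 2 ^ CARD('m)) * ((-1) ^ CARD('m) * (\<Sum>S\<in>UNIV. (-1) ^ card S *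
    (LINT x|lebesgue. u x $ flip S i j * partials (map (flip S j i) (sorted_list_of_set UNIV)) \<phi> x)))"
    unfolding distr_deriv_def by (simp add: sum_distrib_left mult.left_commute)
  also have "(1 / 2 ^ CARD('m)) * ((-1) ^ CARD('m) * x) = (1 / (-2) ^ CARD('m)) * x" for x :: real
    by (cases "even CARD('m)") simp_all
  finally show ?thesis .
qed

text \<open>The number of occurrences of an index.\<close>

definition cnt :: "('m::finite \<Rightarrow> 'd) \<Rightarrow> 'd \<Rightarrow> nat" where
  "cnt i c = card {k. i k = c}"

lemma cnt_sum: "cnt i c = (\<Sum>k\<in>UNIV. of_bool (i k = c))"
  by (simp add: cnt_def)

lemma count_list_map_enum:
  "count_list (map i (sorted_list_of_set UNIV)) c = cnt (i :: 'm::{finite,linorder} \<Rightarrow> 'd) c"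
proof -
  have "count_list (map i xs) c = card {k \<in> set xs. i k = c}" if "distinct xs" for xs :: "'m list"
    using that
  proof (induction xs)
    case (Cons x xs)
    have "{k \<in> set (x # xs). i k = c} = (if i x = c then insert x {k \<in> set xs. i k = c} else {k \<in> set xs. i k = c})"
      by auto
    with Cons show ?case by simp
  qed simp
  from this[of "sorted_list_of_set UNIV"] show ?thesis by (simp add: cnt_def)
qed

lemma sum_cnt: "(\<Sum>c\<in>UNIV. cnt (i :: 'm::finite \<Rightarrow> 'd::finite) c) = CARD('m)"
  unfolding cnt_sum by (subst sum.swap) (simp add: of_bool_def)

lemma cnt_flip_add: "cnt (flip S i j) c + cnt (flip S j i) c = cnt i c + cnt j c"
  unfolding cnt_sum sum.distrib[symmetric] by (intro sum.cong) (auto simp: flip_def)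

lemma flip_even:
  assumes "\<And>k. j k = a \<longleftrightarrow> i k \<noteq> a" "cnt (flip S i j) a = cnt i a"
  shows "even (card S)"
proof -
  have "int (cnt (flip S i j) a) = (\<Sum>k\<in>UNIV. of_bool (i k = a) + (of_bool (k \<in> S) - 2 * of_bool (k \<in> S \<and> i k = a)))"
    unfolding cnt_sum of_nat_sum using assms(1) by (intro sum.cong) (auto simp: flip_def)
  also have "\<dots> = int (cnt i a) + (int (card S) - 2 * (\<Sum>k\<in>UNIV. of_bool (k \<in> S \<and> i k = a)))"
    by (simp add: cnt_def sum.distrib sum_subtractf sum_distrib_left[symmetric])
  finally have "int (card S) = 2 * (\<Sum>k\<in>UNIV. of_bool (k \<in> S \<and> i k = a))" using assms(2) by simp
  then have "even (int (card S))" by (metis dvd_triv_left)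
  then show ?thesis by simp
qed

text \<open>The multi-index of the factors of \<open>sym_basis_prod l\<close>: the indices of the vectors listed by \<open>basis_factors l\<close>.\<close>

definition basis_indices :: "('d::{finite,linorder} \<Rightarrow> nat) \<Rightarrow> 'm::{finite,linorder} \<Rightarrow> 'd" where
  "basis_indices l k = concat (map (\<lambda>a. replicate (l a) a) (sorted_list_of_set UNIV)) ! card {..<k}"

lemma card_lessThan_bij:
  "bij_betw (\<lambda>k::'m::{finite,linorder}. card {..<k}) UNIV {..<CARD('m)}"
proof -
  have lt: "card {..<k} < card {..<k'}" if "k < k'" for k k' :: 'm
    using that by (intro psubset_card_mono) auto
  have inj: "inj (\<lambda>k::'m. card {..<k})"
    by (rule injI) (metis lt less_irrefl linorder_neqE)
  have sub: "range (\<lambda>k::'m. card {..<k}) \<subseteq> {..<CARD('m)}"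
  proof -
    have "card {..<k} < CARD('m)" for k :: 'm by (intro psubset_card_mono) auto
    then show ?thesis by auto
  qed
  have "card (range (\<lambda>k::'m. card {..<k})) = card {..<CARD('m)}"
    by (simp add: card_image[OF inj])
  with sub have "range (\<lambda>k::'m. card {..<k}) = {..<CARD('m)}" by (intro card_subset_eq) auto
  with inj show ?thesis by (simp add: bij_betw_def)
qed

lemma length_basis_list:
  "length (concat (map (\<lambda>a. replicate (l a) a) (sorted_list_of_set (UNIV::'d::{finite,linorder} set)))) = (\<Sum>a\<in>UNIV. l a)"
  by (simp add: length_concat o_def sum_list_distinct_conv_sum_set)

lemma count_basis_list:
  "count_list (concat (map (\<lambda>a. replicate (l a) a) (sorted_list_of_set (UNIV::'d::{finite,linorder} set)))) c = l c"
proof -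
  have rep: "count_list (replicate n a) c = (if a = c then n else 0)" for n and a :: 'd
    by (induction n) auto
  have "count_list (concat (map (\<lambda>a. replicate (l a) a) xs)) c = (\<Sum>a\<leftarrow>xs. if a = c then l a else 0)" for xs :: "'d list"
    by (induction xs) (auto simp: count_list_append rep)
  also have "(\<Sum>a\<leftarrow>sorted_list_of_set (UNIV::'d set). if a = c then l a else 0) = l c"
    by (simp add: sum_list_distinct_conv_sum_set)
  finally show ?thesis by (simp only:)
qed

lemma cnt_basis_indices:
  assumes "(\<Sum>a\<in>UNIV. l a) = CARD('m)"
  shows "cnt (basis_indices l :: 'm::{finite,linorder} \<Rightarrow> 'd::{finite,linorder}) c = l c"
proof -
  let ?xs = "concat (map (\<lambda>a. replicate (l a) a) (sorted_list_of_set (UNIV::'d set)))"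
  have "l c = card {n. n < length ?xs \<and> ?xs ! n = c}"
    unfolding count_basis_list[symmetric, of l c] count_list_eq_length_filter length_filter_conv_card
    by (rule arg_cong[where f = card]) auto
  also have "\<dots> = card {n \<in> {..<CARD('m)}. ?xs ! n = c}"
    using assms by (simp add: length_basis_list)
  also have "\<dots> = card {k \<in> (UNIV::'m set). ?xs ! card {..<k} = c}"
  proof -
    have "bij_betw (\<lambda>k::'m. card {..<k}) {k \<in> UNIV. ?xs ! card {..<k} = c} {n \<in> {..<CARD('m)}. ?xs ! n = c}"
      using card_lessThan_bij[where 'm = 'm] by (auto simp: bij_betw_def inj_on_def)
    then show ?thesis by (simp add: bij_betw_same_card)
  qed
  finally show ?thesis by (simp add: cnt_def basis_indices_def)
qed

lemma sym_basis_prod_component: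
  fixes i :: "'m::{finite,linorder} \<Rightarrow> 'd::{finite,linorder}"
  assumes "(\<Sum>a\<in>UNIV. l a) = CARD('m)"
  shows "sym_basis_prod l $ i = (1 / fact CARD('m)) * (\<Sum>\<tau> | \<tau> permutes UNIV. of_bool (i = basis_indices l \<circ> \<tau>))"
proof -
  have v: "(basis_factors l :: (real, 'd) vec list) ! card {..<k} = axis (basis_indices l k) 1" for k :: 'm
  proof -
    have "card {..<k} < CARD('m)" using card_lessThan_bij[where 'm = 'm] by (auto simp: bij_betw_def)
    then have "card {..<k} < length (concat (map (\<lambda>a. replicate (l a) a) (sorted_list_of_set (UNIV::'d set))))"
      unfolding length_basis_list assms .
    moreover have "(basis_factors l :: (real, 'd) vec list)
        = map (\<lambda>a. axis a 1) (concat (map (\<lambda>a. replicate (l a) a) (sorted_list_of_set UNIV)))"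
      by (simp add: basis_factors_def map_concat o_def)
    ultimately show ?thesis by (simp add: basis_indices_def)
  qed
  have "tensor_prod ((\<lambda>k. basis_factors l ! card {..<k}) \<circ> \<tau>) $ i = of_bool (i = basis_indices l \<circ> \<tau>)"
    for \<tau> :: "'m \<Rightarrow> 'm"
  proof (cases "i = basis_indices l \<circ> \<tau>")
    case True
    then show ?thesis by (simp add: tensor_prod_def v)
  next
    case False
    then obtain k where "i k \<noteq> basis_indices l (\<tau> k)" by (auto simp: fun_eq_iff)
    then have "(\<Prod>k\<in>UNIV. ((\<lambda>k. basis_factors l ! card {..<k}) \<circ> \<tau>) k $ i k) = (0::real)"
      by (intro prod_zero bexI[of _ k]) (auto simp: v axis_def)
    with False show ?thesis by (simp add: tensor_prod_def)
  qed
  then show ?thesis by (simp add: sym_basis_prod_def sym_prod_def)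
qed

lemma cnt_permute: "\<tau> permutes UNIV \<Longrightarrow> cnt (i \<circ> \<tau>) c = cnt i c"
proof -
  assume "\<tau> permutes UNIV"
  from sum.permute[OF this, of "\<lambda>k. of_bool (i k = c) :: nat"] show ?thesis
    unfolding cnt_sum o_def by (rule sym)
qed

lemma sym_basis_prod_nonneg:
  assumes "(\<Sum>a\<in>UNIV. l a) = CARD('m)"
  shows "sym_basis_prod l $ (i :: 'm::{finite,linorder} \<Rightarrow> 'd::{finite,linorder}) \<ge> 0"
  unfolding sym_basis_prod_component[OF assms] by (intro mult_nonneg_nonneg sum_nonneg) auto

lemma sym_basis_prod_nonzero:
  assumes "(\<Sum>a\<in>UNIV. l a) = CARD('m)" and "sym_basis_prod l $ i \<noteq> 0"
  shows "cnt (i :: 'm::{finite,linorder} \<Rightarrow> 'd::{finite,linorder}) = l"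
proof -
  from assms(2) have "\<exists>\<tau>. \<tau> permutes UNIV \<and> i = basis_indices l \<circ> \<tau>"
    unfolding sym_basis_prod_component[OF assms(1)] by (metis (mono_tags, lifting) mem_Collect_eq
      mult_eq_0_iff of_bool_eq_0_iff sum.neutral)
  then show ?thesis using cnt_permute cnt_basis_indices[OF assms(1)] by (metis ext)
qed

lemma sym_basis_prod_pos:
  assumes "(\<Sum>a\<in>UNIV. l a) = CARD('m)" and "cnt i = l"
  shows "sym_basis_prod l $ (i :: 'm::{finite,linorder} \<Rightarrow> 'd::{finite,linorder}) > 0"
proof -
  have "image_mset i (mset_set UNIV) = image_mset (basis_indices l :: 'm \<Rightarrow> 'd) (mset_set UNIV)"
  proof (rule multiset_eqI)
    fix c
    have cc: "count (image_mset i' (mset_set UNIV)) c = cnt i' c" for i' :: "'m \<Rightarrow> 'd"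
      by (simp add: count_image_mset cnt_def vimage_def)
    show "count (image_mset i (mset_set UNIV)) c = count (image_mset (basis_indices l :: 'm \<Rightarrow> 'd) (mset_set UNIV)) c"
      unfolding cc by (simp add: assms(2) cnt_basis_indices[OF assms(1)])
  qed
  then obtain \<tau> where \<tau>: "\<tau> permutes UNIV" "\<forall>k\<in>UNIV. i k = basis_indices l (\<tau> k)"
    using image_mset_eq_implies_permutes[OF finite_class.finite_UNIV] by metis
  then have "(\<Sum>\<tau>' | \<tau>' permutes UNIV. of_bool (i = basis_indices l \<circ> \<tau>')) > (0::real)"
    by (intro sum_pos2[of _ \<tau>]) (auto simp: fun_eq_iff finite_permutations)
  then show ?thesis unfolding sym_basis_prod_component[OF assms(1)] by simp
qed

lemma sym_basis_prod_sum:
  assumes "(\<Sum>a\<in>UNIV. l a) = CARD('m)"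
  shows "(\<Sum>i\<in>UNIV. (sym_basis_prod l :: ('m::{finite,linorder}, 'd::{finite,linorder}) tensor) $ i) = 1"
proof -
  have "(\<Sum>i\<in>UNIV. (sym_basis_prod l :: ('m, 'd) tensor) $ i)
      = (1 / fact CARD('m)) * (\<Sum>\<tau> | \<tau> permutes (UNIV::'m set). \<Sum>i\<in>UNIV. of_bool (i = (basis_indices l :: 'm \<Rightarrow> 'd) \<circ> \<tau>))"
    unfolding sym_basis_prod_component[OF assms] sum_distrib_left[symmetric] by (subst sum.swap) simp
  also have "\<dots> = (1 / fact CARD('m)) * real (card {\<tau>. \<tau> permutes (UNIV::'m set)})"
    by (simp add: of_bool_def)
  also have "\<dots> = 1" by (simp add: card_permutations)
  finally show ?thesis .
qed

section \<open>The elastic estimate\<close>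

lemma cauchy_schwarz_set:
  fixes G :: "'a::euclidean_space \<Rightarrow> real"
  assumes \<Omega>: "\<Omega> \<in> lmeasurable" "measure lebesgue \<Omega> > 0"
    and G: "(\<lambda>x. indicator \<Omega> x * G x) \<in> borel_measurable lebesgue"
    and E: "(\<integral>\<^sup>+x\<in>\<Omega>. ennreal ((G x)\<^sup>2) \<partial>lebesgue) \<le> ennreal E" "E \<ge> 0"
  shows "set_integrable lebesgue \<Omega> G" "(LINT x:\<Omega>|lebesgue. \<bar>G x\<bar>) \<le> sqrt (measure lebesgue \<Omega> * E)"
proof -
  define h where "h x = indicator \<Omega> x * G x" for x
  define \<mu> where "\<mu> = measure lebesgue \<Omega>"
  have hm[measurable]: "h \<in> borel_measurable lebesgue" using G by (simp add: h_def[abs_def])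
  have \<Omega>m[measurable]: "\<Omega> \<in> sets lebesgue" using \<Omega>(1) by blast
  have hi: "ennreal \<bar>h x\<bar> * indicator \<Omega> x = ennreal \<bar>h x\<bar>" for x by (simp add: h_def indicator_def)
  have h2: "(ennreal \<bar>h x\<bar>)\<^sup>2 = ennreal ((G x)\<^sup>2) * indicator \<Omega> x" for x
    by (simp add: h_def indicator_def ennreal_power)
  have "(\<integral>\<^sup>+x. (indicator \<Omega> x)\<^sup>2 \<partial>lebesgue) = (\<integral>\<^sup>+x. indicator \<Omega> x \<partial>lebesgue)"
    by (intro nn_integral_cong) (simp add: indicator_def)
  also have "\<dots> = ennreal \<mu>" using \<Omega>(1) by (simp add: \<mu>_def emeasure_eq_measure2)
  finally have \<mu>: "(\<integral>\<^sup>+x. (indicator \<Omega> x)\<^sup>2 \<partial>lebesgue) = ennreal \<mu>" .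
  have "(\<integral>\<^sup>+x. ennreal \<bar>h x\<bar> * indicator \<Omega> x \<partial>lebesgue)\<^sup>2
      \<le> (\<integral>\<^sup>+x. (ennreal \<bar>h x\<bar>)\<^sup>2 \<partial>lebesgue) * (\<integral>\<^sup>+x. (indicator \<Omega> x)\<^sup>2 \<partial>lebesgue)"
    by (rule Cauchy_Schwarz_nn_integral) measurable
  also have "\<dots> \<le> ennreal E * ennreal \<mu>" unfolding h2 \<mu> by (intro mult_right_mono E) simp
  also have "\<dots> = ennreal (E * \<mu>)" using E(2) by (simp add: ennreal_mult \<mu>_def)
  finally have cs: "(\<integral>\<^sup>+x. ennreal \<bar>h x\<bar> \<partial>lebesgue)\<^sup>2 \<le> ennreal (E * \<mu>)" unfolding hi .
  have "(\<integral>\<^sup>+x. ennreal \<bar>h x\<bar> \<partial>lebesgue) \<noteq> \<infinity>"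
  proof
    assume "(\<integral>\<^sup>+x. ennreal \<bar>h x\<bar> \<partial>lebesgue) = \<infinity>"
    with cs show False by (simp add: power2_eq_square ennreal_top_mult top_unique)
  qed
  then have ih: "integrable lebesgue h" by (intro integrableI_bounded) (auto simp: less_top)
  then show "set_integrable lebesgue \<Omega> G" by (simp add: set_integrable_def h_def[abs_def])
  define a where "a = (LINT x|lebesgue. \<bar>h x\<bar>)"
  have a0: "a \<ge> 0" by (simp add: a_def)
  have "(\<integral>\<^sup>+x. ennreal \<bar>h x\<bar> \<partial>lebesgue) = ennreal a"
    unfolding a_def by (rule nn_integral_eq_integral[OF integrable_abs[OF ih]]) simp
  then have "a\<^sup>2 \<le> E * \<mu>" using cs a0 E(2) by (simp add: ennreal_power \<mu>_def)
  then have "a \<le> sqrt (\<mu> * E)" by (simp add: real_le_rsqrt mult.commute)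
  moreover have "(LINT x:\<Omega>|lebesgue. \<bar>G x\<bar>) = a"
    unfolding a_def set_lebesgue_integral_def
    by (intro Bochner_Integration.integral_cong) (auto simp: h_def abs_mult)
  ultimately show "(LINT x:\<Omega>|lebesgue. \<bar>G x\<bar>) \<le> sqrt (measure lebesgue \<Omega> * E)" by (simp add: \<mu>_def)
qed

lemma conv_test_function_UNIV:
  assumes w: "weight p q \<sigma>" and \<Phi>: "\<And>c. compact_smooth R (\<Phi> c)"
  shows "conv \<sigma> (tens \<Phi>) \<in> test_functions UNIV"
proof (rule conv_test_function[OF w \<Phi>])
  let ?K = "cbox (p - (\<chi> c. \<bar>R\<bar>)) (q + (\<chi> c. \<bar>R\<bar>))"
  show "compact ?K" "?K \<subseteq> UNIV" by auto
  fix x y assume y: "y \<in> cbox p q" and nz: "\<And>c. \<Phi> c ((x - y) $ c) \<noteq> 0"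
  have 1: "(x - y) $ c \<in> {-R..R}" for c using nz[of c] compact_smooth_zero[OF \<Phi>] by blast
  have 2: "p $ c \<le> y $ c \<and> y $ c \<le> q $ c" for c using y by (simp add: mem_box_cart)
  show "x \<in> ?K" unfolding mem_box_cart
  proof
    fix c show "(p - (\<chi> c. \<bar>R\<bar>)) $ c \<le> x $ c \<and> x $ c \<le> (q + (\<chi> c. \<bar>R\<bar>)) $ c"
      using 1[of c] 2[of c] by auto
  qed
qed

lemma integrable_lebesgue_test_function:
  "\<psi> \<in> test_functions \<Omega> \<Longrightarrow> integrable lebesgue \<psi>"
  using test_function_integrable by (auto simp: integrable_completion)

lemma L2_loc_test_integrable:
  fixes u :: "real ^ 'd::finite \<Rightarrow> real ^ 'n::finite"
  assumes u: "u \<in> L2_loc" and \<psi>: "\<psi> \<in> test_functions \<Omega>"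
  shows "integrable lebesgue (\<lambda>x. u x $ i * \<psi> x)"
proof -
  obtain K where K: "compact K" "\<And>x. x \<notin> K \<Longrightarrow> \<psi> x = 0" using test_function_support[OF \<psi>] by metis
  obtain B where B: "B \<ge> 0" "\<And>x. \<bar>\<psi> x\<bar> \<le> B" using test_function_bounded[OF \<psi>] by metis
  have um[measurable]: "u \<in> borel_measurable lebesgue" using u by (simp add: L2_loc_def)
  have \<psi>m[measurable]: "\<psi> \<in> borel_measurable lebesgue"
    using integrable_lebesgue_test_function[OF \<psi>] by auto
  have ui[measurable]: "(\<lambda>x. u x $ i) \<in> borel_measurable lebesgue"
    using borel_measurable_continuous_onI[of "\<lambda>v :: real ^ 'n. v $ i"] um
    by (auto intro!: continuous_intros measurable_compose[OF um])
  have "integrable lebesgue (\<lambda>x. indicator K x * (norm (u x))\<^sup>2)"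
    using u K(1) by (simp add: L2_loc_def set_integrable_def)
  moreover have "integrable lebesgue (indicator K :: _ \<Rightarrow> real)"
    using lmeasurable_compact[OF K(1)] by (intro integrable_real_indicator) (auto simp: fmeasurable_def)
  ultimately have int: "integrable lebesgue (\<lambda>x. B * (indicator K x + indicator K x * (norm (u x))\<^sup>2))"
    by (intro integrable_mult_right Bochner_Integration.integrable_add)
  show ?thesis
  proof (rule Bochner_Integration.integrable_bound[OF int])
    have "norm (u x $ i * \<psi> x) \<le> norm (B * (indicator K x + indicator K x * (norm (u x))\<^sup>2))" for x
    proof (cases "x \<in> K")
      case True
      have "0 \<le> (norm (u x) - 1/2)\<^sup>2" by simp
      then have "norm (u x) \<le> 1 + (norm (u x))\<^sup>2" by (simp add: power2_diff power_divide)
      moreover have "\<bar>u x $ i\<bar> \<le> norm (u x)" by (rule component_le_norm_cart)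
      ultimately have "\<bar>\<psi> x\<bar> * \<bar>u x $ i\<bar> \<le> B * (1 + (norm (u x))\<^sup>2)" by (intro mult_mono B) auto
      then show ?thesis using True B(1) by (simp add: abs_mult mult.commute)
    qed (simp add: K(2))
    then show "AE x in lebesgue. norm (u x $ i * \<psi> x) \<le> norm (B * (indicator K x + indicator K x * (norm (u x))\<^sup>2))"
      by simp
  qed measurable
qed

text \<open>The Saint-Venant equation for \<open>u - F\<close> on the domain: the constant \<open>F\<close> solves the equation, and \<open>u = F\<close>
  almost everywhere outside the domain.\<close>

lemma admissible_identity:
  fixes u :: "real ^ 'd::finite \<Rightarrow> ('m::{finite,linorder}, 'd) tensor"
    and i j :: "'m \<Rightarrow> 'd"
  assumes u: "u \<in> admissible \<Omega> F" and \<Omega>: "open \<Omega>" "negligible (frontier \<Omega>)"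
    and \<phi>: "\<phi> \<in> test_functions UNIV"
  defines "\<psi> S \<equiv> partials (map (flip S j i) (sorted_list_of_set UNIV)) \<phi>"
  shows "(\<Sum>S\<in>UNIV. (-1) ^ card S * (LINT x:\<Omega>|lebesgue. (u x - F) $ flip S i j * \<psi> S x)) = 0"
    and "set_integrable lebesgue \<Omega> (\<lambda>x. (u x - F) $ flip S i j * \<psi> S x)"
proof -
  have uL: "u \<in> L2_loc" and sv: "saint_venant u \<phi> i j = 0"
    and ae: "AE x in lebesgue. x \<notin> closure \<Omega> \<longrightarrow> u x = F"
    using u \<phi> by (auto simp: admissible_def)
  have \<psi>: "\<psi> S \<in> test_functions UNIV" for S unfolding \<psi>_def by (rule test_function_partials[OF \<phi>])
  have mean: "(LINT x|lebesgue. \<psi> S x) = 0" for S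
  proof -
    have "sorted_list_of_set (UNIV :: 'm set) \<noteq> []" by simp
    then obtain k ks where "sorted_list_of_set (UNIV :: 'm set) = k # ks" using list.exhaust by blast
    then have eq: "\<psi> S = partial (flip S j i k) (partials (map (flip S j i) ks) \<phi>)"
      by (simp add: \<psi>_def partials_Cons)
    have "(LINT x|lborel. \<psi> S x) = 0"
      unfolding eq by (rule test_function_integral_partial[OF test_function_partials[OF \<phi>]])
    then show ?thesis using \<psi>[of S] by (subst integral_completion) auto
  qed
  have int1: "integrable lebesgue (\<lambda>x. u x $ flip S i j * \<psi> S x)" for S
    by (rule L2_loc_test_integrable[OF uL \<psi>])
  have int2: "integrable lebesgue (\<lambda>x. F $ flip S i j * \<psi> S x)" for S
    using integrable_lebesgue_test_function[OF \<psi>] by simp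
  have int3: "integrable lebesgue (\<lambda>x. (u x - F) $ flip S i j * \<psi> S x)" for S
    using Bochner_Integration.integrable_diff[OF int1[of S] int2[of S]] by (simp add: left_diff_distrib)
  have \<Omega>m: "\<Omega> \<in> sets lebesgue" using \<Omega>(1) by auto
  show "set_integrable lebesgue \<Omega> (\<lambda>x. (u x - F) $ flip S i j * \<psi> S x)"
    unfolding set_integrable_def by (rule integrable_mult_indicator[OF \<Omega>m int3])
  have eq: "(LINT x|lebesgue. u x $ flip S i j * \<psi> S x) = (LINT x:\<Omega>|lebesgue. (u x - F) $ flip S i j * \<psi> S x)" for S
  proof -
    have "(LINT x|lebesgue. u x $ flip S i j * \<psi> S x)
        = (LINT x|lebesgue. u x $ flip S i j * \<psi> S x) - (LINT x|lebesgue. F $ flip S i j * \<psi> S x)"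
      using mean[of S] by simp
    also have "\<dots> = (LINT x|lebesgue. (u x - F) $ flip S i j * \<psi> S x)"
      using int1[of S] int2[of S] by (simp add: left_diff_distrib)
    also have "\<dots> = (LINT x:\<Omega>|lebesgue. (u x - F) $ flip S i j * \<psi> S x)"
      unfolding set_lebesgue_integral_def
    proof (rule integral_cong_AE)
      show "(\<lambda>x. (u x - F) $ flip S i j * \<psi> S x) \<in> borel_measurable lebesgue" using int3[of S] by auto
      show "(\<lambda>x. indicat_real \<Omega> x *\<^sub>R ((u x - F) $ flip S i j * \<psi> S x)) \<in> borel_measurable lebesgue"
        using integrable_mult_indicator[OF \<Omega>m int3[of S]] by auto
      have "AE x in lebesgue. x \<notin> frontier \<Omega>"
        using \<Omega>(2) by (simp add: negligible_iff_null_sets AE_not_in)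
      with ae show "AE x in lebesgue. (u x - F) $ flip S i j * \<psi> S x = indicat_real \<Omega> x *\<^sub>R ((u x - F) $ flip S i j * \<psi> S x)"
      proof eventually_elim
        case (elim x)
        then show ?case using interior_open[OF \<Omega>(1)]
          by (cases "x \<in> closure \<Omega>") (auto simp: frontier_def indicator_def)
      qed
    qed
    finally show ?thesis .
  qed
  show "(\<Sum>S\<in>UNIV. (-1) ^ card S * (LINT x:\<Omega>|lebesgue. (u x - F) $ flip S i j * \<psi> S x)) = 0"
    using sv unfolding saint_venant_eq \<psi>_def[symmetric] eq by simp
qed

text \<open>The duality estimate behind the lower bound: testing with a convolution whose derivative along
  the indices \<open>j\<close> is integrated against the phase indicator \<open>f\<close>.\<close>

lemma elastic_estimate:
  fixes u chi :: "real ^ 'd::{finite,linorder} \<Rightarrow> ('m::{finite,linorder}, 'd) tensor"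
    and i j :: "'m \<Rightarrow> 'd"
  assumes u: "u \<in> admissible \<Omega> F" and \<Omega>: "open \<Omega>" "negligible (frontier \<Omega>)" "bounded \<Omega>" "\<Omega> \<noteq> {}"
    and chi: "\<And>x. x \<in> \<Omega> \<Longrightarrow> chi x = F + f x *\<^sub>R sym_basis_prod l"
    and f: "(\<lambda>x. indicator \<Omega> x * f x) \<in> borel_measurable lebesgue" "\<And>x. x \<in> \<Omega> \<Longrightarrow> \<bar>f x\<bar> \<le> 1"
    and l: "(\<Sum>c\<in>UNIV. l c) = CARD('m)" and i: "cnt i = l"
    and j: "\<And>k. j k = a \<longleftrightarrow> i k \<noteq> a"
    and E: "(\<integral>\<^sup>+x\<in>\<Omega>. ennreal ((norm (u x - chi x))\<^sup>2) \<partial>lebesgue) \<le> ennreal E" "E \<ge> 0"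
    and w: "weight p q \<sigma>" and \<Phi>: "\<And>c. compact_smooth R (\<Phi> c)"
    and D: "\<And>k. (\<Sum>c\<in>UNIV. k c) = CARD('m) \<Longrightarrow> (\<Prod>c\<in>UNIV. L1 ((deriv ^^ k c) (\<Phi> c))) \<le> D"
  shows "sym_basis_prod l $ i * \<bar>LINT x:\<Omega>|lebesgue. f x * conv \<sigma> (tens (\<lambda>c. (deriv ^^ cnt j c) (\<Phi> c))) x\<bar>
    \<le> 2 ^ CARD('m) * (D * sqrt (measure lebesgue \<Omega> * E))"
proof -
  let ?M = "sym_basis_prod l :: ('m, 'd) tensor"
  define \<phi> where "\<phi> = conv \<sigma> (tens \<Phi>)"
  define P where "P k = conv \<sigma> (tens (\<lambda>c. (deriv ^^ k c) (\<Phi> c)))" for k :: "'d \<Rightarrow> nat"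
  have sm: "smooth (\<Phi> c)" for c using \<Phi> by (rule compact_smooth_smooth)
  have \<phi>: "\<phi> \<in> test_functions UNIV"
    unfolding \<phi>_def by (rule conv_test_function_UNIV[OF w \<Phi>])
  have part: "partials (map (flip S j i) (sorted_list_of_set UNIV)) \<phi> = P (cnt (flip S j i))" for S
    unfolding \<phi>_def P_def conv_partials[OF w sm] count_list_map_enum ..
  have P: "P (cnt (flip S j i)) \<in> test_functions UNIV" for S
    unfolding part[symmetric] by (rule test_function_partials[OF \<phi>])
  have Pb: "\<bar>P k x\<bar> \<le> D" if "(\<Sum>c\<in>UNIV. k c) = CARD('m)" for k x
    unfolding P_def using conv_bound[OF w compact_smooth_funpow[OF \<Phi>]] D[OF that] by (rule order_trans)
  have fin: "\<Omega> \<in> lmeasurable" using \<Omega> by (simp add: lmeasurable_open)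
  have pos: "measure lebesgue \<Omega> > 0"
  proof -
    have "\<not> negligible \<Omega>" using \<Omega> open_not_negligible by blast
    then show ?thesis using fin by (simp add: negligible_iff_measure zero_less_measure_iff)
  qed
  have \<Omega>m: "\<Omega> \<in> sets lebesgue" using \<Omega>(1) by auto
  note id = admissible_identity[OF u \<Omega>(1,2) \<phi>, where i = i and j = j, unfolded part]
  define g where "g S x = (u x - chi x) $ flip S i j" for S x
  have dec: "(u x - F) $ flip S i j = f x * ?M $ flip S i j + g S x" if "x \<in> \<Omega>" for S x
    using chi[OF that] by (simp add: g_def)
  have dec': "u x $ flip S i j = F $ flip S i j + (f x * ?M $ flip S i j + g S x)" if "x \<in> \<Omega>" for S x
    using dec[OF that, of S] by simp
  have fP: "set_integrable lebesgue \<Omega> (\<lambda>x. f x * P (cnt (flip S j i)) x)" for S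
    unfolding set_integrable_def
  proof (rule Bochner_Integration.integrable_bound)
    show "integrable lebesgue (P (cnt (flip S j i)))" by (rule integrable_lebesgue_test_function[OF P])
    have "(\<lambda>x. (indicator \<Omega> x * f x) * P (cnt (flip S j i)) x) \<in> borel_measurable lebesgue"
      by (rule borel_measurable_times[OF f(1) borel_measurable_integrable[OF integrable_lebesgue_test_function[OF P]]])
    then show "(\<lambda>x. indicat_real \<Omega> x *\<^sub>R (f x * P (cnt (flip S j i)) x)) \<in> borel_measurable lebesgue"
      by (simp add: mult.assoc)
    show "AE x in lebesgue. norm (indicat_real \<Omega> x *\<^sub>R (f x * P (cnt (flip S j i)) x)) \<le> norm (P (cnt (flip S j i)) x)"
      using f(2) by (intro AE_I2) (auto simp: indicator_def abs_mult mult_left_le_one_le)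
  qed
  have gm: "(\<lambda>x. indicator \<Omega> x * g S x) \<in> borel_measurable lebesgue" for S
  proof -
    have "u \<in> borel_measurable lebesgue" using u by (simp add: admissible_def L2_loc_def)
    then have "(\<lambda>x. u x $ flip S i j) \<in> borel_measurable lebesgue"
      by (rule measurable_compose) (auto intro!: borel_measurable_continuous_onI continuous_intros)
    then have "(\<lambda>x. indicator \<Omega> x * (u x $ flip S i j - F $ flip S i j)) \<in> borel_measurable lebesgue"
      using \<Omega>m by (intro borel_measurable_times borel_measurable_indicator borel_measurable_diff) auto
    moreover have "(\<lambda>x. (indicator \<Omega> x * f x) * ?M $ flip S i j) \<in> borel_measurable lebesgue"
      by (rule borel_measurable_times[OF f(1)]) simp
    ultimately have "(\<lambda>x. indicator \<Omega> x * (u x $ flip S i j - F $ flip S i j) - (indicator \<Omega> x * f x) * ?M $ flip S i j) \<in> borel_measurable lebesgue"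
      by (rule borel_measurable_diff)
    also have "(\<lambda>x. indicator \<Omega> x * (u x $ flip S i j - F $ flip S i j) - (indicator \<Omega> x * f x) * ?M $ flip S i j)
        = (\<lambda>x. indicator \<Omega> x * g S x)"
      using dec by (auto simp: indicator_def fun_eq_iff)
    finally show ?thesis .
  qed
  have gE: "(\<integral>\<^sup>+x\<in>\<Omega>. ennreal ((g S x)\<^sup>2) \<partial>lebesgue) \<le> ennreal E" for S
  proof -
    have "(g S x)\<^sup>2 \<le> (norm (u x - chi x))\<^sup>2" for x
      unfolding g_def using component_le_norm_cart[of "u x - chi x" "flip S i j"]
      by (intro abs_le_square_iff[THEN iffD1]) simp
    then have "(\<integral>\<^sup>+x\<in>\<Omega>. ennreal ((g S x)\<^sup>2) \<partial>lebesgue) \<le> (\<integral>\<^sup>+x\<in>\<Omega>. ennreal ((norm (u x - chi x))\<^sup>2) \<partial>lebesgue)"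
      by (intro nn_integral_mono mult_right_mono ennreal_leI) auto
    with E(1) show ?thesis by (rule order_trans[rotated])
  qed
  note CS = cauchy_schwarz_set[OF fin pos gm gE E(2)]
  have gP: "set_integrable lebesgue \<Omega> (\<lambda>x. g S x * P (cnt (flip S j i)) x)" for S
  proof -
    have "set_integrable lebesgue \<Omega> (\<lambda>x. (u x - F) $ flip S i j * P (cnt (flip S j i)) x - ?M $ flip S i j * (f x * P (cnt (flip S j i)) x))"
      by (intro set_integral_diff set_integrable_mult_right id(2) fP)
    then show ?thesis
      by (rule set_integrable_cong[THEN iffD1, rotated -1]) (auto simp: dec' algebra_simps)
  qed
  define J where "J = (LINT x:\<Omega>|lebesgue. f x * P (cnt j) x)"
  define G where "G S = (LINT x:\<Omega>|lebesgue. g S x * P (cnt (flip S j i)) x)" for S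
  have split: "(LINT x:\<Omega>|lebesgue. (u x - F) $ flip S i j * P (cnt (flip S j i)) x)
      = ?M $ flip S i j * (LINT x:\<Omega>|lebesgue. f x * P (cnt (flip S j i)) x) + G S" for S
  proof -
    have "(LINT x:\<Omega>|lebesgue. (u x - F) $ flip S i j * P (cnt (flip S j i)) x)
        = (LINT x:\<Omega>|lebesgue. ?M $ flip S i j * (f x * P (cnt (flip S j i)) x) + g S x * P (cnt (flip S j i)) x)"
      by (rule set_lebesgue_integral_cong[OF \<Omega>m]) (auto simp: dec' algebra_simps)
    also have "\<dots> = (LINT x:\<Omega>|lebesgue. ?M $ flip S i j * (f x * P (cnt (flip S j i)) x)) + G S"
      unfolding G_def by (intro set_integral_add set_integrable_mult_right fP gP)
    finally show ?thesis by simp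
  qed
  have coef: "(-1) ^ card S * (?M $ flip S i j * (LINT x:\<Omega>|lebesgue. f x * P (cnt (flip S j i)) x)) = ?M $ flip S i j * J" for S
  proof (cases "?M $ flip S i j = 0")
    case False
    then have c: "cnt (flip S i j) = l" by (rule sym_basis_prod_nonzero[OF l])
    then have "even (card S)" using flip_even[of j a i S] j i by simp
    moreover have "cnt (flip S j i) = cnt j"
    proof
      show "cnt (flip S j i) c' = cnt j c'" for c' using cnt_flip_add[of S i j c'] c i by simp
    qed
    ultimately show ?thesis by (simp add: J_def)
  qed simp
  have "0 = (\<Sum>S\<in>UNIV. ?M $ flip S i j * J) + (\<Sum>S\<in>UNIV. (-1) ^ card S * G S)"
    using id(1) unfolding split by (simp add: distrib_left coef sum.distrib)
  then have "(\<Sum>S\<in>UNIV. ?M $ flip S i j) * J = - (\<Sum>S\<in>UNIV. (-1) ^ card S * G S)"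
    unfolding sum_distrib_right by linarith
  then have "\<bar>(\<Sum>S\<in>UNIV. ?M $ flip S i j) * J\<bar> = \<bar>\<Sum>S\<in>UNIV. (-1) ^ card S * G S\<bar>"
    by (simp only: abs_minus_cancel)
  moreover have "(\<Sum>S\<in>UNIV. ?M $ flip S i j) \<ge> 0" by (intro sum_nonneg sym_basis_prod_nonneg[OF l])
  ultimately have eq: "(\<Sum>S\<in>UNIV. ?M $ flip S i j) * \<bar>J\<bar> = \<bar>\<Sum>S\<in>UNIV. (-1) ^ card S * G S\<bar>"
    by (simp only: abs_mult abs_of_nonneg)
  have Gb: "\<bar>G S\<bar> \<le> D * sqrt (measure lebesgue \<Omega> * E)" for S
  proof -
    have sumc: "(\<Sum>c\<in>UNIV. cnt (flip S j i) c) = CARD('m)" by (rule sum_cnt)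
    have D0: "0 \<le> D" using Pb[OF sumc, of undefined] by (meson abs_ge_zero order_trans)
    have "\<bar>G S\<bar> \<le> (LINT x:\<Omega>|lebesgue. \<bar>g S x * P (cnt (flip S j i)) x\<bar>)"
      unfolding G_def set_lebesgue_integral_def
      using integral_abs_bound[of lebesgue "\<lambda>x. indicator \<Omega> x *\<^sub>R (g S x * P (cnt (flip S j i)) x)"]
      by (simp add: abs_mult)
    also have "\<dots> \<le> (LINT x:\<Omega>|lebesgue. D * \<bar>g S x\<bar>)"
    proof (rule set_integral_mono)
      show "set_integrable lebesgue \<Omega> (\<lambda>x. \<bar>g S x * P (cnt (flip S j i)) x\<bar>)"
        using gP by (rule set_integrable_abs)
      show "set_integrable lebesgue \<Omega> (\<lambda>x. D * \<bar>g S x\<bar>)"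
        by (intro set_integrable_mult_right set_integrable_abs CS(1))
      show "\<bar>g S x * P (cnt (flip S j i)) x\<bar> \<le> D * \<bar>g S x\<bar>" for x
        using mult_right_mono[OF Pb[OF sumc, of x], of "\<bar>g S x\<bar>"] by (simp add: abs_mult mult.commute)
    qed
    also have "\<dots> = D * (LINT x:\<Omega>|lebesgue. \<bar>g S x\<bar>)" by simp
    also have "\<dots> \<le> D * sqrt (measure lebesgue \<Omega> * E)"
      using CS(2) D0 by (rule mult_left_mono)
    finally show ?thesis .
  qed
  have "?M $ i * \<bar>J\<bar> \<le> (\<Sum>S\<in>UNIV. ?M $ flip S i j) * \<bar>J\<bar>"
  proof (rule mult_right_mono)
    have "?M $ flip {} i j \<le> (\<Sum>S\<in>UNIV. ?M $ flip S i j)"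
      by (rule member_le_sum) (auto intro: sym_basis_prod_nonneg[OF l])
    then show "?M $ i \<le> (\<Sum>S\<in>UNIV. ?M $ flip S i j)" by (simp add: flip_def)
  qed simp
  also have "\<dots> \<le> (\<Sum>S\<in>(UNIV::'m set set). D * sqrt (measure lebesgue \<Omega> * E))"
    unfolding eq using Gb by (intro order_trans[OF sum_abs] sum_mono) (simp add: abs_mult)
  also have "\<dots> = 2 ^ CARD('m) * (D * sqrt (measure lebesgue \<Omega> * E))"
    by (simp add: card_UNIV_set)
  finally show ?thesis by (simp add: J_def P_def)
qed

section \<open>Telescoping over dyadic scales\<close>

lemma prod_diff_telescope:
  fixes g h :: "'d::linorder \<Rightarrow> real"
  assumes "finite A"
  shows "(\<Prod>c\<in>A. g c) - (\<Prod>c\<in>A. h c)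
    = (\<Sum>a\<in>A. \<Prod>c\<in>A. if c < a then g c else if c = a then g c - h c else h c)"
  using assms
proof (induction A rule: finite_linorder_max_induct)
  case (insert b A)
  let ?t = "\<lambda>a c. if c < a then g c else if c = a then g c - h c else h c"
  have b: "b \<notin> A" using insert by auto
  have 1: "(\<Prod>c\<in>insert b A. ?t b c) = (g b - h b) * (\<Prod>c\<in>A. g c)"
    using insert b by simp
  have 2: "(\<Prod>c\<in>insert b A. ?t a c) = h b * (\<Prod>c\<in>A. ?t a c)" if "a \<in> A" for a
    using insert b that by (subst prod.insert) auto
  have "(\<Sum>a\<in>insert b A. \<Prod>c\<in>insert b A. ?t a c) = (g b - h b) * (\<Prod>c\<in>A. g c) + h b * (\<Sum>a\<in>A. \<Prod>c\<in>A. ?t a c)"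
  proof -
    have "(\<Sum>a\<in>insert b A. \<Prod>c\<in>insert b A. ?t a c) = (\<Prod>c\<in>insert b A. ?t b c) + (\<Sum>a\<in>A. \<Prod>c\<in>insert b A. ?t a c)"
      by (rule sum.insert[OF insert(1) b])
    also have "(\<Sum>a\<in>A. \<Prod>c\<in>insert b A. ?t a c) = h b * (\<Sum>a\<in>A. \<Prod>c\<in>A. ?t a c)"
      unfolding sum_distrib_left by (rule sum.cong[OF refl 2])
    finally show ?thesis unfolding 1 .
  qed
  also have "\<dots> = (\<Prod>c\<in>insert b A. g c) - (\<Prod>c\<in>insert b A. h c)"
    unfolding insert.IH[symmetric] using insert b by (simp add: algebra_simps)
  finally show ?case ..
qed simp

text \<open>The part of the difference of two consecutive dyadic kernels that oscillates in direction \<open>a\<close>.\<close>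

definition block :: "(real \<Rightarrow> real) \<Rightarrow> (real \<Rightarrow> real) \<Rightarrow> nat \<Rightarrow> nat \<Rightarrow> 'd::linorder \<Rightarrow> 'd \<Rightarrow> real \<Rightarrow> real" where
  "block r \<kappa> k n a c = (if c < a then dilate (Suc n) r else if c = a then (deriv ^^ k) (dilate n \<kappa>) else dilate n r)"

lemma tens_dilate_telescope:
  fixes x :: "real ^ 'd::{finite,linorder}"
  assumes "\<And>t. 2 * r (2 * t) - r t = (deriv ^^ m) \<kappa> t" "smooth \<kappa>"
  shows "tens (\<lambda>_. dilate (Suc n) r) x - tens (\<lambda>_. dilate n r) x
    = (\<Sum>a\<in>UNIV. (1 / 2 ^ (n * m)) * tens (block r \<kappa> m n a) x)"
proof -
  have d: "dilate (Suc n) r t - dilate n r t = (1 / 2 ^ (n * m)) * (deriv ^^ m) (dilate n \<kappa>) t" for t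
    unfolding dilate_difference[OF assms] by (simp only: funpow_deriv_cmult[OF dilate_smooth[OF assms(2)]])
  have "(\<Prod>c\<in>UNIV. if c < a then dilate (Suc n) r (x $ c) else if c = a then
      dilate (Suc n) r (x $ c) - dilate n r (x $ c) else dilate n r (x $ c))
    = (1 / 2 ^ (n * m)) * tens (block r \<kappa> m n a) x" (is "?l = _") for a
  proof -
    have "?l = (\<Prod>c\<in>UNIV. (if c = a then 1 / 2 ^ (n * m) else 1) * block r \<kappa> m n a c (x $ c))"
      by (intro prod.cong refl) (auto simp: block_def d)
    also have "\<dots> = (1 / 2 ^ (n * m)) * tens (block r \<kappa> m n a) x"
      unfolding prod.distrib tens_def by (simp add: prod.delta)
    finally show ?thesis .
  qed
  then show ?thesis
    unfolding tens_def using prod_diff_telescope[of UNIV "\<lambda>c. dilate (Suc n) r (x $ c)" "\<lambda>c. dilate n r (x $ c)"]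
    by (simp add: tens_def)
qed

lemma block_compact_smooth:
  assumes "compact_smooth 1 r" "compact_smooth 1 \<kappa>"
  shows "compact_smooth 1 (block r \<kappa> k n a c)"
  using assms by (simp add: block_def dilate_compact_smooth compact_smooth_funpow)

lemma conv_cmult: "conv \<sigma> (\<lambda>x. c * \<Psi> x) x = c * conv \<sigma> \<Psi> x"
proof -
  have "conv \<sigma> (\<lambda>x. c * \<Psi> x) x = (LINT y|lborel. c * (\<sigma> y * \<Psi> (x - y)))"
    by (simp add: conv_def mult.left_commute)
  then show ?thesis by (simp add: conv_def)
qed

lemma conv_sum:
  assumes "weight p q \<sigma>" "\<And>i. i \<in> I \<Longrightarrow> continuous_on UNIV (\<Psi> i)"
  shows "conv \<sigma> (\<lambda>x. \<Sum>i\<in>I. \<Psi> i x) x = (\<Sum>i\<in>I. conv \<sigma> (\<Psi> i) x)"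
  unfolding conv_def sum_distrib_left
  by (rule Bochner_Integration.integral_sum) (rule conv_integrable(1)[OF assms(1,2)])

lemma conv_dilate_telescope:
  fixes \<sigma> :: "real ^ 'd::{finite,linorder} \<Rightarrow> real"
  assumes w: "weight p q \<sigma>" and r: "compact_smooth 1 r" and k: "compact_smooth 1 \<kappa>"
    and eq: "\<And>t. 2 * r (2 * t) - r t = (deriv ^^ m) \<kappa> t"
  shows "conv \<sigma> (tens (\<lambda>_. dilate (Suc n) r)) x - conv \<sigma> (tens (\<lambda>_. dilate n r)) x
    = (\<Sum>a\<in>UNIV. (1 / 2 ^ (n * m)) * conv \<sigma> (tens (block r \<kappa> m n a)) x)"
proof -
  have sm: "smooth \<kappa>" "smooth r" using k r by (auto intro: compact_smooth_smooth)
  have c: "continuous_on UNIV (tens (\<lambda>_::'d. dilate n r))" for n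
    by (intro tens_continuous dilate_smooth sm)
  have cb: "continuous_on UNIV (tens (block r \<kappa> m n a))" for a :: 'd
    by (intro tens_continuous compact_smooth_smooth[OF block_compact_smooth[OF r k]])
  have "conv \<sigma> (tens (\<lambda>_. dilate (Suc n) r)) x - conv \<sigma> (tens (\<lambda>_. dilate n r)) x
      = conv \<sigma> (\<lambda>x. tens (\<lambda>_. dilate (Suc n) r) x - tens (\<lambda>_. dilate n r) x) x"
    unfolding conv_def right_diff_distrib
    by (rule Bochner_Integration.integral_diff[symmetric]; rule conv_integrable(1)[OF w c])
  also have "\<dots> = (\<Sum>a\<in>UNIV. conv \<sigma> (\<lambda>x. (1 / 2 ^ (n * m)) * tens (block r \<kappa> m n a) x) x)"
    unfolding tens_dilate_telescope[OF eq sm(1)]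
    by (rule conv_sum[OF w]) (intro continuous_intros cb)
  finally show ?thesis unfolding conv_cmult .
qed

lemma conv_cong_near:
  assumes w: "weight p q \<sigma>" and eq: "\<And>y. y \<in> cbox p q \<Longrightarrow> \<Psi> (x - y) = \<Psi>' (x - y)"
  shows "conv \<sigma> \<Psi> x = conv \<sigma> \<Psi>' x"
proof -
  have "\<sigma> y * \<Psi> (x - y) = \<sigma> y * \<Psi>' (x - y)" for y
    using eq[of y] w by (cases "y \<in> cbox p q") (auto simp: weight_def)
  then show ?thesis by (simp only: conv_def)
qed

text \<open>An admissible field \<open>u\<close> whose squared \<open>L\<^sup>2\<close> distance on the domain to the phase field given by \<open>f\<close> is at most \<open>E\<close>.\<close>

definition near_phase ::
  "(real, 'd) vec set \<Rightarrow> ('m, 'd) tensor \<Rightarrow> ('d \<Rightarrow> nat)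
    \<Rightarrow> ((real, 'd) vec \<Rightarrow> ('m::{finite,linorder}, 'd::{finite,linorder}) tensor)
    \<Rightarrow> ((real, 'd) vec \<Rightarrow> real) \<Rightarrow> real \<Rightarrow> bool" where
  "near_phase \<Omega> F l u f E \<longleftrightarrow> u \<in> admissible \<Omega> F \<and>
     (\<lambda>x. indicator \<Omega> x * f x) \<in> borel_measurable lebesgue \<and> (\<forall>x\<in>\<Omega>. \<bar>f x\<bar> \<le> 1) \<and> E \<ge> 0 \<and>
     (\<integral>\<^sup>+x\<in>\<Omega>. ennreal ((norm (u x - (F + f x *\<^sub>R sym_basis_prod l)))\<^sup>2) \<partial>lebesgue) \<le> ennreal E"

text \<open>All that the lower bound uses about the domain. It covers bounded Lipschitz domains and the unit square.\<close>

definition regular_domain :: "(real ^ 'd::finite) set \<Rightarrow> bool" where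
  "regular_domain \<Omega> \<longleftrightarrow> open \<Omega> \<and> negligible (frontier \<Omega>) \<and> bounded \<Omega> \<and> \<Omega> \<noteq> {}"

lemma near_phase_estimate:
  fixes u :: "real ^ 'd::{finite,linorder} \<Rightarrow> ('m::{finite,linorder}, 'd) tensor"
    and i j :: "'m \<Rightarrow> 'd"
  assumes \<Omega>: "regular_domain \<Omega>" and u: "near_phase \<Omega> F l u f E"
    and l: "(\<Sum>c\<in>UNIV. l c) = CARD('m)" and i: "cnt i = l"
    and j: "\<And>k. j k = a \<longleftrightarrow> i k \<noteq> a"
    and w: "weight p q \<sigma>" and \<Phi>: "\<And>c. compact_smooth R (\<Phi> c)"
    and D: "\<And>k. (\<Sum>c\<in>UNIV. k c) = CARD('m) \<Longrightarrow> (\<Prod>c\<in>UNIV. L1 ((deriv ^^ k c) (\<Phi> c))) \<le> D"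
  shows "(sym_basis_prod l :: ('m, 'd) tensor) $ i * \<bar>LINT x:\<Omega>|lebesgue. f x * conv \<sigma> (tens (\<lambda>c. (deriv ^^ cnt j c) (\<Phi> c))) x\<bar>
    \<le> 2 ^ CARD('m) * (D * sqrt (measure lebesgue \<Omega> * E))"
  using \<Omega> u unfolding regular_domain_def near_phase_def
  by (intro elastic_estimate[where chi = "\<lambda>x. F + f x *\<^sub>R sym_basis_prod l" and u = u and F = F
        and R = R and p = p and q = q, OF _ _ _ _ _ refl _ _ l i j _ _ w \<Phi> D]) auto

text \<open>The indices \<open>i\<close> run through the exponents \<open>l\<close>; the derivatives are taken in direction \<open>b\<close> at the
  positions of \<open>a\<close>, and in direction \<open>a\<close> elsewhere.\<close>

lemma exists_paired_indices:
  fixes l :: "'d::{finite,linorder} \<Rightarrow> nat"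
  assumes l: "(\<Sum>c\<in>UNIV. l c) = CARD('m)" and ab: "a \<noteq> b"
  obtains i j :: "'m::{finite,linorder} \<Rightarrow> 'd" where "cnt i = l" "\<And>k. j k = a \<longleftrightarrow> i k \<noteq> a"
    "cnt j a = CARD('m) - l a" "cnt j b = l a" "\<And>c. c \<noteq> a \<Longrightarrow> c \<noteq> b \<Longrightarrow> cnt j c = 0"
proof -
  define i :: "'m \<Rightarrow> 'd" where "i = basis_indices l"
  define j where "j k = (if i k = a then b else a)" for k
  have i: "cnt i = l" using cnt_basis_indices[OF l] by (auto simp: i_def)
  have "{k. j k = b} = {k. i k = a}" "{k. j k = a} = UNIV - {k. i k = a}" using ab by (auto simp: j_def)
  then have "cnt j b = l a" "cnt j a = CARD('m) - l a"
    using i by (auto simp: cnt_def card_Diff_subset)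
  moreover have "cnt j c = 0" if "c \<noteq> a" "c \<noteq> b" for c using that by (auto simp: cnt_def j_def)
  ultimately show ?thesis using that[of i j] i ab by (auto simp: j_def)
qed

lemma exists_other: "CARD('d::finite) \<ge> 2 \<Longrightarrow> \<exists>b::'d. a \<noteq> b"
proof (rule ccontr)
  assume "CARD('d) \<ge> 2" "\<not> (\<exists>b. a \<noteq> b)"
  then have "(UNIV :: 'd set) = {a}" by auto
  then have "CARD('d) = card {a}" by (simp only:)
  with \<open>CARD('d) \<ge> 2\<close> show False by simp
qed

lemma single_le_sum_nat: "(k :: 'd::finite \<Rightarrow> nat) c \<le> (\<Sum>c\<in>UNIV. k c)"
  by (rule member_le_sum) auto

text \<open>The elastic estimate for one block at scale \<open>2\<^sup>-\<^sup>n\<close>. The \<open>l\<^sub>a\<close>-fold primitive in direction \<open>b\<close>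
  costs nothing, and at most \<open>l\<^sub>a\<close> derivatives are not compensated by primitives in direction \<open>a\<close>.\<close>

lemma block_estimate:
  fixes \<Omega> :: "(real ^ 'd::{finite,linorder}) set" and p q :: "(real, 'd) vec" and l :: "'d \<Rightarrow> nat"
  assumes \<Omega>: "regular_domain \<Omega>" and d: "CARD('d) \<ge> 2"
    and l: "(\<Sum>c\<in>UNIV. l c) = CARD('m::{finite,linorder})" and L: "\<And>c. l c \<le> L"
    and r: "compact_smooth 1 r" and k: "compact_smooth 1 \<kappa>"
    and T: "\<And>x y c. x \<in> \<Omega> \<Longrightarrow> y \<in> cbox p q \<Longrightarrow> \<bar>x $ c - y $ c\<bar> < T"
  shows "\<exists>C\<ge>0. \<forall>n F f E \<sigma>. \<forall>u :: (real, 'd) vec \<Rightarrow> ('m, 'd) tensor. near_phase \<Omega> F l u f E \<longrightarrow> weight p q \<sigma> \<longrightarrow>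
    \<bar>LINT x:\<Omega>|lebesgue. f x * conv \<sigma> (tens (block r \<kappa> CARD('m) n a)) x\<bar>
      \<le> C * 2 ^ (n * (CARD('m) + L)) * sqrt E"
proof -
  define m where "m = CARD('m)"
  obtain b where ab: "a \<noteq> b" using exists_other[OF d] by blast
  obtain i j :: "'m \<Rightarrow> 'd" where i: "cnt i = l" and j: "\<And>k. j k = a \<longleftrightarrow> i k \<noteq> a"
    and cj: "cnt j a = m - l a" "cnt j b = l a" "\<And>c. c \<noteq> a \<Longrightarrow> c \<noteq> b \<Longrightarrow> cnt j c = 0"
    using exists_paired_indices[OF l ab] unfolding m_def by metis
  have la: "l a \<le> m" using single_le_sum_nat[of l a] l by (simp add: m_def)
  obtain C1 R where C1: "C1 \<ge> 1" "R \<ge> 0" and prim: "\<And>g. compact_smooth 1 g \<Longrightarrow>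
    \<exists>G. compact_smooth R G \<and> (\<forall>t\<in>{-T<..<T}. (deriv ^^ l a) G t = g t) \<and>
       (\<forall>k. L1 ((deriv ^^ k) G) \<le> C1 * L1 ((deriv ^^ (k - l a)) g))"
    using exists_local_primitive[of 1 T "l a"] by auto
  define N where "N = 1 + (\<Sum>k\<le>2*m. L1 ((deriv ^^ k) r) + L1 ((deriv ^^ k) \<kappa>))"
  have N1: "N \<ge> 1" unfolding N_def by (simp add: sum_nonneg L1_nonneg)
  have N: "L1 ((deriv ^^ k) r) \<le> N" "L1 ((deriv ^^ k) \<kappa>) \<le> N" if "k \<le> 2 * m" for k
  proof -
    have "L1 ((deriv ^^ k) r) + L1 ((deriv ^^ k) \<kappa>) \<le> (\<Sum>k\<le>2*m. L1 ((deriv ^^ k) r) + L1 ((deriv ^^ k) \<kappa>))"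
      using that by (intro member_le_sum) (auto simp: L1_nonneg)
    then show "L1 ((deriv ^^ k) r) \<le> N" "L1 ((deriv ^^ k) \<kappa>) \<le> N"
      unfolding N_def using L1_nonneg[of "(deriv ^^ k) r"] L1_nonneg[of "(deriv ^^ k) \<kappa>"] by linarith+
  qed
  define B where "B = C1 * N * 2 ^ m"
  have B1: "B \<ge> N" "B \<ge> N * 2 ^ m"
  proof -
    have "1 * N * 2 ^ m \<le> C1 * N * 2 ^ m" using C1 N1 by (intro mult_right_mono) auto
    then show "B \<ge> N * 2 ^ m" by (simp add: B_def)
    moreover have "N * 1 \<le> N * 2 ^ m" using N1 by (intro mult_left_mono) auto
    ultimately show "B \<ge> N" by simp
  qed
  have smr: "smooth r" "smooth \<kappa>" using r k by (auto intro: compact_smooth_smooth)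
  have rn: "L1 ((deriv ^^ k) (dilate n' r)) \<le> 2 ^ (n * k) * (N * 2 ^ m)" if "n' = n \<or> n' = Suc n" "k \<le> m" for n n' k
  proof -
    have "L1 ((deriv ^^ k) (dilate n' r)) = 2 ^ (n' * k) * L1 ((deriv ^^ k) r)"
      by (rule L1_funpow_deriv_dilate[OF smr(1)])
    also have "\<dots> \<le> (2 ^ (n * k) * 2 ^ m) * N"
    proof (rule mult_mono)
      have "n' * k \<le> n * k + m" using that by auto
      then have "(2::real) ^ (n' * k) \<le> 2 ^ (n * k + m)" by (rule power_increasing) simp
      then show "(2::real) ^ (n' * k) \<le> 2 ^ (n * k) * 2 ^ m" by (simp add: power_add)
    qed (use N that in \<open>auto simp: L1_nonneg\<close>)
    finally show ?thesis by (simp add: mult_ac)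
  qed
  have Mi: "(sym_basis_prod l :: ('m, 'd) tensor) $ i > 0" by (rule sym_basis_prod_pos[OF l i])
  define C where "C = 2 ^ m * (B ^ CARD('d) * sqrt (measure lebesgue \<Omega>)) / (sym_basis_prod l :: ('m, 'd) tensor) $ i"
  show ?thesis
  proof (intro exI[of _ C] conjI allI impI)
    show "C \<ge> 0" unfolding C_def using Mi B1 N1 by (intro divide_nonneg_pos mult_nonneg_nonneg) auto
    fix n F f E \<sigma> and u :: "(real, 'd) vec \<Rightarrow> ('m, 'd) tensor"
    assume u: "near_phase \<Omega> F l u f E" and w: "weight p q \<sigma>"
    obtain G where G: "compact_smooth R G" "\<And>t. t\<in>{-T<..<T} \<Longrightarrow> (deriv ^^ l a) G t = block r \<kappa> m n a b t"
       "\<And>k. L1 ((deriv ^^ k) G) \<le> C1 * L1 ((deriv ^^ (k - l a)) (block r \<kappa> m n a b))"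
      using prim[OF block_compact_smooth[OF r k, of m n a b]] by blast
    define \<Phi> where "\<Phi> c = (if c = a then (deriv ^^ l a) (dilate n \<kappa>) else if c = b then G else block r \<kappa> m n a c)" for c
    have \<Phi>: "compact_smooth (max 1 R) (\<Phi> c)" for c
      unfolding \<Phi>_def using G(1) block_compact_smooth[OF r k, of m n a c] dilate_compact_smooth[OF k, of n]
      by (auto intro: compact_smooth_mono compact_smooth_funpow)
    have fin: "(\<Prod>c\<in>UNIV. L1 ((deriv ^^ k c) (\<Phi> c))) \<le> B ^ CARD('d) * 2 ^ (n * (m + L))"
      if kk: "(\<Sum>c\<in>UNIV. k c) = CARD('m)" for k
    proof -
      have km: "k c \<le> m" for c using single_le_sum_nat[of k c] kk by (simp add: m_def)
      define e where "e c = (if c = a then l a + k a else if c = b then k b - l a else k c)" for c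
      have fac: "L1 ((deriv ^^ k c) (\<Phi> c)) \<le> B * 2 ^ (n * e c)" for c
      proof -
        consider "c = a" | "c = b" "c \<noteq> a" | "c \<noteq> a" "c \<noteq> b" by blast
        then show ?thesis
        proof cases
          case 1
          have "L1 ((deriv ^^ k c) (\<Phi> c)) = L1 ((deriv ^^ (k a + l a)) (dilate n \<kappa>))"
            using 1 by (simp add: \<Phi>_def funpow_add)
          also have "\<dots> = 2 ^ (n * e c) * L1 ((deriv ^^ (k a + l a)) \<kappa>)"
            using 1 by (simp add: L1_funpow_deriv_dilate[OF smr(2)] e_def add.commute)
          also have "\<dots> \<le> 2 ^ (n * e c) * B"
            using N(2)[of "k a + l a"] km[of a] la B1(1) by (intro mult_left_mono) auto
          finally show ?thesis by (simp add: mult.commute)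
        next
          case 2
          have "L1 ((deriv ^^ k c) (\<Phi> c)) \<le> C1 * L1 ((deriv ^^ (k b - l a)) (block r \<kappa> m n a b))"
            using 2 G(3)[of "k b"] by (simp add: \<Phi>_def)
          also have "L1 ((deriv ^^ (k b - l a)) (block r \<kappa> m n a b)) \<le> 2 ^ (n * e c) * (N * 2 ^ m)"
            using 2 rn[of _ n "k b - l a"] km[of b] by (auto simp: block_def e_def)
          then have "C1 * L1 ((deriv ^^ (k b - l a)) (block r \<kappa> m n a b)) \<le> C1 * (2 ^ (n * e c) * (N * 2 ^ m))"
            using C1 by (intro mult_left_mono) auto
          finally show ?thesis by (simp add: B_def mult_ac)
        next
          case 3
          then have "L1 ((deriv ^^ k c) (\<Phi> c)) \<le> 2 ^ (n * e c) * (N * 2 ^ m)"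
            using rn[of _ n "k c"] km[of c] by (auto simp: \<Phi>_def block_def e_def)
          also have "\<dots> \<le> 2 ^ (n * e c) * B" using B1 by (intro mult_left_mono) auto
          finally show ?thesis by (simp add: mult.commute)
        qed
      qed
      have "(\<Prod>c\<in>UNIV. L1 ((deriv ^^ k c) (\<Phi> c))) \<le> (\<Prod>c\<in>UNIV. B * 2 ^ (n * e c))"
        by (intro prod_mono conjI L1_nonneg fac)
      also have "\<dots> = B ^ CARD('d) * 2 ^ (\<Sum>c\<in>UNIV. n * e c)"
        by (simp add: prod.distrib power_sum)
      also have "(\<Sum>c\<in>UNIV. n * e c) = n * (\<Sum>c\<in>UNIV. e c)" by (simp add: sum_distrib_left)
      also have "B ^ CARD('d) * 2 ^ \<dots> \<le> B ^ CARD('d) * 2 ^ (n * (m + L))"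
      proof -
        have "(\<Sum>c\<in>UNIV. f c) = f a + f b + (\<Sum>c\<in>UNIV - {a} - {b}. f c)" for f :: "'d \<Rightarrow> nat"
          using ab by (simp add: sum.remove[of UNIV a] sum.remove[of "UNIV - {a}" b])
        from this[of e] this[of k] have "(\<Sum>c\<in>UNIV. e c) + k b = l a + (\<Sum>c\<in>UNIV. k c) + (k b - l a)"
          using ab by (simp add: e_def)
        then have "(\<Sum>c\<in>UNIV. e c) \<le> m + l a" using kk km[of b] by (simp add: m_def)
        also have "\<dots> \<le> m + L" using L by simp
        finally have "n * (\<Sum>c\<in>UNIV. e c) \<le> n * (m + L)" by simp
        then have "(2::real) ^ (n * (\<Sum>c\<in>UNIV. e c)) \<le> 2 ^ (n * (m + L))"
          by (rule power_increasing) simp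
        then show ?thesis using B1 N1 by (intro mult_left_mono) auto
      qed
      finally show ?thesis .
    qed
    have eq: "conv \<sigma> (tens (\<lambda>c. (deriv ^^ cnt j c) (\<Phi> c))) x = conv \<sigma> (tens (block r \<kappa> m n a)) x" if x: "x \<in> \<Omega>" for x
    proof (rule conv_cong_near[OF w])
      fix y assume y: "y \<in> cbox p q"
      show "tens (\<lambda>c. (deriv ^^ cnt j c) (\<Phi> c)) (x - y) = tens (block r \<kappa> m n a) (x - y)"
        unfolding tens_def
      proof (intro prod.cong refl)
        fix c
        have t: "(x - y) $ c \<in> {-T<..<T}" using T[OF x y, of c] by (auto simp: abs_less_iff)
        have "(deriv ^^ (m - l a)) ((deriv ^^ l a) (dilate n \<kappa>)) = (deriv ^^ m) (dilate n \<kappa>)"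
          using la by (metis comp_apply funpow_add le_add_diff_inverse2)
        then show "(deriv ^^ cnt j c) (\<Phi> c) ((x - y) $ c) = block r \<kappa> m n a c ((x - y) $ c)"
          using cj ab G(2)[OF t] by (cases "c = a"; cases "c = b") (auto simp: \<Phi>_def block_def)
      qed
    qed
    have \<Omega>m: "\<Omega> \<in> sets lebesgue" using \<Omega> by (auto simp: regular_domain_def)
    have "(sym_basis_prod l :: ('m, 'd) tensor) $ i * \<bar>LINT x:\<Omega>|lebesgue. f x * conv \<sigma> (tens (\<lambda>c. (deriv ^^ cnt j c) (\<Phi> c))) x\<bar>
        \<le> 2 ^ CARD('m) * ((B ^ CARD('d) * 2 ^ (n * (m + L))) * sqrt (measure lebesgue \<Omega> * E))"
      by (rule near_phase_estimate[OF \<Omega> u l i j w \<Phi> fin])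
    also have "(LINT x:\<Omega>|lebesgue. f x * conv \<sigma> (tens (\<lambda>c. (deriv ^^ cnt j c) (\<Phi> c))) x)
        = (LINT x:\<Omega>|lebesgue. f x * conv \<sigma> (tens (block r \<kappa> m n a)) x)"
      by (rule set_lebesgue_integral_cong[OF \<Omega>m]) (simp add: eq)
    finally show "\<bar>LINT x:\<Omega>|lebesgue. f x * conv \<sigma> (tens (block r \<kappa> CARD('m) n a)) x\<bar> \<le> C * 2 ^ (n * (CARD('m) + L)) * sqrt E"
      unfolding m_def[symmetric] using Mi by (simp add: C_def field_simps real_sqrt_mult)
  qed
qed

text \<open>At the largest scale every derivative is harmless.\<close>

lemma base_estimate:
  fixes \<Omega> :: "(real ^ 'd::{finite,linorder}) set" and p q :: "(real, 'd) vec" and l :: "'d \<Rightarrow> nat"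
  assumes \<Omega>: "regular_domain \<Omega>" and d: "CARD('d) \<ge> 2"
    and l: "(\<Sum>c\<in>UNIV. l c) = CARD('m::{finite,linorder})"
    and r: "compact_smooth 1 r"
    and T: "\<And>x y c. x \<in> \<Omega> \<Longrightarrow> y \<in> cbox p q \<Longrightarrow> \<bar>x $ c - y $ c\<bar> < T"
  shows "\<exists>C\<ge>0. \<forall>F f E \<sigma>. \<forall>u :: (real, 'd) vec \<Rightarrow> ('m, 'd) tensor. near_phase \<Omega> F l u f E \<longrightarrow> weight p q \<sigma> \<longrightarrow>
    \<bar>LINT x:\<Omega>|lebesgue. f x * conv \<sigma> (tens (\<lambda>_. r)) x\<bar> \<le> C * sqrt E"
proof -
  define m where "m = CARD('m)"
  obtain a b :: 'd where ab: "a \<noteq> b" using exists_other[OF d] by blast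
  obtain i j :: "'m \<Rightarrow> 'd" where i: "cnt i = l" and j: "\<And>k. j k = a \<longleftrightarrow> i k \<noteq> a"
    and cj: "cnt j a = m - l a" "cnt j b = l a" "\<And>c. c \<noteq> a \<Longrightarrow> c \<noteq> b \<Longrightarrow> cnt j c = 0"
    using exists_paired_indices[OF l ab] unfolding m_def by metis
  define o' where "o' c = (if c = a then m - l a else if c = b then l a else 0)" for c
  define Q where "Q c C R G \<longleftrightarrow> C \<ge> 1 \<and> R \<ge> 0 \<and> compact_smooth R G \<and> (\<forall>t\<in>{-T<..<T}. (deriv ^^ o' c) G t = r t) \<and>
       (\<forall>k. L1 ((deriv ^^ k) G) \<le> C * L1 ((deriv ^^ (k - o' c)) r))" for c C R G
  have "\<forall>c. \<exists>C R G. Q c C R G"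
  proof
    fix c
    obtain C R' where "C \<ge> 1" "R' \<ge> 0" and prim: "\<And>g. compact_smooth 1 g \<Longrightarrow>
      \<exists>G. compact_smooth R' G \<and> (\<forall>t\<in>{-T<..<T}. (deriv ^^ o' c) G t = g t) \<and>
       (\<forall>k. L1 ((deriv ^^ k) G) \<le> C * L1 ((deriv ^^ (k - o' c)) g))"
      using exists_local_primitive[of 1 T "o' c"] by auto
    with prim[OF r] show "\<exists>C R G. Q c C R G" unfolding Q_def by blast
  qed
  then obtain C1 R \<Phi> where Q: "\<And>c. Q c (C1 c) (R c) (\<Phi> c)" by metis
  have C1: "\<And>c. C1 c \<ge> 1" and R: "\<And>c. R c \<ge> 0" and \<Phi>: "\<And>c. compact_smooth (R c) (\<Phi> c)"
    and \<Phi>eq: "\<And>c t. t\<in>{-T<..<T} \<Longrightarrow> (deriv ^^ o' c) (\<Phi> c) t = r t"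
    and \<Phi>L: "\<And>c k. L1 ((deriv ^^ k) (\<Phi> c)) \<le> C1 c * L1 ((deriv ^^ (k - o' c)) r)"
    using Q unfolding Q_def by simp_all
  define N where "N = (\<Sum>k\<le>m. L1 ((deriv ^^ k) r))"
  have N: "L1 ((deriv ^^ k) r) \<le> N" if "k \<le> m" for k
    unfolding N_def using that by (intro member_le_sum) (auto simp: L1_nonneg)
  have N0: "N \<ge> 0" by (simp add: N_def sum_nonneg L1_nonneg)
  define R' where "R' = (\<Sum>c\<in>UNIV. R c)"
  have R': "R c \<le> R'" for c unfolding R'_def using R by (intro member_le_sum) auto
  define D where "D = (\<Prod>c\<in>UNIV. C1 c * N)"
  have D: "(\<Prod>c\<in>UNIV. L1 ((deriv ^^ k c) (\<Phi> c))) \<le> D" if "(\<Sum>c\<in>UNIV. k c) = CARD('m)" for k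
    unfolding D_def
  proof (intro prod_mono conjI L1_nonneg)
    fix c
    have "k c - o' c \<le> m" using single_le_sum_nat[of k c] that by (simp add: m_def)
    then have "C1 c * L1 ((deriv ^^ (k c - o' c)) r) \<le> C1 c * N"
      using C1[of c] by (intro mult_left_mono N) auto
    then show "L1 ((deriv ^^ k c) (\<Phi> c)) \<le> C1 c * N" using \<Phi>L[of "k c" c] by linarith
  qed
  have D0: "D \<ge> 0" unfolding D_def using C1 N0 by (intro prod_nonneg mult_nonneg_nonneg) (auto intro: order_trans[of 0 1])
  have Mi: "(sym_basis_prod l :: ('m, 'd) tensor) $ i > 0" by (rule sym_basis_prod_pos[OF l i])
  define C where "C = 2 ^ m * (D * sqrt (measure lebesgue \<Omega>)) / (sym_basis_prod l :: ('m, 'd) tensor) $ i"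
  show ?thesis
  proof (intro exI[of _ C] conjI allI impI)
    show "C \<ge> 0" unfolding C_def using Mi D0 by (intro divide_nonneg_pos mult_nonneg_nonneg) auto
    fix F f E \<sigma> and u :: "(real, 'd) vec \<Rightarrow> ('m, 'd) tensor"
    assume u: "near_phase \<Omega> F l u f E" and w: "weight p q \<sigma>"
    have eq: "conv \<sigma> (tens (\<lambda>c. (deriv ^^ cnt j c) (\<Phi> c))) x = conv \<sigma> (tens (\<lambda>_. r)) x" if x: "x \<in> \<Omega>" for x
    proof (rule conv_cong_near[OF w])
      fix y assume y: "y \<in> cbox p q"
      show "tens (\<lambda>c. (deriv ^^ cnt j c) (\<Phi> c)) (x - y) = tens (\<lambda>_. r) (x - y)"
        unfolding tens_def
      proof (intro prod.cong refl)
        fix c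
        have t: "(x - y) $ c \<in> {-T<..<T}" using T[OF x y, of c] by (auto simp: abs_less_iff)
        have "cnt j c = o' c" using cj ab by (simp add: o'_def)
        then show "(deriv ^^ cnt j c) (\<Phi> c) ((x - y) $ c) = r ((x - y) $ c)"
          using \<Phi>eq[OF t, of c] by simp
      qed
    qed
    have \<Omega>m: "\<Omega> \<in> sets lebesgue" using \<Omega> by (auto simp: regular_domain_def)
    have "(sym_basis_prod l :: ('m, 'd) tensor) $ i * \<bar>LINT x:\<Omega>|lebesgue. f x * conv \<sigma> (tens (\<lambda>c. (deriv ^^ cnt j c) (\<Phi> c))) x\<bar>
        \<le> 2 ^ CARD('m) * (D * sqrt (measure lebesgue \<Omega> * E))"
      by (rule near_phase_estimate[OF \<Omega> u l i j w compact_smooth_mono[OF \<Phi> R'] D])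
    also have "(LINT x:\<Omega>|lebesgue. f x * conv \<sigma> (tens (\<lambda>c. (deriv ^^ cnt j c) (\<Phi> c))) x)
        = (LINT x:\<Omega>|lebesgue. f x * conv \<sigma> (tens (\<lambda>_. r)) x)"
      by (rule set_lebesgue_integral_cong[OF \<Omega>m]) (simp add: eq)
    finally show "\<bar>LINT x:\<Omega>|lebesgue. f x * conv \<sigma> (tens (\<lambda>_. r)) x\<bar> \<le> C * sqrt E"
      unfolding m_def[symmetric] using Mi by (simp add: C_def field_simps real_sqrt_mult)
  qed
qed

section \<open>The surface estimate\<close>

lemma partial_cmult:
  assumes "\<phi> differentiable (at x)"
  shows "partial a (\<lambda>x. c * \<phi> x) x = c * partial a \<phi> x"
proof -
  have "(\<phi> has_derivative frechet_derivative \<phi> (at x)) (at x)"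
    using assms by (simp add: frechet_derivative_works)
  then have "((\<lambda>x. c * \<phi> x) has_derivative (\<lambda>h. c * frechet_derivative \<phi> (at x) h)) (at x)"
    by (rule has_derivative_mult_right)
  from frechet_derivative_at[OF this] show ?thesis by (simp add: partial_def fun_eq_iff)
qed

lemma test_function_cmult:
  assumes \<phi>: "\<phi> \<in> test_functions \<Omega>" shows "(\<lambda>x. c * \<phi> x) \<in> test_functions \<Omega>"
proof -
  have eq: "partials as (\<lambda>x. c * \<phi> x) = (\<lambda>x. c * partials as \<phi> x)" for as
  proof (induction as)
    case (Cons a as)
    show ?case unfolding partials_Cons Cons
      by (rule ext) (rule partial_cmult[OF test_function_differentiable[OF \<phi>]])
  qed (simp add: partials_Nil)
  obtain K where K: "compact K" "K \<subseteq> \<Omega>" "\<And>x. x \<notin> K \<Longrightarrow> \<phi> x = 0"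
    using test_function_support[OF \<phi>] by metis
  have "partials as (\<lambda>x. c * \<phi> x) differentiable (at x)" for as x
    unfolding eq using test_function_differentiable[OF \<phi>] by (intro differentiable_mult) auto
  with K show ?thesis unfolding test_functions_def by auto
qed

lemma norm_axis_eq: "norm (axis i x :: 'a::real_inner ^ 'n::finite) = norm x"
  by (simp add: norm_eq_sqrt_inner inner_axis)

lemma phase_integrable:
  fixes f h :: "'a::euclidean_space \<Rightarrow> real"
  assumes "(\<lambda>x. indicator \<Omega> x * f x) \<in> borel_measurable lebesgue" "\<And>x. x \<in> \<Omega> \<Longrightarrow> \<bar>f x\<bar> \<le> 1"
    and "integrable lebesgue h"
  shows "set_integrable lebesgue \<Omega> (\<lambda>x. f x * h x)"
  unfolding set_integrable_def
proof (rule Bochner_Integration.integrable_bound[OF assms(3)])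
  have "(\<lambda>x. (indicator \<Omega> x * f x) * h x) \<in> borel_measurable lebesgue"
    by (rule borel_measurable_times[OF assms(1) borel_measurable_integrable[OF assms(3)]])
  then show "(\<lambda>x. indicat_real \<Omega> x *\<^sub>R (f x * h x)) \<in> borel_measurable lebesgue"
    by (simp add: mult.assoc)
  show "AE x in lebesgue. norm (indicat_real \<Omega> x *\<^sub>R (f x * h x)) \<le> norm (h x)"
    using assms(2) by (intro AE_I2) (auto simp: indicator_def abs_mult mult_left_le_one_le)
qed

lemma test_function_set_integral_partial:
  assumes \<phi>: "\<phi> \<in> test_functions \<Omega>"
  shows "(LINT x:\<Omega>|lebesgue. partial a \<phi> x) = 0"
proof -
  have t: "partial a \<phi> \<in> test_functions \<Omega>" by (rule test_function_partial[OF \<phi>])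
  obtain K where K: "K \<subseteq> \<Omega>" "\<And>x. x \<notin> K \<Longrightarrow> partial a \<phi> x = 0"
    using test_function_support[OF t] by metis
  then have z: "indicator \<Omega> x *\<^sub>R partial a \<phi> x = partial a \<phi> x" for x
    using K(1) K(2)[of x] by (cases "x \<in> \<Omega>") auto
  have "(LINT x|lebesgue. partial a \<phi> x) = (LINT x|lborel. partial a \<phi> x)"
    by (rule integral_completion) (use test_function_measurable[OF t] in simp)
  then show ?thesis
    unfolding set_lebesgue_integral_def z using test_function_integral_partial[OF \<phi>] by simp
qed

text \<open>The total variation controls \<open>f\<close> tested with a partial derivative of a test function. A single component
  \<open>i\<close> of \<open>M\<close> is enough.\<close>

lemma surface_estimate:
  fixes chi :: "real ^ 'd::finite \<Rightarrow> real ^ 'n::finite"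
  assumes \<Omega>: "open \<Omega>" "bounded \<Omega>"
    and chi: "\<And>x. x \<in> \<Omega> \<Longrightarrow> chi x = F + f x *\<^sub>R M"
    and f: "(\<lambda>x. indicator \<Omega> x * f x) \<in> borel_measurable lebesgue" "\<And>x. x \<in> \<Omega> \<Longrightarrow> \<bar>f x\<bar> \<le> 1"
    and V: "total_variation \<Omega> chi \<le> ennreal V" "V \<ge> 0"
    and \<Psi>: "\<Psi> \<in> test_functions \<Omega>" "\<And>x. \<bar>\<Psi> x\<bar> \<le> D" and D: "D > 0"
  shows "M $ i * \<bar>LINT x:\<Omega>|lebesgue. f x * partial a \<Psi> x\<bar> \<le> D * V"
proof -
  define J where "J = (LINT x:\<Omega>|lebesgue. f x * partial a \<Psi> x)"
  define s where "s = sgn J / D"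
  define \<psi> :: "real ^ 'd \<Rightarrow> (real ^ 'd) ^ 'n" where "\<psi> x = axis i (axis a (s * \<Psi> x))" for x
  have comp: "\<psi> x $ i' $ a' = (if i' = i \<and> a' = a then s else 0) * \<Psi> x" for x i' a'
    by (simp add: \<psi>_def axis_def)
  have tf: "(\<lambda>x. \<psi> x $ i' $ a') \<in> test_functions \<Omega>" for i' a'
    unfolding comp by (rule test_function_cmult[OF \<Psi>(1)])
  have nrm: "norm (\<psi> x) \<le> 1" for x
  proof -
    have "\<bar>s\<bar> * \<bar>\<Psi> x\<bar> \<le> (1 / D) * D" using D \<Psi>(2) by (intro mult_mono) (auto simp: s_def abs_sgn_eq)
    then show ?thesis using D by (simp add: \<psi>_def norm_axis_eq abs_mult)
  qed
  have pc: "partial a' (\<lambda>y. \<psi> y $ i' $ a') x = (if i' = i \<and> a' = a then s else 0) * partial a' \<Psi> x" for x i' a'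
    unfolding comp using test_function_differentiable[OF \<Psi>(1), of "[]"] by (intro partial_cmult) (simp add: partials_Nil)
  have sumeq: "(\<Sum>i'\<in>UNIV. chi x $ i' * (\<Sum>a'\<in>UNIV. partial a' (\<lambda>y. \<psi> y $ i' $ a') x)) = chi x $ i * (s * partial a \<Psi> x)" for x
  proof -
    have "(\<Sum>a'\<in>UNIV. partial a' (\<lambda>y. \<psi> y $ i' $ a') x) = (if i' = i then s * partial a \<Psi> x else 0)" for i'
      unfolding pc by (cases "i' = i") (auto simp: if_distrib[of "\<lambda>c. c * _"] cong: if_cong)
    then show ?thesis by (simp add: if_distrib[of "\<lambda>c. _ * c"] cong: if_cong)
  qed
  have pt: "partial a \<Psi> \<in> test_functions \<Omega>" by (rule test_function_partial[OF \<Psi>(1)])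
  have \<Omega>m: "\<Omega> \<in> sets lebesgue" using \<Omega> by auto
  have i1: "set_integrable lebesgue \<Omega> (partial a \<Psi>)"
    unfolding set_integrable_def by (rule integrable_mult_indicator[OF \<Omega>m integrable_lebesgue_test_function[OF pt]])
  have i2: "set_integrable lebesgue \<Omega> (\<lambda>x. f x * partial a \<Psi> x)"
    by (rule phase_integrable[OF f integrable_lebesgue_test_function[OF pt]])
  have "(LINT x:\<Omega>|lebesgue. chi x $ i * (s * partial a \<Psi> x))
      = (LINT x:\<Omega>|lebesgue. (F $ i * s) * partial a \<Psi> x + (M $ i * s) * (f x * partial a \<Psi> x))"
    by (rule set_lebesgue_integral_cong[OF \<Omega>m]) (auto simp: chi algebra_simps)
  also have "\<dots> = (LINT x:\<Omega>|lebesgue. (F $ i * s) * partial a \<Psi> x) + (LINT x:\<Omega>|lebesgue. (M $ i * s) * (f x * partial a \<Psi> x))"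
    by (intro set_integral_add set_integrable_mult_right i1 i2)
  also have "\<dots> = M $ i * (\<bar>J\<bar> / D)"
    using test_function_set_integral_partial[OF \<Psi>(1), of a]
    by (simp add: J_def[symmetric] s_def mult.assoc) (simp add: abs_sgn mult.commute)
  finally have J: "(LINT x:\<Omega>|lebesgue. chi x $ i * (s * partial a \<Psi> x)) = M $ i * (\<bar>J\<bar> / D)" .
  have "ennreal (LINT x:\<Omega>|lebesgue. (\<Sum>i'\<in>UNIV. chi x $ i' * (\<Sum>a'\<in>UNIV. partial a' (\<lambda>y. \<psi> y $ i' $ a') x)))
      \<le> total_variation \<Omega> chi"
    unfolding total_variation_def by (rule SUP_upper) (use tf nrm in auto)
  then have "ennreal (M $ i * (\<bar>J\<bar> / D)) \<le> ennreal V" unfolding sumeq J using V(1) by (rule order_trans)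
  then have "M $ i * (\<bar>J\<bar> / D) \<le> V" using V(2) by simp
  then show ?thesis using D by (simp add: J_def[symmetric] field_simps)
qed

section \<open>The lower bound\<close>

text \<open>The dilated kernels form an approximate identity.\<close>

lemma conv_dilate_uniform:
  fixes \<sigma> :: "real ^ 'd::finite \<Rightarrow> real"
  assumes w: "weight p q \<sigma>" and r: "compact_smooth 1 r" and one: "(LINT t|lborel. r t) = 1" and e: "e > 0"
  shows "\<exists>n0. \<forall>n\<ge>n0. \<forall>x. \<bar>conv \<sigma> (tens (\<lambda>_. dilate n r)) x - \<sigma> x\<bar> \<le> e"
proof -
  define K where "K = cbox (p - (\<chi> c. 1)) (q + (\<chi> c. 1))"
  define e' where "e' = e / (1 + L1 r ^ CARD('d))"
  have pos: "1 + L1 r ^ CARD('d) > 0" by (simp add: L1_nonneg add_pos_nonneg)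
  have e': "e' > 0" using e pos by (simp add: e'_def)
  have "uniformly_continuous_on K \<sigma>"
    using w by (intro compact_uniformly_continuous) (auto simp: K_def weight_def intro: continuous_on_subset)
  then obtain \<delta> where \<delta>: "\<delta> > 0" "\<And>x y. x \<in> K \<Longrightarrow> y \<in> K \<Longrightarrow> dist y x < \<delta> \<Longrightarrow> dist (\<sigma> y) (\<sigma> x) < e'"
    using e' unfolding uniformly_continuous_on_def by metis
  obtain n0 where n0: "CARD('d) / \<delta> < 2 ^ n0" using real_arch_pow[of 2 "CARD('d) / \<delta>"] by auto
  show ?thesis
  proof (intro exI[of _ n0] allI impI)
    fix n x assume n: "n0 \<le> n"
    let ?P = "tens (\<lambda>_::'d. dilate n r)"
    have "(2::real) ^ n0 \<le> 2 ^ n" using n by (rule power_increasing) simp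
    then have "CARD('d) / \<delta> < 2 ^ n" using n0 by linarith
    then have n2: "CARD('d) / 2 ^ n < \<delta>" using \<delta>(1) by (simp add: field_simps)
    have int: "integrable lborel (dilate n r)" for c :: 'd
      by (rule compact_smooth_integrable[OF dilate_compact_smooth[OF r]]) simp
    have P: "integrable lborel (\<lambda>y. ?P (x - y))" "(LINT y|lborel. ?P (x - y)) = 1"
      using tens_reflected_integral[OF int, of x] one by (simp_all add: integral_dilate)
    have c: "continuous_on UNIV ?P"
      by (intro tens_continuous dilate_smooth compact_smooth_smooth[OF r])
    have near: "\<bar>\<sigma> y - \<sigma> x\<bar> \<le> e'" if "?P (x - y) \<noteq> 0" for y
    proof -
      have "\<bar>(x - y) $ c\<bar> \<le> 1 / 2 ^ n" for c
      proof (rule ccontr)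
        assume "\<not> \<bar>(x - y) $ c\<bar> \<le> 1 / 2 ^ n"
        then have "dilate n r ((x - y) $ c) = 0" by (intro dilate_support[OF r]) auto
        then have "?P (x - y) = 0" unfolding tens_def by (intro prod_zero) auto
        with that show False by simp
      qed
      note xy = this
      have "norm (x - y) \<le> (\<Sum>c\<in>UNIV. \<bar>(x - y) $ c\<bar>)" by (rule norm_le_l1_cart)
      also have "\<dots> \<le> (\<Sum>c\<in>(UNIV::'d set). 1 / 2 ^ n)" by (intro sum_mono xy)
      also have "\<dots> < \<delta>" using n2 by simp
      finally have dxy: "dist y x < \<delta>" by (simp add: dist_norm norm_minus_commute)
      have h1: "(1::real) / 2 ^ n \<le> 1" by simp
      have in_K: "v \<in> K" if "v' \<in> cbox p q" "\<And>c. \<bar>(v - v') $ c\<bar> \<le> 1 / 2 ^ n" for v v'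
        unfolding K_def mem_box_cart
      proof
        fix c
        have "p $ c \<le> v' $ c \<and> v' $ c \<le> q $ c" using that(1) by (simp add: mem_box_cart)
        moreover have "\<bar>(v - v') $ c\<bar> \<le> 1" using that(2)[of c] h1 by (rule order_trans)
        ultimately show "(p - (\<chi> c. 1)) $ c \<le> v $ c \<and> v $ c \<le> (q + (\<chi> c. 1)) $ c"
          by (simp add: abs_le_iff)
      qed
      show ?thesis
      proof (cases "x \<in> cbox p q \<or> y \<in> cbox p q")
        case True
        have "\<bar>(v - v) $ c\<bar> \<le> 1 / 2 ^ n" for v :: "real ^ 'd" and c by simp
        moreover have "\<bar>(y - x) $ c\<bar> \<le> 1 / 2 ^ n" for c using xy[of c] by (simp add: abs_minus_commute)
        ultimately have "x \<in> K" "y \<in> K" using True in_K[of x x] in_K[of y y] in_K[of x y] in_K[of y x] xy by blast+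
        from \<delta>(2)[OF this dxy] show ?thesis by (simp add: dist_real_def)
      next
        case False
        then show ?thesis using w e' by (simp add: weight_def)
      qed
    qed
    have i1: "integrable lborel (\<lambda>y. \<sigma> y * ?P (x - y))" by (rule conv_integrable(1)[OF w c])
    have "conv \<sigma> ?P x - \<sigma> x = (LINT y|lborel. \<sigma> y * ?P (x - y)) - \<sigma> x * (LINT y|lborel. ?P (x - y))"
      by (simp add: conv_def P(2))
    also have "\<dots> = (LINT y|lborel. (\<sigma> y - \<sigma> x) * ?P (x - y))"
      using i1 P(1) by (simp add: left_diff_distrib)
    finally have "\<bar>conv \<sigma> ?P x - \<sigma> x\<bar> = \<bar>LINT y|lborel. (\<sigma> y - \<sigma> x) * ?P (x - y)\<bar>" by simp
    also have "\<dots> \<le> (LINT y|lborel. \<bar>(\<sigma> y - \<sigma> x) * ?P (x - y)\<bar>)" by (rule integral_abs_bound)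
    also have "\<dots> \<le> (LINT y|lborel. e' * tens (\<lambda>_ t. \<bar>dilate n r t\<bar>) (x - y))"
    proof (rule integral_mono)
      show "integrable lborel (\<lambda>y. \<bar>(\<sigma> y - \<sigma> x) * ?P (x - y)\<bar>)"
        unfolding left_diff_distrib using i1 P(1) by auto
      show "integrable lborel (\<lambda>y. e' * tens (\<lambda>_ t. \<bar>dilate n r t\<bar>) (x - y))"
        using int by (intro integrable_mult_right tens_reflected_integral) auto
      show "\<bar>(\<sigma> y - \<sigma> x) * ?P (x - y)\<bar> \<le> e' * tens (\<lambda>_ t. \<bar>dilate n r t\<bar>) (x - y)" for y
        unfolding abs_mult tens_abs[symmetric] using near[of y] by (cases "?P (x - y) = 0") (auto intro: mult_right_mono)
    qed
    also have "\<dots> = e' * L1 r ^ CARD('d)"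
      using tens_reflected_integral(2)[of "\<lambda>_ t. \<bar>dilate n r t\<bar>" x] int L1_dilate[of n r]
      by (simp add: L1_def)
    also have "\<dots> \<le> e' * (1 + L1 r ^ CARD('d))" using e' by simp
    also have "\<dots> = e" using pos by (simp add: e'_def)
    finally show "\<bar>conv \<sigma> ?P x - \<sigma> x\<bar> \<le> e" .
  qed
qed

lemma weight_integrable:
  assumes w: "weight p q \<sigma>" shows "integrable lebesgue \<sigma>"
proof -
  have \<sigma>c: "continuous_on S \<sigma>" for S using w by (auto simp: weight_def intro: continuous_on_subset)
  have "integrable lborel (\<lambda>x. indicat_real (cbox p q) x *\<^sub>R \<sigma> x)"
    by (rule borel_integrable_compact[OF compact_cbox \<sigma>c])
  also have "(\<lambda>x. indicat_real (cbox p q) x *\<^sub>R \<sigma> x) = \<sigma>" using w by (auto simp: weight_def indicator_def fun_eq_iff)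
  finally show ?thesis
    using borel_measurable_continuous_onI[OF \<sigma>c] by (simp add: integrable_completion)
qed

text \<open>A continuous approximation of the sign of \<open>f\<close> on a box.\<close>

lemma exists_sign_weight:
  fixes f :: "real ^ 'd::finite \<Rightarrow> real"
  assumes f: "(\<lambda>x. indicator \<Omega> x * f x) \<in> borel_measurable lebesgue" "\<And>x. x \<in> \<Omega> \<Longrightarrow> \<bar>f x\<bar> \<le> 1"
    and \<theta>: "\<theta> > 0" "\<And>x. x \<in> \<Omega> \<Longrightarrow> \<bar>f x\<bar> \<ge> \<theta>"
    and \<Omega>: "\<Omega> \<in> lmeasurable" "box p q \<subseteq> \<Omega>" "box p q \<noteq> {}"
  shows "\<exists>\<sigma>. weight p q \<sigma> \<and> (LINT x:\<Omega>|lebesgue. f x * \<sigma> x) \<ge> \<theta> * measure lebesgue (box p q) / 2"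
proof -
  let ?\<mu> = "measure lebesgue (box p q)"
  have \<mu>: "?\<mu> > 0"
    using \<Omega>(3) by (simp add: measure_lborel_box_eq box_ne_empty inner_diff_left prod_pos less_imp_le)
  define \<epsilon> where "\<epsilon> = \<theta> * ?\<mu> / 8"
  have \<epsilon>: "\<epsilon> > 0" using \<mu> \<theta> by (simp add: \<epsilon>_def)
  define P where "P = {x \<in> space lebesgue. 0 < indicator \<Omega> x * f x} \<inter> box p q"
  define N where "N = {x \<in> space lebesgue. indicator \<Omega> x * f x < 0} \<inter> box p q"
  have P: "P \<in> sets lebesgue" unfolding P_def
    by (intro sets.Int borel_measurable_less borel_measurable_const f(1)) auto
  have N: "N \<in> sets lebesgue" unfolding N_def
    by (intro sets.Int borel_measurable_less borel_measurable_const f(1)) auto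
  obtain T1 where T1: "closed T1" "T1 \<subseteq> P" "P - T1 \<in> lmeasurable" "emeasure lebesgue (P - T1) < ennreal \<epsilon>"
    using sets_lebesgue_inner_closed[OF P \<epsilon>] by metis
  obtain T2 where T2: "closed T2" "T2 \<subseteq> N" "N - T2 \<in> lmeasurable" "emeasure lebesgue (N - T2) < ennreal \<epsilon>"
    using sets_lebesgue_inner_closed[OF N \<epsilon>] by metis
  define T3 where "T3 = - box p q"
  have T3: "closed T3" by (simp add: T3_def closed_def open_box)
  have "P \<inter> N = {}" by (force simp: P_def N_def)
  then have dis: "T1 \<inter> T2 = {}" using T1(2) T2(2) by blast
  have dis3: "T1 \<inter> T3 = {}" "T2 \<inter> T3 = {}"
    using T1(2) T2(2) by (auto simp: P_def N_def T3_def)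
  have d1: "T1 \<inter> (T2 \<union> T3) = {}" and d2: "T2 \<inter> (T1 \<union> T3) = {}" using dis dis3 by auto
  have c1: "closed (T2 \<union> T3)" and c2: "closed (T1 \<union> T3)" using T1(1) T2(1) T3 by auto
  obtain s1 :: "real ^ 'd \<Rightarrow> real" where s1: "continuous_on UNIV s1" "\<And>x. s1 x \<in> closed_segment 1 0"
      "\<And>x. x \<in> T1 \<Longrightarrow> s1 x = 1" "\<And>x. x \<in> T2 \<union> T3 \<Longrightarrow> s1 x = 0"
    by (rule Urysohn[OF T1(1) c1 d1]) blast
  obtain s2 :: "real ^ 'd \<Rightarrow> real" where s2: "continuous_on UNIV s2" "\<And>x. s2 x \<in> closed_segment 1 0"
      "\<And>x. x \<in> T2 \<Longrightarrow> s2 x = 1" "\<And>x. x \<in> T1 \<union> T3 \<Longrightarrow> s2 x = 0"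
    by (rule Urysohn[OF T2(1) c2 d2]) blast
  define \<sigma> where "\<sigma> x = s1 x - s2 x" for x
  have b: "0 \<le> s1 x" "s1 x \<le> 1" "0 \<le> s2 x" "s2 x \<le> 1" for x
    using s1(2)[of x] s2(2)[of x] by (auto simp: closed_segment_eq_real_ivl)
  have \<sigma>b: "\<bar>\<sigma> x\<bar> \<le> 1" for x using b[of x] by (auto simp: \<sigma>_def abs_le_iff)
  have \<sigma>3: "\<sigma> x = 0" if "x \<notin> box p q" for x using s1(4)[of x] s2(4)[of x] that by (simp add: \<sigma>_def T3_def)
  have w: "weight p q \<sigma>"
    unfolding weight_def
  proof (intro conjI allI impI)
    show "continuous_on UNIV \<sigma>" unfolding \<sigma>_def[abs_def] by (intro continuous_on_diff s1 s2)
    show "\<sigma> x = 0" if "x \<notin> cbox p q" for x using \<sigma>3 that box_subset_cbox by blast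
  qed (rule \<sigma>b)
  define W where "W = (P - T1) \<union> (N - T2)"
  have Wm: "W \<in> lmeasurable" unfolding W_def using T1(3) T2(3) by (rule fmeasurable.Un)
  have Wmeas: "measure lebesgue W \<le> 2 * \<epsilon>"
  proof -
    have "measure lebesgue (P - T1) \<le> \<epsilon>" "measure lebesgue (N - T2) \<le> \<epsilon>"
      using T1(3,4) T2(3,4) \<epsilon> by (auto simp: emeasure_eq_measure2 ennreal_less_iff less_imp_le)
    moreover have "measure lebesgue W \<le> measure lebesgue (P - T1) + measure lebesgue (N - T2)"
      unfolding W_def using T1(3) T2(3) by (intro measure_Un_le) (auto simp: fmeasurable_def)
    ultimately show ?thesis by linarith
  qed
  obtain x0 where "x0 \<in> \<Omega>" using \<Omega>(2,3) by blast
  then have \<theta>1: "\<theta> \<le> 1" using \<theta>(2) f(2) order_trans by blast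
  have pw: "indicator \<Omega> x * (f x * \<sigma> x) \<ge> \<theta> * indicator (box p q) x - 2 * indicator W x" for x
  proof (cases "x \<in> box p q")
    case False
    then have "x \<notin> W" by (auto simp: W_def P_def N_def)
    then show ?thesis using False \<sigma>3 by simp
  next
    case True
    then have x: "x \<in> \<Omega>" using \<Omega>(2) by blast
    have fx: "\<theta> \<le> \<bar>f x\<bar>" "\<bar>f x\<bar> \<le> 1" using f \<theta> x by auto
    show ?thesis
    proof (cases "x \<in> W")
      case True
      have "\<bar>f x * \<sigma> x\<bar> \<le> 1 * 1" unfolding abs_mult using fx \<sigma>b[of x] by (intro mult_mono) auto
      then show ?thesis using True x \<open>x \<in> box p q\<close> \<theta>1 by (auto simp: abs_le_iff)
    next
      case False
      have "f x \<noteq> 0" using fx \<theta>(1) by auto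
      then have "x \<in> P \<or> x \<in> N" using True x by (auto simp: P_def N_def)
      with False have "(x \<in> T1 \<and> x \<in> P) \<or> (x \<in> T2 \<and> x \<in> N)" by (auto simp: W_def)
      then have "f x * \<sigma> x = \<bar>f x\<bar>"
      proof
        assume *: "x \<in> T1 \<and> x \<in> P"
        then have "\<sigma> x = 1" using s1(3) s2(4) by (simp add: \<sigma>_def)
        moreover have "f x > 0" using * x by (simp add: P_def)
        ultimately show ?thesis by simp
      next
        assume *: "x \<in> T2 \<and> x \<in> N"
        then have "\<sigma> x = -1" using s2(3) s1(4) by (simp add: \<sigma>_def)
        moreover have "f x < 0" using * x by (simp add: N_def)
        ultimately show ?thesis by simp
      qed
      then show ?thesis using fx True False x by simp
    qed
  qed
  have bm: "box p q \<in> lmeasurable" by (rule lmeasurable_box)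
  have ib: "integrable lebesgue (indicator (box p q) :: _ \<Rightarrow> real)" "integrable lebesgue (indicator W :: _ \<Rightarrow> real)"
    using bm Wm by (auto intro!: integrable_real_indicator simp: fmeasurable_def)
  have if\<sigma>: "integrable lebesgue (\<lambda>x. indicator \<Omega> x * (f x * \<sigma> x))"
  proof -
    have "integrable lebesgue \<sigma>" by (rule weight_integrable[OF w])
    then show ?thesis using phase_integrable[OF f] by (simp add: set_integrable_def)
  qed
  have "\<theta> * ?\<mu> - 2 * measure lebesgue W = (LINT x|lebesgue. \<theta> * indicator (box p q) x - 2 * indicator W x)"
    using ib by simp
  also have "\<dots> \<le> (LINT x|lebesgue. indicator \<Omega> x * (f x * \<sigma> x))"
    by (intro integral_mono pw if\<sigma> Bochner_Integration.integrable_diff integrable_mult_right ib)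
  finally have "(LINT x:\<Omega>|lebesgue. f x * \<sigma> x) \<ge> \<theta> * ?\<mu> / 2"
    using Wmeas by (simp add: set_lebesgue_integral_def \<epsilon>_def)
  with w show ?thesis by blast
qed

lemma block_support:
  assumes "compact_smooth 1 r" "compact_smooth 1 \<kappa>" "\<bar>t\<bar> > 1 / 2 ^ n"
  shows "block r \<kappa> k n a c t = 0"
proof -
  have "(1::real) / 2 ^ Suc n \<le> 1 / 2 ^ n" by (simp add: field_simps)
  then have "\<bar>t\<bar> > 1 / 2 ^ Suc n" using assms(3) by linarith
  then show ?thesis
    using dilate_support[OF assms(1), of n t] dilate_support[OF assms(1), of "Suc n" t]
      dilate_support[OF compact_smooth_funpow[OF assms(2)], of n t] assms(3)
    by (simp add: block_def funpow_deriv_dilate[OF compact_smooth_smooth[OF assms(2)]])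
qed

lemma sum_geometric_le:
  fixes L :: nat assumes "L \<ge> 1"
  shows "(\<Sum>k<n. (2::real) ^ (k * L)) \<le> 2 ^ (n * L)"
proof (induction n)
  case (Suc n)
  have "(2::real) ^ (n * L) * 2 ^ 1 \<le> 2 ^ (n * L) * 2 ^ L"
    by (intro mult_left_mono power_increasing) (use assms in auto)
  then have "(2::real) ^ (n * L) * 2 \<le> 2 ^ (Suc n * L)" by (simp add: power_add mult.commute)
  with Suc show ?case by simp
qed simp

text \<open>The blocks at scales coarser than \<open>2\<^sup>-\<^sup>n\<close> are estimated by the elastic energy, the finer ones by
  the surface energy.\<close>

lemma coercivity:
  fixes \<Omega> :: "(real ^ 'd::{finite,linorder}) set" and l :: "'d \<Rightarrow> nat"
  assumes \<Omega>: "regular_domain \<Omega>" and d: "CARD('d) \<ge> 2"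
    and l: "(\<Sum>c\<in>UNIV. l c) = CARD('m::{finite,linorder})" and L: "\<And>c. l c \<le> L" "L \<ge> 1"
  shows "\<exists>C>0. \<exists>\<beta>>0. \<exists>n0. \<forall>\<theta> F f E V chi n. \<forall>u :: (real, 'd) vec \<Rightarrow> ('m, 'd) tensor.
    \<theta> > 0 \<longrightarrow> near_phase \<Omega> F l u f E \<longrightarrow> (\<forall>x\<in>\<Omega>. \<theta> \<le> \<bar>f x\<bar>) \<longrightarrow>
    (\<forall>x\<in>\<Omega>. chi x = F + f x *\<^sub>R sym_basis_prod l) \<longrightarrow> total_variation \<Omega> chi \<le> ennreal V \<longrightarrow> V \<ge> 0 \<longrightarrow> n \<ge> n0 \<longrightarrow>
    \<theta> * \<beta> \<le> C * (2 ^ (n * L) * sqrt E + V / 2 ^ n)"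
proof -
  let ?M = "sym_basis_prod l :: ('m, 'd) tensor"
  define m where "m = CARD('m)"
  have m1: "m \<ge> 1" by (simp add: m_def Suc_le_eq)
  have open_\<Omega>: "open \<Omega>" and bdd: "bounded \<Omega>" and ne: "\<Omega> \<noteq> {}" using \<Omega> by (auto simp: regular_domain_def)
  have \<Omega>lm: "\<Omega> \<in> lmeasurable" by (rule lmeasurable_open[OF bdd open_\<Omega>])
  obtain x0 \<rho> where \<rho>: "\<rho> > 0" "ball x0 \<rho> \<subseteq> \<Omega>" using open_\<Omega> ne open_contains_ball by (metis ex_in_conv)
  \<comment> \<open>A box whose \<open>\<delta>\<close>-neighbourhood stays in the domain.\<close>
  define \<delta> where "\<delta> = \<rho> / (4 * CARD('d))"
  have \<delta>: "\<delta> > 0" using \<rho>(1) by (simp add: \<delta>_def)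
  define p where "p = x0 - (\<chi> c. \<delta>)"
  define q where "q = x0 + (\<chi> c. \<delta>)"
  have inK: "x \<in> \<Omega>" if "x \<in> cbox (p - (\<chi> c. \<delta>)) (q + (\<chi> c. \<delta>))" for x
  proof -
    have "\<bar>(x0 - x) $ c\<bar> \<le> 2 * \<delta>" for c
    proof -
      have "(p - (\<chi> c. \<delta>)) $ c \<le> x $ c \<and> x $ c \<le> (q + (\<chi> c. \<delta>)) $ c" using that unfolding mem_box_cart by blast
      then show ?thesis unfolding p_def q_def by (simp add: abs_le_iff)
    qed
    then have "norm (x0 - x) \<le> (\<Sum>c\<in>(UNIV::'d set). 2 * \<delta>)"
      by (intro order_trans[OF norm_le_l1_cart] sum_mono) auto
    also have "\<dots> < \<rho>" using \<rho>(1) by (simp add: \<delta>_def)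
    finally show ?thesis using \<rho>(2) by (auto simp: dist_norm)
  qed
  have sub: "cbox p q \<subseteq> \<Omega>"
  proof
    fix x assume "x \<in> cbox p q"
    then have "x \<in> cbox (p - (\<chi> c. \<delta>)) (q + (\<chi> c. \<delta>))"
      using \<delta> unfolding mem_box_cart by (simp add: add_increasing2 diff_le_eq)
    then show "x \<in> \<Omega>" by (rule inK)
  qed
  have box_sub: "box p q \<subseteq> \<Omega>" using sub box_subset_cbox by blast
  have "p $ c < q $ c" for c using \<delta> by (simp add: p_def q_def)
  then have box_ne: "box p q \<noteq> {}" by (auto simp: interval_ne_empty_cart)
  obtain R where R: "\<And>x. x \<in> \<Omega> \<Longrightarrow> norm x \<le> R" using bdd by (auto simp: bounded_iff)
  define T where "T = 2 * R + 1"
  have T: "\<bar>x $ c - y $ c\<bar> < T" if "x \<in> \<Omega>" "y \<in> cbox p q" for x y c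
  proof -
    have "\<bar>x $ c\<bar> \<le> R" "\<bar>y $ c\<bar> \<le> R"
      using R[OF that(1)] R[of y] that(2) sub component_le_norm_cart order_trans by blast+
    then show ?thesis by (simp add: T_def)
  qed
  obtain r \<kappa> where r: "compact_smooth 1 r" and k: "compact_smooth 1 \<kappa>" and one: "(LINT t|lborel. r t) = 1"
    and eq: "\<And>t. 2 * r (2 * t) - r t = (deriv ^^ m) \<kappa> t" using exists_moment_kernel[OF m1] by blast
  obtain C0 where C0: "C0 \<ge> 0" and base: "\<And>F f E \<sigma> (u :: (real, 'd) vec \<Rightarrow> ('m, 'd) tensor).
      near_phase \<Omega> F l u f E \<Longrightarrow> weight p q \<sigma> \<Longrightarrow>
      \<bar>LINT x:\<Omega>|lebesgue. f x * conv \<sigma> (tens (\<lambda>_. r)) x\<bar> \<le> C0 * sqrt E"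
    using base_estimate[OF \<Omega> d l r T] by blast
  define Q where "Q a C \<longleftrightarrow> C \<ge> 0 \<and> (\<forall>n F f E \<sigma>. \<forall>u :: (real, 'd) vec \<Rightarrow> ('m, 'd) tensor. near_phase \<Omega> F l u f E \<longrightarrow> weight p q \<sigma> \<longrightarrow>
    \<bar>LINT x:\<Omega>|lebesgue. f x * conv \<sigma> (tens (block r \<kappa> m n a)) x\<bar>
      \<le> C * 2 ^ (n * (m + L)) * sqrt E)" for a C
  have "\<forall>a. \<exists>C. Q a C"
    using block_estimate[OF \<Omega> d l L(1) r k T] unfolding Q_def m_def by blast
  then obtain Cb where Cb: "\<And>a. Q a (Cb a)" by metis
  define Cs where "Cs = (\<Sum>a\<in>UNIV. Cb a)"
  have Cs0: "Cs \<ge> 0" unfolding Cs_def using Cb by (auto simp: Q_def intro: sum_nonneg)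
  define N where "N = 1 + L1 r + L1 ((deriv ^^ (m - 1)) \<kappa>)"
  have N: "L1 r \<le> N" "L1 ((deriv ^^ (m - 1)) \<kappa>) \<le> N" "N > 0"
    using L1_nonneg[of r] L1_nonneg[of "(deriv ^^ (m - 1)) \<kappa>"] by (auto simp: N_def)
  define i0 :: "'m \<Rightarrow> 'd" where "i0 = basis_indices l"
  have Mi: "?M $ i0 > 0" by (rule sym_basis_prod_pos[OF l]) (use cnt_basis_indices[OF l] in \<open>auto simp: i0_def\<close>)
  define Cv where "Cv = CARD('d) * N ^ CARD('d) / ?M $ i0"
  have Cv0: "Cv \<ge> 0" using N Mi by (simp add: Cv_def)
  obtain n0 where n0: "1 / \<delta> < 2 ^ n0" using real_arch_pow[of 2 "1 / \<delta>"] by auto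
  have fine: "1 / 2 ^ n < \<delta>" if "n \<ge> n0" for n
  proof -
    have "(2::real) ^ n0 \<le> 2 ^ n" using that by (rule power_increasing) simp
    then have "1 / \<delta> < 2 ^ n" using n0 by linarith
    then show ?thesis using \<delta> by (simp add: field_simps)
  qed
  define \<mu> where "\<mu> = measure lebesgue \<Omega>"
  define \<mu>B where "\<mu>B = measure lebesgue (box p q)"
  have \<mu>B: "\<mu>B > 0" using box_ne by (simp add: \<mu>B_def measure_lborel_box_eq box_ne_empty inner_diff_left prod_pos less_imp_le)
  have "\<mu>B \<le> \<mu>" unfolding \<mu>_def \<mu>B_def by (rule measure_mono_fmeasurable[OF box_sub _ \<Omega>lm]) simp
  with \<mu>B have \<mu>: "\<mu> > 0" by simp
  define C where "C = 1 + C0 + Cs + 2 * Cv"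
  have C: "C > 0" using C0 Cs0 Cv0 by (simp add: C_def)
  have \<mu>B4: "\<mu>B / 4 > 0" using \<mu>B by simp
  show ?thesis
  proof (rule exI[of _ C], rule conjI[OF C], rule exI[of _ "\<mu>B / 4"], rule conjI[OF \<mu>B4], rule exI[of _ n0], intro allI impI)
    fix \<theta> F f E V chi n and u :: "(real, 'd) vec \<Rightarrow> ('m, 'd) tensor"
    assume \<theta>: "\<theta> > 0" and u: "near_phase \<Omega> F l u f E" and f\<theta>: "\<forall>x\<in>\<Omega>. \<theta> \<le> \<bar>f x\<bar>"
      and chi: "\<forall>x\<in>\<Omega>. chi x = F + f x *\<^sub>R ?M" and V: "total_variation \<Omega> chi \<le> ennreal V" "V \<ge> 0" and n: "n \<ge> n0"
    have f: "(\<lambda>x. indicator \<Omega> x * f x) \<in> borel_measurable lebesgue" "\<And>x. x \<in> \<Omega> \<Longrightarrow> \<bar>f x\<bar> \<le> 1" and E0: "E \<ge> 0"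
      using u by (auto simp: near_phase_def)
    obtain \<sigma> where w: "weight p q \<sigma>" and f\<sigma>: "(LINT x:\<Omega>|lebesgue. f x * \<sigma> x) \<ge> \<theta> * \<mu>B / 2"
      using exists_sign_weight[OF f \<theta> _ \<Omega>lm box_sub box_ne] f\<theta> unfolding \<mu>B_def by blast
    define J where "J n = (LINT x:\<Omega>|lebesgue. f x * conv \<sigma> (tens (\<lambda>_. dilate n r)) x)" for n
    define K where "K n a = (LINT x:\<Omega>|lebesgue. f x * conv \<sigma> (tens (block r \<kappa> m n a)) x)" for n a
    have intJ: "set_integrable lebesgue \<Omega> (\<lambda>x. f x * conv \<sigma> (tens (\<lambda>_. dilate n r)) x)" for n
      by (rule phase_integrable[OF f integrable_lebesgue_test_function[OF
            conv_test_function_UNIV[OF w dilate_compact_smooth[OF r zero_le_one]]]])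
    have intK: "set_integrable lebesgue \<Omega> (\<lambda>x. f x * conv \<sigma> (tens (block r \<kappa> m n a)) x)" for n a
      by (rule phase_integrable[OF f integrable_lebesgue_test_function[OF
            conv_test_function_UNIV[OF w block_compact_smooth[OF r k]]]])
    have \<Omega>m: "\<Omega> \<in> sets lebesgue" using open_\<Omega> by auto
    have step: "J (Suc n) - J n = (\<Sum>a\<in>UNIV. (1 / 2 ^ (n * m)) * K n a)" for n
    proof -
      have "J (Suc n) - J n = (LINT x:\<Omega>|lebesgue. f x * conv \<sigma> (tens (\<lambda>_. dilate (Suc n) r)) x - f x * conv \<sigma> (tens (\<lambda>_. dilate n r)) x)"
        unfolding J_def by (rule set_integral_diff(2)[symmetric]; rule intJ)
      also have "\<dots> = (LINT x:\<Omega>|lebesgue. (\<Sum>a\<in>UNIV. (1 / 2 ^ (n * m)) * (f x * conv \<sigma> (tens (block r \<kappa> m n a)) x)))"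
      proof (rule set_lebesgue_integral_cong[OF \<Omega>m], intro allI impI)
        fix x
        have "f x * conv \<sigma> (tens (\<lambda>_. dilate (Suc n) r)) x - f x * conv \<sigma> (tens (\<lambda>_. dilate n r)) x
          = f x * (\<Sum>a\<in>UNIV. (1 / 2 ^ (n * m)) * conv \<sigma> (tens (block r \<kappa> m n a)) x)"
          unfolding right_diff_distrib[symmetric] conv_dilate_telescope[OF w r k eq] ..
        then show "f x * conv \<sigma> (tens (\<lambda>_. dilate (Suc n) r)) x - f x * conv \<sigma> (tens (\<lambda>_. dilate n r)) x
          = (\<Sum>a\<in>UNIV. (1 / 2 ^ (n * m)) * (f x * conv \<sigma> (tens (block r \<kappa> m n a)) x))"
          by (simp only: sum_distrib_left mult.left_commute)
      qed
      also have "\<dots> = (\<Sum>a\<in>UNIV. (LINT x:\<Omega>|lebesgue. (1 / 2 ^ (n * m)) * (f x * conv \<sigma> (tens (block r \<kappa> m n a)) x)))"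
        unfolding set_lebesgue_integral_def scaleR_sum_right
        by (rule Bochner_Integration.integral_sum)
           (rule set_integrable_mult_right[OF intK, unfolded set_integrable_def])
      finally show ?thesis by (simp add: K_def)
    qed
    have el: "\<bar>J (Suc n) - J n\<bar> \<le> Cs * 2 ^ (n * L) * sqrt E" for n
    proof -
      have "\<bar>J (Suc n) - J n\<bar> \<le> (\<Sum>a\<in>UNIV. \<bar>(1 / 2 ^ (n * m)) * K n a\<bar>)" unfolding step by (rule sum_abs)
      also have "\<dots> \<le> (\<Sum>a\<in>UNIV. Cb a * (2 ^ (n * L) * sqrt E))"
      proof (rule sum_mono)
        fix a
        have "\<bar>K n a\<bar> \<le> Cb a * 2 ^ (n * (m + L)) * sqrt E" unfolding K_def using Cb[of a, unfolded Q_def] u w by blast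
        then have "(1 / 2 ^ (n * m)) * \<bar>K n a\<bar> \<le> (1 / 2 ^ (n * m)) * (Cb a * 2 ^ (n * (m + L)) * sqrt E)"
          by (intro mult_left_mono) auto
        also have "\<dots> = Cb a * (2 ^ (n * L) * sqrt E)" by (simp add: distrib_left power_add)
        finally show "\<bar>(1 / 2 ^ (n * m)) * K n a\<bar> \<le> Cb a * (2 ^ (n * L) * sqrt E)" by (simp add: abs_mult)
      qed
      finally show ?thesis by (simp add: Cs_def sum_distrib_right mult.assoc)
    qed
    have su: "\<bar>J (Suc n') - J n'\<bar> \<le> Cv * (V / 2 ^ n')" if n': "n' \<ge> n0" for n'
    proof -
      have Kb: "?M $ i0 * \<bar>K n' a\<bar> \<le> (N ^ CARD('d) * 2 ^ (n' * (m - 1))) * V" for a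
      proof -
        define \<Phi> where "\<Phi> = block r \<kappa> (m - 1) n' a"
        define \<Psi> where "\<Psi> = conv \<sigma> (tens \<Phi>)"
        have \<Phi>: "compact_smooth 1 (\<Phi> c)" for c unfolding \<Phi>_def by (rule block_compact_smooth[OF r k])
        have t: "\<Psi> \<in> test_functions \<Omega>" unfolding \<Psi>_def
        proof (rule conv_test_function[OF w \<Phi>])
          let ?K = "cbox (p - (\<chi> c. \<delta>)) (q + (\<chi> c. \<delta>))"
          show "compact ?K" "?K \<subseteq> \<Omega>" using inK by auto
          fix x y assume y: "y \<in> cbox p q" and nz: "\<And>c. \<Phi> c ((x - y) $ c) \<noteq> 0"
          show "x \<in> ?K" unfolding mem_box_cart
          proof
            fix c
            have "\<bar>(x - y) $ c\<bar> \<le> 1 / 2 ^ n'"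
              using nz[of c] block_support[OF r k] unfolding \<Phi>_def by (meson not_le)
            then have "\<bar>x $ c - y $ c\<bar> \<le> \<delta>" using fine[OF n'] by simp
            moreover have "p $ c \<le> y $ c \<and> y $ c \<le> q $ c" using y by (simp add: mem_box_cart)
            ultimately show "(p - (\<chi> c. \<delta>)) $ c \<le> x $ c \<and> x $ c \<le> (q + (\<chi> c. \<delta>)) $ c"
              by (simp add: abs_le_iff)
          qed
        qed
        have bd: "\<bar>\<Psi> x\<bar> \<le> N ^ CARD('d) * 2 ^ (n' * (m - 1))" for x
        proof -
          have "\<bar>\<Psi> x\<bar> \<le> (\<Prod>c\<in>UNIV. L1 (\<Phi> c))" unfolding \<Psi>_def by (rule conv_bound[OF w \<Phi>])
          also have "\<dots> \<le> (\<Prod>c\<in>UNIV. N * (if c = a then 2 ^ (n' * (m - 1)) else 1))"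
          proof (intro prod_mono conjI L1_nonneg)
            fix c show "L1 (\<Phi> c) \<le> N * (if c = a then 2 ^ (n' * (m - 1)) else 1)"
              using N by (simp add: \<Phi>_def block_def L1_dilate L1_funpow_deriv_dilate[OF compact_smooth_smooth[OF k]] mult.commute)
          qed
          also have "\<dots> = N ^ CARD('d) * 2 ^ (n' * (m - 1))" by (simp add: prod.distrib prod.delta)
          finally show ?thesis .
        qed
        have upd: "\<Phi>(a := deriv (\<Phi> a)) = block r \<kappa> m n' a"
        proof
          fix c
          have "deriv ((deriv ^^ (m - 1)) g) = (deriv ^^ m) g" for g :: "real \<Rightarrow> real"
            using m1 by (cases m) auto
          then show "(\<Phi>(a := deriv (\<Phi> a))) c = block r \<kappa> m n' a c" by (auto simp: \<Phi>_def block_def)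
        qed
        have pa: "partial a \<Psi> = conv \<sigma> (tens (block r \<kappa> m n' a))"
          unfolding \<Psi>_def upd[symmetric] by (rule ext) (rule conv_partial(2)[OF w compact_smooth_smooth[OF \<Phi>]])
        have D: "N ^ CARD('d) * 2 ^ (n' * (m - 1)) > 0" using N by simp
        from surface_estimate[OF open_\<Omega> bdd _ f V t bd D, of F ?M i0 a] chi
        show ?thesis unfolding pa K_def by simp
      qed
      have Kb': "(1 / 2 ^ (n' * m)) * \<bar>K n' a\<bar> \<le> (N ^ CARD('d) / ?M $ i0) * (V / 2 ^ n')" for a
      proof -
        have "n' * m = n' * (m - 1) + n'" using m1 by (cases m) auto
        then have p2: "(2::real) ^ (n' * m) = 2 ^ (n' * (m - 1)) * 2 ^ n'" by (simp add: power_add)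
        have "\<bar>K n' a\<bar> \<le> (N ^ CARD('d) * 2 ^ (n' * (m - 1))) * V / ?M $ i0"
          using Kb[of a] Mi by (simp add: field_simps)
        then have "(1 / 2 ^ (n' * m)) * \<bar>K n' a\<bar> \<le> (1 / 2 ^ (n' * m)) * ((N ^ CARD('d) * 2 ^ (n' * (m - 1))) * V / ?M $ i0)"
          by (intro mult_left_mono) auto
        also have "\<dots> = (N ^ CARD('d) / ?M $ i0) * (V / 2 ^ n')" unfolding p2 by simp
        finally show ?thesis .
      qed
      have "\<bar>J (Suc n') - J n'\<bar> \<le> (\<Sum>a\<in>UNIV. \<bar>(1 / 2 ^ (n' * m)) * K n' a\<bar>)" unfolding step by (rule sum_abs)
      also have "\<dots> \<le> (\<Sum>a\<in>(UNIV::'d set). (N ^ CARD('d) / ?M $ i0) * (V / 2 ^ n'))"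
        by (intro sum_mono) (use Kb' in \<open>simp add: abs_mult\<close>)
      also have "\<dots> = Cv * (V / 2 ^ n')" by (simp add: Cv_def)
      finally show ?thesis .
    qed
    \<comment> \<open>Coarse scales: the elastic energy.\<close>
    have low: "\<bar>J n\<bar> \<le> C0 * sqrt E + Cs * sqrt E * (\<Sum>k<n. 2 ^ (k * L))" for n
    proof (induction n)
      case 0
      then show ?case using base[OF u w] by (simp add: J_def dilate_0)
    next
      case (Suc n)
      have "\<bar>J (Suc n)\<bar> \<le> \<bar>J n\<bar> + \<bar>J (Suc n) - J n\<bar>" by simp
      with Suc el[of n] show ?case by (simp add: algebra_simps)
    qed
    \<comment> \<open>Fine scales: the surface energy, with a geometric sum.\<close>
    have high: "\<bar>J (n + k) - J n\<bar> \<le> 2 * Cv * V * (1 / 2 ^ n - 1 / 2 ^ (n + k))" for k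
    proof (induction k)
      case (Suc k)
      have "\<bar>J (n + Suc k) - J n\<bar> \<le> \<bar>J (Suc (n + k)) - J (n + k)\<bar> + \<bar>J (n + k) - J n\<bar>" by simp
      also have "\<dots> \<le> Cv * (V / 2 ^ (n + k)) + 2 * Cv * V * (1 / 2 ^ n - 1 / 2 ^ (n + k))"
        using su[of "n + k"] n Suc by simp
      also have "\<dots> = 2 * Cv * V * (1 / 2 ^ n - 1 / 2 ^ (n + Suc k))" by (simp add: field_simps)
      finally show ?case .
    qed simp
    define e where "e = \<theta> * \<mu>B / (4 * \<mu>)"
    have e: "e > 0" using \<theta> \<mu> \<mu>B by (simp add: e_def)
    obtain n1 where n1: "\<And>n x. n \<ge> n1 \<Longrightarrow> \<bar>conv \<sigma> (tens (\<lambda>_. dilate n r)) x - \<sigma> x\<bar> \<le> e"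
      using conv_dilate_uniform[OF w r one e] by blast
    have app: "\<bar>J (n + n1) - (LINT x:\<Omega>|lebesgue. f x * \<sigma> x)\<bar> \<le> e * \<mu>"
    proof -
      have i\<sigma>: "set_integrable lebesgue \<Omega> (\<lambda>x. f x * \<sigma> x)"
        by (rule phase_integrable[OF f weight_integrable[OF w]])
      have ii: "set_integrable lebesgue \<Omega> (\<lambda>x. f x * conv \<sigma> (tens (\<lambda>_. dilate (n + n1) r)) x - f x * \<sigma> x)"
        by (rule set_integral_diff(1)[OF intJ i\<sigma>])
      have "J (n + n1) - (LINT x:\<Omega>|lebesgue. f x * \<sigma> x)
          = (LINT x:\<Omega>|lebesgue. f x * conv \<sigma> (tens (\<lambda>_. dilate (n + n1) r)) x - f x * \<sigma> x)"
        unfolding J_def by (rule set_integral_diff(2)[symmetric, OF intJ i\<sigma>])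
      also have "\<bar>\<dots>\<bar> \<le> (LINT x:\<Omega>|lebesgue. \<bar>f x * conv \<sigma> (tens (\<lambda>_. dilate (n + n1) r)) x - f x * \<sigma> x\<bar>)"
        unfolding set_lebesgue_integral_def
        using integral_abs_bound[of lebesgue "\<lambda>x. indicator \<Omega> x *\<^sub>R (f x * conv \<sigma> (tens (\<lambda>_. dilate (n + n1) r)) x - f x * \<sigma> x)"]
        by (simp add: abs_mult)
      also have "\<dots> \<le> (LINT x:\<Omega>|lebesgue. e)"
      proof (rule set_integral_mono)
        show "set_integrable lebesgue \<Omega> (\<lambda>x. \<bar>f x * conv \<sigma> (tens (\<lambda>_. dilate (n + n1) r)) x - f x * \<sigma> x\<bar>)"
          by (rule set_integrable_abs[OF ii])
        show "set_integrable lebesgue \<Omega> (\<lambda>x. e)"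
          unfolding set_integrable_def using \<Omega>lm
          by (intro integrable_scaleR_left integrable_real_indicator) (auto simp: fmeasurable_def)
        fix x assume "x \<in> \<Omega>"
        then have "\<bar>f x\<bar> * \<bar>conv \<sigma> (tens (\<lambda>_. dilate (n + n1) r)) x - \<sigma> x\<bar> \<le> 1 * e"
          by (intro mult_mono f n1) auto
        then show "\<bar>f x * conv \<sigma> (tens (\<lambda>_. dilate (n + n1) r)) x - f x * \<sigma> x\<bar> \<le> e"
          by (simp add: right_diff_distrib[symmetric] abs_mult)
      qed
      also have "\<dots> = e * \<mu>" using \<Omega>lm by (simp add: \<mu>_def set_lebesgue_integral_def fmeasurable_def)
      finally show ?thesis .
    qed
    have "e * \<mu> = \<theta> * \<mu>B / 4" using \<mu> by (simp add: e_def)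
    then have main: "\<theta> * \<mu>B / 4 \<le> \<bar>J (n + n1)\<bar>" using app f\<sigma> by linarith
    have "\<bar>J (n + n1)\<bar> \<le> \<bar>J n\<bar> + 2 * Cv * V * (1 / 2 ^ n)"
    proof -
      have "2 * Cv * V * (1 / 2 ^ n - 1 / 2 ^ (n + n1)) \<le> 2 * Cv * V * (1 / 2 ^ n)"
        using Cv0 V(2) by (intro mult_left_mono) auto
      then show ?thesis using high[of n1] by linarith
    qed
    moreover have "\<bar>J n\<bar> \<le> C0 * sqrt E * 2 ^ (n * L) + Cs * sqrt E * 2 ^ (n * L)"
    proof -
      have "C0 * sqrt E * 1 \<le> C0 * sqrt E * 2 ^ (n * L)" using C0 E0 by (intro mult_left_mono) auto
      moreover have "Cs * sqrt E * (\<Sum>k<n. 2 ^ (k * L)) \<le> Cs * sqrt E * 2 ^ (n * L)"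
        using Cs0 E0 by (intro mult_left_mono sum_geometric_le L(2)) auto
      ultimately show ?thesis using low[of n] by linarith
    qed
    ultimately have "\<theta> * (\<mu>B / 4) \<le> (C0 + Cs) * (2 ^ (n * L) * sqrt E) + (2 * Cv) * (V / 2 ^ n)"
    proof -
      have "(C0 + Cs) * (2 ^ (n * L) * sqrt E) = C0 * sqrt E * 2 ^ (n * L) + Cs * sqrt E * 2 ^ (n * L)"
        by (simp add: algebra_simps)
      moreover have "(2 * Cv) * (V / 2 ^ n) = 2 * Cv * V * (1 / 2 ^ n)" by simp
      moreover assume "\<bar>J (n + n1)\<bar> \<le> \<bar>J n\<bar> + 2 * Cv * V * (1 / 2 ^ n)"
        "\<bar>J n\<bar> \<le> C0 * sqrt E * 2 ^ (n * L) + Cs * sqrt E * 2 ^ (n * L)"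
      ultimately show ?thesis using main by linarith
    qed
    also have "\<dots> \<le> C * (2 ^ (n * L) * sqrt E) + C * (V / 2 ^ n)"
      using C0 Cs0 Cv0 E0 V(2) by (intro add_mono mult_right_mono) (auto simp: C_def)
    finally show "\<theta> * (\<mu>B / 4) \<le> C * (2 ^ (n * L) * sqrt E + V / 2 ^ n)" by (simp add: distrib_left)
  qed
qed


lemma exists_dyadic:
  assumes "0 < (x::real)" "x \<le> 1"
  obtains n where "x \<le> 1 / 2 ^ n" "1 / 2 ^ n < 2 * x"
proof -
  define N where "N = (LEAST N. 1 / 2 ^ N < x)"
  obtain k where "1 / x < 2 ^ k" using real_arch_pow[of 2 "1 / x"] by auto
  then have "1 / 2 ^ k < x" using assms by (simp add: field_simps)
  then have N: "1 / 2 ^ N < x" unfolding N_def by (rule LeastI)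
  have "N \<noteq> 0"
  proof
    assume "N = 0"
    with N assms show False by simp
  qed
  then obtain n where n: "N = Suc n" using not0_implies_Suc by blast
  have "\<not> 1 / 2 ^ n < x" using not_less_Least[of n "\<lambda>N. 1 / 2 ^ N < x"] n by (simp add: N_def)
  moreover have "1 / 2 ^ n < 2 * x" using N n by (simp add: field_simps)
  ultimately show ?thesis using that[of n] by simp
qed

text \<open>Balancing the two terms of the coercivity estimate at \<open>2\<^sup>-\<^sup>n \<approx> \<epsilon>\<^bsup>1/(2L+1)\<^esup>\<close>.\<close>

lemma balance:
  fixes L n0 :: nat
  assumes C: "C > 0" and \<beta>: "\<beta> > 0"
    and \<theta>: "0 < \<theta>" "\<theta> \<le> 1" and E: "E \<ge> 0" and V: "V \<ge> 0"
    and main: "\<And>n. n \<ge> n0 \<Longrightarrow> \<theta> * \<beta> \<le> C * (2 ^ (n * L) * sqrt E + V / 2 ^ n)"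
    and eps: "0 < eps" "eps powr (1 / (2 * L + 1)) \<le> 1 / 2 ^ Suc n0"
  shows "min ((\<beta> / (2 * C))\<^sup>2) (\<beta> / (4 * C)) * \<theta>\<^sup>2 * eps powr (2 * L / (2 * L + 1)) \<le> E + eps * V"
proof -
  define x where "x = eps powr (1 / (2 * L + 1))"
  define c where "c = \<beta> / (2 * C)"
  have c: "c > 0" using \<beta> C by (simp add: c_def)
  have x: "x > 0" using eps by (simp add: x_def)
  have "x \<le> 1 / 2 ^ Suc n0" using eps(2) by (simp only: x_def)
  also have "(1::real) / 2 ^ Suc n0 \<le> 1" by (simp only: divide_le_eq_1) (simp add: one_le_power del: power_Suc)
  finally have x1: "x \<le> 1" .
  have pw: "eps powr (2 * L / (2 * L + 1)) = x ^ (2 * L)"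
  proof -
    have "x ^ (2 * L) = x powr real (2 * L)" using x by (simp only: powr_realpow)
    also have "\<dots> = eps powr (1 / (2 * L + 1) * real (2 * L))" unfolding x_def powr_powr ..
    finally show ?thesis by simp
  qed
  have ex: "eps = x ^ (2 * L) * x"
  proof -
    have "x ^ (2 * L) * x = x ^ (2 * L + 1)" by simp
    also have "\<dots> = x powr real (2 * L + 1)" using x by (simp only: powr_realpow)
    also have "\<dots> = eps powr (1 / (2 * L + 1) * real (2 * L + 1))" unfolding x_def powr_powr ..
    also have "\<dots> = eps" using eps by simp
    finally show ?thesis ..
  qed
  obtain n where n: "x \<le> 1 / 2 ^ n" "1 / 2 ^ n < 2 * x" using exists_dyadic[OF x x1] by blast
  have "n \<ge> n0"
  proof (rule ccontr)
    assume "\<not> n \<ge> n0"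
    then have "(2::real) ^ n \<le> 2 ^ n0" by (intro power_increasing) auto
    then have "(1::real) / 2 ^ n0 \<le> 1 / 2 ^ n" by (simp add: field_simps)
    moreover have "2 * x \<le> 1 / 2 ^ n0" using eps(2) by (simp add: x_def field_simps)
    ultimately show False using n(2) by linarith
  qed
  note m = main[OF this]
  show ?thesis
  proof (cases "\<theta> * \<beta> / 2 \<le> C * (2 ^ (n * L) * sqrt E)")
    case True
    then have "c * \<theta> / 2 ^ (n * L) \<le> sqrt E" using C by (simp add: c_def field_simps)
    moreover have "x ^ L \<le> 1 / 2 ^ (n * L)"
      using power_mono[OF n(1), of L] x by (simp add: power_mult power_one_over)
    then have "c * \<theta> * x ^ L \<le> c * \<theta> * (1 / 2 ^ (n * L))" using c \<theta> by (intro mult_left_mono) auto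
    ultimately have "c * \<theta> * x ^ L \<le> sqrt E" by simp
    then have "(c * \<theta> * x ^ L)\<^sup>2 \<le> E" using c \<theta> x E by (simp add: sqrt_ge_absD)
    then have "c\<^sup>2 * \<theta>\<^sup>2 * x ^ (2 * L) \<le> E" by (simp add: power_mult_distrib power_mult[symmetric] mult.commute)
    moreover have "min (c\<^sup>2) (\<beta> / (4 * C)) * \<theta>\<^sup>2 * x ^ (2 * L) \<le> c\<^sup>2 * \<theta>\<^sup>2 * x ^ (2 * L)"
      using x by (intro mult_right_mono) auto
    moreover have "0 \<le> eps * V" using eps V by simp
    ultimately show ?thesis unfolding pw c_def by linarith
  next
    case False
    then have "\<theta> * \<beta> / 2 \<le> C * (V / 2 ^ n)" using m[unfolded distrib_left] by linarith
    also have "\<dots> \<le> C * (V * (2 * x))"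
      using n(2) V C by (intro mult_left_mono) (auto simp: divide_inverse intro!: mult_left_mono)
    finally have "\<theta> * (\<beta> / (4 * C)) \<le> x * V" using C by (simp add: field_simps)
    then have "\<theta> * (\<beta> / (4 * C)) * x ^ (2 * L) \<le> x * V * x ^ (2 * L)"
      using x by (intro mult_right_mono) auto
    also have "\<dots> = eps * V" by (subst ex) (simp add: mult_ac)
    finally have "\<theta> * (\<beta> / (4 * C)) * x ^ (2 * L) \<le> eps * V" .
    moreover have "\<theta>\<^sup>2 \<le> \<theta>" using \<theta> by (simp add: power2_eq_square mult_left_le)
    then have "min (c\<^sup>2) (\<beta> / (4 * C)) * \<theta>\<^sup>2 * x ^ (2 * L) \<le> (\<beta> / (4 * C)) * \<theta> * x ^ (2 * L)"
      using x \<beta> C \<theta> by (intro mult_right_mono mult_mono) auto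
    ultimately show ?thesis unfolding pw c_def using E by (simp add: mult.commute mult.left_commute)
  qed
qed

text \<open>The scaling in \<open>\<epsilon>\<close>, and the infimum of the energies over all phase fields.\<close>

abbreviation rate :: "nat \<Rightarrow> real \<Rightarrow> real" where
  "rate L eps \<equiv> eps powr (2 * real L / (2 * real L + 1))"

abbreviation inf_energy ::
  "(real ^ 'd::finite) set \<Rightarrow> real \<Rightarrow> ('m::{finite,linorder}, 'd) tensor \<Rightarrow> ('m, 'd) tensor \<Rightarrow> ('m, 'd) tensor \<Rightarrow> ennreal" where
  "inf_energy \<Omega> eps A B F \<equiv> (INF chi \<in> BV \<Omega> {A, B}. energy \<Omega> eps chi F)"

lemma lower_bound:
  fixes \<Omega> :: "(real ^ 'd::{finite,linorder}) set" and l :: "'d \<Rightarrow> nat"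
  assumes \<Omega>: "regular_domain \<Omega>" and d: "CARD('d) \<ge> 2"
    and l: "(\<Sum>c\<in>UNIV. l c) = CARD('m::{finite,linorder})"
  shows "\<exists>C>0. \<exists>eps0>0. \<forall>lam. 0 < lam \<and> lam < 1 \<longrightarrow> (\<forall>(A :: ('m, 'd) tensor) B. A - B = sym_basis_prod l \<longrightarrow>
    (\<forall>eps. 0 < eps \<and> eps < eps0 \<longrightarrow>
      ennreal (C * (min (1 - lam) lam)\<^sup>2 * rate (Max (range l)) eps)
        \<le> inf_energy \<Omega> eps A B (lam *\<^sub>R A + (1 - lam) *\<^sub>R B)))"
proof -
  let ?M = "sym_basis_prod l :: ('m, 'd) tensor"
  define L where "L = Max (range l)"
  have L: "l c \<le> L" for c unfolding L_def by (rule Max_ge) auto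
  have L1: "L \<ge> 1"
  proof (rule ccontr)
    assume "\<not> L \<ge> 1"
    then have "l c = 0" for c using L[of c] by simp
    then show False using l by simp
  qed
  obtain C \<beta> n0 where C: "C > 0" and \<beta>: "\<beta> > 0" and main:
    "\<forall>\<theta> F f E V chi n. \<forall>u :: (real, 'd) vec \<Rightarrow> ('m, 'd) tensor.
    \<theta> > 0 \<longrightarrow> near_phase \<Omega> F l u f E \<longrightarrow> (\<forall>x\<in>\<Omega>. \<theta> \<le> \<bar>f x\<bar>) \<longrightarrow>
    (\<forall>x\<in>\<Omega>. chi x = F + f x *\<^sub>R ?M) \<longrightarrow> total_variation \<Omega> chi \<le> ennreal V \<longrightarrow> V \<ge> 0 \<longrightarrow> n \<ge> n0 \<longrightarrow>
    \<theta> * \<beta> \<le> C * (2 ^ (n * L) * sqrt E + V / 2 ^ n)"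
    using coercivity[OF \<Omega> d l L L1] by (elim exE conjE) (rule that, assumption+)
  define c where "c = min ((\<beta> / (2 * C))\<^sup>2) (\<beta> / (4 * C))"
  define eps0 :: real where "eps0 = (1 / 2 ^ Suc n0) powr (2 * L + 1)"
  show ?thesis
  proof (rule exI[of _ c], rule conjI, goal_cases)
    case 1 show ?case using C \<beta> by (simp add: c_def)
  next
    case 2 show ?case
    proof (rule exI[of _ eps0], intro conjI allI impI, goal_cases)
      case 1 show ?case by (simp add: eps0_def)
    next
      case (2 lam A B eps)
      then have lam: "0 < lam" "lam < 1" and AB: "A - B = ?M" and eps: "0 < eps" "eps < eps0" by auto
      define \<theta> where "\<theta> = min (1 - lam) lam"
      have \<theta>: "0 < \<theta>" "\<theta> \<le> 1" using lam by (auto simp: \<theta>_def)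
      define F where "F = lam *\<^sub>R A + (1 - lam) *\<^sub>R B"
      have AF: "A = F + (1 - lam) *\<^sub>R ?M" and BF: "B = F + (- lam) *\<^sub>R ?M"
        unfolding AB[symmetric] F_def by (simp_all add: algebra_simps)
      have epsx: "eps powr (1 / (2 * L + 1)) \<le> 1 / 2 ^ Suc n0"
      proof -
        have "eps powr (1 / (2 * L + 1)) \<le> eps0 powr (1 / (2 * L + 1))"
          using eps by (intro powr_mono2) auto
        also have "\<dots> = 1 / 2 ^ Suc n0" unfolding eps0_def powr_powr by simp
        finally show ?thesis .
      qed
      define i0 :: "'m \<Rightarrow> 'd" where "i0 = basis_indices l"
      have Mi: "?M $ i0 > 0" by (rule sym_basis_prod_pos[OF l]) (use cnt_basis_indices[OF l] in \<open>auto simp: i0_def\<close>)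
      have \<Omega>m: "\<Omega> \<in> sets lebesgue" using \<Omega> by (auto simp: regular_domain_def)
      have "ennreal (c * \<theta>\<^sup>2 * eps powr (2 * L / (2 * L + 1))) \<le> energy \<Omega> eps chi F" if chi: "chi \<in> BV \<Omega> {A, B}" for chi
      proof -
        define f where "f x = (if chi x = A then 1 - lam else - lam)" for x
        have chif: "chi x = F + f x *\<^sub>R ?M" if "x \<in> \<Omega>" for x
          using chi that AF BF by (auto simp: BV_def f_def)
        have fm: "(\<lambda>x. indicator \<Omega> x * f x) \<in> borel_measurable lebesgue"
        proof -
          have "(\<lambda>x. indicator \<Omega> x *\<^sub>R chi x) \<in> borel_measurable lebesgue"
            using chi by (auto simp: BV_def set_integrable_def)
          then have "(\<lambda>x. (indicator \<Omega> x *\<^sub>R chi x) $ i0) \<in> borel_measurable lebesgue"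
            by (rule measurable_compose) (auto intro!: borel_measurable_continuous_onI continuous_intros)
          then have "(\<lambda>x. ((indicator \<Omega> x *\<^sub>R chi x) $ i0 - indicator \<Omega> x * F $ i0) / ?M $ i0) \<in> borel_measurable lebesgue"
            using \<Omega>m by (intro borel_measurable_divide borel_measurable_diff borel_measurable_times borel_measurable_indicator) auto
          also have "(\<lambda>x. ((indicator \<Omega> x *\<^sub>R chi x) $ i0 - indicator \<Omega> x * F $ i0) / ?M $ i0) = (\<lambda>x. indicator \<Omega> x * f x)"
            using chif Mi by (auto simp: indicator_def fun_eq_iff)
          finally show ?thesis .
        qed
        define V where "V = enn2real (total_variation \<Omega> chi)"
        have V: "total_variation \<Omega> chi = ennreal V" "V \<ge> 0"
          using chi by (auto simp: BV_def V_def)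
        have "ennreal (c * \<theta>\<^sup>2 * eps powr (2 * L / (2 * L + 1)))
            \<le> (\<integral>\<^sup>+x\<in>\<Omega>. ennreal ((norm (u x - chi x))\<^sup>2) \<partial>lebesgue) + ennreal eps * ennreal V" if u: "u \<in> admissible \<Omega> F" for u
        proof (cases "(\<integral>\<^sup>+x\<in>\<Omega>. ennreal ((norm (u x - chi x))\<^sup>2) \<partial>lebesgue)")
          case (real E)
          have "(\<integral>\<^sup>+x\<in>\<Omega>. ennreal ((norm (u x - (F + f x *\<^sub>R ?M)))\<^sup>2) \<partial>lebesgue)
              = (\<integral>\<^sup>+x\<in>\<Omega>. ennreal ((norm (u x - chi x))\<^sup>2) \<partial>lebesgue)"
            by (intro nn_integral_cong) (auto simp: indicator_def chif)
          then have np: "near_phase \<Omega> F l u f E"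
            using u fm real lam by (auto simp: near_phase_def f_def)
          have f\<theta>: "\<forall>x\<in>\<Omega>. \<theta> \<le> \<bar>f x\<bar>" using lam by (auto simp: f_def \<theta>_def)
          have "c * \<theta>\<^sup>2 * eps powr (2 * L / (2 * L + 1)) \<le> E + eps * V"
            unfolding c_def
          proof (rule balance[OF C \<beta> \<theta> _ V(2) _ eps(1) epsx])
            show "\<theta> * \<beta> \<le> C * (2 ^ (n * L) * sqrt E + V / 2 ^ n)" if "n0 \<le> n" for n
              using main[rule_format, OF \<theta>(1) np f\<theta>[rule_format] chif _ V(2) that] V(1) by auto
          qed (rule real)
          then show ?thesis using real eps V by (simp add: ennreal_mult[symmetric] ennreal_plus[symmetric] del: ennreal_plus)
        qed simp
        then have "ennreal (c * \<theta>\<^sup>2 * eps powr (2 * L / (2 * L + 1))) - ennreal eps * ennreal V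
            \<le> (INF u \<in> admissible \<Omega> F. (\<integral>\<^sup>+x\<in>\<Omega>. ennreal ((norm (u x - chi x))\<^sup>2) \<partial>lebesgue))"
          by (intro INF_greatest) (auto simp: ennreal_minus_le_iff add.commute)
        then show ?thesis unfolding energy_def V(1) by (auto simp: ennreal_minus_le_iff add.commute)
      qed
      then show ?case unfolding F_def[symmetric] \<theta>_def[symmetric] L_def[symmetric] by (intro INF_greatest) (simp add: add.commute)
    qed
  qed
qed

text \<open>The boundary of a Lipschitz domain is locally contained in the graph of a Lipschitz function, which is the
  Lipschitz image of a hyperplane.\<close>

lemma negligible_frontier_lipschitz_domain:
  fixes \<Omega> :: "'a::euclidean_space set"
  assumes "lipschitz_domain \<Omega>"
  shows "negligible (frontier \<Omega>)"
proof (rule locally_negligible_alt[THEN iffD2], rule ballI)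
  fix p assume p: "p \<in> frontier \<Omega>"
  have "\<exists>r > 0. \<exists>\<nu> M. \<exists>g :: 'a \<Rightarrow> real. norm \<nu> = 1 \<and> M-lipschitz_on UNIV g \<and>
        \<Omega> \<inter> ball p r = {x \<in> ball p r. x \<bullet> \<nu> < g (x - (x \<bullet> \<nu>) *\<^sub>R \<nu>)}"
    using assms p unfolding lipschitz_domain_def by (elim conjE) (rule bspec)
  then obtain r \<nu> M g where r: "r > 0" and \<nu>: "norm (\<nu>::'a) = 1" and g: "M-lipschitz_on UNIV (g :: 'a \<Rightarrow> real)"
    and eq: "\<Omega> \<inter> ball p r = {x \<in> ball p r. x \<bullet> \<nu> < g (x - (x \<bullet> \<nu>) *\<^sub>R \<nu>)}"
    by (elim exE conjE)
  define G where "G = (\<lambda>x. g (x - (x \<bullet> \<nu>) *\<^sub>R \<nu>) - x \<bullet> \<nu>)"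
  have contg: "continuous_on UNIV g" by (rule lipschitz_on_continuous_on[OF g])
  have contG: "continuous_on UNIV G"
    unfolding G_def by (intro continuous_on_diff continuous_on_compose2[OF contg] continuous_intros) auto
  have mem: "y \<in> \<Omega> \<longleftrightarrow> G y > 0" if "y \<in> ball p r" for y
  proof -
    have "y \<in> \<Omega> \<inter> ball p r \<longleftrightarrow> y \<in> {x \<in> ball p r. x \<bullet> \<nu> < g (x - (x \<bullet> \<nu>) *\<^sub>R \<nu>)}" unfolding eq ..
    then show ?thesis using that by (simp add: G_def)
  qed
  have fr: "G x = 0" if x: "x \<in> frontier \<Omega> \<inter> ball p r" for x
  proof (rule ccontr)
    assume "G x \<noteq> 0"
    then consider "G x > 0" | "G x < 0" by linarith
    then show False
    proof cases
      case 1
      have "open (ball p r \<inter> {x. G x > 0})"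
        using contG by (intro open_Int open_ball open_Collect_less continuous_on_const) auto
      moreover have "ball p r \<inter> {x. G x > 0} \<subseteq> \<Omega>" using mem by blast
      ultimately have "x \<in> interior \<Omega>" using 1 x by (intro interiorI) auto
      then show False using x by (simp add: frontier_def)
    next
      case 2
      have "open (ball p r \<inter> {x. G x < 0})"
        using contG by (intro open_Int open_ball open_Collect_less continuous_on_const) auto
      moreover have "ball p r \<inter> {x. G x < 0} \<inter> \<Omega> = {}" using mem by fastforce
      ultimately have "ball p r \<inter> {x. G x < 0} \<inter> closure \<Omega> = {}" by (simp add: open_Int_closure_eq_empty)
      moreover have "x \<in> closure \<Omega>" using x by (simp add: frontier_def)
      ultimately show False using 2 x by blast
    qed
  qed
  have hyp: "negligible {y. \<nu> \<bullet> y = 0}" using \<nu> by (intro negligible_hyperplane) auto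
  define h where "h = (\<lambda>y. y + g y *\<^sub>R \<nu>)"
  have "negligible (h ` {y. \<nu> \<bullet> y = 0})"
  proof (rule negligible_locally_Lipschitz_image[OF order_refl hyp])
    fix x
    have "norm (h y - h x) \<le> (1 + M) * norm (y - x)" for y
    proof -
      have "\<bar>g y - g x\<bar> \<le> M * norm (y - x)" using lipschitz_onD[OF g, of y x] by (simp add: dist_norm)
      moreover have "h y - h x = (y - x) + (g y - g x) *\<^sub>R \<nu>" by (simp add: h_def algebra_simps)
      then have "norm (h y - h x) \<le> norm (y - x) + norm ((g y - g x) *\<^sub>R \<nu>)"
        by (simp only: norm_triangle_ineq)
      ultimately show ?thesis using \<nu> by (simp add: distrib_right)
    qed
    then show "\<exists>T B. open T \<and> x \<in> T \<and> (\<forall>y\<in>{y. \<nu> \<bullet> y = 0} \<inter> T. norm (h y - h x) \<le> B * norm (y - x))"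
      by (intro exI[of _ UNIV] exI[of _ "1 + M"]) auto
  qed
  moreover have "frontier \<Omega> \<inter> ball p r \<subseteq> h ` {y. \<nu> \<bullet> y = 0}"
  proof
    fix x assume "x \<in> frontier \<Omega> \<inter> ball p r"
    then have Gx: "G x = 0" by (rule fr)
    have "\<nu> \<bullet> \<nu> = 1" using \<nu> by (simp add: dot_square_norm)
    then have "\<nu> \<bullet> (x - (x \<bullet> \<nu>) *\<^sub>R \<nu>) = 0" by (simp add: inner_diff_right inner_commute)
    moreover have "x = h (x - (x \<bullet> \<nu>) *\<^sub>R \<nu>)" using Gx by (simp add: h_def G_def)
    ultimately show "x \<in> h ` {y. \<nu> \<bullet> y = 0}" by blast
  qed
  ultimately have "negligible (frontier \<Omega> \<inter> ball p r)" by (rule negligible_subset)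
  then show "\<exists>U. openin (top_of_set (frontier \<Omega>)) U \<and> p \<in> U \<and> negligible U"
    using p r by (intro exI[of _ "frontier \<Omega> \<inter> ball p r"]) (auto simp: openin_open)
qed

section \<open>Functions of two variables\<close>

text \<open>The point of the plane with \<open>a\<close>-coordinate \<open>s\<close>, the other coordinate being \<open>t\<close>.\<close>

definition mk :: "2 \<Rightarrow> real \<Rightarrow> real \<Rightarrow> real ^ 2" where
  "mk a s t = (\<chi> c. if c = a then s else t)"

lemma mk_nth [simp]: "mk a s t $ a = s" "b \<noteq> a \<Longrightarrow> mk a s t $ b = t"
  by (simp_all add: mk_def)

lemma UNIV_2_pair: "a \<noteq> b \<Longrightarrow> (UNIV :: 2 set) = {a, b}"
proof -
  assume ab: "a \<noteq> b"
  have "card {a, b} = card (UNIV :: 2 set)" using ab by simp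
  then show ?thesis by (intro card_subset_eq[symmetric]) auto
qed

lemma all_2_pair: "a \<noteq> b \<Longrightarrow> (\<forall>c::2. P c) \<longleftrightarrow> P a \<and> P b"
  by (metis UNIV_2_pair UNIV_I insertE singletonD)

lemma mk_measurable: "(\<lambda>(s, t). mk a s t) \<in> borel_measurable (lborel \<Otimes>\<^sub>M lborel)"
proof -
  have "continuous_on UNIV (\<lambda>z :: real \<times> real. mk a (fst z) (snd z))"
    unfolding mk_def
  proof (rule continuous_on_vec_lambda)
    fix c show "continuous_on UNIV (\<lambda>z :: real \<times> real. if c = a then fst z else snd z)"
      by (cases "c = a") (auto intro!: continuous_on_fst continuous_on_snd continuous_on_id)
  qed
  then have "(\<lambda>z :: real \<times> real. mk a (fst z) (snd z)) \<in> borel_measurable borel"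
    by (rule borel_measurable_continuous_onI)
  then show ?thesis by (simp add: case_prod_beta' lborel_prod)
qed

lemma lborel_2_eq: "lborel = distr (lborel \<Otimes>\<^sub>M lborel) borel (\<lambda>(s, t). mk a s t)"
proof (rule lborel_eqI)
  fix l u :: "real ^ 2" assume le: "\<And>c. c \<in> Basis \<Longrightarrow> l \<bullet> c \<le> u \<bullet> c"
  obtain b where b: "a \<noteq> b" using exists_other[of a] by auto
  have le': "l $ c \<le> u $ c" for c using le[of "axis c 1"] by (simp add: inner_axis)
  have vim: "(\<lambda>(s, t). mk a s t) -` box l u = box (l $ a) (u $ a) \<times> box (l $ b) (u $ b)"
    using b by (auto simp: mem_box_cart all_2_pair[OF b])
  have "emeasure (distr (lborel \<Otimes>\<^sub>M lborel) borel (\<lambda>(s, t). mk a s t)) (box l u)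
      = emeasure (lborel \<Otimes>\<^sub>M lborel) (box (l $ a) (u $ a) \<times> box (l $ b) (u $ b))"
    using mk_measurable[of a] by (subst emeasure_distr) (simp_all add: vim space_pair_measure)
  also have "\<dots> = ennreal (u $ a - l $ a) * ennreal (u $ b - l $ b)"
    by (subst lborel.emeasure_pair_measure_Times) (simp_all add: le' box_real)
  also have "\<dots> = ennreal ((u $ a - l $ a) * (u $ b - l $ b))"
    using le' by (simp add: ennreal_mult)
  also have "(u $ a - l $ a) * (u $ b - l $ b) = (\<Prod>c\<in>Basis. (u - l) \<bullet> c)"
    unfolding Basis_vec_eq using b
    by (subst prod.reindex[OF inj_axis]) (simp add: UNIV_2_pair[OF b] inner_axis)
  finally show "emeasure (distr (lborel \<Otimes>\<^sub>M lborel) borel (\<lambda>(s, t). mk a s t)) (box l u)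
      = ennreal (\<Prod>c\<in>Basis. (u - l) \<bullet> c)" .
qed simp

lemma integral_2:
  fixes h :: "real ^ 2 \<Rightarrow> real"
  assumes h: "integrable lborel h"
  shows "(LINT x|lborel. h x) = (LINT t|lborel. LINT s|lborel. h (mk a s t))"
    and "(LINT x|lborel. h x) = (LINT s|lborel. LINT t|lborel. h (mk a s t))"
    and "integrable lborel (\<lambda>t. LINT s|lborel. h (mk a s t))"
    and "integrable lborel (\<lambda>s. LINT t|lborel. h (mk a s t))"
proof -
  have hm: "h \<in> borel_measurable borel" using h by auto
  have i: "integrable (lborel \<Otimes>\<^sub>M lborel) (\<lambda>(s, t). h (mk a s t))"
    using h by (subst (asm) lborel_2_eq[of a], subst (asm) integrable_distr_eq[OF mk_measurable hm])
      (simp add: case_prod_beta')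
  have "(LINT x|lborel. h x) = (LINT z|(lborel \<Otimes>\<^sub>M lborel). (\<lambda>(s, t). h (mk a s t)) z)"
    by (subst lborel_2_eq[of a], subst integral_distr[OF mk_measurable hm]) (simp add: case_prod_beta')
  then show "(LINT x|lborel. h x) = (LINT t|lborel. LINT s|lborel. h (mk a s t))"
    "(LINT x|lborel. h x) = (LINT s|lborel. LINT t|lborel. h (mk a s t))"
    using lborel_pair.integral_snd[OF i] lborel_pair.integral_fst[OF i] by (simp_all add: case_prod_beta')
  show "integrable lborel (\<lambda>t. LINT s|lborel. h (mk a s t))"
    "integrable lborel (\<lambda>s. LINT t|lborel. h (mk a s t))"
    using lborel_pair.integrable_snd[OF i] lborel_pair.integrable_fst[OF i] by simp_all
qed

text \<open>Partial derivatives of smooth functions commute: both mixed derivatives are limits of the same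
  second difference quotient.\<close>

lemma second_difference:
  assumes \<phi>: "\<phi> \<in> test_functions \<Omega>" and h: "h > 0"
  shows "\<exists>s t. 0 < s \<and> s < h \<and> 0 < t \<and> t < h \<and>
    \<phi> (x + h *\<^sub>R axis a 1 + h *\<^sub>R axis b 1) - \<phi> (x + h *\<^sub>R axis a 1) - \<phi> (x + h *\<^sub>R axis b 1) + \<phi> x
      = h * (h * partial b (partial a \<phi>) (x + s *\<^sub>R axis a 1 + t *\<^sub>R axis b 1))"
proof -
  let ?a = "axis a 1 :: real ^ _" and ?b = "axis b 1 :: real ^ _"
  define u where "u s = \<phi> (x + h *\<^sub>R ?b + s *\<^sub>R ?a) - \<phi> (x + s *\<^sub>R ?a)" for s
  have "(u has_field_derivative partial a \<phi> (x + h *\<^sub>R ?b + s *\<^sub>R ?a) - partial a \<phi> (x + s *\<^sub>R ?a)) (at s)" for s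
    unfolding u_def by (intro DERIV_diff test_function_along_line[OF \<phi>])
  then obtain s where s: "0 < s" "s < h"
    "u h - u 0 = (h - 0) * (partial a \<phi> (x + h *\<^sub>R ?b + s *\<^sub>R ?a) - partial a \<phi> (x + s *\<^sub>R ?a))"
    using MVT2[OF h, of u "\<lambda>s. partial a \<phi> (x + h *\<^sub>R ?b + s *\<^sub>R ?a) - partial a \<phi> (x + s *\<^sub>R ?a)"] by blast
  obtain t where t: "0 < t" "t < h"
    "partial a \<phi> (x + s *\<^sub>R ?a + h *\<^sub>R ?b) - partial a \<phi> (x + s *\<^sub>R ?a + 0 *\<^sub>R ?b)
      = (h - 0) * partial b (partial a \<phi>) (x + s *\<^sub>R ?a + t *\<^sub>R ?b)"
    using MVT2[OF h, of "\<lambda>t. partial a \<phi> (x + s *\<^sub>R ?a + t *\<^sub>R ?b)" "\<lambda>t. partial b (partial a \<phi>) (x + s *\<^sub>R ?a + t *\<^sub>R ?b)"]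
      test_function_along_line[OF test_function_partial[OF \<phi>, of a], of "x + s *\<^sub>R ?a" b] by blast
  have "u h - u 0 = h * (h * partial b (partial a \<phi>) (x + s *\<^sub>R ?a + t *\<^sub>R ?b))"
    using s(3) t(3) by (simp add: add.commute add.left_commute)
  then show ?thesis using s t by (intro exI[of _ s] exI[of _ t]) (simp add: u_def add_ac)
qed

lemma partial_commute:
  assumes \<phi>: "\<phi> \<in> test_functions \<Omega>"
  shows "partial a (partial b \<phi>) = partial b (partial a \<phi>)"
proof
  fix x
  let ?a = "axis a 1 :: real ^ _" and ?b = "axis b 1 :: real ^ _"
  define h where "h n = inverse (real (Suc n))" for n
  have h: "h n > 0" for n by (simp add: h_def)
  have h0: "h \<longlonglongrightarrow> 0" unfolding h_def by (rule LIMSEQ_inverse_real_of_nat)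
  have *: "\<exists>y z. norm (y - x) \<le> 2 * h n \<and> norm (z - x) \<le> 2 * h n \<and> partial b (partial a \<phi>) y = partial a (partial b \<phi>) z" for n
  proof -
    obtain s t where 1: "0 < s" "s < h n" "0 < t" "t < h n"
      "\<phi> (x + h n *\<^sub>R ?a + h n *\<^sub>R ?b) - \<phi> (x + h n *\<^sub>R ?a) - \<phi> (x + h n *\<^sub>R ?b) + \<phi> x
      = h n * (h n * partial b (partial a \<phi>) (x + s *\<^sub>R ?a + t *\<^sub>R ?b))"
      using second_difference[OF \<phi> h] by blast
    obtain s' t' where 2: "0 < s'" "s' < h n" "0 < t'" "t' < h n"
      "\<phi> (x + h n *\<^sub>R ?b + h n *\<^sub>R ?a) - \<phi> (x + h n *\<^sub>R ?b) - \<phi> (x + h n *\<^sub>R ?a) + \<phi> x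
      = h n * (h n * partial a (partial b \<phi>) (x + s' *\<^sub>R ?b + t' *\<^sub>R ?a))"
      using second_difference[OF \<phi> h] by blast
    have nrm: "norm (v *\<^sub>R axis c 1 + w *\<^sub>R axis c' (1::real)) \<le> 2 * h n" if "0 < v" "v < h n" "0 < w" "w < h n" for v w c c'
    proof -
      have "norm (v *\<^sub>R axis c 1 + w *\<^sub>R axis c' (1::real)) \<le> norm (v *\<^sub>R axis c (1::real)) + norm (w *\<^sub>R axis c' (1::real))"
        by (rule norm_triangle_ineq)
      then show ?thesis using that by (simp add: norm_axis_eq)
    qed
    have "h n * (h n * partial b (partial a \<phi>) (x + s *\<^sub>R ?a + t *\<^sub>R ?b)) = h n * (h n * partial a (partial b \<phi>) (x + s' *\<^sub>R ?b + t' *\<^sub>R ?a))"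
      unfolding 1(5)[symmetric] 2(5)[symmetric] by (simp add: add_ac)
    then have "partial b (partial a \<phi>) (x + s *\<^sub>R ?a + t *\<^sub>R ?b) = partial a (partial b \<phi>) (x + s' *\<^sub>R ?b + t' *\<^sub>R ?a)"
      using h[of n] by simp
    moreover have "norm (x + s *\<^sub>R ?a + t *\<^sub>R ?b - x) \<le> 2 * h n" using nrm[OF 1(1-4), of a b] by (simp add: add.assoc)
    moreover have "norm (x + s' *\<^sub>R ?b + t' *\<^sub>R ?a - x) \<le> 2 * h n" using nrm[OF 2(1-4), of b a] by (simp add: add.assoc)
    ultimately show ?thesis by blast
  qed
  then obtain y z where y: "\<And>n. norm (y n - x) \<le> 2 * h n" and z: "\<And>n. norm (z n - x) \<le> 2 * h n"
    and eq: "\<And>n. partial b (partial a \<phi>) (y n) = partial a (partial b \<phi>) (z n)" by metis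
  have lim: "v \<longlonglongrightarrow> x" if "\<And>n. norm (v n - x) \<le> 2 * h n" for v
  proof -
    have "(\<lambda>n. 2 * h n) \<longlonglongrightarrow> 0" using tendsto_mult_right_zero[OF h0] by simp
    then have "(\<lambda>n. v n - x) \<longlonglongrightarrow> 0"
      by (rule Lim_null_comparison[rotated]) (use that in auto)
    then show ?thesis by (simp add: LIM_zero_iff)
  qed
  have c: "isCont (partial a (partial b \<phi>)) x" for a b
    using test_function_continuous[OF test_function_partial[OF test_function_partial[OF \<phi>]], of UNIV]
    by (simp add: continuous_on_eq_continuous_at)
  have "(\<lambda>n. partial b (partial a \<phi>) (y n)) \<longlonglongrightarrow> partial b (partial a \<phi>) x"
    by (rule isCont_tendsto_compose[OF c lim[OF y]])
  moreover have "(\<lambda>n. partial b (partial a \<phi>) (y n)) \<longlonglongrightarrow> partial a (partial b \<phi>) x"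
    unfolding eq by (rule isCont_tendsto_compose[OF c lim[OF z]])
  ultimately show "partial a (partial b \<phi>) x = partial b (partial a \<phi>) x" using LIMSEQ_unique by blast
qed

lemma partials_partial_commute:
  "\<phi> \<in> test_functions \<Omega> \<Longrightarrow> partials as (partial b \<phi>) = partial b (partials as \<phi>)"
  by (induction as) (simp_all add: partials_Nil partials_Cons partial_commute[OF test_function_partials])

lemma partials_commute:
  "\<phi> \<in> test_functions \<Omega> \<Longrightarrow> partials as (partials bs \<phi>) = partials bs (partials as \<phi>)"
  by (induction bs) (simp_all add: partials_Nil partials_Cons partials_partial_commute[OF test_function_partials])

lemma partials_replicate_Suc: "partials (replicate (Suc n) a) \<phi> = partial a (partials (replicate n a) \<phi>)"
  by (simp add: partials_Cons)

lemma partials_sort_2: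
  assumes ab: "a \<noteq> b" and \<phi>: "\<phi> \<in> test_functions \<Omega>"
  shows "partials as \<phi> = partials (replicate (count_list as b) b) (partials (replicate (count_list as a) (a::2)) \<phi>)"
proof (induction as)
  case (Cons c as)
  have "c = a \<or> c = b" using UNIV_2_pair[OF ab] by blast
  then show ?case
  proof
    assume "c = a"
    then show ?thesis
      using ab by (simp add: partials_Cons Cons partials_partial_commute[OF test_function_partials[OF \<phi>], symmetric])
  qed (use ab in \<open>simp add: partials_Cons Cons\<close>)
qed (simp add: partials_Nil)

text \<open>The restrictions of a test function to coordinate lines.\<close>

lemma mk_eq: "b \<noteq> a \<Longrightarrow> mk a s t = mk a 0 t + s *\<^sub>R axis a 1" "b \<noteq> a \<Longrightarrow> mk a s t = mk a s 0 + t *\<^sub>R axis b 1"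
  by (auto simp: vec_eq_iff mk_def axis_def) (metis UNIV_2_pair insertE singletonD UNIV_I)

lemma test_function_section:
  fixes \<phi> :: "real ^ 2 \<Rightarrow> real"
  assumes \<phi>: "\<phi> \<in> test_functions \<Omega>" and ab: "a \<noteq> b"
  shows "(deriv ^^ n) (\<lambda>s. \<phi> (mk a s t)) = (\<lambda>s. partials (replicate n a) \<phi> (mk a s t))"
    "(deriv ^^ n) (\<lambda>t. \<phi> (mk a s t)) = (\<lambda>t. partials (replicate n b) \<phi> (mk a s t))"
    "\<exists>R. \<forall>s t. compact_smooth R (\<lambda>s. \<phi> (mk a s t)) \<and> compact_smooth R (\<lambda>t. \<phi> (mk a s t))"
proof -
  have da: "((\<lambda>s. \<phi> (mk a s t)) has_field_derivative partial a \<phi> (mk a s t)) (at s)" if "\<phi> \<in> test_functions \<Omega>" for \<phi> s t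
    using test_function_along_line[OF that, of "mk a 0 t" a s] by (simp add: mk_eq(1)[OF ab[symmetric], symmetric])
  have db: "((\<lambda>t. \<phi> (mk a s t)) has_field_derivative partial b \<phi> (mk a s t)) (at t)" if "\<phi> \<in> test_functions \<Omega>" for \<phi> s t
    using test_function_along_line[OF that, of "mk a s 0" b t] by (simp add: mk_eq(2)[OF ab[symmetric], symmetric])
  show 1: "(deriv ^^ n) (\<lambda>s. \<phi> (mk a s t)) = (\<lambda>s. partials (replicate n a) \<phi> (mk a s t))" for n t
  proof (induction n)
    case (Suc n)
    show ?case unfolding funpow.simps o_def Suc partials_replicate_Suc
      by (rule deriv_eqI) (rule da[OF test_function_partials[OF \<phi>]])
  qed (simp add: partials_Nil)
  show 2: "(deriv ^^ n) (\<lambda>t. \<phi> (mk a s t)) = (\<lambda>t. partials (replicate n b) \<phi> (mk a s t))" for n s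
  proof (induction n)
    case (Suc n)
    show ?case unfolding funpow.simps o_def Suc partials_replicate_Suc
      by (rule deriv_eqI) (rule db[OF test_function_partials[OF \<phi>]])
  qed (simp add: partials_Nil)
  obtain K where K: "compact K" "\<And>x. x \<notin> K \<Longrightarrow> \<phi> x = 0" using test_function_support[OF \<phi>] by metis
  from compact_imp_bounded[OF K(1)] obtain R where R: "\<And>x. x \<in> K \<Longrightarrow> norm x \<le> R" by (auto simp: bounded_iff)
  have "\<phi> (mk a s t) = 0" if "s \<notin> {-R..R} \<or> t \<notin> {-R..R}" for s t
  proof (rule K(2), rule notI)
    assume "mk a s t \<in> K"
    then have "norm (mk a s t) \<le> R" by (rule R)
    then have "\<bar>s\<bar> \<le> R" "\<bar>t\<bar> \<le> R"
      using component_le_norm_cart[of "mk a s t" a] component_le_norm_cart[of "mk a s t" b] ab by auto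
    with that show False by auto
  qed
  moreover have "smooth (\<lambda>s. \<phi> (mk a s t))" for t
    unfolding smooth_def 1 using da[OF test_function_partials[OF \<phi>]] real_differentiable_def by blast
  moreover have "smooth (\<lambda>t. \<phi> (mk a s t))" for s
    unfolding smooth_def 2 using db[OF test_function_partials[OF \<phi>]] real_differentiable_def by blast
  ultimately show "\<exists>R. \<forall>s t. compact_smooth R (\<lambda>s. \<phi> (mk a s t)) \<and> compact_smooth R (\<lambda>t. \<phi> (mk a s t))"
    unfolding compact_smooth_def by blast
qed

section \<open>Integration by parts on rays\<close>

lemma compact_smooth_mult: "smooth Z \<Longrightarrow> compact_smooth R \<psi> \<Longrightarrow> compact_smooth R (\<lambda>t. Z t * \<psi> t)"
  by (auto simp: compact_smooth_def smooth_mult)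

lemma integral_deriv_Icc:
  assumes H: "smooth H" and "u \<le> v"
  shows "(LINT t|lborel. indicator {u..v} t * deriv H t) = H v - H u"
proof -
  have "(LINT t|lborel. indicator {u..v} t *\<^sub>R deriv H t) = H v - H u"
  proof (rule integral_FTC_atLeastAtMost[OF assms(2)])
    show "(H has_vector_derivative deriv H x) (at x within {u..v})" for x
      using smooth_DERIV[OF H] by (auto simp: has_real_derivative_iff_has_vector_derivative intro: has_vector_derivative_at_within)
  qed (rule smooth_continuous[OF smooth_deriv[OF H]])
  then show ?thesis by simp
qed

lemma integral_deriv_almost_Icc:
  assumes H: "compact_smooth R H" and "u \<le> v" "I \<in> sets borel"
    and I: "\<And>t. t \<noteq> u \<Longrightarrow> t \<noteq> v \<Longrightarrow> t \<in> {-R..R} \<Longrightarrow> t \<in> I \<longleftrightarrow> t \<in> {u..v}"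
  shows "(LINT t|lborel. indicator I t * deriv H t) = H v - H u"
proof -
  have sm: "smooth H" using H by (rule compact_smooth_smooth)
  have dz: "deriv H t = 0" if "t \<notin> {-R..R}" for t
    using compact_smooth_deriv[OF H] that by (rule compact_smooth_zero)
  have m: "deriv H \<in> borel_measurable borel"
    by (rule borel_measurable_continuous_onI[OF smooth_continuous[OF smooth_deriv[OF sm]]])
  have "AE t in lborel. t \<noteq> u \<and> t \<noteq> v" using AE_lborel_singleton[of u] AE_lborel_singleton[of v] by auto
  then have "AE t in lborel. indicator I t * deriv H t = indicator {u..v} t * deriv H t"
  proof eventually_elim
    case (elim t)
    then show ?case using I[of t] dz[of t] by (cases "t \<in> {-R..R}") (auto simp: indicator_def)
  qed
  then have "(LINT t|lborel. indicator I t * deriv H t) = (LINT t|lborel. indicator {u..v} t * deriv H t)"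
    by (rule integral_cong_AE[rotated 2]) (use m assms(3) in measurable)
  then show ?thesis using integral_deriv_Icc[OF sm assms(2)] by simp
qed

text \<open>Open rays with end point \<open>\<tau>\<close>.\<close>

definition ray :: "real \<Rightarrow> real set \<Rightarrow> bool" where
  "ray \<tau> I \<longleftrightarrow> I = {\<tau><..} \<or> I = {..<\<tau>}"

lemma integral_deriv_ray:
  assumes H: "compact_smooth R H" and I: "I = {} \<or> I = UNIV \<or> (\<exists>\<tau>. ray \<tau> I \<and> H \<tau> = 0)"
  shows "(LINT t|lborel. indicator I t * deriv H t) = 0"
proof -
  define B where "B = \<bar>R\<bar> + 1"
  have out: "H t = 0" if "\<bar>t\<bar> \<ge> B" for t
  proof -
    have "t \<notin> {-R..R}" using that by (auto simp: B_def abs_if split: if_splits)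
    then show ?thesis by (rule compact_smooth_zero[OF H])
  qed
  consider "I = {}" | "I = UNIV" | \<tau> where "I = {\<tau><..}" "H \<tau> = 0" | \<tau> where "I = {..<\<tau>}" "H \<tau> = 0"
    using I unfolding ray_def by blast
  then show ?thesis
  proof cases
    case 1 then show ?thesis by simp
  next
    case 2
    have "(LINT t|lborel. indicator I t * deriv H t) = H B - H (-B)"
      by (rule integral_deriv_almost_Icc[OF H]) (use 2 in \<open>auto simp: B_def\<close>)
    then show ?thesis using out[of B] out[of "-B"] by (simp add: B_def)
  next
    case (3 \<tau>)
    have "(LINT t|lborel. indicator I t * deriv H t) = H (max \<tau> B) - H \<tau>"
      by (rule integral_deriv_almost_Icc[OF H]) (use 3 in \<open>auto simp: B_def le_max_iff_disj\<close>)
    moreover have "H (max \<tau> B) = 0" by (rule out) (simp add: max_def B_def)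
    ultimately show ?thesis using 3 by simp
  next
    case (4 \<tau>)
    have "(LINT t|lborel. indicator I t * deriv H t) = H \<tau> - H (min \<tau> (-B))"
      by (rule integral_deriv_almost_Icc[OF H]) (use 4 in \<open>auto simp: B_def min_le_iff_disj\<close>)
    moreover have "H (min \<tau> (-B)) = 0" by (rule out) (simp add: min_def B_def)
    ultimately show ?thesis using 4 by simp
  qed
qed

lemma integral_by_parts_ray:
  assumes "smooth Z" "compact_smooth R \<psi>" and I: "I = {} \<or> I = UNIV \<or> (\<exists>\<tau>. ray \<tau> I \<and> (\<forall>k<L. (deriv ^^ k) Z \<tau> = 0))"
    "I \<in> sets borel"
  shows "(LINT t|lborel. indicator I t * (Z t * (deriv ^^ L) \<psi> t)) = (-1) ^ L * (LINT t|lborel. indicator I t * ((deriv ^^ L) Z t * \<psi> t))"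
  using assms(1) I
proof (induction L arbitrary: Z)
  case 0 then show ?case by simp
next
  case (Suc L)
  define \<chi>' where "\<chi>' = (deriv ^^ L) \<psi>"
  have c: "compact_smooth R \<chi>'" unfolding \<chi>'_def by (rule compact_smooth_funpow[OF assms(2)])
  have smc: "smooth \<chi>'" using c by (rule compact_smooth_smooth)
  have H: "compact_smooth R (\<lambda>t. Z t * \<chi>' t)" by (rule compact_smooth_mult[OF Suc.prems(1) c])
  have dH: "deriv (\<lambda>t. Z t * \<chi>' t) = (\<lambda>t. Z t * deriv \<chi>' t + deriv Z t * \<chi>' t)"
    by (rule deriv_eqI) (auto intro!: derivative_eq_intros smooth_DERIV smc Suc.prems(1))
  have I0: "I = {} \<or> I = UNIV \<or> (\<exists>\<tau>. ray \<tau> I \<and> Z \<tau> * \<chi>' \<tau> = 0)"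
    using Suc.prems(2) by (metis funpow_0 mult_zero_left zero_less_Suc)
  have I1: "I = {} \<or> I = UNIV \<or> (\<exists>\<tau>. ray \<tau> I \<and> (\<forall>k<L. (deriv ^^ k) (deriv Z) \<tau> = 0))"
    using Suc.prems(2) by (metis Suc_less_eq deriv_funpow_Suc)
  have i: "integrable lborel (\<lambda>t. indicator I t * g t)" if "compact_smooth R g" for g :: "real \<Rightarrow> real"
    using integrable_mult_indicator[OF _ compact_smooth_integrable[OF that], of I] Suc.prems(3) by simp
  have i1: "integrable lborel (\<lambda>t. indicator I t * (Z t * deriv \<chi>' t))"
    by (rule i[OF compact_smooth_mult[OF Suc.prems(1) compact_smooth_deriv[OF c]]])
  have i2: "integrable lborel (\<lambda>t. indicator I t * (deriv Z t * \<chi>' t))"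
    by (rule i[OF compact_smooth_mult[OF smooth_deriv[OF Suc.prems(1)] c]])
  have "0 = (LINT t|lborel. indicator I t * deriv (\<lambda>t. Z t * \<chi>' t) t)"
    by (rule integral_deriv_ray[OF H I0, symmetric])
  also have "\<dots> = (LINT t|lborel. indicator I t * (Z t * deriv \<chi>' t)) + (LINT t|lborel. indicator I t * (deriv Z t * \<chi>' t))"
    unfolding dH distrib_left by (rule Bochner_Integration.integral_add[OF i1 i2])
  finally have "(LINT t|lborel. indicator I t * (Z t * deriv \<chi>' t)) = - (LINT t|lborel. indicator I t * (deriv Z t * \<chi>' t))" by linarith
  also have "(LINT t|lborel. indicator I t * (deriv Z t * \<chi>' t)) = (-1) ^ L * (LINT t|lborel. indicator I t * ((deriv ^^ L) (deriv Z) t * \<psi> t))"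
    unfolding \<chi>'_def by (rule Suc.IH[OF smooth_deriv[OF Suc.prems(1)] I1 Suc.prems(3)])
  finally show ?case by (simp add: \<chi>'_def deriv_funpow_Suc[of L Z, symmetric] del: funpow.simps) (simp add: funpow_swap1)
qed

lemma sublevel_ray_mono:
  fixes \<gamma> :: "real \<Rightarrow> real"
  assumes c: "continuous_on UNIV \<gamma>" and m: "mono \<gamma>"
  shows "{t. \<gamma> t < s} = {} \<or> {t. \<gamma> t < s} = UNIV \<or> (\<exists>\<tau>. \<gamma> \<tau> = s \<and> {t. \<gamma> t < s} = {..<\<tau>})"
proof (cases "{t. \<gamma> t < s} = {} \<or> {t. \<gamma> t < s} = UNIV")
  case False
  from False obtain t0 where t0: "\<gamma> t0 < s" by blast
  from False obtain t1 where "\<not> \<gamma> t1 < s" by blast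
  with t0 have t: "\<gamma> t0 < s" "\<gamma> t1 \<ge> s" by auto
  define J where "J = {t. s \<le> \<gamma> t}"
  define \<tau> where "\<tau> = Inf J"
  have bd: "bdd_below J"
  proof (rule bdd_belowI)
    fix x assume "x \<in> J"
    then have "\<gamma> t0 < \<gamma> x" using t by (simp add: J_def)
    then show "t0 \<le> x" using monoD[OF m, of x t0] by (meson le_cases not_le)
  qed
  have "closed J" unfolding J_def by (intro closed_Collect_le continuous_on_const c)
  then have \<tau>J: "\<tau> \<in> J" unfolding \<tau>_def using bd t by (intro closed_contains_Inf) (auto simp: J_def)
  have lt: "\<gamma> x < s" if "x < \<tau>" for x
    using cInf_lower[OF _ bd, of x] that by (auto simp: \<tau>_def J_def not_le[symmetric])
  have ge: "s \<le> \<gamma> x" if "\<tau> \<le> x" for x using monoD[OF m that] \<tau>J by (simp add: J_def)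
  have "\<gamma> \<tau> \<le> s"
  proof (rule tendsto_upperbound)
    show "(\<gamma> \<longlongrightarrow> \<gamma> \<tau>) (at_left \<tau>)"
      using c by (simp add: continuous_on_eq_continuous_within continuous_within filterlim_at_split)
    show "\<forall>\<^sub>F x in at_left \<tau>. \<gamma> x \<le> s" by (auto simp: eventually_at_filter less_imp_le lt)
  qed auto
  moreover have "{t. \<gamma> t < s} = {..<\<tau>}" using lt ge by (auto simp: not_le[symmetric])
  ultimately show ?thesis using \<tau>J by (auto simp: J_def intro!: exI[of _ \<tau>])
qed blast

lemma sublevel_ray:
  fixes \<gamma> :: "real \<Rightarrow> real"
  assumes c: "continuous_on UNIV \<gamma>" and m: "mono \<gamma> \<or> antimono \<gamma>"
  shows "{t. \<gamma> t < s} = {} \<or> {t. \<gamma> t < s} = UNIV \<or> (\<exists>\<tau>. ray \<tau> {t. \<gamma> t < s} \<and> \<gamma> \<tau> = s)"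
  using m
proof
  assume "mono \<gamma>"
  from sublevel_ray_mono[OF c this, of s] show ?thesis unfolding ray_def by blast
next
  assume am: "antimono \<gamma>"
  have "continuous_on UNIV (\<lambda>t. \<gamma> (- t))" by (rule continuous_on_compose2[OF c]) (auto intro!: continuous_intros)
  moreover have "mono (\<lambda>t. \<gamma> (- t))" using am by (auto simp: monotone_def)
  ultimately have *: "{t. \<gamma> (-t) < s} = {} \<or> {t. \<gamma> (-t) < s} = UNIV \<or> (\<exists>\<tau>. \<gamma> (-\<tau>) = s \<and> {t. \<gamma> (-t) < s} = {..<\<tau>})"
    by (rule sublevel_ray_mono)
  have eq: "{t. \<gamma> t < s} = uminus ` {t. \<gamma> (-t) < s}"
  proof (intro equalityI subsetI)
    fix x assume "x \<in> {t. \<gamma> t < s}"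
    then have "- x \<in> {t. \<gamma> (-t) < s}" by simp
    then show "x \<in> uminus ` {t. \<gamma> (-t) < s}" by (rule image_eqI[rotated]) simp
  qed auto
  from * show ?thesis unfolding eq ray_def by (elim disjE exE) (auto simp: image_uminus_lessThan)
qed

lemma funpow_deriv_power_zero:
  assumes z: "smooth z" and "k < L" "z \<tau> = 0"
  shows "(deriv ^^ k) (\<lambda>t. z t ^ L) \<tau> = 0"
proof -
  have "\<exists>w. smooth w \<and> (deriv ^^ k) (\<lambda>t. z t ^ L) = (\<lambda>t. z t ^ (L - k) * w t)" if "k < L" for k
    using that
  proof (induction k)
    case 0
    then show ?case by (intro exI[of _ "\<lambda>_. 1"]) (simp add: smooth_const)
  next
    case (Suc k)
    then obtain w where w: "smooth w" and eq: "(deriv ^^ k) (\<lambda>t. z t ^ L) = (\<lambda>t. z t ^ (L - k) * w t)" by auto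
    obtain n where n: "L - k = Suc n" "L - Suc k = n" using Suc.prems by (metis Suc_diff_Suc Suc_lessD)
    have "(deriv ^^ Suc k) (\<lambda>t. z t ^ L) = (\<lambda>t. z t ^ n * ((Suc n * deriv z t) * w t + z t * deriv w t))"
      unfolding funpow.simps o_def eq n
    proof (rule deriv_eqI)
      fix t
      have "((\<lambda>t. z t ^ Suc n) has_field_derivative (1 + of_nat n) * (deriv z t * z t ^ n)) (at t)"
        by (rule DERIV_power_Suc[OF smooth_DERIV[OF z]])
      from DERIV_mult[OF this smooth_DERIV[OF w]]
      show "((\<lambda>t. z t ^ Suc n * w t) has_field_derivative z t ^ n * ((Suc n * deriv z t) * w t + z t * deriv w t)) (at t)"
        by (simp add: algebra_simps)
    qed
    moreover have "smooth (\<lambda>t. (Suc n * deriv z t) * w t + z t * deriv w t)"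
      by (intro smooth_add smooth_mult smooth_cmult smooth_deriv z w)
    ultimately show ?case unfolding n by blast
  qed
  from this[OF assms(2)] show ?thesis using assms(2,3) by auto
qed

section \<open>Compatible pairs\<close>

text \<open>The smooth monotone step used to move interfaces; it is constant near \<open>0\<close> and near \<open>1\<close>.\<close>

definition smooth_step :: "(real \<Rightarrow> real) \<Rightarrow> bool" where
  "smooth_step S \<longleftrightarrow> smooth S \<and> mono S \<and> (\<forall>t\<le>1/3. S t = 0) \<and> (\<forall>t\<ge>2/3. S t = 1)"

definition stp :: "real \<Rightarrow> real" where
  "stp = (SOME S. smooth_step S)"

lemma smooth_step_stp: "smooth_step stp"
proof -
  obtain S where S: "smooth S" "mono S" "\<And>t. t \<le> 0 \<Longrightarrow> S t = 0" "\<And>t. t \<ge> 1 \<Longrightarrow> S t = 1"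
    by (rule exists_smooth_step) blast
  have "smooth_step (\<lambda>t. S (3 * t + (-1)))"
    unfolding smooth_step_def using S smooth_affine[OF S(1), of 3 "-1"] by (auto simp: mono_def)
  then show ?thesis unfolding stp_def by (rule someI[of smooth_step])
qed

lemma stp_smooth: "smooth stp" and stp_mono: "mono stp"
  and stp_0: "t \<le> 1/3 \<Longrightarrow> stp t = 0" and stp_1: "t \<ge> 2/3 \<Longrightarrow> stp t = 1"
  using smooth_step_stp by (auto simp: smooth_step_def)

lemma stp_bounds: "0 \<le> stp t" "stp t \<le> 1"
proof -
  have "stp (min t 0) \<le> stp t" "stp t \<le> stp (max t 1)" by (intro monoD[OF stp_mono]; simp)+
  then show "0 \<le> stp t" "stp t \<le> 1" by (simp_all add: stp_0 stp_1)
qed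

text \<open>The \<open>L\<close>-th derivative of the \<open>L\<close>-th power of the distance to a moving interface.\<close>

definition profile :: "nat \<Rightarrow> real \<Rightarrow> real \<Rightarrow> real \<Rightarrow> real" where
  "profile L \<xi> B \<tau> = (\<xi> - B * stp \<tau>) ^ L / fact L"

definition profile_deriv :: "nat \<Rightarrow> real \<Rightarrow> real \<Rightarrow> real \<Rightarrow> real" where
  "profile_deriv L \<xi> B = (deriv ^^ L) (profile L \<xi> B)"

lemma profile_smooth: "smooth (profile L \<xi> B)"
proof -
  have "smooth (\<lambda>\<tau>. (1 / fact L) * (\<xi> - B * stp \<tau>) ^ L)"
    by (intro smooth_cmult smooth_power smooth_diff smooth_const stp_smooth)
  then show ?thesis by (simp add: profile_def[abs_def])
qed

lemma profile_deriv_expand: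
  "profile_deriv L \<xi> B \<tau> = (\<Sum>i\<le>L. (real (L choose i) * (- B) ^ i * \<xi> ^ (L - i) / fact L) * (deriv ^^ L) (\<lambda>\<tau>. stp \<tau> ^ i) \<tau>)"
proof -
  have eq: "profile L \<xi> B = (\<lambda>\<tau>. \<Sum>i\<le>L. (real (L choose i) * (- B) ^ i * \<xi> ^ (L - i) / fact L) * stp \<tau> ^ i)"
  proof
    fix \<tau>
    have "(\<xi> - B * stp \<tau>) ^ L = ((- B) * stp \<tau> + \<xi>) ^ L" by simp
    also have "\<dots> = (\<Sum>i\<le>L. real (L choose i) * ((- B) * stp \<tau>) ^ i * \<xi> ^ (L - i))" by (rule binomial_ring)
    finally show "profile L \<xi> B \<tau> = (\<Sum>i\<le>L. (real (L choose i) * (- B) ^ i * \<xi> ^ (L - i) / fact L) * stp \<tau> ^ i)"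
      by (simp only: profile_def divide_inverse sum_distrib_right sum_distrib_left power_mult_distrib mult_ac)
  qed
  have "(deriv ^^ L) (profile L \<xi> B) = (\<lambda>\<tau>. \<Sum>i\<le>L. (deriv ^^ L) (\<lambda>\<tau>. (real (L choose i) * (- B) ^ i * \<xi> ^ (L - i) / fact L) * stp \<tau> ^ i) \<tau>)"
    unfolding eq by (rule funpow_deriv_sum) (intro smooth_cmult smooth_power stp_smooth)
  then show ?thesis
    unfolding profile_deriv_def by (simp only: funpow_deriv_cmult[OF smooth_power[OF stp_smooth]])
qed

lemma profile_deriv_continuous:
  assumes "continuous_on X f" "continuous_on X g"
  shows "continuous_on X (\<lambda>x. profile_deriv L (f x) B (g x))"
  unfolding profile_deriv_expand
  by (intro continuous_on_sum continuous_on_mult continuous_on_divide continuous_on_power continuous_on_const assms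
      continuous_on_compose2[OF funpow_continuous[OF smooth_power[OF stp_smooth], of UNIV] assms(2)]) auto

lemma funpow_deriv_locally_const:
  assumes "smooth f" "open U" "\<And>t. t \<in> U \<Longrightarrow> f t = c" "t \<in> U" "n \<ge> 1"
  shows "(deriv ^^ n) f t = 0"
proof -
  have "(deriv ^^ n) f t = (deriv ^^ n) (\<lambda>_. c) t"
    by (rule funpow_deriv_cong_open[OF assms(1) smooth_const assms(2-4)])
  also have "\<dots> = 0" using funpow_deriv_const[of "n - 1" c] assms(5) by simp
  finally show ?thesis .
qed

lemma profile_deriv_zero:
  assumes "L \<ge> 1" "\<tau> \<notin> {1/3..2/3}" shows "profile_deriv L \<xi> B \<tau> = 0"
proof -
  consider "\<tau> < 1/3" | "\<tau> > 2/3" using assms(2) by force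
  then show ?thesis
  proof cases
    case 1
    show ?thesis unfolding profile_deriv_def
      by (rule funpow_deriv_locally_const[OF profile_smooth, where U = "{..<1/3}" and c = "\<xi> ^ L / fact L"])
         (use 1 assms in \<open>auto simp: profile_def stp_0\<close>)
  next
    case 2
    show ?thesis unfolding profile_deriv_def
      by (rule funpow_deriv_locally_const[OF profile_smooth, where U = "{2/3<..}" and c = "(\<xi> - B) ^ L / fact L"])
         (use 2 assms in \<open>auto simp: profile_def stp_1\<close>)
  qed
qed

lemma profile_deriv_bounded:
  assumes "L \<ge> 1"
  obtains C where "C \<ge> 0" "\<And>\<xi> B \<tau>. \<bar>\<xi>\<bar> \<le> 1 \<Longrightarrow> \<bar>B\<bar> \<le> 1 \<Longrightarrow> \<bar>profile_deriv L \<xi> B \<tau>\<bar> \<le> C"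
proof -
  have "\<exists>C\<ge>0. \<forall>\<tau>\<in>{1/3..2/3}. \<bar>(deriv ^^ L) (\<lambda>\<tau>. stp \<tau> ^ i) \<tau>\<bar> \<le> C" for i
  proof -
    have "compact ((deriv ^^ L) (\<lambda>\<tau>. stp \<tau> ^ i) ` {1/3..2/3})"
      by (intro compact_continuous_image funpow_continuous smooth_power stp_smooth) simp
    then obtain C where "\<forall>\<tau>\<in>{1/3..2/3}. \<bar>(deriv ^^ L) (\<lambda>\<tau>. stp \<tau> ^ i) \<tau>\<bar> \<le> C"
      using compact_imp_bounded bounded_iff by (metis imageI real_norm_def)
    then show ?thesis by (intro exI[of _ "max 0 C"]) (auto simp: le_max_iff_disj)
  qed
  then obtain c where c: "\<And>i. c i \<ge> 0" "\<And>i \<tau>. \<tau> \<in> {1/3..2/3} \<Longrightarrow> \<bar>(deriv ^^ L) (\<lambda>\<tau>. stp \<tau> ^ i) \<tau>\<bar> \<le> c i" by metis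
  define C where "C = (\<Sum>i\<le>L. real (L choose i) / fact L * c i)"
  have C0: "C \<ge> 0" unfolding C_def using c(1) by (intro sum_nonneg mult_nonneg_nonneg) auto
  have "\<bar>profile_deriv L \<xi> B \<tau>\<bar> \<le> C" if "\<bar>\<xi>\<bar> \<le> 1" "\<bar>B\<bar> \<le> 1" for \<xi> B \<tau>
  proof (cases "\<tau> \<in> {1/3..2/3}")
    case True
    have "\<bar>profile_deriv L \<xi> B \<tau>\<bar> \<le> (\<Sum>i\<le>L. \<bar>(real (L choose i) * (- B) ^ i * \<xi> ^ (L - i) / fact L) * (deriv ^^ L) (\<lambda>\<tau>. stp \<tau> ^ i) \<tau>\<bar>)"
      unfolding profile_deriv_expand by (rule sum_abs)
    also have "\<dots> \<le> C"
      unfolding C_def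
    proof (rule sum_mono)
      fix i
      have "\<bar>(- B) ^ i\<bar> * \<bar>\<xi> ^ (L - i)\<bar> \<le> 1 * 1"
        using that by (intro mult_mono) (auto simp: power_abs intro: power_le_one)
      then have "real (L choose i) / fact L * (\<bar>(- B) ^ i\<bar> * \<bar>\<xi> ^ (L - i)\<bar>) \<le> real (L choose i) / fact L * 1"
        by (intro mult_left_mono) auto
      then have "(real (L choose i) / fact L * (\<bar>(- B) ^ i\<bar> * \<bar>\<xi> ^ (L - i)\<bar>)) * \<bar>(deriv ^^ L) (\<lambda>\<tau>. stp \<tau> ^ i) \<tau>\<bar> \<le> (real (L choose i) / fact L) * c i"
        using c(2)[OF True, of i] by (intro mult_mono) auto
      then show "\<bar>(real (L choose i) * (- B) ^ i * \<xi> ^ (L - i) / fact L) * (deriv ^^ L) (\<lambda>\<tau>. stp \<tau> ^ i) \<tau>\<bar> \<le> real (L choose i) / fact L * c i"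
        by (simp add: abs_mult mult_ac)
    qed
    finally show ?thesis .
  qed (simp add: profile_deriv_zero[OF assms] C0)
  with C0 that show ?thesis by blast
qed

text \<open>Pairs \<open>(p, q)\<close> of functions of the coordinates \<open>x\<^sub>a, x\<^sub>b\<close> with \<open>\<partial>\<^sub>b\<^sup>L p = \<partial>\<^sub>a\<^sup>L q\<close> in the sense of distributions.\<close>

definition pairs_with :: "2 \<Rightarrow> 2 \<Rightarrow> (real \<Rightarrow> real \<Rightarrow> real) \<Rightarrow> (real ^ 2 \<Rightarrow> real) \<Rightarrow> real ^ 2 \<Rightarrow> real" where
  "pairs_with a b p \<phi> x = p (x $ a) (x $ b) * \<phi> x"

definition compat :: "nat \<Rightarrow> 2 \<Rightarrow> 2 \<Rightarrow> (real \<Rightarrow> real \<Rightarrow> real) \<Rightarrow> (real \<Rightarrow> real \<Rightarrow> real) \<Rightarrow> bool" where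
  "compat L a b p q \<longleftrightarrow> (\<lambda>x. p (x $ a) (x $ b)) \<in> borel_measurable borel \<and> (\<lambda>x. q (x $ a) (x $ b)) \<in> borel_measurable borel \<and>
    (\<forall>\<phi>\<in>test_functions UNIV. integrable lborel (pairs_with a b p \<phi>) \<and> integrable lborel (pairs_with a b q \<phi>) \<and>
      (LINT x|lborel. pairs_with a b p (partials (replicate L b) \<phi>) x)
        = (LINT x|lborel. pairs_with a b q (partials (replicate L a) \<phi>) x))"

lemma compat_zero: "compat L a b (\<lambda>s t. 0) (\<lambda>s t. 0)"
  by (simp add: compat_def pairs_with_def[abs_def])

lemma compat_linear:
  assumes 1: "compat L a b p q" and 2: "compat L a b p' q'"
  shows "compat L a b (\<lambda>s t. c * p s t + c' * p' s t) (\<lambda>s t. c * q s t + c' * q' s t)"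
proof -
  have eq: "pairs_with a b (\<lambda>s t. c * p s t + c' * p' s t) \<phi> = (\<lambda>x. c * pairs_with a b p \<phi> x + c' * pairs_with a b p' \<phi> x)" for p p' \<phi>
    by (simp add: pairs_with_def fun_eq_iff algebra_simps)
  have m: "(\<lambda>x. c * p (x $ a) (x $ b) + c' * p' (x $ a) (x $ b)) \<in> borel_measurable borel"
    "(\<lambda>x. c * q (x $ a) (x $ b) + c' * q' (x $ a) (x $ b)) \<in> borel_measurable borel"
    using 1 2 unfolding compat_def by (intro borel_measurable_add borel_measurable_times borel_measurable_const; blast)+
  have i: "integrable lborel (pairs_with a b p \<phi>)" "integrable lborel (pairs_with a b q \<phi>)"
    "integrable lborel (pairs_with a b p' \<phi>)" "integrable lborel (pairs_with a b q' \<phi>)" if "\<phi> \<in> test_functions UNIV" for \<phi>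
    using 1 2 that unfolding compat_def by blast+
  have e: "(LINT x|lborel. pairs_with a b p (partials (replicate L b) \<phi>) x) = (LINT x|lborel. pairs_with a b q (partials (replicate L a) \<phi>) x)"
    "(LINT x|lborel. pairs_with a b p' (partials (replicate L b) \<phi>) x) = (LINT x|lborel. pairs_with a b q' (partials (replicate L a) \<phi>) x)"
    if "\<phi> \<in> test_functions UNIV" for \<phi> using 1 2 that unfolding compat_def by blast+
  show ?thesis
    unfolding compat_def eq
  proof (intro conjI ballI m)
    fix \<phi> :: "real ^ 2 \<Rightarrow> real" assume \<phi>: "\<phi> \<in> test_functions UNIV"
    note i' = i[OF test_function_partials[OF \<phi>]]
    show "integrable lborel (\<lambda>x. c * pairs_with a b p \<phi> x + c' * pairs_with a b p' \<phi> x)"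
      "integrable lborel (\<lambda>x. c * pairs_with a b q \<phi> x + c' * pairs_with a b q' \<phi> x)"
      using i[OF \<phi>] by auto
    show "(LINT x|lborel. c * pairs_with a b p (partials (replicate L b) \<phi>) x + c' * pairs_with a b p' (partials (replicate L b) \<phi>) x)
      = (LINT x|lborel. c * pairs_with a b q (partials (replicate L a) \<phi>) x + c' * pairs_with a b q' (partials (replicate L a) \<phi>) x)"
      using i' e[OF \<phi>] by simp
  qed
qed

lemma compat_add: "compat L a b p q \<Longrightarrow> compat L a b p' q' \<Longrightarrow> compat L a b (\<lambda>s t. p s t + p' s t) (\<lambda>s t. q s t + q' s t)"
  using compat_linear[of L a b p q p' q' 1 1] by simp

lemma compat_diff: "compat L a b p q \<Longrightarrow> compat L a b p' q' \<Longrightarrow> compat L a b (\<lambda>s t. p s t - p' s t) (\<lambda>s t. q s t - q' s t)"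
  using compat_linear[of L a b p q p' q' 1 "-1"] by simp

lemma compat_sum:
  "(\<And>i. i \<in> I \<Longrightarrow> compat L a b (p i) (q i)) \<Longrightarrow> compat L a b (\<lambda>s t. \<Sum>i\<in>I. p i s t) (\<lambda>s t. \<Sum>i\<in>I. q i s t)"
  by (induction I rule: infinite_finite_induct) (auto simp: compat_zero intro: compat_add)

lemma integrable_continuous_test_function:
  assumes "continuous_on UNIV g" "\<phi> \<in> test_functions \<Omega>" "X \<in> sets borel"
  shows "integrable lborel (\<lambda>x. indicator X x * (g x * \<phi> x))"
proof -
  obtain K where K: "compact K" "\<And>x. x \<notin> K \<Longrightarrow> \<phi> x = 0" using test_function_support[OF assms(2)] by metis
  have "integrable lborel (\<lambda>x. indicator K x *\<^sub>R (g x * \<phi> x))"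
    by (rule borel_integrable_compact[OF K(1)])
       (intro continuous_on_mult continuous_on_subset[OF assms(1)] test_function_continuous[OF assms(2)], auto)
  also have "(\<lambda>x. indicator K x *\<^sub>R (g x * \<phi> x)) = (\<lambda>x. g x * \<phi> x)" using K(2) by (auto simp: indicator_def fun_eq_iff)
  finally have "integrable lborel (\<lambda>x. g x * \<phi> x)" .
  from integrable_mult_indicator[OF _ this, of X] assms(3) show ?thesis by simp
qed

lemma funpow_deriv_power_fact: "(deriv ^^ L) (\<lambda>s. (s - c) ^ L / fact L) = (\<lambda>s. 1 :: real)"
proof (induction L)
  case (Suc L)
  have "deriv (\<lambda>s. (s - c) ^ Suc L / fact (Suc L)) = (\<lambda>s. (s - c) ^ L / fact L)"
  proof (rule deriv_eqI)
    fix t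
    have "((\<lambda>s. s - c) has_field_derivative 1) (at t)" by (auto intro!: derivative_eq_intros)
    from DERIV_cdivide[OF DERIV_power_Suc[OF this, of L], of "fact (Suc L)"]
    have "((\<lambda>s. (s - c) ^ Suc L / fact (Suc L)) has_field_derivative (real (Suc L) * (t - c) ^ L) / fact (Suc L)) (at t)"
      by simp
    also have "(real (Suc L) * (t - c) ^ L) / fact (Suc L) = (t - c) ^ L / fact L"
      by (simp add: fact_Suc del: of_nat_Suc)
    finally show "((\<lambda>s. (s - c) ^ Suc L / fact (Suc L)) has_field_derivative (t - c) ^ L / fact L) (at t)" .
  qed
  then show ?case by (simp only: deriv_funpow_Suc Suc)
qed simp

text \<open>The interface \<open>k s - A = B stp ((t - y)/H)\<close> as a graph over the \<open>t\<close>-axis.\<close>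

definition interface :: "real \<Rightarrow> real \<Rightarrow> real \<Rightarrow> real \<Rightarrow> real \<Rightarrow> real \<Rightarrow> real" where
  "interface k A B y H t = (A + B * stp ((1 / H) * t + (- y / H))) / k"

lemma interface_iff:
  assumes k: "k > 0"
  shows "k * s - A > B * stp ((t - y) / H) \<longleftrightarrow> interface k A B y H t < s"
proof -
  have eq: "(t - y) / H = (1 / H) * t + (- y / H)" by (simp add: diff_divide_distrib)
  show ?thesis unfolding eq interface_def using k by (simp add: field_simps)
qed

lemma interface_smooth: "smooth (interface k A B y H)"
proof -
  have "smooth (\<lambda>t. (1 / k) * (A + B * stp ((1 / H) * t + (- y / H))))"
    by (intro smooth_cmult smooth_add smooth_const smooth_affine stp_smooth)
  then show ?thesis by (simp add: interface_def[abs_def])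
qed

lemma interface_mono:
  assumes k: "k > 0"
  shows "mono (interface k A B y H) \<or> antimono (interface k A B y H)"
proof -
  have arg: "mono (\<lambda>t. stp ((1 / H) * t + (- y / H))) \<or> antimono (\<lambda>t. stp ((1 / H) * t + (- y / H)))"
  proof (cases "H > 0")
    case True
    then have "mono (\<lambda>t. stp ((1 / H) * t + (- y / H)))"
      by (intro monoI monoD[OF stp_mono]) (simp add: divide_right_mono)
    then show ?thesis ..
  next
    case False
    then have "antimono (\<lambda>t. stp ((1 / H) * t + (- y / H)))"
      by (intro antimonoI monoD[OF stp_mono]) (simp add: divide_right_mono_neg)
    then show ?thesis ..
  qed
  have "mono (\<lambda>t. (A + B * h t) / k) \<or> antimono (\<lambda>t. (A + B * h t) / k)"
    if "mono h \<or> antimono h" for h :: "real \<Rightarrow> real"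
  proof (cases "B \<ge> 0")
    case True
    then show ?thesis using that k
      by (auto simp: monotone_def intro!: divide_right_mono mult_left_mono)
  next
    case False
    then show ?thesis using that k
      by (auto simp: monotone_def intro!: divide_right_mono mult_left_mono_neg)
  qed
  from this[OF arg] show ?thesis by (simp add: interface_def[abs_def])
qed

text \<open>The basic pair: the region to the right of the moving interface \<open>k s - A = B stp ((t - y)/H)\<close>.\<close>

lemma compat_interface:
  assumes ab: "a \<noteq> b" and k: "k > 0" and H: "H \<noteq> 0"
  shows "compat L a b (\<lambda>s t. of_bool (k * s - A > B * stp ((t - y) / H)))
    (\<lambda>s t. of_bool (k * s - A > B * stp ((t - y) / H)) * ((1 / (k * H)) ^ L * profile_deriv L (k * s - A) B ((t - y) / H)))"
proof -
  define \<gamma> where "\<gamma> = interface k A B y H"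
  have af: "(t - y) / H = (1 / H) * t + (- y / H)" for t by (simp add: diff_divide_distrib)
  note iff = interface_iff[OF k, where A = A and B = B and y = y and H = H, folded \<gamma>_def]
  have sm\<gamma>: "smooth \<gamma>" unfolding \<gamma>_def by (rule interface_smooth)
  have mono\<gamma>: "mono \<gamma> \<or> antimono \<gamma>" unfolding \<gamma>_def by (rule interface_mono[OF k])
  have cont\<gamma>: "continuous_on X \<gamma>" for X by (rule smooth_continuous[OF sm\<gamma>])
  define X where "X = {x :: real ^ 2. \<gamma> (x $ b) < x $ a}"
  have cb: "continuous_on UNIV (\<lambda>x :: real ^ 2. \<gamma> (x $ b))"
    by (rule continuous_on_compose2[OF cont\<gamma>[of UNIV]]) (auto intro!: continuous_intros)
  have "open X" unfolding X_def by (intro open_Collect_less cb continuous_intros)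
  then have X: "X \<in> sets borel" by simp
  define g where "g x = (1 / (k * H)) ^ L * profile_deriv L (k * x $ a - A) B ((1 / H) * (x $ b) + (- y / H))" for x :: "real ^ 2"
  have cg: "continuous_on UNIV g" unfolding g_def
    by (intro continuous_on_mult[OF continuous_on_const] profile_deriv_continuous) (use H in \<open>auto intro!: continuous_intros\<close>)
  have ind: "of_bool (\<gamma> (x $ b) < x $ a) = (indicator X x :: real)" for x by (auto simp: X_def)
  have m1: "(\<lambda>x. of_bool (k * x $ a - A > B * stp ((x $ b - y) / H)) :: real) \<in> borel_measurable borel"
    unfolding iff ind by (rule borel_measurable_indicator[OF X])
  have gx: "(1 / (k * H)) ^ L * profile_deriv L (k * x $ a - A) B ((x $ b - y) / H) = g x" for x :: "real ^ 2"
    by (simp only: g_def af)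
  have m2: "(\<lambda>x. of_bool (k * x $ a - A > B * stp ((x $ b - y) / H)) * ((1 / (k * H)) ^ L * profile_deriv L (k * x $ a - A) B ((x $ b - y) / H))) \<in> borel_measurable borel"
    unfolding iff ind gx
    by (intro borel_measurable_times borel_measurable_indicator X borel_measurable_continuous_onI[OF cg])
  have p_eq: "pairs_with a b (\<lambda>s t. of_bool (k * s - A > B * stp ((t - y) / H))) \<phi> = (\<lambda>x. indicator X x * (1 * \<phi> x))" for \<phi>
    unfolding pairs_with_def iff ind by simp
  have q_eq: "pairs_with a b (\<lambda>s t. of_bool (k * s - A > B * stp ((t - y) / H)) * ((1 / (k * H)) ^ L * profile_deriv L (k * s - A) B ((t - y) / H))) \<phi>
      = (\<lambda>x. indicator X x * (g x * \<phi> x))" for \<phi>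
    unfolding pairs_with_def iff ind gx by (simp only: mult.assoc)
  define Z where "Z s t = (s - \<gamma> t) ^ L / fact L" for s t
  have Zs: "(deriv ^^ L) (\<lambda>s. Z s t) = (\<lambda>s. 1)" for t unfolding Z_def by (rule funpow_deriv_power_fact)
  have smid: "smooth (\<lambda>s. s)"
    by (rule smooth_coinduct[of "\<lambda>g. g = (\<lambda>s. s) \<or> smooth g"])
       (use smooth_DERIV smooth_deriv smooth_const[of 1] in \<open>auto intro!: derivative_eq_intros\<close>)
  have smZ: "smooth (\<lambda>s. Z s t)" "smooth (Z s)" for s t
  proof -
    have "smooth (\<lambda>s. (1 / fact L) * (s - \<gamma> t) ^ L)" by (intro smooth_cmult smooth_power smooth_diff smooth_const smid)
    then show "smooth (\<lambda>s. Z s t)" by (simp add: Z_def)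
    have "smooth (\<lambda>t. (1 / fact L) * (s - \<gamma> t) ^ L)" by (intro smooth_cmult smooth_power smooth_diff smooth_const sm\<gamma>)
    then show "smooth (Z s)" by (simp add: Z_def[abs_def])
  qed
  have Zt: "(deriv ^^ L) (Z s) t = g (mk a s t)" for s t
  proof -
    have "Z s = (\<lambda>t. (1 / k) ^ L * profile L (k * s - A) B ((1 / H) * t + (- y / H)))"
    proof
      fix t
      have "s - \<gamma> t = (1 / k) * (k * s - A - B * stp ((1 / H) * t + (- y / H)))"
        using k by (simp add: \<gamma>_def interface_def field_simps)
      then show "Z s t = (1 / k) ^ L * profile L (k * s - A) B ((1 / H) * t + (- y / H))"
        by (simp only: Z_def profile_def power_mult_distrib times_divide_eq_right)
    qed
    then have "(deriv ^^ L) (Z s) t = (1 / k) ^ L * ((1 / H) ^ L * profile_deriv L (k * s - A) B ((1 / H) * t + (- y / H)))"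
      by (simp only: funpow_deriv_cmult[OF smooth_affine[OF profile_smooth]] funpow_deriv_affine[OF profile_smooth] profile_deriv_def)
    then show ?thesis using ab H k by (simp add: g_def power_mult_distrib power_divide)
  qed
  have zs: "(deriv ^^ n) (\<lambda>s. Z s t) (\<gamma> t) = 0" if "n < L" for n t
  proof -
    have "(\<lambda>s. Z s t) = (\<lambda>s. (1 / fact L) * (s - \<gamma> t) ^ L)" by (simp add: Z_def)
    then show ?thesis
      using funpow_deriv_cmult[OF smooth_power[OF smooth_diff[OF smid smooth_const[of "\<gamma> t"]]], of n "1 / fact L" L]
        funpow_deriv_power_zero[OF smooth_diff[OF smid smooth_const[of "\<gamma> t"]] that] by simp
  qed
  have zt: "(deriv ^^ n) (Z s) \<tau> = 0" if "n < L" "\<gamma> \<tau> = s" for n s \<tau>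
  proof -
    have "Z s = (\<lambda>t. (1 / fact L) * (s - \<gamma> t) ^ L)" by (simp add: Z_def fun_eq_iff)
    then show ?thesis
      using funpow_deriv_cmult[OF smooth_power[OF smooth_diff[OF smooth_const[of s] sm\<gamma>]], of n "1 / fact L" L]
        funpow_deriv_power_zero[OF smooth_diff[OF smooth_const[of s] sm\<gamma>] that(1), of \<tau>] that(2) by simp
  qed
  have main: "(LINT x|lborel. indicator X x * (1 * partials (replicate L b) \<phi> x)) = (LINT x|lborel. indicator X x * (g x * partials (replicate L a) \<phi> x))"
    if \<phi>: "\<phi> \<in> test_functions UNIV" for \<phi>
  proof -
    define \<phi>a where "\<phi>a = partials (replicate L a) \<phi>"
    define \<phi>b where "\<phi>b = partials (replicate L b) \<phi>"
    define \<phi>ab where "\<phi>ab = partials (replicate L a) \<phi>b"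
    have \<phi>ab2: "\<phi>ab = partials (replicate L b) \<phi>a"
      unfolding \<phi>ab_def \<phi>a_def \<phi>b_def by (rule partials_commute[OF \<phi>])
    have t: "\<phi>a \<in> test_functions UNIV" "\<phi>b \<in> test_functions UNIV" "\<phi>ab \<in> test_functions UNIV"
      unfolding \<phi>ab_def \<phi>a_def \<phi>b_def by (intro test_function_partials \<phi>)+
    define h where "h x = (x $ a - \<gamma> (x $ b)) ^ L / fact L" for x :: "real ^ 2"
    have ch: "continuous_on UNIV h" unfolding h_def by (intro continuous_intros cb) auto
    have i1: "integrable lborel (\<lambda>x. indicator X x * (1 * \<phi>b x))"
      by (rule integrable_continuous_test_function[OF continuous_on_const t(2) X])
    have i2: "integrable lborel (\<lambda>x. indicator X x * (h x * \<phi>ab x))"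
      by (rule integrable_continuous_test_function[OF ch t(3) X])
    have i3: "integrable lborel (\<lambda>x. indicator X x * (g x * \<phi>a x))"
      by (rule integrable_continuous_test_function[OF cg t(1) X])
    have indX: "indicator X (mk a s t) = (indicator {\<gamma> t<..} s :: real)" "indicator X (mk a s t) = (indicator {t. \<gamma> t < s} t :: real)" for s t
      using ab by (auto simp: X_def indicator_def)
    have hmk: "h (mk a s t) = Z s t" for s t using ab by (simp add: h_def Z_def)
    have in_s: "(LINT s|lborel. indicator X (mk a s t) * (1 * \<phi>b (mk a s t))) = (-1) ^ L * (LINT s|lborel. indicator X (mk a s t) * (h (mk a s t) * \<phi>ab (mk a s t)))" for t
    proof -
      obtain R where R: "\<And>s t. compact_smooth R (\<lambda>s. \<phi>b (mk a s t))" using test_function_section(3)[OF t(2) ab] by blast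
      have "(LINT s|lborel. indicator {\<gamma> t<..} s * (Z s t * (deriv ^^ L) (\<lambda>s. \<phi>b (mk a s t)) s))
          = (-1) ^ L * (LINT s|lborel. indicator {\<gamma> t<..} s * ((deriv ^^ L) (\<lambda>s. Z s t) s * \<phi>b (mk a s t)))"
        by (rule integral_by_parts_ray[OF smZ(1) R]) (use zs in \<open>auto simp: ray_def\<close>)
      then have "(LINT s|lborel. indicator {\<gamma> t<..} s * (1 * \<phi>b (mk a s t)))
          = (-1) ^ L * (LINT s|lborel. indicator {\<gamma> t<..} s * (Z s t * \<phi>ab (mk a s t)))"
        unfolding Zs test_function_section(1)[OF t(2) ab] \<phi>ab_def[symmetric] by (simp add: mult.assoc[symmetric] power_mult_distrib[symmetric])
      then show ?thesis unfolding indX(1) hmk .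
    qed
    have in_t: "(LINT t|lborel. indicator X (mk a s t) * (h (mk a s t) * \<phi>ab (mk a s t))) = (-1) ^ L * (LINT t|lborel. indicator X (mk a s t) * (g (mk a s t) * \<phi>a (mk a s t)))" for s
    proof -
      obtain R where R: "\<And>s t. compact_smooth R (\<lambda>t. \<phi>a (mk a s t))" using test_function_section(3)[OF t(1) ab] by blast
      have "open {t. \<gamma> t < s}" by (intro open_Collect_less cont\<gamma> continuous_on_const)
      then have "{t. \<gamma> t < s} \<in> sets borel" by simp
      moreover have "{t. \<gamma> t < s} = {} \<or> {t. \<gamma> t < s} = UNIV \<or> (\<exists>\<tau>. ray \<tau> {t. \<gamma> t < s} \<and> (\<forall>n<L. (deriv ^^ n) (Z s) \<tau> = 0))"
        using sublevel_ray[OF cont\<gamma> mono\<gamma>, of s] zt by metis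
      ultimately have "(LINT t|lborel. indicator {t. \<gamma> t < s} t * (Z s t * (deriv ^^ L) (\<lambda>t. \<phi>a (mk a s t)) t))
          = (-1) ^ L * (LINT t|lborel. indicator {t. \<gamma> t < s} t * ((deriv ^^ L) (Z s) t * \<phi>a (mk a s t)))"
        by (intro integral_by_parts_ray[OF smZ(2) R])
      then show ?thesis unfolding indX(2) hmk Zt test_function_section(2)[OF t(1) ab] \<phi>ab2[symmetric] .
    qed
    have "(LINT x|lborel. indicator X x * (1 * \<phi>b x)) = (LINT t|lborel. LINT s|lborel. indicator X (mk a s t) * (1 * \<phi>b (mk a s t)))"
      by (rule integral_2(1)[OF i1])
    also have "\<dots> = (-1) ^ L * (LINT t|lborel. LINT s|lborel. indicator X (mk a s t) * (h (mk a s t) * \<phi>ab (mk a s t)))"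
      unfolding in_s by simp
    also have "(LINT t|lborel. LINT s|lborel. indicator X (mk a s t) * (h (mk a s t) * \<phi>ab (mk a s t))) = (LINT x|lborel. indicator X x * (h x * \<phi>ab x))"
      by (rule integral_2(1)[OF i2, symmetric])
    also have "\<dots> = (LINT s|lborel. LINT t|lborel. indicator X (mk a s t) * (h (mk a s t) * \<phi>ab (mk a s t)))"
      by (rule integral_2(2)[OF i2])
    also have "\<dots> = (-1) ^ L * (LINT s|lborel. LINT t|lborel. indicator X (mk a s t) * (g (mk a s t) * \<phi>a (mk a s t)))"
      unfolding in_t by simp
    also have "(LINT s|lborel. LINT t|lborel. indicator X (mk a s t) * (g (mk a s t) * \<phi>a (mk a s t))) = (LINT x|lborel. indicator X x * (g x * \<phi>a x))"
      by (rule integral_2(2)[OF i3, symmetric])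
    finally show ?thesis by (simp add: \<phi>a_def \<phi>b_def mult.assoc[symmetric] power_mult_distrib[symmetric])
  qed
  show ?thesis
    unfolding compat_def p_eq q_eq
  proof (intro conjI ballI m1 m2 main)
    fix \<phi> :: "real ^ 2 \<Rightarrow> real" assume \<phi>: "\<phi> \<in> test_functions UNIV"
    show "integrable lborel (\<lambda>x. indicator X x * (1 * \<phi> x))"
      by (rule integrable_continuous_test_function[OF continuous_on_const \<phi> X])
    show "integrable lborel (\<lambda>x. indicator X x * (g x * \<phi> x))"
      by (rule integrable_continuous_test_function[OF cg \<phi> X])
  qed
qed

section \<open>Surface measure of regions bounded by graphs\<close>

lemma integral_deriv_interval_bound:
  assumes H: "compact_smooth R H" and b: "\<And>t. \<bar>H t\<bar> \<le> 1" and I: "is_interval I" "I \<in> sets borel"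
  shows "\<bar>LINT t|lborel. indicator I t * deriv H t\<bar> \<le> 2"
proof -
  define B where "B = \<bar>R\<bar> + 1"
  define Y where "Y = I \<inter> {-B..B}"
  show ?thesis
  proof (cases "Y = {}")
    case True
    have 0: "indicator I t * deriv H t = 0" for t
    proof (cases "t \<in> {-R..R}")
      case True
      then have "t \<notin> I" using \<open>Y = {}\<close> by (auto simp: Y_def B_def)
      then show ?thesis by simp
    next
      case False
      then show ?thesis using compact_smooth_zero[OF compact_smooth_deriv[OF H]] by simp
    qed
    show ?thesis unfolding 0 by simp
  next
    case False
    define u where "u = Inf Y"
    define v where "v = Sup Y"
    have bd: "bdd_below Y" "bdd_above Y" by (auto simp: Y_def intro: bdd_belowI[of _ "-B"] bdd_aboveI[of _ B])
    have uv: "u \<le> v" unfolding u_def v_def by (rule cInf_le_cSup[OF False bd(2,1)])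
    have "(LINT t|lborel. indicator I t * deriv H t) = H v - H u"
    proof (rule integral_deriv_almost_Icc[OF H uv I(2)])
      fix t assume t: "t \<noteq> u" "t \<noteq> v" "t \<in> {-R..R}"
      then have tB: "t \<in> {-B..B}" by (auto simp: B_def)
      show "t \<in> I \<longleftrightarrow> t \<in> {u..v}"
      proof
        assume "t \<in> I"
        with tB have "t \<in> Y" by (simp add: Y_def)
        then show "t \<in> {u..v}" unfolding u_def v_def using cInf_lower[OF _ bd(1)] cSup_upper[OF _ bd(2)] by auto
      next
        assume "t \<in> {u..v}"
        then have "u < t" "t < v" using t by auto
        then obtain x y where "x \<in> Y" "x < t" "y \<in> Y" "t < y"
          unfolding u_def v_def using cInf_lessD[OF False] less_cSupD[OF False] by metis
        then show "t \<in> I" using I(1) unfolding is_interval_1 Y_def by (meson IntD1 less_imp_le)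
      qed
    qed
    then show ?thesis using b[of v] b[of u] by linarith
  qed
qed

text \<open>\<open>P\<close> bounds the distributional partial derivatives of the function \<open>h(x\<^sub>a, x\<^sub>b)\<close> in the whole plane.\<close>

definition surf :: "2 \<Rightarrow> 2 \<Rightarrow> (real \<Rightarrow> real \<Rightarrow> real) \<Rightarrow> real \<Rightarrow> bool" where
  "surf a b h P \<longleftrightarrow> (\<forall>\<phi>\<in>test_functions UNIV. integrable lborel (pairs_with a b h \<phi>)) \<and>
    (\<forall>\<phi>\<in>test_functions UNIV. (\<forall>x. \<bar>\<phi> x\<bar> \<le> 1) \<longrightarrow> (\<forall>c. \<bar>LINT x|lborel. pairs_with a b h (partial c \<phi>) x\<bar> \<le> P))"

lemma surf_zero: "surf a b (\<lambda>s t. 0) 0"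
  by (simp add: surf_def pairs_with_def[abs_def])

lemma surf_linear:
  assumes 1: "surf a b h P" and 2: "surf a b h' P'"
  shows "surf a b (\<lambda>s t. c * h s t + c' * h' s t) (\<bar>c\<bar> * P + \<bar>c'\<bar> * P')"
proof -
  have eq: "pairs_with a b (\<lambda>s t. c * h s t + c' * h' s t) \<phi> = (\<lambda>x. c * pairs_with a b h \<phi> x + c' * pairs_with a b h' \<phi> x)" for \<phi>
    by (simp add: pairs_with_def fun_eq_iff algebra_simps)
  have i: "integrable lborel (pairs_with a b h \<phi>)" "integrable lborel (pairs_with a b h' \<phi>)" if "\<phi> \<in> test_functions UNIV" for \<phi>
    using 1 2 that unfolding surf_def by blast+
  show ?thesis
    unfolding surf_def eq
  proof (intro conjI ballI impI allI)
    fix \<phi> :: "real ^ 2 \<Rightarrow> real" assume \<phi>: "\<phi> \<in> test_functions UNIV"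
    show "integrable lborel (\<lambda>x. c * pairs_with a b h \<phi> x + c' * pairs_with a b h' \<phi> x)" using i[OF \<phi>] by auto
    fix d assume b: "\<forall>x. \<bar>\<phi> x\<bar> \<le> 1"
    note i' = i[OF test_function_partial[OF \<phi>], of d]
    have "\<bar>LINT x|lborel. pairs_with a b h (partial d \<phi>) x\<bar> \<le> P" "\<bar>LINT x|lborel. pairs_with a b h' (partial d \<phi>) x\<bar> \<le> P'"
      using 1 2 \<phi> b unfolding surf_def by blast+
    then have "\<bar>c\<bar> * \<bar>LINT x|lborel. pairs_with a b h (partial d \<phi>) x\<bar> + \<bar>c'\<bar> * \<bar>LINT x|lborel. pairs_with a b h' (partial d \<phi>) x\<bar> \<le> \<bar>c\<bar> * P + \<bar>c'\<bar> * P'"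
      by (intro add_mono mult_left_mono) auto
    moreover have "(LINT x|lborel. c * pairs_with a b h (partial d \<phi>) x + c' * pairs_with a b h' (partial d \<phi>) x)
      = c * (LINT x|lborel. pairs_with a b h (partial d \<phi>) x) + c' * (LINT x|lborel. pairs_with a b h' (partial d \<phi>) x)"
      using i' by simp
    ultimately show "\<bar>LINT x|lborel. c * pairs_with a b h (partial d \<phi>) x + c' * pairs_with a b h' (partial d \<phi>) x\<bar> \<le> \<bar>c\<bar> * P + \<bar>c'\<bar> * P'"
      using abs_triangle_ineq[of "c * (LINT x|lborel. pairs_with a b h (partial d \<phi>) x)" "c' * (LINT x|lborel. pairs_with a b h' (partial d \<phi>) x)"]
      by (simp add: abs_mult)
  qed
qed

lemma surf_add: "surf a b h P \<Longrightarrow> surf a b h' P' \<Longrightarrow> surf a b (\<lambda>s t. h s t + h' s t) (P + P')"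
  using surf_linear[of a b h P h' P' 1 1] by simp

lemma surf_diff: "surf a b h P \<Longrightarrow> surf a b h' P' \<Longrightarrow> surf a b (\<lambda>s t. h s t - h' s t) (P + P')"
  using surf_linear[of a b h P h' P' 1 "-1"] by simp

lemma surf_sum:
  "(\<And>i. i \<in> I \<Longrightarrow> surf a b (h i) (P i)) \<Longrightarrow> surf a b (\<lambda>s t. \<Sum>i\<in>I. h i s t) (\<Sum>i\<in>I. P i)"
  by (induction I rule: infinite_finite_induct) (auto simp: surf_zero intro: surf_add)

lemma surf_mono: "surf a b h P \<Longrightarrow> P \<le> P' \<Longrightarrow> surf a b h P'"
  unfolding surf_def by (meson order_trans)

lemma sublevel_is_interval:
  fixes \<gamma> :: "real \<Rightarrow> real"
  assumes "mono \<gamma> \<or> antimono \<gamma>" shows "is_interval {t. \<gamma> t < s}"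
  using assms
proof
  assume "mono \<gamma>"
  then show ?thesis unfolding is_interval_1 using monoD le_less_trans by blast
next
  assume "antimono \<gamma>"
  then show ?thesis unfolding is_interval_1 using antimonoD le_less_trans by blast
qed

text \<open>The part of a rectangle on one side of a monotone interface meets each coordinate line in an interval, so
  that its derivatives are bounded by twice the side lengths.\<close>

lemma surf_region:
  assumes ab: "a \<noteq> b" and k: "k > 0" and \<alpha>: "\<alpha> \<le> \<beta>" and I: "I \<in> {{\<alpha><..\<beta>}, {\<alpha>..<\<beta>}}"
    and y: "y0 \<le> y1" and J: "J \<in> {{y0<..y1}, {y0..<y1}, {y0<..<y1}}"
  shows "surf a b (\<lambda>s t. of_bool (s \<in> I \<and> t \<in> J) * of_bool (k * s - A > B * stp ((t - y) / H))) (2 * (\<beta> - \<alpha>) + 2 * (y1 - y0))"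
proof -
  define \<gamma> where "\<gamma> = interface k A B y H"
  note iff = interface_iff[OF k, where A = A and B = B and y = y and H = H, folded \<gamma>_def]
  have mono\<gamma>: "mono \<gamma> \<or> antimono \<gamma>" unfolding \<gamma>_def by (rule interface_mono[OF k])
  have cont\<gamma>: "continuous_on X \<gamma>" for X unfolding \<gamma>_def by (rule smooth_continuous[OF interface_smooth])
  have Im: "I \<in> sets borel" "is_interval I" and Iint: "integrable lborel (indicator I :: real \<Rightarrow> real)" and Ilen: "measure lborel I = \<beta> - \<alpha>"
    using I \<alpha> by (auto simp: is_interval_1)
  have Jm: "J \<in> sets borel" "is_interval J" and Jint: "integrable lborel (indicator J :: real \<Rightarrow> real)" and Jlen: "measure lborel J = y1 - y0"
    using J y by (auto simp: is_interval_1)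
  define X where "X = {x :: real ^ 2. x $ a \<in> I \<and> x $ b \<in> J \<and> \<gamma> (x $ b) < x $ a}"
  have X: "X \<in> sets borel"
  proof -
    have cb: "continuous_on UNIV (\<lambda>x :: real ^ 2. \<gamma> (x $ b))"
      by (rule continuous_on_compose2[OF cont\<gamma>[of UNIV]]) (auto intro!: continuous_intros)
    have "{x :: real ^ 2. \<gamma> (x $ b) < x $ a} \<in> sets borel"
      by (intro borel_open open_Collect_less cb continuous_intros)
    moreover have "{x :: real ^ 2. x $ c \<in> Y} \<in> sets borel" if "Y \<in> sets borel" for Y and c :: 2
      using measurable_sets[of "\<lambda>x :: real ^ 2. x $ c" borel borel Y] that
      by (auto simp: vimage_def intro!: borel_measurable_continuous_onI continuous_intros)
    ultimately have "{x :: real ^ 2. x $ a \<in> I} \<inter> ({x. x $ b \<in> J} \<inter> {x. \<gamma> (x $ b) < x $ a}) \<in> sets borel"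
      using Im(1) Jm(1) by (intro sets.Int) auto
    then show ?thesis by (simp add: X_def Collect_conj_eq)
  qed
  have eq: "pairs_with a b (\<lambda>s t. of_bool (s \<in> I \<and> t \<in> J) * of_bool (k * s - A > B * stp ((t - y) / H))) \<phi> = (\<lambda>x. indicator X x * (1 * \<phi> x))" for \<phi>
    unfolding pairs_with_def iff by (auto simp: X_def fun_eq_iff indicator_def)
  have int: "integrable lborel (\<lambda>x. indicator X x * (1 * \<phi> x))" if "\<phi> \<in> test_functions UNIV" for \<phi>
    by (rule integrable_continuous_test_function[OF continuous_on_const that X])
  show ?thesis
    unfolding surf_def eq
  proof (intro conjI ballI impI allI int)
    fix \<phi> :: "real ^ 2 \<Rightarrow> real" and c :: 2
    assume \<phi>: "\<phi> \<in> test_functions UNIV" and b1: "\<forall>x. \<bar>\<phi> x\<bar> \<le> 1"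
    have i: "integrable lborel (\<lambda>x. indicator X x * (1 * partial c \<phi> x))" by (rule int[OF test_function_partial[OF \<phi>]])
    obtain R where R: "\<And>s t. compact_smooth R (\<lambda>s. \<phi> (mk a s t))" "\<And>s t. compact_smooth R (\<lambda>t. \<phi> (mk a s t))"
      using test_function_section(3)[OF \<phi> ab] by blast
    have d: "deriv (\<lambda>s. \<phi> (mk a s t)) = (\<lambda>s. partial a \<phi> (mk a s t))" "deriv (\<lambda>t. \<phi> (mk a s t)) = (\<lambda>t. partial b \<phi> (mk a s t))" for s t
      using test_function_section(1,2)[OF \<phi> ab, of 1] by (simp_all add: partials_Cons partials_Nil)
    have "c = a \<or> c = b" using UNIV_2_pair[OF ab] by blast
    then have "\<bar>LINT x|lborel. indicator X x * (1 * partial c \<phi> x)\<bar> \<le> max (2 * (y1 - y0)) (2 * (\<beta> - \<alpha>))"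
    proof
      assume c: "c = a"
      have inner: "\<bar>LINT s|lborel. indicator X (mk a s t) * (1 * partial c \<phi> (mk a s t))\<bar> \<le> 2 * indicator J t" for t
      proof (cases "t \<in> J")
        case True
        have "indicator X (mk a s t) = (indicator (I \<inter> {\<gamma> t<..}) s :: real)" for s
          using True ab by (auto simp: X_def indicator_def)
        moreover have "is_interval (I \<inter> {\<gamma> t<..})" by (intro is_interval_Int Im(2)) (auto simp: is_interval_1)
        ultimately show ?thesis
          using integral_deriv_interval_bound[OF R(1)[of t], of "I \<inter> {\<gamma> t<..}"] b1 Im(1) True c by (simp add: d)
      next
        case False
        then have "indicator X (mk a s t) = (0 :: real)" for s using ab by (auto simp: X_def)
        then show ?thesis using False by simp
      qed
      have "\<bar>LINT x|lborel. indicator X x * (1 * partial c \<phi> x)\<bar> = \<bar>LINT t|lborel. LINT s|lborel. indicator X (mk a s t) * (1 * partial c \<phi> (mk a s t))\<bar>"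
        by (rule arg_cong[where f = abs], rule integral_2(1)[OF i])
      also have "\<dots> \<le> (LINT t|lborel. \<bar>LINT s|lborel. indicator X (mk a s t) * (1 * partial c \<phi> (mk a s t))\<bar>)"
        by (rule integral_abs_bound)
      also have "\<dots> \<le> (LINT t|lborel. 2 * indicator J t)"
        by (intro integral_mono inner integrable_abs integral_2(3)[OF i] integrable_mult_right Jint)
      also have "\<dots> = 2 * (y1 - y0)" by (simp add: Jlen)
      finally show ?thesis by simp
    next
      assume c: "c = b"
      have inner: "\<bar>LINT t|lborel. indicator X (mk a s t) * (1 * partial c \<phi> (mk a s t))\<bar> \<le> 2 * indicator I s" for s
      proof (cases "s \<in> I")
        case True
        have "indicator X (mk a s t) = (indicator (J \<inter> {t. \<gamma> t < s}) t :: real)" for t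
          using True ab by (auto simp: X_def indicator_def)
        moreover have "is_interval (J \<inter> {t. \<gamma> t < s})" by (intro is_interval_Int Jm(2) sublevel_is_interval mono\<gamma>)
        moreover have "J \<inter> {t. \<gamma> t < s} \<in> sets borel"
          by (intro sets.Int Jm(1) borel_open open_Collect_less cont\<gamma> continuous_on_const)
        ultimately show ?thesis
          using integral_deriv_interval_bound[OF R(2)[of s], of "J \<inter> {t. \<gamma> t < s}"] b1 True c by (simp add: d)
      next
        case False
        then have "indicator X (mk a s t) = (0 :: real)" for t using ab by (auto simp: X_def)
        then show ?thesis using False by simp
      qed
      have "\<bar>LINT x|lborel. indicator X x * (1 * partial c \<phi> x)\<bar> = \<bar>LINT s|lborel. LINT t|lborel. indicator X (mk a s t) * (1 * partial c \<phi> (mk a s t))\<bar>"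
        by (rule arg_cong[where f = abs], rule integral_2(2)[OF i])
      also have "\<dots> \<le> (LINT s|lborel. \<bar>LINT t|lborel. indicator X (mk a s t) * (1 * partial c \<phi> (mk a s t))\<bar>)"
        by (rule integral_abs_bound)
      also have "\<dots> \<le> (LINT s|lborel. 2 * indicator I s)"
        by (intro integral_mono inner integrable_abs integral_2(4)[OF i] integrable_mult_right Iint)
      also have "\<dots> = 2 * (\<beta> - \<alpha>)" by (simp add: Ilen)
      finally show ?thesis by simp
    qed
    also have "\<dots> \<le> 2 * (\<beta> - \<alpha>) + 2 * (y1 - y0)" using \<alpha> y by simp
    finally show "\<bar>LINT x|lborel. indicator X x * (1 * partial c \<phi> x)\<bar> \<le> 2 * (\<beta> - \<alpha>) + 2 * (y1 - y0)" .
  qed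
qed

section \<open>Sign patterns with vanishing moments\<close>

text \<open>\<open>comb_sum L F\<close> is the integral of \<open>F'\<close>, up to sign, against the Thue-Morse sign pattern on \<open>2\<^sup>L\<close> equal
  subintervals of the unit interval: a sum of the values of \<open>F\<close> at the jumps, weighted with the jumps.\<close>

fun comb_sum :: "nat \<Rightarrow> (real \<Rightarrow> real) \<Rightarrow> real" where
  "comb_sum 0 F = F 0 / 2 - F 1 / 2"
| "comb_sum (Suc L) F = comb_sum L (\<lambda>s. F (s / 2) - F ((s + 1) / 2))"

lemma comb_sum_cong: "(\<And>s. s \<in> {0..1} \<Longrightarrow> F s = G s) \<Longrightarrow> comb_sum L F = comb_sum L G"
proof (induction L arbitrary: F G)
  case (Suc L)
  show ?case unfolding comb_sum.simps
    by (rule Suc.IH) (use Suc.prems in auto)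
qed auto

lemma comb_sum_linear: "comb_sum L (\<lambda>s. c * F s + d * G s) = c * comb_sum L F + d * comb_sum L G"
proof (induction L arbitrary: F G)
  case (Suc L)
  have "comb_sum (Suc L) (\<lambda>s. c * F s + d * G s)
      = comb_sum L (\<lambda>s. c * (F (s / 2) - F ((s + 1) / 2)) + d * (G (s / 2) - G ((s + 1) / 2)))"
    by (simp add: algebra_simps)
  then show ?case by (simp add: Suc)
qed (simp add: algebra_simps diff_divide_distrib add_divide_distrib)

lemma comb_sum_add: "comb_sum L (\<lambda>s. F s + G s) = comb_sum L F + comb_sum L G"
  using comb_sum_linear[of L 1 F 1 G] by simp
lemma comb_sum_diff: "comb_sum L (\<lambda>s. F s - G s) = comb_sum L F - comb_sum L G"
  using comb_sum_linear[of L 1 F "-1" G] by simp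
lemma comb_sum_cmult: "comb_sum L (\<lambda>s. c * F s) = c * comb_sum L F"
  using comb_sum_linear[of L c F 0 F] by simp
lemma comb_sum_zero: "comb_sum L (\<lambda>s. 0) = 0"
  using comb_sum_cmult[of L 0 "\<lambda>s. 0"] by simp
lemma comb_sum_sum: "comb_sum L (\<lambda>s. \<Sum>i\<in>I. F i s) = (\<Sum>i\<in>I. comb_sum L (F i))"
  by (induction I rule: infinite_finite_induct) (auto simp: comb_sum_zero comb_sum_add)

text \<open>Polynomials of degree at most \<open>L\<close> are annihilated.\<close>

lemma comb_sum_power: "k \<le> L \<Longrightarrow> comb_sum L (\<lambda>s. (\<alpha> + \<beta> * s) ^ k) = 0"
proof (induction L arbitrary: k \<alpha> \<beta>)
  case (Suc L)
  have eq: "(\<alpha> + \<beta> * (s / 2)) ^ k - (\<alpha> + \<beta> * ((s + 1) / 2)) ^ k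
      = (\<Sum>j<k. (- (real (k choose j) * (\<beta> / 2) ^ (k - j))) * (\<alpha> + (\<beta> / 2) * s) ^ j)" for s
  proof -
    have "(\<alpha> + \<beta> * ((s + 1) / 2)) ^ k = ((\<alpha> + (\<beta> / 2) * s) + \<beta> / 2) ^ k" by (simp add: field_simps)
    also have "\<dots> = (\<Sum>j\<le>k. real (k choose j) * (\<alpha> + (\<beta> / 2) * s) ^ j * (\<beta> / 2) ^ (k - j))" by (rule binomial_ring)
    also have "\<dots> = (\<Sum>j<k. real (k choose j) * (\<alpha> + (\<beta> / 2) * s) ^ j * (\<beta> / 2) ^ (k - j)) + (\<alpha> + (\<beta> / 2) * s) ^ k"
      by (simp add: lessThan_Suc_atMost[symmetric])
    finally show ?thesis by (simp add: sum_negf[symmetric] mult_ac)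
  qed
  have "comb_sum (Suc L) (\<lambda>s. (\<alpha> + \<beta> * s) ^ k) = (\<Sum>j<k. (- (real (k choose j) * (\<beta> / 2) ^ (k - j))) * comb_sum L (\<lambda>s. (\<alpha> + (\<beta> / 2) * s) ^ j))"
    unfolding comb_sum.simps eq comb_sum_sum comb_sum_cmult ..
  also have "\<dots> = 0"
  proof (intro sum.neutral ballI)
    fix j assume "j \<in> {..<k}"
    then have "j \<le> L" using Suc.prems by simp
    then show "(- (real (k choose j) * (\<beta> / 2) ^ (k - j))) * comb_sum L (\<lambda>s. (\<alpha> + (\<beta> / 2) * s) ^ j) = 0"
      by (simp only: Suc.IH mult_zero_right)
  qed
  finally show ?case .
qed simp

lemma comb_sum_const: "comb_sum L (\<lambda>s. c) = 0"
  using comb_sum_power[of 0 L] comb_sum_cmult[of L c "\<lambda>s. 1"] by simp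

lemma comb_sum_bound: "(\<And>s. s \<in> {0..1} \<Longrightarrow> \<bar>F s\<bar> \<le> K) \<Longrightarrow> \<bar>comb_sum L F\<bar> \<le> 2 ^ L * K"
proof (induction L arbitrary: F K)
  case 0
  from 0[of 0] 0[of 1] show ?case by simp
next
  case (Suc L)
  have "\<bar>comb_sum L (\<lambda>s. F (s / 2) - F ((s + 1) / 2))\<bar> \<le> 2 ^ L * (2 * K)"
  proof (rule Suc.IH)
    fix s :: real assume "s \<in> {0..1}"
    then show "\<bar>F (s / 2) - F ((s + 1) / 2)\<bar> \<le> 2 * K"
      using Suc.prems[of "s / 2"] Suc.prems[of "(s + 1) / 2"] by auto
  qed
  then show ?case by simp
qed

lemma comb_sum_smooth:
  assumes "\<And>s. smooth (F s)"
  shows "smooth (\<lambda>\<tau>. comb_sum L (\<lambda>s. F s \<tau>))"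
    "(deriv ^^ n) (\<lambda>\<tau>. comb_sum L (\<lambda>s. F s \<tau>)) = (\<lambda>\<tau>. comb_sum L (\<lambda>s. (deriv ^^ n) (F s) \<tau>))"
  using assms
proof (induction L arbitrary: F)
  case 0
  have eq: "(\<lambda>\<tau>. comb_sum 0 (\<lambda>s. F s \<tau>)) = (\<lambda>\<tau>. (1/2) * F 0 \<tau> - (1/2) * F 1 \<tau>)" for F :: "real \<Rightarrow> real \<Rightarrow> real" by simp
  { case 1 then show ?case unfolding eq by (intro smooth_diff smooth_cmult) auto }
  { case 2
    have "(deriv ^^ n) (\<lambda>\<tau>. (1/2) * F 0 \<tau> - (1/2) * F 1 \<tau>) = (\<lambda>\<tau>. (1/2) * (deriv ^^ n) (F 0) \<tau> - (1/2) * (deriv ^^ n) (F 1) \<tau>)"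
      by (simp only: funpow_deriv_diff[OF smooth_cmult[OF 2] smooth_cmult[OF 2]] funpow_deriv_cmult[OF 2])
    then show ?case unfolding eq by simp }
next
  case (Suc L)
  have sm: "smooth (\<lambda>\<tau>. F (s / 2) \<tau> - F ((s + 1) / 2) \<tau>)" if "\<And>s. smooth (F s)" for s and F :: "real \<Rightarrow> real \<Rightarrow> real"
    by (intro smooth_diff that)
  { case 1 show ?case using Suc.IH(1)[OF sm[OF 1]] by simp }
  { case 2 show ?case using Suc.IH(2)[OF sm[OF 2]] by (simp add: funpow_deriv_diff[OF 2 2]) }
qed

text \<open>The Thue-Morse sign pattern, with values \<open>1/2\<close> and \<open>-1/2\<close> on \<open>(0, 1]\<close> and zero elsewhere.\<close>

definition pattern :: "nat \<Rightarrow> real \<Rightarrow> real" where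
  "pattern L \<xi> = comb_sum L (\<lambda>s. of_bool (\<xi> > s))"

lemma pattern_Suc: "pattern (Suc L) \<xi> = pattern L (2 * \<xi>) - pattern L (2 * \<xi> - 1)"
proof -
  have "(\<xi> > s / 2) = (2 * \<xi> > s)" "(\<xi> > (s + 1) / 2) = (2 * \<xi> - 1 > s)" for s by auto
  then show ?thesis unfolding pattern_def comb_sum.simps comb_sum_diff by simp
qed

lemma pattern_value: "pattern L \<xi> = 0" if "\<xi> \<le> 0 \<or> \<xi> > 1" for L \<xi>
  using that
proof (induction L arbitrary: \<xi>)
  case 0 then show ?case by (auto simp: pattern_def)
next
  case (Suc L) then show ?case by (auto simp: pattern_Suc)
qed

lemma pattern_abs: "\<bar>pattern L \<xi>\<bar> = 1/2" if "0 < \<xi>" "\<xi> \<le> 1" for L \<xi>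
  using that
proof (induction L arbitrary: \<xi>)
  case 0 then show ?case by (auto simp: pattern_def)
next
  case (Suc L)
  show ?case
  proof (cases "\<xi> \<le> 1/2")
    case True
    then show ?thesis using Suc.IH[of "2 * \<xi>"] Suc.prems pattern_value[of "2 * \<xi> - 1" L] by (simp add: pattern_Suc)
  next
    case False
    then show ?thesis using Suc.IH[of "2 * \<xi> - 1"] Suc.prems pattern_value[of "2 * \<xi>" L] by (simp add: pattern_Suc)
  qed
qed

section \<open>Branching cells\<close>

text \<open>At \<open>\<sigma> = 0\<close> one pattern fills the unit interval. As \<open>\<sigma>\<close> grows to \<open>1\<close> a second scaled copy grows on \<open>[0, \<sigma>/2]\<close> while the
  first one shrinks to \<open>[\<sigma>/2, 1]\<close>. In the closing cell the pattern shrinks to \<open>[0, 1 - \<sigma>]\<close>.\<close>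

definition cellp :: "nat \<Rightarrow> real \<Rightarrow> real \<Rightarrow> real" where
  "cellp L \<xi> \<sigma> = comb_sum L (\<lambda>s. of_bool (\<xi> - 0 > (s / 2) * \<sigma>) + of_bool (\<xi> - s > ((1 - s) / 2) * \<sigma>))"

text \<open>The corresponding correctors, which superpose the correctors of the single interfaces; \<open>\<sigma> = stp \<tau>\<close>.\<close>

definition cellq :: "nat \<Rightarrow> real \<Rightarrow> real \<Rightarrow> real" where
  "cellq L \<xi> \<tau> = comb_sum L (\<lambda>s. of_bool (\<xi> - 0 > (s / 2) * stp \<tau>) * profile_deriv L (\<xi> - 0) (s / 2) \<tau>
     + of_bool (\<xi> - s > ((1 - s) / 2) * stp \<tau>) * profile_deriv L (\<xi> - s) ((1 - s) / 2) \<tau>)"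

definition endp :: "nat \<Rightarrow> real \<Rightarrow> real \<Rightarrow> real" where
  "endp L \<xi> \<sigma> = comb_sum L (\<lambda>s. of_bool (\<xi> - s > (- s) * \<sigma>))"

definition endq :: "nat \<Rightarrow> real \<Rightarrow> real \<Rightarrow> real" where
  "endq L \<xi> \<tau> = comb_sum L (\<lambda>s. of_bool (\<xi> - s > (- s) * stp \<tau>) * profile_deriv L (\<xi> - s) (- s) \<tau>)"

lemma comb_sum_of_bool_scaled:
  assumes "w > 0" shows "comb_sum L (\<lambda>s. of_bool (\<xi> > s * w)) = pattern L (\<xi> / w)"
proof -
  have "(\<xi> > s * w) = (\<xi> / w > s)" for s using assms by (simp add: field_simps)
  then show ?thesis by (simp add: pattern_def)
qed

lemma cellp_eq:
  assumes "0 \<le> \<sigma>" "\<sigma> \<le> 1"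
  shows "cellp L \<xi> \<sigma> = (if \<sigma> > 0 then pattern L (\<xi> / (\<sigma> / 2)) else 0) + pattern L ((\<xi> - \<sigma> / 2) / (1 - \<sigma> / 2))"
proof -
  have 1: "comb_sum L (\<lambda>s. of_bool (\<xi> - 0 > (s / 2) * \<sigma>)) = (if \<sigma> > 0 then pattern L (\<xi> / (\<sigma> / 2)) else 0)"
  proof (cases "\<sigma> > 0")
    case True
    then show ?thesis using comb_sum_of_bool_scaled[of "\<sigma> / 2" L \<xi>] by simp
  next
    case False
    then show ?thesis using assms comb_sum_const[of L "of_bool (\<xi> > 0)"] by simp
  qed
  have "(\<xi> - s > ((1 - s) / 2) * \<sigma>) = (\<xi> - \<sigma> / 2 > s * (1 - \<sigma> / 2))" for s
  proof -
    have "((1 - s) / 2) * \<sigma> = \<sigma> / 2 - s * (\<sigma> / 2)" "s * (1 - \<sigma> / 2) = s - s * (\<sigma> / 2)"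
      by (simp_all add: diff_divide_distrib left_diff_distrib right_diff_distrib)
    then show ?thesis by auto
  qed
  then have 2: "comb_sum L (\<lambda>s. of_bool (\<xi> - s > ((1 - s) / 2) * \<sigma>)) = pattern L ((\<xi> - \<sigma> / 2) / (1 - \<sigma> / 2))"
    using comb_sum_of_bool_scaled[of "1 - \<sigma> / 2" L "\<xi> - \<sigma> / 2"] assms by simp
  show ?thesis unfolding cellp_def comb_sum_add 1 2 ..
qed

lemma cellp_zero: "cellp L \<xi> \<sigma> = 0" if "0 \<le> \<sigma>" "\<sigma> \<le> 1" "\<xi> \<le> 0 \<or> \<xi> > 1"
proof -
  have "\<xi> / (\<sigma> / 2) \<le> 0 \<or> \<xi> / (\<sigma> / 2) > 1" if "\<sigma> > 0"
    using \<open>\<xi> \<le> 0 \<or> \<xi> > 1\<close> that \<open>\<sigma> \<le> 1\<close> by (auto simp: field_simps)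
  moreover have "(\<xi> - \<sigma> / 2) / (1 - \<sigma> / 2) \<le> 0 \<or> (\<xi> - \<sigma> / 2) / (1 - \<sigma> / 2) > 1"
    using that by (auto simp: field_simps)
  ultimately show ?thesis using that by (simp add: cellp_eq pattern_value)
qed

lemma cellp_abs: "\<bar>cellp L \<xi> \<sigma>\<bar> = 1/2" if "0 \<le> \<sigma>" "\<sigma> \<le> 1" "0 < \<xi>" "\<xi> \<le> 1"
proof (cases "\<xi> \<le> \<sigma> / 2")
  case True
  then have "\<bar>pattern L (\<xi> / (\<sigma> / 2))\<bar> = 1/2" using that by (intro pattern_abs) (auto simp: field_simps)
  moreover have "pattern L ((\<xi> - \<sigma> / 2) / (1 - \<sigma> / 2)) = 0" using True that by (intro pattern_value) (auto simp: field_simps)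
  moreover have "\<sigma> > 0" using True that by simp
  ultimately show ?thesis using that by (simp add: cellp_eq)
next
  case False
  then have "\<bar>pattern L ((\<xi> - \<sigma> / 2) / (1 - \<sigma> / 2))\<bar> = 1/2" using that by (intro pattern_abs) (auto simp: field_simps)
  moreover have "(if \<sigma> > 0 then pattern L (\<xi> / (\<sigma> / 2)) else 0) = 0" using False by (auto intro!: pattern_value simp: field_simps)
  ultimately show ?thesis unfolding cellp_eq[OF that(1,2)] by simp
qed

lemma cellp_0: "cellp L \<xi> 0 = pattern L \<xi>"
  by (simp add: cellp_eq)

lemma cellp_1: "cellp L \<xi> 1 = pattern L (2 * \<xi>) + pattern L (2 * \<xi> - 1)"
proof -
  have "(\<xi> - 1 / 2) / (1 - 1 / 2) = 2 * \<xi> - 1" "\<xi> / (1 / 2) = 2 * \<xi>" by (simp_all add: field_simps)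
  then show ?thesis by (simp add: cellp_eq mult.commute)
qed

lemma endp_eq:
  assumes "0 \<le> \<sigma>" "\<sigma> \<le> 1"
  shows "endp L \<xi> \<sigma> = (if \<sigma> < 1 then pattern L (\<xi> / (1 - \<sigma>)) else 0)"
proof -
  have eq: "(\<xi> - s > (- s) * \<sigma>) = (\<xi> > s * (1 - \<sigma>))" for s by (simp add: algebra_simps)
  show ?thesis
  proof (cases "\<sigma> < 1")
    case True
    then show ?thesis unfolding endp_def eq using comb_sum_of_bool_scaled[of "1 - \<sigma>" L \<xi>] by simp
  next
    case False
    then show ?thesis unfolding endp_def eq using assms comb_sum_const[of L "of_bool (\<xi> > 0)"] by simp
  qed
qed

lemma endp_0: "endp L \<xi> 0 = pattern L \<xi>" and endp_1: "endp L \<xi> 1 = 0"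
  by (simp_all add: endp_eq)

lemma endp_zero: "endp L \<xi> \<sigma> = 0" if "0 \<le> \<sigma>" "\<sigma> \<le> 1" "\<xi> \<le> 0 \<or> \<xi> > 1"
  using that by (auto simp: endp_eq field_simps intro!: pattern_value)

lemma endp_abs: "\<bar>endp L \<xi> \<sigma>\<bar> \<le> 1/2" if "0 \<le> \<sigma>" "\<sigma> \<le> 1"
proof -
  have "\<bar>pattern L x\<bar> \<le> 1/2" for x
    using pattern_value[of x L] pattern_abs[of x L] by (cases "0 < x \<and> x \<le> 1") auto
  then show ?thesis using that by (simp add: endp_eq)
qed

text \<open>Outside of the cell the corrector vanishes because the pattern annihilates polynomials.\<close>

lemma profile_deriv_comb:
  assumes "\<And>s \<tau>. u s - v s * stp \<tau> = \<alpha> \<tau> + \<beta> \<tau> * s"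
  shows "comb_sum L (\<lambda>s. profile_deriv L (u s) (v s) \<tau>) = 0"
proof -
  have "comb_sum L (\<lambda>s. profile L (u s) (v s) \<tau>) = 0" for \<tau>
  proof -
    have "profile L (u s) (v s) \<tau> = (1 / fact L) * (\<alpha> \<tau> + \<beta> \<tau> * s) ^ L" for s by (simp add: profile_def assms)
    then show ?thesis by (simp only: comb_sum_cmult comb_sum_power[OF order_refl] mult_zero_right)
  qed
  then have "(deriv ^^ L) (\<lambda>\<tau>. comb_sum L (\<lambda>s. profile L (u s) (v s) \<tau>)) \<tau> = 0"
    using funpow_deriv_const0[of L] by simp
  then show ?thesis
    unfolding comb_sum_smooth(2)[OF profile_smooth] by (simp add: profile_deriv_def)
qed

lemma cellq_zero:
  assumes "\<xi> \<le> 0 \<or> \<xi> > 1" shows "cellq L \<xi> \<tau> = 0"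
  using assms
proof
  assume "\<xi> \<le> 0"
  then have "cellq L \<xi> \<tau> = comb_sum L (\<lambda>s. 0)"
    unfolding cellq_def
  proof (intro comb_sum_cong)
    fix s :: real assume s: "s \<in> {0..1}"
    have "s / 2 * stp \<tau> \<ge> 0" "(1 - s) / 2 * stp \<tau> \<ge> 0" using s stp_bounds[of \<tau>] by (auto intro: mult_nonneg_nonneg)
    then have "\<not> (\<xi> - 0 > s / 2 * stp \<tau>)" "\<not> (\<xi> - s > (1 - s) / 2 * stp \<tau>)" using s \<open>\<xi> \<le> 0\<close> by auto
    then show "of_bool (\<xi> - 0 > s / 2 * stp \<tau>) * profile_deriv L (\<xi> - 0) (s / 2) \<tau>
     + of_bool (\<xi> - s > (1 - s) / 2 * stp \<tau>) * profile_deriv L (\<xi> - s) ((1 - s) / 2) \<tau> = 0" by simp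
  qed
  then show ?thesis by (simp add: comb_sum_zero)
next
  assume \<xi>: "\<xi> > 1"
  have "cellq L \<xi> \<tau> = comb_sum L (\<lambda>s. profile_deriv L (\<xi> - 0) (s / 2) \<tau> + profile_deriv L (\<xi> - s) ((1 - s) / 2) \<tau>)"
    unfolding cellq_def
  proof (intro comb_sum_cong)
    fix s :: real assume s: "s \<in> {0..1}"
    have "s / 2 * stp \<tau> \<le> s / 2 * 1" "(1 - s) / 2 * stp \<tau> \<le> (1 - s) / 2 * 1"
      using s mult_left_mono[OF stp_bounds(2)[of \<tau>], of "s / 2"] mult_left_mono[OF stp_bounds(2)[of \<tau>], of "(1 - s) / 2"] by simp_all
    then have "\<xi> - 0 > s / 2 * stp \<tau>" "\<xi> - s > (1 - s) / 2 * stp \<tau>" using s \<xi> by auto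
    then show "of_bool (\<xi> - 0 > s / 2 * stp \<tau>) * profile_deriv L (\<xi> - 0) (s / 2) \<tau>
     + of_bool (\<xi> - s > (1 - s) / 2 * stp \<tau>) * profile_deriv L (\<xi> - s) ((1 - s) / 2) \<tau>
     = profile_deriv L (\<xi> - 0) (s / 2) \<tau> + profile_deriv L (\<xi> - s) ((1 - s) / 2) \<tau>" by simp
  qed
  also have "\<dots> = 0"
  proof -
    have "\<xi> - s - ((1 - s) / 2) * stp \<tau> = (\<xi> - stp \<tau> / 2) + (stp \<tau> / 2 - 1) * s" for s \<tau>
      by (simp add: field_simps)
    then have "comb_sum L (\<lambda>s. profile_deriv L (\<xi> - s) ((1 - s) / 2) \<tau>) = 0" by (rule profile_deriv_comb)
    moreover have "\<xi> - 0 - (s / 2) * stp \<tau> = \<xi> + (- stp \<tau> / 2) * s" for s \<tau> by simp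
    then have "comb_sum L (\<lambda>s. profile_deriv L (\<xi> - 0) (s / 2) \<tau>) = 0" by (rule profile_deriv_comb)
    ultimately show ?thesis unfolding comb_sum_add by simp
  qed
  finally show ?thesis .
qed

lemma endq_zero:
  assumes "\<xi> \<le> 0 \<or> \<xi> > 1" shows "endq L \<xi> \<tau> = 0"
  using assms
proof
  assume "\<xi> \<le> 0"
  then have "endq L \<xi> \<tau> = comb_sum L (\<lambda>s. 0)"
    unfolding endq_def
  proof (intro comb_sum_cong)
    fix s :: real assume s: "s \<in> {0..1}"
    have "s * stp \<tau> \<le> s * 1" using s stp_bounds[of \<tau>] by (intro mult_left_mono) auto
    then have "\<not> (\<xi> - s > (- s) * stp \<tau>)" using \<open>\<xi> \<le> 0\<close> by auto
    then show "of_bool (\<xi> - s > (- s) * stp \<tau>) * profile_deriv L (\<xi> - s) (- s) \<tau> = 0" by simp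
  qed
  then show ?thesis by (simp add: comb_sum_zero)
next
  assume \<xi>: "\<xi> > 1"
  have "endq L \<xi> \<tau> = comb_sum L (\<lambda>s. profile_deriv L (\<xi> - s) (- s) \<tau>)"
    unfolding endq_def
  proof (intro comb_sum_cong)
    fix s :: real assume s: "s \<in> {0..1}"
    have "s * stp \<tau> \<ge> 0" using s stp_bounds[of \<tau>] by auto
    then have "\<xi> - s > (- s) * stp \<tau>" using s \<xi> by auto
    then show "of_bool (\<xi> - s > (- s) * stp \<tau>) * profile_deriv L (\<xi> - s) (- s) \<tau> = profile_deriv L (\<xi> - s) (- s) \<tau>" by simp
  qed
  also have "\<dots> = 0"
    by (rule profile_deriv_comb[of _ _ "\<lambda>\<tau>. \<xi>" "\<lambda>\<tau>. stp \<tau> - 1"]) (simp add: algebra_simps)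
  finally show ?thesis .
qed

lemma cellq_stationary: "L \<ge> 1 \<Longrightarrow> \<tau> \<notin> {1/3..2/3} \<Longrightarrow> cellq L \<xi> \<tau> = 0" "L \<ge> 1 \<Longrightarrow> \<tau> \<notin> {1/3..2/3} \<Longrightarrow> endq L \<xi> \<tau> = 0"
  unfolding cellq_def endq_def by (simp_all add: profile_deriv_zero comb_sum_zero)

lemma cellq_bounded:
  assumes "L \<ge> 1"
  obtains K where "K \<ge> 0" "\<And>\<xi> \<tau>. \<bar>cellq L \<xi> \<tau>\<bar> \<le> K" "\<And>\<xi> \<tau>. \<bar>endq L \<xi> \<tau>\<bar> \<le> K"
proof -
  obtain C where C: "C \<ge> 0" "\<And>\<xi> B \<tau>. \<bar>\<xi>\<bar> \<le> 1 \<Longrightarrow> \<bar>B\<bar> \<le> 1 \<Longrightarrow> \<bar>profile_deriv L \<xi> B \<tau>\<bar> \<le> C"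
    using profile_deriv_bounded[OF assms] by metis
  have ob: "\<bar>of_bool P * x\<bar> \<le> C" if "\<bar>x\<bar> \<le> C" for P and x :: real using that C(1) by (cases P) auto
  have c: "\<bar>cellq L \<xi> \<tau>\<bar> \<le> 2 ^ L * (2 * C)" for \<xi> \<tau>
  proof (cases "0 < \<xi> \<and> \<xi> \<le> 1")
    case True
    show ?thesis unfolding cellq_def
    proof (rule comb_sum_bound)
      fix s :: real assume s: "s \<in> {0..1}"
      have "\<bar>of_bool (\<xi> - 0 > (s / 2) * stp \<tau>) * profile_deriv L (\<xi> - 0) (s / 2) \<tau>\<bar> \<le> C"
        by (intro ob C(2)) (use s True in \<open>auto simp: abs_le_iff\<close>)
      moreover have "\<bar>of_bool (\<xi> - s > ((1 - s) / 2) * stp \<tau>) * profile_deriv L (\<xi> - s) ((1 - s) / 2) \<tau>\<bar> \<le> C"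
        by (intro ob C(2)) (use s True in \<open>auto simp: abs_le_iff\<close>)
      ultimately show "\<bar>of_bool (\<xi> - 0 > (s / 2) * stp \<tau>) * profile_deriv L (\<xi> - 0) (s / 2) \<tau>
        + of_bool (\<xi> - s > ((1 - s) / 2) * stp \<tau>) * profile_deriv L (\<xi> - s) ((1 - s) / 2) \<tau>\<bar> \<le> 2 * C"
        by linarith
    qed
  next
    case False
    then show ?thesis using cellq_zero[of \<xi> L \<tau>] C(1) by auto
  qed
  have e: "\<bar>endq L \<xi> \<tau>\<bar> \<le> 2 ^ L * (2 * C)" for \<xi> \<tau>
  proof (cases "0 < \<xi> \<and> \<xi> \<le> 1")
    case True
    show ?thesis unfolding endq_def
    proof (rule comb_sum_bound)
      fix s :: real assume s: "s \<in> {0..1}"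
      have "\<bar>of_bool (\<xi> - s > (- s) * stp \<tau>) * profile_deriv L (\<xi> - s) (- s) \<tau>\<bar> \<le> C"
        by (intro ob C(2)) (use s True in \<open>auto simp: abs_le_iff\<close>)
      then show "\<bar>of_bool (\<xi> - s > (- s) * stp \<tau>) * profile_deriv L (\<xi> - s) (- s) \<tau>\<bar> \<le> 2 * C" using C(1) by linarith
    qed
  next
    case False
    then show ?thesis using endq_zero[of \<xi> L \<tau>] C(1) by auto
  qed
  show ?thesis by (rule that[of "2 ^ L * (2 * C)"]) (use C c e in auto)
qed

section \<open>Rows of cells\<close>

lemma compat_comb_sum:
  assumes "\<And>r. compat L a b (P r) (Q r)"
  shows "compat L a b (\<lambda>s t. comb_sum K (\<lambda>r. P r s t)) (\<lambda>s t. comb_sum K (\<lambda>r. Q r s t))"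
  using assms
proof (induction K arbitrary: P Q)
  case 0
  then show ?case using compat_linear[OF 0[of 0] 0[of 1], of "1/2" "-1/2"] by simp
next
  case (Suc K)
  show ?case unfolding comb_sum.simps
    by (rule Suc.IH[where P = "\<lambda>r s t. P (r / 2) s t - P ((r + 1) / 2) s t" and Q = "\<lambda>r s t. Q (r / 2) s t - Q ((r + 1) / 2) s t"])
       (intro compat_diff Suc.prems)
qed

lemma surf_comb_sum:
  assumes "\<And>r. surf a b (P r) B"
  shows "surf a b (\<lambda>s t. comb_sum K (\<lambda>r. P r s t)) (2 ^ K * B)"
  using assms
proof (induction K arbitrary: P B)
  case 0
  then show ?case using surf_linear[OF 0[of 0] 0[of 1], of "1/2" "-1/2"] by simp
next
  case (Suc K)
  have "surf a b (\<lambda>s t. comb_sum K (\<lambda>r. P (r / 2) s t - P ((r + 1) / 2) s t)) (2 ^ K * (B + B))"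
    by (rule Suc.IH[where P = "\<lambda>r s t. P (r / 2) s t - P ((r + 1) / 2) s t"]) (intro surf_diff Suc.prems)
  then show ?case by (simp add: algebra_simps)
qed

text \<open>\<open>2\<^sup>k\<close> scaled copies of the function \<open>g\<close> on the unit interval, side by side.\<close>

definition row :: "(real \<Rightarrow> real) \<Rightarrow> nat \<Rightarrow> real \<Rightarrow> real" where
  "row g k s = (\<Sum>j<2 ^ k. g (2 ^ k * s - real j))"

lemma row_outside:
  assumes "\<And>\<xi>. \<xi> \<le> 0 \<or> \<xi> > 1 \<Longrightarrow> g \<xi> = 0" "s \<le> 0 \<or> s > 1"
  shows "row g k s = 0"
proof -
  have "g (2 ^ k * s - real j) = 0" if "j < 2 ^ k" for j
  proof (rule assms(1))
    have j: "real j + 1 \<le> 2 ^ k"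
      using that by (metis Suc_leI of_nat_Suc of_nat_le_iff of_nat_numeral of_nat_power add.commute)
    show "2 ^ k * s - real j \<le> 0 \<or> 2 ^ k * s - real j > 1"
      using assms(2)
    proof
      assume "s \<le> 0"
      then have "2 ^ k * s \<le> 0" by (simp add: mult_nonneg_nonpos)
      then show ?thesis by simp
    next
      assume "s > 1"
      then have "2 ^ k * s > 2 ^ k" by simp
      then show ?thesis using j by linarith
    qed
  qed
  then show ?thesis by (simp add: row_def)
qed

lemma row_inside:
  assumes g: "\<And>\<xi>. \<xi> \<le> 0 \<or> \<xi> > 1 \<Longrightarrow> g \<xi> = 0" and s: "0 < s" "s \<le> 1"
  obtains j where "j < 2 ^ k" "0 < 2 ^ k * s - real j" "2 ^ k * s - real j \<le> 1" "row g k s = g (2 ^ k * s - real j)"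
proof -
  define c where "c = \<lceil>2 ^ k * s\<rceil>"
  define j where "j = nat (c - 1)"
  have "0 < 2 ^ k * s" using s by simp
  then have c1: "c \<ge> 1" unfolding c_def by linarith
  then have j: "real j = real_of_int c - 1" by (simp add: j_def)
  have le: "2 ^ k * s \<le> 2 ^ k" using s by simp
  then have "c \<le> 2 ^ k" unfolding c_def by (simp add: ceiling_le_iff)
  then have jk: "j < 2 ^ k" using c1 by (simp add: j_def nat_less_iff)
  have b: "0 < 2 ^ k * s - real j" "2 ^ k * s - real j \<le> 1" unfolding j c_def by linarith+
  have z: "g (2 ^ k * s - real i) = 0" if "i \<noteq> j" for i
  proof (rule g)
    have "real i \<ge> real j + 1 \<or> real i \<le> real j - 1" using that by linarith
    then show "2 ^ k * s - real i \<le> 0 \<or> 2 ^ k * s - real i > 1" using b by auto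
  qed
  have "row g k s = (\<Sum>i<2 ^ k. if i = j then g (2 ^ k * s - real j) else 0)"
    unfolding row_def by (intro sum.cong refl) (simp add: z)
  also have "\<dots> = g (2 ^ k * s - real j)" using jk by (simp add: sum.delta)
  finally show ?thesis using that jk b by blast
qed

lemma row_abs_le:
  assumes g: "\<And>\<xi>. \<xi> \<le> 0 \<or> \<xi> > 1 \<Longrightarrow> g \<xi> = 0" and K: "\<And>\<xi>. \<bar>g \<xi>\<bar> \<le> K"
  shows "\<bar>row g k s\<bar> \<le> K"
proof (cases "0 < s \<and> s \<le> 1")
  case True
  then have s: "0 < s" "s \<le> 1" by auto
  obtain j where "row g k s = g (2 ^ k * s - real j)" by (rule row_inside[where g = g and k = k and s = s, OF g s])
  then show ?thesis using K by simp
next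
  case False
  then have "s \<le> 0 \<or> s > 1" by auto
  then have "row g k s = 0" by (intro row_outside g)
  then show ?thesis using K[of 0] by simp
qed

lemma row_abs_eq:
  assumes g: "\<And>\<xi>. \<xi> \<le> 0 \<or> \<xi> > 1 \<Longrightarrow> g \<xi> = 0" and c: "\<And>\<xi>. 0 < \<xi> \<Longrightarrow> \<xi> \<le> 1 \<Longrightarrow> \<bar>g \<xi>\<bar> = c" and s: "0 < s" "s \<le> 1"
  shows "\<bar>row g k s\<bar> = c"
proof -
  obtain j where "0 < 2 ^ k * s - real j" "2 ^ k * s - real j \<le> 1" "row g k s = g (2 ^ k * s - real j)"
    by (rule row_inside[where g = g and k = k and s = s, OF g s])
  then show ?thesis using c by simp
qed

lemma sum_even_odd: "(\<Sum>j<2 * n. f j) = (\<Sum>j<n. f (2 * j) + f (2 * j + 1 :: nat) :: real)"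
  by (induction n) (auto simp: algebra_simps)

lemma row_double: "row (\<lambda>\<xi>. g (2 * \<xi>) + g (2 * \<xi> - 1)) k s = row g (Suc k) s"
  unfolding row_def power_Suc sum_even_odd by (intro sum.cong refl) (simp add: algebra_simps)

lemma profile_deriv_0: "L \<ge> 1 \<Longrightarrow> profile_deriv L \<xi> 0 \<tau> = 0"
  unfolding profile_deriv_def
  by (rule funpow_deriv_locally_const[OF profile_smooth open_UNIV, of L \<xi> 0 "\<xi> ^ L / fact L"]) (auto simp: profile_def)

lemma compat_row_pattern:
  assumes ab: "a \<noteq> b" and L: "L \<ge> 1"
  shows "compat L a b (\<lambda>s t. row (pattern K) k s) (\<lambda>s t. 0)"
proof -
  have "compat L a b (\<lambda>s t. comb_sum K (\<lambda>r. of_bool (2 ^ k * s - real j > r))) (\<lambda>s t. comb_sum K (\<lambda>r. 0))" for j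
  proof (rule compat_comb_sum)
    fix r :: real
    have "(2 ^ k * s - (real j + r) > 0) = (2 ^ k * s - real j > r)" for s by auto
    then show "compat L a b (\<lambda>s t. of_bool (2 ^ k * s - real j > r)) (\<lambda>s t. 0)"
      using compat_interface[OF ab, where k = "2 ^ k" and H = 1 and L = L and A = "real j + r" and B = 0 and y = 0] by (simp add: profile_deriv_0[OF L])
  qed
  then have "compat L a b (\<lambda>s t. pattern K (2 ^ k * s - real j)) (\<lambda>s t. 0)" for j
    by (simp add: pattern_def comb_sum_zero)
  from compat_sum[where I = "{..<2 ^ k}", OF this] show ?thesis by (simp add: row_def)
qed

lemma compat_interface_scaled:
  assumes ab: "a \<noteq> b" and H: "H \<noteq> 0"
  shows "compat L a b (\<lambda>s t. of_bool (2 ^ k * s - real j - r > B * stp ((t - y) / H)))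
    (\<lambda>s t. (1 / (2 ^ k * H)) ^ L * (of_bool (2 ^ k * s - real j - r > B * stp ((t - y) / H)) * profile_deriv L (2 ^ k * s - real j - r) B ((t - y) / H)))"
proof -
  have eq: "2 ^ k * s - (real j + r) = 2 ^ k * s - real j - r" for s by simp
  show ?thesis using compat_interface[OF ab _ H, where k = "2 ^ k" and L = L and A = "real j + r" and B = B and y = y]
    unfolding eq by (simp add: mult_ac)
qed

lemma compat_row_cell:
  assumes ab: "a \<noteq> b" and H: "H \<noteq> 0"
  shows "compat L a b (\<lambda>s t. row (\<lambda>\<xi>. cellp L \<xi> (stp ((t - y) / H))) k s)
    (\<lambda>s t. (1 / (2 ^ k * H)) ^ L * row (\<lambda>\<xi>. cellq L \<xi> ((t - y) / H)) k s)"
proof -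
  note c = compat_comb_sum[OF compat_add[OF compat_interface_scaled[OF ab H, where r = 0 and k = k and y = y and L = L]
     compat_interface_scaled[OF ab H, where k = k and y = y and L = L]]]
  show ?thesis
    unfolding cellp_def cellq_def row_def sum_distrib_left comb_sum_cmult[symmetric] distrib_left
    by (intro compat_sum c)
qed

lemma compat_row_end:
  assumes ab: "a \<noteq> b" and H: "H \<noteq> 0"
  shows "compat L a b (\<lambda>s t. row (\<lambda>\<xi>. endp L \<xi> (stp ((t - y) / H))) k s)
    (\<lambda>s t. (1 / (2 ^ k * H)) ^ L * row (\<lambda>\<xi>. endq L \<xi> ((t - y) / H)) k s)"
proof -
  note c = compat_comb_sum[OF compat_interface_scaled[OF ab H, where k = k and y = y and L = L]]
  show ?thesis
    unfolding endp_def endq_def row_def sum_distrib_left comb_sum_cmult[symmetric]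
    by (intro compat_sum c)
qed

section \<open>The branching construction\<close>

text \<open>The strips between the heights \<open>1 - \<theta>\<^sup>n / 2\<close> for \<open>n \<le> N\<close>, and a last one reaching up to \<open>1\<close>.\<close>

definition strip_y :: "real \<Rightarrow> nat \<Rightarrow> real" where
  "strip_y \<theta> n = 1 - \<theta> ^ n / 2"

definition strip_h :: "real \<Rightarrow> nat \<Rightarrow> nat \<Rightarrow> real" where
  "strip_h \<theta> N n = (if n < N then (1 - \<theta>) * \<theta> ^ n / 2 else \<theta> ^ n / 2)"

lemma strip_h_pos: "0 < \<theta> \<Longrightarrow> \<theta> < 1 \<Longrightarrow> strip_h \<theta> N n > 0"
  by (simp add: strip_h_def)

lemma strip_end: "n < N \<Longrightarrow> strip_y \<theta> n + strip_h \<theta> N n = strip_y \<theta> (Suc n)" "strip_y \<theta> N + strip_h \<theta> N N = 1"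
  by (simp_all add: strip_y_def strip_h_def field_simps)

lemma strip_y_0: "strip_y \<theta> 0 = 1/2" by (simp add: strip_y_def)

lemma strip_y_mono: "0 < \<theta> \<Longrightarrow> \<theta> < 1 \<Longrightarrow> i \<le> j \<Longrightarrow> strip_y \<theta> i \<le> strip_y \<theta> j"
  by (simp add: strip_y_def power_decreasing)

lemma strip_y_less_1: "0 < \<theta> \<Longrightarrow> strip_y \<theta> i < 1"
  by (simp add: strip_y_def)

lemma strip_end_le:
  assumes "0 < \<theta>" "\<theta> < 1" "i < n" "n \<le> N" shows "strip_y \<theta> i + strip_h \<theta> N i \<le> strip_y \<theta> n"
  using assms strip_end(1)[of i N \<theta>] strip_y_mono[of \<theta> "Suc i" n] by simp

lemma strip_exists:
  assumes "0 < \<theta>" "\<theta> < 1" "1/2 \<le> t" "t < 1"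
  obtains n where "n \<le> N" "strip_y \<theta> n \<le> t" "t < strip_y \<theta> n + strip_h \<theta> N n"
proof -
  define S where "S = {n. n \<le> N \<and> strip_y \<theta> n \<le> t}"
  have S: "finite S" "0 \<in> S" using assms by (auto simp: S_def strip_y_0)
  define n where "n = Max S"
  have n: "n \<in> S" unfolding n_def using S Max_in by blast
  have "t < strip_y \<theta> n + strip_h \<theta> N n"
  proof (cases "n < N")
    case True
    have "Suc n \<notin> S" using Max_ge[OF S(1), of "Suc n"] by (auto simp: n_def)
    then show ?thesis using True by (simp add: S_def strip_end)
  next
    case False
    then have "n = N" using n by (simp add: S_def)
    then show ?thesis using assms strip_end(2)[of \<theta> N] by simp
  qed
  then show ?thesis using that n by (auto simp: S_def)
qed

text \<open>The cells branch in the strips of index \<open>n < N\<close> and close in the strip of index \<open>N\<close>.\<close>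

definition strip_cellp :: "nat \<Rightarrow> nat \<Rightarrow> nat \<Rightarrow> real \<Rightarrow> real \<Rightarrow> real" where
  "strip_cellp L N n = (if n < N then cellp L else endp L)"

definition strip_cellq :: "nat \<Rightarrow> nat \<Rightarrow> nat \<Rightarrow> real \<Rightarrow> real \<Rightarrow> real" where
  "strip_cellq L N n = (if n < N then cellq L else endq L)"

text \<open>The rescaled height in the strip \<open>n\<close>, and the rows of \<open>2\<^bsup>M+n\<^esup>\<close> cells in that strip with their correctors.\<close>

abbreviation strip_time :: "real \<Rightarrow> nat \<Rightarrow> nat \<Rightarrow> real \<Rightarrow> real" where
  "strip_time \<theta> N n t \<equiv> (t - strip_y \<theta> n) / strip_h \<theta> N n"

abbreviation strip_p :: "nat \<Rightarrow> real \<Rightarrow> nat \<Rightarrow> nat \<Rightarrow> nat \<Rightarrow> real \<Rightarrow> real \<Rightarrow> real" where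
  "strip_p L \<theta> M N n s t \<equiv> row (\<lambda>\<xi>. strip_cellp L N n \<xi> (stp (strip_time \<theta> N n t))) (M + n) s"

abbreviation strip_q :: "nat \<Rightarrow> real \<Rightarrow> nat \<Rightarrow> nat \<Rightarrow> nat \<Rightarrow> real \<Rightarrow> real \<Rightarrow> real" where
  "strip_q L \<theta> M N n s t \<equiv> (1 / (2 ^ (M + n) * strip_h \<theta> N n)) ^ L * row (\<lambda>\<xi>. strip_cellq L N n \<xi> (strip_time \<theta> N n t)) (M + n) s"

text \<open>The superposition of all rows. A row that has finished branching cancels with the start of the next one, so
  only the row of the current strip survives. Below the height \<open>1/2\<close> only the unbranched pattern is left.\<close>

definition half_p :: "nat \<Rightarrow> real \<Rightarrow> nat \<Rightarrow> nat \<Rightarrow> real \<Rightarrow> real \<Rightarrow> real" where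
  "half_p L \<theta> M N s t = row (pattern L) M s + (\<Sum>n\<le>N.
     strip_p L \<theta> M N n s t - row (pattern L) (M + n) s)"

definition half_q :: "nat \<Rightarrow> real \<Rightarrow> nat \<Rightarrow> nat \<Rightarrow> real \<Rightarrow> real \<Rightarrow> real" where
  "half_q L \<theta> M N s t = (\<Sum>n\<le>N. strip_q L \<theta> M N n s t)"

text \<open>Branching towards both sides \<open>t = 1\<close> and \<open>t = 0\<close>. The reflection of \<open>t\<close> gives the corrector the sign \<open>(-1)\<^sup>L\<close>.\<close>

definition branch_p :: "nat \<Rightarrow> real \<Rightarrow> nat \<Rightarrow> nat \<Rightarrow> real \<Rightarrow> real \<Rightarrow> real" where
  "branch_p L \<theta> M N s t = half_p L \<theta> M N s t + half_p L \<theta> M N s (1 - t) - row (pattern L) M s"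

definition branch_q :: "nat \<Rightarrow> real \<Rightarrow> nat \<Rightarrow> nat \<Rightarrow> real \<Rightarrow> real \<Rightarrow> real" where
  "branch_q L \<theta> M N s t = half_q L \<theta> M N s t + (-1) ^ L * half_q L \<theta> M N s (1 - t)"

lemma compat_strip:
  assumes ab: "a \<noteq> b" and H: "H \<noteq> 0"
  shows "compat L a b (\<lambda>s t. row (\<lambda>\<xi>. strip_cellp L N n \<xi> (stp ((t - y) / H))) k s)
    (\<lambda>s t. (1 / (2 ^ k * H)) ^ L * row (\<lambda>\<xi>. strip_cellq L N n \<xi> ((t - y) / H)) k s)"
  using compat_row_cell[OF assms, of L y k] compat_row_end[OF assms, of L y k]
  by (simp add: strip_cellp_def strip_cellq_def)

lemma compat_strip_mirrored:
  assumes ab: "a \<noteq> b" and H: "H \<noteq> 0"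
  shows "compat L a b (\<lambda>s t. row (\<lambda>\<xi>. strip_cellp L N n \<xi> (stp ((1 - t - y) / H))) k s)
    (\<lambda>s t. (-1) ^ L * ((1 / (2 ^ k * H)) ^ L * row (\<lambda>\<xi>. strip_cellq L N n \<xi> ((1 - t - y) / H)) k s))"
proof -
  have eq: "(t - (1 - y)) / (- H) = (1 - t - y) / H" for t using H by (simp add: field_simps)
  have "(1 / (2 ^ k * (- H))) ^ L = (- 1) ^ L * (1 / (2 ^ k * H)) ^ L"
    by (simp add: power_mult_distrib[symmetric])
  then show ?thesis using compat_strip[OF ab, of "- H" L N n "1 - y" k] H unfolding eq by (simp add: mult.assoc)
qed

lemma compat_half:
  assumes ab: "a \<noteq> b" and L: "L \<ge> 1" and \<theta>: "0 < \<theta>" "\<theta> < 1"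
  shows "compat L a b (half_p L \<theta> M N) (half_q L \<theta> M N)"
    and "compat L a b (\<lambda>s t. half_p L \<theta> M N s (1 - t)) (\<lambda>s t. (-1) ^ L * half_q L \<theta> M N s (1 - t))"
proof -
  have H: "strip_h \<theta> N n \<noteq> 0" for n using strip_h_pos[OF \<theta>] by (metis less_irrefl)
  have "compat L a b (\<lambda>s t. half_p L \<theta> M N s t) (\<lambda>s t. 0 + (\<Sum>n\<le>N. strip_q L \<theta> M N n s t - 0))"
    unfolding half_p_def by (intro compat_add compat_sum compat_diff compat_row_pattern ab L compat_strip H)
  then show "compat L a b (half_p L \<theta> M N) (half_q L \<theta> M N)" by (simp add: half_q_def[abs_def])
  have "compat L a b (\<lambda>s t. half_p L \<theta> M N s (1 - t)) (\<lambda>s t. 0 + (\<Sum>n\<le>N. (-1) ^ L * (strip_q L \<theta> M N n s (1 - t)) - 0))"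
    unfolding half_p_def by (intro compat_add compat_sum compat_diff compat_row_pattern ab L compat_strip_mirrored H)
  then show "compat L a b (\<lambda>s t. half_p L \<theta> M N s (1 - t)) (\<lambda>s t. (-1) ^ L * half_q L \<theta> M N s (1 - t))"
    by (simp add: half_q_def[abs_def] sum_distrib_left)
qed

lemma compat_branch:
  assumes ab: "a \<noteq> b" and L: "L \<ge> 1" and \<theta>: "0 < \<theta>" "\<theta> < 1"
  shows "compat L a b (branch_p L \<theta> M N) (branch_q L \<theta> M N)"
  using compat_diff[OF compat_add[OF compat_half[OF assms]] compat_row_pattern[OF ab L]]
  by (simp add: branch_p_def[abs_def] branch_q_def[abs_def])

lemma stp_before: "\<tau> \<le> 0 \<Longrightarrow> stp \<tau> = 0" "\<tau> \<le> 0 \<Longrightarrow> \<tau> \<notin> {1/3..2/3}"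
  and stp_after: "\<tau> \<ge> 1 \<Longrightarrow> stp \<tau> = 1" "\<tau> \<ge> 1 \<Longrightarrow> \<tau> \<notin> {1/3..2/3}"
  by (auto intro: stp_0 stp_1)

lemma strip_cell_zero:
  assumes "\<xi> \<le> 0 \<or> \<xi> > 1" shows "strip_cellp L N n \<xi> (stp \<tau>) = 0" "strip_cellq L N n \<xi> \<tau> = 0"
  using cellp_zero[OF stp_bounds assms] endp_zero[OF stp_bounds assms] cellq_zero[OF assms] endq_zero[OF assms]
  by (simp_all add: strip_cellp_def strip_cellq_def)

lemma strip_cellq_stationary: "L \<ge> 1 \<Longrightarrow> \<tau> \<notin> {1/3..2/3} \<Longrightarrow> strip_cellq L N n \<xi> \<tau> = 0"
  unfolding strip_cellq_def using cellq_stationary by metis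

lemma row_cong_zero: "(\<And>\<xi>. g \<xi> = 0) \<Longrightarrow> row g k s = 0"
  by (simp add: row_def)

lemma strip_cellp_at_0: "strip_cellp L N n \<xi> 0 = pattern L \<xi>"
  by (simp add: strip_cellp_def cellp_0 endp_0)

lemma row_strip_cellp_1:
  "row (\<lambda>\<xi>. strip_cellp L N n \<xi> 1) k s = (if n < N then row (pattern L) (Suc k) s else 0)"
  using row_double[of "pattern L" k s] by (simp add: strip_cellp_def cellp_1 endp_1 row_def)

text \<open>At each height only one summand of the telescoping sums is active.\<close>

lemma telescoping_strips:
  fixes r :: "nat \<Rightarrow> real \<Rightarrow> real"
  assumes "n \<le> N" "\<And>i. i < n \<Longrightarrow> r i (\<sigma> i) = R (Suc i)" "\<And>i. n < i \<Longrightarrow> i \<le> N \<Longrightarrow> r i (\<sigma> i) = R i"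
  shows "R 0 + (\<Sum>i\<le>N. r i (\<sigma> i) - R i) = r n (\<sigma> n)"
proof -
  have "(\<Sum>i\<le>N. r i (\<sigma> i) - R i) = (\<Sum>i\<le>n. r i (\<sigma> i) - R i)"
    by (rule sum.mono_neutral_right) (use assms in auto)
  also have "\<dots> = (\<Sum>i<n. R (Suc i) - R i) + (r n (\<sigma> n) - R n)"
    unfolding lessThan_Suc_atMost[symmetric] sum.lessThan_Suc using assms(2) by simp
  also have "(\<Sum>i<n. R (Suc i) - R i) = R n - R 0" by (rule sum_lessThan_telescope)
  finally show ?thesis by simp
qed

lemma half_strip:
  assumes L: "L \<ge> 1" and \<theta>: "0 < \<theta>" "\<theta> < 1" and n: "n \<le> N" and t: "strip_y \<theta> n \<le> t" "t < strip_y \<theta> n + strip_h \<theta> N n"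
  shows "half_p L \<theta> M N s t = strip_p L \<theta> M N n s t"
    and "half_q L \<theta> M N s t = strip_q L \<theta> M N n s t"
proof -
  note h = strip_h_pos[OF \<theta>]
  have 1: "strip_time \<theta> N i t \<ge> 1" if "i < n" for i
    using h[of N i] strip_end_le[OF \<theta> that n] t by (simp add: field_simps)
  have 2: "strip_time \<theta> N i t \<le> 0" if "n < i" "i \<le> N" for i
    using h[of N i] strip_end_le[OF \<theta> that] t by (simp add: field_simps)
  have "row (pattern L) (M + 0) s + (\<Sum>i\<le>N. strip_p L \<theta> M N i s t - row (pattern L) (M + i) s)
      = strip_p L \<theta> M N n s t"
  proof (rule telescoping_strips[where r = "\<lambda>i \<sigma>. row (\<lambda>\<xi>. strip_cellp L N i \<xi> \<sigma>) (M + i) s" and R = "\<lambda>i. row (pattern L) (M + i) s"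
     and \<sigma> = "\<lambda>i. stp (strip_time \<theta> N i t)", OF n])
    fix i assume i: "i < n"
    then have "stp (strip_time \<theta> N i t) = 1" by (intro stp_after 1)
    then show "strip_p L \<theta> M N i s t = row (pattern L) (M + Suc i) s"
      using i n by (simp add: row_strip_cellp_1)
  next
    fix i assume i: "n < i" "i \<le> N"
    then have "stp (strip_time \<theta> N i t) = 0" by (intro stp_before 2)
    then show "strip_p L \<theta> M N i s t = row (pattern L) (M + i) s"
      by (simp add: strip_cellp_at_0)
  qed
  then show "half_p L \<theta> M N s t = strip_p L \<theta> M N n s t"
    by (simp add: half_p_def)
  have z: "strip_cellq L N i \<xi> (strip_time \<theta> N i t) = 0" if "i \<noteq> n" "i \<le> N" for i \<xi>
  proof -
    have "strip_time \<theta> N i t \<notin> {1/3..2/3}" using stp_after(2)[OF 1[of i]] stp_before(2)[OF 2[of i]] that by (cases "i < n") auto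
    then show ?thesis by (rule strip_cellq_stationary[OF L])
  qed
  have "half_q L \<theta> M N s t = (\<Sum>i\<le>N. if i = n then strip_q L \<theta> M N n s t else 0)"
    unfolding half_q_def
  proof (intro sum.cong refl)
    fix i assume "i \<in> {..N}"
    then have "row (\<lambda>\<xi>. strip_cellq L N i \<xi> (strip_time \<theta> N i t)) (M + i) s = 0" if "i \<noteq> n"
      using row_cong_zero[OF z[OF that]] by simp
    then show "strip_q L \<theta> M N i s t
      = (if i = n then strip_q L \<theta> M N n s t else 0)" by simp
  qed
  also have "\<dots> = strip_q L \<theta> M N n s t" using n by (simp add: sum.delta)
  finally show "half_q L \<theta> M N s t = \<dots>" .
qed

lemma half_below:
  assumes L: "L \<ge> 1" and \<theta>: "0 < \<theta>" "\<theta> < 1" and t: "t \<le> 1/2"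
  shows "half_p L \<theta> M N s t = row (pattern L) M s" "half_q L \<theta> M N s t = 0"
proof -
  have 2: "strip_time \<theta> N i t \<le> 0" for i
    using strip_h_pos[OF \<theta>, of N i] strip_y_mono[OF \<theta>, of 0 i] t by (simp add: field_simps strip_y_0)
  have "stp (strip_time \<theta> N i t) = 0" "strip_time \<theta> N i t \<notin> {1/3..2/3}" for i
    by (rule stp_before[OF 2])+
  note st = this
  show "half_p L \<theta> M N s t = row (pattern L) M s"
    unfolding half_p_def st(1) strip_cellp_at_0 by simp
  show "half_q L \<theta> M N s t = 0"
    unfolding half_q_def row_cong_zero[OF strip_cellq_stationary[OF L st(2)]] by simp
qed

lemma half_above:
  assumes L: "L \<ge> 1" and \<theta>: "0 < \<theta>" "\<theta> < 1" and t: "t \<ge> 1"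
  shows "half_p L \<theta> M N s t = 0" "half_q L \<theta> M N s t = 0"
proof -
  have 1: "strip_time \<theta> N i t \<ge> 1" if "i \<le> N" for i
  proof -
    have "strip_y \<theta> i + strip_h \<theta> N i \<le> 1"
      using that strip_end(1)[of i N \<theta>] strip_y_less_1[OF \<theta>(1), of "Suc i"] strip_end(2)[of \<theta> N] by (cases "i < N") auto
    then show ?thesis using strip_h_pos[OF \<theta>, of N i] t by (simp add: field_simps)
  qed
  have s1: "stp (strip_time \<theta> N i t) = 1" and o: "strip_time \<theta> N i t \<notin> {1/3..2/3}" if "i \<le> N" for i
    by (rule stp_after[OF 1[OF that]])+
  have "half_p L \<theta> M N s t = row (\<lambda>\<xi>. strip_cellp L N N \<xi> (stp ((t - strip_y \<theta> N) / strip_h \<theta> N N))) (M + N) s"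
    unfolding half_p_def
    using telescoping_strips[where r = "\<lambda>i \<sigma>. row (\<lambda>\<xi>. strip_cellp L N i \<xi> \<sigma>) (M + i) s" and R = "\<lambda>i. row (pattern L) (M + i) s"
     and \<sigma> = "\<lambda>i. stp (strip_time \<theta> N i t)" and n = N and N = N]
    by (simp add: s1 row_strip_cellp_1)
  then show "half_p L \<theta> M N s t = 0" by (simp add: s1 row_strip_cellp_1)
  show "half_q L \<theta> M N s t = 0"
    unfolding half_q_def
  proof (intro sum.neutral ballI)
    fix i assume "i \<in> {..N}"
    then have i: "i \<le> N" by simp
    show "strip_q L \<theta> M N i s t = 0"
      unfolding row_cong_zero[OF strip_cellq_stationary[OF L o[OF i]]] by simp
  qed
qed

lemma branch_eq:
  assumes L: "L \<ge> 1" and \<theta>: "0 < \<theta>" "\<theta> < 1"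
  shows "branch_p L \<theta> M N s t = half_p L \<theta> M N s (max t (1 - t))"
    and "\<bar>branch_q L \<theta> M N s t\<bar> = \<bar>half_q L \<theta> M N s (max t (1 - t))\<bar>"
proof -
  note b = half_below[OF assms]
  have "branch_p L \<theta> M N s t = half_p L \<theta> M N s (max t (1 - t)) \<and>
    \<bar>branch_q L \<theta> M N s t\<bar> = \<bar>half_q L \<theta> M N s (max t (1 - t))\<bar>"
  proof (cases "t \<le> 1/2")
    case True
    then have "max t (1 - t) = 1 - t" by simp
    show ?thesis unfolding branch_p_def branch_q_def \<open>max t (1 - t) = 1 - t\<close> b[OF True] by (simp add: abs_mult power_abs)
  next
    case False
    then have m: "max t (1 - t) = t" and t: "1 - t \<le> 1/2" by auto
    show ?thesis unfolding branch_p_def branch_q_def m b[OF t] by simp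
  qed
  then show "branch_p L \<theta> M N s t = half_p L \<theta> M N s (max t (1 - t))"
    "\<bar>branch_q L \<theta> M N s t\<bar> = \<bar>half_q L \<theta> M N s (max t (1 - t))\<bar>" by blast+
qed

lemma half_p_outside:
  assumes "s \<le> 0 \<or> s > 1" shows "half_p L \<theta> M N s t = 0" "half_q L \<theta> M N s t = 0"
  by (auto simp: half_p_def half_q_def row_outside[OF strip_cell_zero(1) assms] row_outside[OF strip_cell_zero(2) assms] row_outside[OF pattern_value assms])

lemma branch_outside:
  assumes "L \<ge> 1" "0 < \<theta>" "\<theta> < 1" "s \<le> 0 \<or> s > 1 \<or> t \<le> 0 \<or> t \<ge> 1"
  shows "branch_p L \<theta> M N s t = 0" "branch_q L \<theta> M N s t = 0"
proof -
  have "half_p L \<theta> M N s (max t (1 - t)) = 0 \<and> half_q L \<theta> M N s (max t (1 - t)) = 0"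
  proof (cases "s \<le> 0 \<or> s > 1")
    case True
    then show ?thesis by (intro conjI half_p_outside)
  next
    case False
    then have "max t (1 - t) \<ge> 1" using assms(4) by (auto simp: le_max_iff_disj)
    then show ?thesis by (intro conjI half_above[OF assms(1-3)])
  qed
  then show "branch_p L \<theta> M N s t = 0" "branch_q L \<theta> M N s t = 0"
    using branch_eq[OF assms(1-3), of M N s t] by (simp_all only: abs_zero abs_eq_0)
qed

section \<open>Energy and surface of the branching construction\<close>

text \<open>The phase field: the branching pattern, replaced by a constant phase in the two closing strips.\<close>

definition branch_f :: "nat \<Rightarrow> real \<Rightarrow> nat \<Rightarrow> nat \<Rightarrow> real \<Rightarrow> real \<Rightarrow> real" where
  "branch_f L \<theta> M N s t = (if strip_y \<theta> N \<le> max t (1 - t) then 1/2 else branch_p L \<theta> M N s t)"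

lemma surf_strip:
  assumes ab: "a \<noteq> b" and y: "y0 \<le> y1" and J: "J \<in> {{y0<..y1}, {y0..<y1}, {y0<..<y1}}"
  shows "surf a b (\<lambda>s t. of_bool (s \<in> {0<..1} \<and> t \<in> J) * (row (\<lambda>\<xi>. cellp L \<xi> (stp ((t - c) / H))) k s - 1/2))
    (2 ^ (L + 3) * (1 + 2 ^ k * (y1 - y0)))"
proof -
  define I where "I j = {real j / 2 ^ k<..(real j + 1) / 2 ^ k}" for j
  have I_iff: "s \<in> I j \<longleftrightarrow> 0 < 2 ^ k * s - real j \<and> 2 ^ k * s - real j \<le> 1" for s j
    by (auto simp: I_def field_simps)
  have le: "real j / 2 ^ k \<le> (real j + 1) / 2 ^ k" for j by (simp add: divide_right_mono)
  have len: "(real j + 1) / 2 ^ k - real j / 2 ^ k = 1 / 2 ^ k" for j by (simp add: add_divide_distrib)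
  have Isub: "0 < s \<and> s \<le> 1" if "j < 2 ^ k" "s \<in> I j" for s j
  proof -
    have j: "real j + 1 \<le> 2 ^ k"
      using that(1) by (metis Suc_leI of_nat_Suc of_nat_le_iff of_nat_numeral of_nat_power add.commute)
    have "0 \<le> real j / 2 ^ k" "(real j + 1) / 2 ^ k \<le> 1" using j by (simp_all add: divide_le_eq)
    moreover have "real j / 2 ^ k < s" "s \<le> (real j + 1) / 2 ^ k" using that(2) by (simp_all add: I_def)
    ultimately show ?thesis by linarith
  qed
  define B where "B = 2 * (1 / 2 ^ k) + 2 * (y1 - y0)"
  define B2 where "B2 = B + B"
  have cell: "surf a b (\<lambda>s t. of_bool (s \<in> I j \<and> t \<in> J) * cellp L (2 ^ k * s - real j) (stp ((t - c) / H))) (2 ^ L * B2)" for j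
  proof -
    have reg: "surf a b (\<lambda>s t. of_bool (s \<in> I j \<and> t \<in> J) * of_bool (2 ^ k * s - real j - r > w * stp ((t - c) / H))) B" for r w
    proof -
      have eq: "2 ^ k * s - (real j + r) = 2 ^ k * s - real j - r" for s by simp
      show ?thesis
        using surf_region[OF ab _ le _ y J, where k = "2 ^ k" and I = "I j" and A = "real j + r" and B = w and y = c and H = H, of j]
        unfolding eq len B_def by (simp add: I_def)
    qed
    show ?thesis
      unfolding cellp_def comb_sum_cmult[symmetric] distrib_left
      by (rule surf_comb_sum) (unfold B2_def, intro surf_add reg)
  qed
  have rect: "surf a b (\<lambda>s t. of_bool (s \<in> {0<..1} \<and> t \<in> J) * of_bool (1 * s - (-1) > 0 * stp ((t - c) / H))) (2 * (1 - 0) + 2 * (y1 - y0))"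
    by (rule surf_region[OF ab _ _ _ y J]) auto
  have eq: "of_bool (s \<in> {0<..1} \<and> t \<in> J) * (row (\<lambda>\<xi>. cellp L \<xi> (stp ((t - c) / H))) k s - 1/2)
    = 1 * (\<Sum>j<2 ^ k. of_bool (s \<in> I j \<and> t \<in> J) * cellp L (2 ^ k * s - real j) (stp ((t - c) / H)))
      + (- 1/2) * (of_bool (s \<in> {0<..1} \<and> t \<in> J) * of_bool (1 * s - (-1) > 0 * stp ((t - c) / H)))" for s t
  proof -
    have c: "of_bool (s \<in> {0<..1} \<and> t \<in> J) * cellp L (2 ^ k * s - real j) (stp ((t - c) / H))
      = of_bool (s \<in> I j \<and> t \<in> J) * cellp L (2 ^ k * s - real j) (stp ((t - c) / H))" if "j < 2 ^ k" for j
    proof (cases "s \<in> I j")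
      case True
      then show ?thesis using Isub[OF that True] by simp
    next
      case False
      then have "2 ^ k * s - real j \<le> 0 \<or> 2 ^ k * s - real j > 1" unfolding I_iff by linarith
      then show ?thesis using cellp_zero[OF stp_bounds] by simp
    qed
    have "(\<Sum>j<2 ^ k. of_bool (s \<in> I j \<and> t \<in> J) * cellp L (2 ^ k * s - real j) (stp ((t - c) / H)))
      = of_bool (s \<in> {0<..1} \<and> t \<in> J) * row (\<lambda>\<xi>. cellp L \<xi> (stp ((t - c) / H))) k s"
      unfolding row_def sum_distrib_left by (intro sum.cong refl c[symmetric]) (simp only: lessThan_iff)
    then show ?thesis by (simp only:) (simp add: algebra_simps)
  qed
  have "surf a b (\<lambda>s t. of_bool (s \<in> {0<..1} \<and> t \<in> J) * (row (\<lambda>\<xi>. cellp L \<xi> (stp ((t - c) / H))) k s - 1/2))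
    (\<bar>1\<bar> * (\<Sum>j<(2::nat) ^ k. 2 ^ L * B2) + \<bar>- 1/2\<bar> * (2 * (1 - 0) + 2 * (y1 - y0)))"
    unfolding eq by (intro surf_linear surf_sum cell rect)
  then show ?thesis
  proof (rule surf_mono)
    define w where "w = y1 - y0"
    have w: "w \<ge> 0" using y by (simp add: w_def)
    have "(1::real) \<le> 2 ^ k" "(1::real) \<le> 2 ^ L" by simp_all
    have "w \<le> 2 ^ k * w" using mult_right_mono[OF \<open>(1::real) \<le> 2 ^ k\<close> w] by simp
    define X where "X = (2::real) ^ L * (1 + 2 ^ k * w)"
    have X0: "0 \<le> X" using w by (simp add: X_def)
    have "1 + w \<le> X"
      using \<open>w \<le> 2 ^ k * w\<close> mult_mono[OF \<open>(1::real) \<le> 2 ^ L\<close>, of "1 + w" "1 + 2 ^ k * w"] w by (simp add: X_def)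
    moreover have s: "(\<Sum>j<(2::nat) ^ k. 2 ^ L * B2) = 4 * X"
      by (simp add: X_def B2_def B_def w_def field_simps)
    moreover have p: "(2::real) ^ (L + 3) * (1 + 2 ^ k * w) = 8 * X" by (simp add: X_def power_add)
    ultimately show "\<bar>1\<bar> * (\<Sum>j<(2::nat) ^ k. 2 ^ L * B2) + \<bar>- 1/2\<bar> * (2 * (1 - 0) + 2 * (y1 - y0)) \<le> 2 ^ (L + 3) * (1 + 2 ^ k * (y1 - y0))"
      unfolding w_def[symmetric] s p using X0 by simp
  qed
qed

lemma strip_unique:
  assumes \<theta>: "0 < \<theta>" "\<theta> < 1" and n: "n \<le> N" "n' \<le> N"
    and t: "strip_y \<theta> n \<le> t" "t < strip_y \<theta> n + strip_h \<theta> N n" "strip_y \<theta> n' \<le> t" "t < strip_y \<theta> n' + strip_h \<theta> N n'"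
  shows "n = n'"
proof (rule ccontr)
  assume "n \<noteq> n'"
  then have "n < n' \<or> n' < n" by linarith
  then show False using strip_end_le[OF \<theta>, of n n' N] strip_end_le[OF \<theta>, of n' n N] n t by linarith
qed

lemma sum_only:
  assumes "m < (N :: nat)" "\<And>n. n < N \<Longrightarrow> n \<noteq> m \<Longrightarrow> g n = (0 :: real)"
  shows "(\<Sum>n<N. g n) = g m"
proof -
  have "(\<Sum>n<N. g n) = (\<Sum>n<N. if n = m then g m else 0)" by (intro sum.cong refl) (use assms in auto)
  then show ?thesis using assms(1) by (simp add: sum.delta)
qed

text \<open>The phase field differs from the constant \<open>1/2\<close> on the strips of index below \<open>N\<close> and their mirror images only.\<close>

lemma surf_branch:
  assumes ab: "a \<noteq> b" and L: "L \<ge> 1" and \<theta>: "0 < \<theta>" "\<theta> < 1"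
  obtains D where "surf a b D (2 ^ (L + 4) * (\<Sum>n<N. 1 + 2 ^ (M + n) * strip_h \<theta> N n))"
    "\<And>s t. 0 < s \<Longrightarrow> s \<le> 1 \<Longrightarrow> 0 < t \<Longrightarrow> t < 1 \<Longrightarrow> branch_f L \<theta> M N s t = 1/2 + D s t"
proof -
  let ?y = "strip_y \<theta>" and ?h = "strip_h \<theta> N"
  note hp = strip_h_pos[OF \<theta>, of N]
  define J where "J n = {?y n..<?y n + ?h n}" for n
  define J' where "J' n = (if n = 0 then {1 - (?y n + ?h n)<..<1 - ?y n} else {1 - (?y n + ?h n)<..1 - ?y n})" for n
  have J'_iff: "t \<in> J' n \<longleftrightarrow> 1 - t \<in> J n \<and> t < 1/2" for t n
  proof (cases "n = 0")
    case True then show ?thesis by (auto simp: J_def J'_def strip_y_0)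
  next
    case False
    have "\<theta> ^ n < 1" using False \<theta> by (simp add: power_less_one_iff)
    then have "?y n > 1/2" by (simp add: strip_y_def)
    then show ?thesis using False by (auto simp: J_def J'_def)
  qed
  have J_half: "t \<ge> 1/2" if "t \<in> J n" for t n using that strip_y_mono[OF \<theta>, of 0 n] by (simp add: J_def strip_y_0)
  define g where "g n s t = row (\<lambda>\<xi>. cellp L \<xi> (stp ((t - ?y n) / ?h n))) (M + n) s - 1/2" for n s t
  define D where "D s t = (\<Sum>n<N. of_bool (s \<in> {0<..1} \<and> t \<in> J n) * g n s t + of_bool (s \<in> {0<..1} \<and> t \<in> J' n) * g n s (1 - t))" for s t
  have S1: "surf a b (\<lambda>s t. of_bool (s \<in> {0<..1} \<and> t \<in> J n) * g n s t) (2 ^ (L + 3) * (1 + 2 ^ (M + n) * ?h n))" for n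
    using surf_strip[OF ab, of "?y n" "?y n + ?h n" "J n" L "?y n" "?h n" "M + n"] hp[of n] by (simp add: J_def g_def)
  have S2: "surf a b (\<lambda>s t. of_bool (s \<in> {0<..1} \<and> t \<in> J' n) * g n s (1 - t)) (2 ^ (L + 3) * (1 + 2 ^ (M + n) * ?h n))" for n
  proof -
    have eq: "(t - (1 - ?y n)) / (- ?h n) = (1 - t - ?y n) / ?h n" for t using hp[of n] by (simp add: field_simps)
    have mem: "J' n \<in> {{1 - (?y n + ?h n)<..1 - ?y n}, {1 - (?y n + ?h n)..<1 - ?y n}, {1 - (?y n + ?h n)<..<1 - ?y n}}"
      unfolding J'_def by auto
    have le: "1 - (?y n + ?h n) \<le> 1 - ?y n" using hp[of n] by simp
    have len: "1 - ?y n - (1 - (?y n + ?h n)) = ?h n" by simp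
    show ?thesis using surf_strip[OF ab le mem, of L "1 - ?y n" "- ?h n" "M + n"] unfolding eq len by (simp add: g_def)
  qed
  have "surf a b (\<lambda>s t. D s t) (\<Sum>n<N. 2 ^ (L + 3) * (1 + 2 ^ (M + n) * ?h n) + 2 ^ (L + 3) * (1 + 2 ^ (M + n) * ?h n))"
    unfolding D_def by (intro surf_sum surf_add S1 S2)
  also have "(\<Sum>n<N. 2 ^ (L + 3) * (1 + 2 ^ (M + n) * ?h n) + 2 ^ (L + 3) * (1 + 2 ^ (M + n) * ?h n))
    = 2 ^ (L + 4) * (\<Sum>n<N. 1 + 2 ^ (M + n) * ?h n)"
    unfolding sum_distrib_left by (intro sum.cong refl) (simp add: power_add)
  finally have 1: "surf a b D (2 ^ (L + 4) * (\<Sum>n<N. 1 + 2 ^ (M + n) * ?h n))" .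
  have uniq: "n = n'" if "n < N" "n' < N" "t \<in> J n" "t \<in> J n'" for n n' t
    using strip_unique[OF \<theta>, of n N n' t] that by (simp add: J_def)
  have "branch_f L \<theta> M N s t = 1/2 + D s t" if s: "0 < s" "s \<le> 1" and t: "0 < t" "t < 1" for s t
  proof (cases "?y N \<le> max t (1 - t)")
    case True
    have no: "x \<notin> J n" if "n < N" "?y N \<le> x" for n x
      using strip_end_le[OF \<theta> that(1) order_refl] that(2) by (simp add: J_def)
    have yN: "?y N \<ge> 1/2" using strip_y_mono[OF \<theta>, of 0 N] by (simp add: strip_y_0)
    have "t \<notin> J n \<and> t \<notin> J' n" if "n < N" for n
    proof (cases "?y N \<le> t")
      case True
      then show ?thesis using no[OF that True] yN by (simp add: J'_iff)
    next
      case False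
      then have "?y N \<le> 1 - t" using \<open>?y N \<le> max t (1 - t)\<close> by (simp add: le_max_iff_disj)
      moreover have "t < ?y N" using False by simp
      ultimately show ?thesis using no[OF that, of "1 - t"] J_half[of t n] no[OF that, of t] yN
        by (cases "t = 1/2") (auto simp: J'_iff)
    qed
    then have "D s t = 0" unfolding D_def by (intro sum.neutral) auto
    then show ?thesis using True by (simp add: branch_f_def)
  next
    case False
    define x where "x = max t (1 - t)"
    have x: "1/2 \<le> x" "x < 1" "x < ?y N" using t False by (auto simp: x_def max_def)
    obtain m where m: "m \<le> N" "?y m \<le> x" "x < ?y m + ?h m" by (rule strip_exists[OF \<theta> x(1,2)])
    have mN: "m < N" using m x(3) by (cases "m = N") auto
    have xJ: "x \<in> J m" using m by (simp add: J_def)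
    have "branch_f L \<theta> M N s t = half_p L \<theta> M N s x"
      using False by (simp add: branch_f_def branch_eq[OF L \<theta>] x_def)
    also have "\<dots> = 1/2 + g m s x" unfolding half_strip(1)[OF L \<theta> m] g_def using mN by (simp add: strip_cellp_def)
    also have "g m s x = D s t"
    proof (cases "t \<ge> 1/2")
      case True
      then have "x = t" by (simp add: x_def)
      have "D s t = of_bool (s \<in> {0<..1} \<and> t \<in> J m) * g m s t + of_bool (s \<in> {0<..1} \<and> t \<in> J' m) * g m s (1 - t)"
        unfolding D_def
      proof (rule sum_only[OF mN])
        fix n assume "n < N" "n \<noteq> m"
        then have "t \<notin> J n" "t \<notin> J' n" using uniq[of n m t] xJ \<open>x = t\<close> mN True by (auto simp: J'_iff)
        then show "of_bool (s \<in> {0<..1} \<and> t \<in> J n) * g n s t + of_bool (s \<in> {0<..1} \<and> t \<in> J' n) * g n s (1 - t) = 0" by simp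
      qed
      moreover have "t \<in> J m" "t \<notin> J' m" using xJ \<open>x = t\<close> True by (auto simp: J'_iff)
      ultimately show ?thesis using s \<open>x = t\<close> by simp
    next
      case False
      then have "x = 1 - t" by (simp add: x_def)
      have nJ: "t \<notin> J n" for n using J_half[of t n] False by auto
      have "D s t = of_bool (s \<in> {0<..1} \<and> t \<in> J m) * g m s t + of_bool (s \<in> {0<..1} \<and> t \<in> J' m) * g m s (1 - t)"
        unfolding D_def
      proof (rule sum_only[OF mN])
        fix n assume "n < N" "n \<noteq> m"
        then have "t \<notin> J' n" using uniq[of n m "1 - t"] xJ \<open>x = 1 - t\<close> mN by (auto simp: J'_iff)
        then show "of_bool (s \<in> {0<..1} \<and> t \<in> J n) * g n s t + of_bool (s \<in> {0<..1} \<and> t \<in> J' n) * g n s (1 - t) = 0" using nJ by simp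
      qed
      moreover have "t \<in> J' m" using xJ \<open>x = 1 - t\<close> False by (simp add: J'_iff)
      ultimately show ?thesis using s nJ \<open>x = 1 - t\<close> by simp
    qed
    finally show ?thesis .
  qed
  with 1 show ?thesis by (rule that)
qed

lemma branch_f_value:
  assumes L: "L \<ge> 1" and \<theta>: "0 < \<theta>" "\<theta> < 1" and s: "0 < s" "s \<le> 1" and t: "0 < t" "t < 1"
  shows "\<bar>branch_f L \<theta> M N s t\<bar> = 1/2"
proof (cases "strip_y \<theta> N \<le> max t (1 - t)")
  case False
  have x: "1/2 \<le> max t (1 - t)" "max t (1 - t) < 1" using t by (auto simp: max_def)
  obtain m where m: "m \<le> N" "strip_y \<theta> m \<le> max t (1 - t)" "max t (1 - t) < strip_y \<theta> m + strip_h \<theta> N m" by (rule strip_exists[OF \<theta> x])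
  have mN: "m < N" using m False by (cases "m = N") auto
  have "\<bar>row (\<lambda>\<xi>. cellp L \<xi> (stp \<tau>)) k s\<bar> = 1/2" for \<tau> k
    by (rule row_abs_eq[OF cellp_zero[OF stp_bounds] cellp_abs[OF stp_bounds] s])
  then show ?thesis using False mN by (simp add: branch_f_def branch_eq[OF L \<theta>] half_strip(1)[OF L \<theta> m] strip_cellp_def)
qed (simp add: branch_f_def)

lemma strip_cellp_abs_le: "\<bar>strip_cellp L N n \<xi> (stp \<tau>)\<bar> \<le> 1/2"
proof (cases "0 < \<xi> \<and> \<xi> \<le> 1")
  case True
  then show ?thesis using cellp_abs[OF stp_bounds, of \<xi> L \<tau>] endp_abs[OF stp_bounds, of L \<xi> \<tau>] by (simp add: strip_cellp_def)
next
  case False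
  then have "\<xi> \<le> 0 \<or> \<xi> > 1" by auto
  then show ?thesis by (simp add: strip_cell_zero)
qed

text \<open>The elastic energy density at a point in terms of the strip that contains it or its mirror image.\<close>

lemma branch_pointwise:
  assumes L: "L \<ge> 1" and \<theta>: "0 < \<theta>" "\<theta> < 1" and s: "0 < s" "s \<le> 1" and t: "0 < t" "t < 1"
    and K: "\<And>\<xi> \<tau>. \<bar>cellq L \<xi> \<tau>\<bar> \<le> K" "\<And>\<xi> \<tau>. \<bar>endq L \<xi> \<tau>\<bar> \<le> K"
  obtains n where "n \<le> N" "strip_y \<theta> n \<le> max t (1 - t)" "max t (1 - t) < strip_y \<theta> n + strip_h \<theta> N n"
    "\<bar>branch_p L \<theta> M N s t\<bar> \<le> 1/2"
    "(branch_p L \<theta> M N s t - branch_f L \<theta> M N s t)\<^sup>2 + (branch_q L \<theta> M N s t)\<^sup>2 \<le> of_bool (n = N) + K\<^sup>2 * (1 / (2 ^ (M + n) * strip_h \<theta> N n)) ^ (2 * L)"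
proof -
  have x: "1/2 \<le> max t (1 - t)" "max t (1 - t) < 1" using t by (auto simp: max_def)
  obtain n where n: "n \<le> N" "strip_y \<theta> n \<le> max t (1 - t)" "max t (1 - t) < strip_y \<theta> n + strip_h \<theta> N n" by (rule strip_exists[OF \<theta> x])
  have p: "\<bar>branch_p L \<theta> M N s t\<bar> \<le> 1/2"
    unfolding branch_eq(1)[OF L \<theta>] half_strip(1)[OF L \<theta> n] by (rule row_abs_le[OF strip_cell_zero(1) strip_cellp_abs_le])
  have f: "(branch_p L \<theta> M N s t - branch_f L \<theta> M N s t)\<^sup>2 \<le> of_bool (n = N)"
  proof (cases "n = N")
    case True
    have "\<bar>branch_p L \<theta> M N s t - branch_f L \<theta> M N s t\<bar> \<le> 1" using p branch_f_value[OF L \<theta> s t, of M N] by linarith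
    then show ?thesis using True by (simp add: abs_square_le_1)
  next
    case False
    then have "max t (1 - t) < strip_y \<theta> N" using n(1) n(3) strip_end_le[OF \<theta>, of n N N] by linarith
    then have nle: "\<not> strip_y \<theta> N \<le> max t (1 - t)" by (simp only: not_le)
    show ?thesis unfolding branch_f_def if_not_P[OF nle] by simp
  qed
  have "\<bar>strip_cellq L N n \<xi> \<tau>\<bar> \<le> K" for \<xi> \<tau> using K by (simp add: strip_cellq_def)
  then have r: "\<bar>row (\<lambda>\<xi>. strip_cellq L N n \<xi> \<tau>) k s\<bar> \<le> K" for \<tau> k by (intro row_abs_le[OF strip_cell_zero(2)])
  define c where "c = (1 / (2 ^ (M + n) * strip_h \<theta> N n)) ^ L"
  have c: "c \<ge> 0" using strip_h_pos[OF \<theta>, of N n] by (simp add: c_def)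
  have "\<bar>branch_q L \<theta> M N s t\<bar> \<le> c * K"
    unfolding branch_eq(2)[OF L \<theta>] half_strip(2)[OF L \<theta> n] abs_mult c_def[symmetric] using c r by (simp add: mult_left_mono)
  then have "\<bar>branch_q L \<theta> M N s t\<bar>\<^sup>2 \<le> (c * K)\<^sup>2" by (rule power_mono) simp
  also have "\<dots> = K\<^sup>2 * (1 / (2 ^ (M + n) * strip_h \<theta> N n)) ^ (2 * L)"
    unfolding power_mult_distrib c_def power_mult[symmetric] by (simp add: mult.commute)
  finally have "(branch_q L \<theta> M N s t)\<^sup>2 \<le> K\<^sup>2 * (1 / (2 ^ (M + n) * strip_h \<theta> N n)) ^ (2 * L)" by simp
  with f have "(branch_p L \<theta> M N s t - branch_f L \<theta> M N s t)\<^sup>2 + (branch_q L \<theta> M N s t)\<^sup>2 \<le> of_bool (n = N) + K\<^sup>2 * (1 / (2 ^ (M + n) * strip_h \<theta> N n)) ^ (2 * L)"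
    by linarith
  with n p show ?thesis by (rule that)
qed

lemma integral_slab:
  assumes ab: "a \<noteq> b" and cd: "c \<le> d"
  shows "integrable lborel (indicator (cbox (mk a 0 c) (mk a 1 d)) :: real ^ 2 \<Rightarrow> real)"
    "(LINT x|lborel. indicator (cbox (mk a 0 c) (mk a 1 d)) x) = d - c"
    "x \<in> cbox (mk a 0 c) (mk a 1 d) \<longleftrightarrow> 0 \<le> x $ a \<and> x $ a \<le> 1 \<and> c \<le> x $ b \<and> x $ b \<le> d"
proof -
  show mem: "x \<in> cbox (mk a 0 c) (mk a 1 d) \<longleftrightarrow> 0 \<le> x $ a \<and> x $ a \<le> 1 \<and> c \<le> x $ b \<and> x $ b \<le> d" for x
    using ab by (auto simp: mem_box_cart all_2_pair[OF ab] mk_nth)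
  show "integrable lborel (indicator (cbox (mk a 0 c) (mk a 1 d)) :: real ^ 2 \<Rightarrow> real)"
    by (rule integrable_real_indicator[OF _ emeasure_lborel_cbox_finite]) simp
  have "mk a 0 c \<in> cbox (mk a 0 c) (mk a 1 d)" unfolding mem using cd ab by (simp add: mk_nth)
  then have "cbox (mk a 0 c) (mk a 1 d) \<noteq> {}" by blast
  then have "measure lborel (cbox (mk a 0 c) (mk a 1 d)) = (\<Prod>i\<in>{a, b}. mk a 1 d $ i - mk a 0 c $ i)"
    using content_cbox_cart UNIV_2_pair[OF ab] by metis
  also have "\<dots> = d - c" using ab by (simp add: mk_nth)
  finally show "(LINT x|lborel. indicator (cbox (mk a 0 c) (mk a 1 d)) x) = d - c" by simp
qed

lemma branch_energy:
  fixes a b :: 2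
  assumes ab: "a \<noteq> b" and L: "L \<ge> 1" and \<theta>: "0 < \<theta>" "\<theta> < 1"
    and K: "\<And>\<xi> \<tau>. \<bar>cellq L \<xi> \<tau>\<bar> \<le> K" "\<And>\<xi> \<tau>. \<bar>endq L \<xi> \<tau>\<bar> \<le> K"
  shows "(\<integral>\<^sup>+x\<in>box 0 1. ennreal ((branch_p L \<theta> M N (x $ a) (x $ b) - branch_f L \<theta> M N (x $ a) (x $ b))\<^sup>2 + (branch_q L \<theta> M N (x $ a) (x $ b))\<^sup>2) \<partial>lebesgue)
    \<le> ennreal (\<Sum>n\<le>N. (of_bool (n = N) + K\<^sup>2 * (1 / (2 ^ (M + n) * strip_h \<theta> N n)) ^ (2 * L)) * (2 * strip_h \<theta> N n))"
proof -
  define w where "w n = of_bool (n = N) + K\<^sup>2 * (1 / (2 ^ (M + n) * strip_h \<theta> N n)) ^ (2 * L)" for n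
  have w0: "w n \<ge> 0" for n unfolding w_def by simp
  let ?y = "strip_y \<theta>" and ?h = "strip_h \<theta> N"
  have h: "?h n > 0" for n by (rule strip_h_pos[OF \<theta>])
  define G :: "real ^ 2 \<Rightarrow> real" where "G x = (\<Sum>n\<le>N. w n * (indicator (cbox (mk a 0 (?y n)) (mk a 1 (?y n + ?h n))) x
     + indicator (cbox (mk a 0 (1 - (?y n + ?h n))) (mk a 1 (1 - ?y n))) x))" for x
  have G0: "G x \<ge> 0" for x unfolding G_def by (intro sum_nonneg mult_nonneg_nonneg w0 add_nonneg_nonneg) auto
  have le: "?y n \<le> ?y n + ?h n" "1 - (?y n + ?h n) \<le> 1 - ?y n" for n using h[of n] by auto
  note slab = integral_slab[OF ab le(1)] integral_slab[OF ab le(2)]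
  have iG: "integrable lborel G" unfolding G_def by (intro Bochner_Integration.integrable_sum integrable_mult_right Bochner_Integration.integrable_add slab(1,4))
  have IG: "(LINT x|lborel. G x) = (\<Sum>n\<le>N. w n * (2 * ?h n))"
    unfolding G_def using slab(1,2,4,5) by (simp add: Bochner_Integration.integral_sum)
  have pt: "(branch_p L \<theta> M N (x $ a) (x $ b) - branch_f L \<theta> M N (x $ a) (x $ b))\<^sup>2 + (branch_q L \<theta> M N (x $ a) (x $ b))\<^sup>2 \<le> G x"
    if "x \<in> box 0 1" for x :: "real ^ 2"
  proof -
    define s where "s = x $ a" define t where "t = x $ b"
    have st: "0 < s" "s < 1" "0 < t" "t < 1" using that by (auto simp: mem_box_cart s_def t_def)
    obtain n where n: "n \<le> N" "?y n \<le> max t (1 - t)" "max t (1 - t) < ?y n + ?h n"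
      "(branch_p L \<theta> M N s t - branch_f L \<theta> M N s t)\<^sup>2 + (branch_q L \<theta> M N s t)\<^sup>2 \<le> w n"
      unfolding w_def by (rule branch_pointwise[OF L \<theta> st(1) less_imp_le[OF st(2)] st(3,4) K])
    have "max t (1 - t) = t \<or> max t (1 - t) = 1 - t" by (simp add: max_def)
    then have "x \<in> cbox (mk a 0 (?y n)) (mk a 1 (?y n + ?h n)) \<or> x \<in> cbox (mk a 0 (1 - (?y n + ?h n))) (mk a 1 (1 - ?y n))"
      unfolding slab s_def[symmetric] t_def[symmetric] using st n by auto
    then have "1 \<le> (indicator (cbox (mk a 0 (?y n)) (mk a 1 (?y n + ?h n))) x
     + indicator (cbox (mk a 0 (1 - (?y n + ?h n))) (mk a 1 (1 - ?y n))) x :: real)" by (auto simp: indicator_def)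
    then have "w n * 1 \<le> w n * (indicator (cbox (mk a 0 (?y n)) (mk a 1 (?y n + ?h n))) x
     + indicator (cbox (mk a 0 (1 - (?y n + ?h n))) (mk a 1 (1 - ?y n))) x)" by (intro mult_left_mono w0)
    also have "\<dots> \<le> G x" unfolding G_def
      by (rule member_le_sum) (use n w0 in \<open>auto intro!: mult_nonneg_nonneg add_nonneg_nonneg\<close>)
    finally show ?thesis using n(4) unfolding s_def t_def by linarith
  qed
  have "(\<integral>\<^sup>+x\<in>box 0 1. ennreal ((branch_p L \<theta> M N (x $ a) (x $ b) - branch_f L \<theta> M N (x $ a) (x $ b))\<^sup>2 + (branch_q L \<theta> M N (x $ a) (x $ b))\<^sup>2) \<partial>lebesgue)
    \<le> (\<integral>\<^sup>+x. ennreal (G x) \<partial>lebesgue)"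
  proof (intro nn_integral_mono)
    fix x :: "real ^ 2"
    show "ennreal ((branch_p L \<theta> M N (x $ a) (x $ b) - branch_f L \<theta> M N (x $ a) (x $ b))\<^sup>2 + (branch_q L \<theta> M N (x $ a) (x $ b))\<^sup>2) * indicator (box 0 1) x \<le> ennreal (G x)"
      using ennreal_leI[OF pt[of x]] by (cases "x \<in> box 0 1") simp_all
  qed
  also have "\<dots> = (\<integral>\<^sup>+x. ennreal (G x) \<partial>lborel)" by (rule nn_integral_completion)
  also have "\<dots> = ennreal (LINT x|lborel. G x)" by (rule nn_integral_eq_integral[OF iG]) (simp add: G0)
  finally show ?thesis unfolding IG w_def .
qed

text \<open>The ratio \<open>\<rho>\<close> with \<open>\<rho>\<^bsup>2L\<^esup> = 1/2\<close> makes both the elastic and the surface contributions of the strips geometric.\<close>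

lemma strip_sums:
  assumes L: "L \<ge> 1" and \<rho>: "0 < \<rho>" "\<rho> < 1" "\<rho> ^ (2 * L) = 1/2" and \<theta>: "\<theta> = \<rho> / 2" and N: "N = 2 * L * M"
  shows "(\<Sum>n\<le>N. (of_bool (n = N) + K\<^sup>2 * (1 / (2 ^ (M + n) * strip_h \<theta> N n)) ^ (2 * L)) * (2 * strip_h \<theta> N n))
      \<le> 2 * (1 + K\<^sup>2 * 4 ^ (2 * L) / (1 - \<rho>)) * (1/2) ^ (2 * L * M)"
    and "(\<Sum>n<N. 1 + 2 ^ (M + n) * strip_h \<theta> N n) \<le> (2 * real L + 1 / (1 - \<rho>)) * 2 ^ M"
proof -
  have \<theta>1: "0 < \<theta>" "\<theta> < 1/2" using \<rho> \<theta> by auto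
  have \<theta>n: "\<theta> ^ n = \<rho> ^ n / 2 ^ n" for n unfolding \<theta> by (simp add: power_divide)
  have geo: "(\<Sum>n<k. \<rho> ^ n) \<le> 1 / (1 - \<rho>)" for k
  proof -
    have "(\<Sum>n<k. \<rho> ^ n) = (1 - \<rho> ^ k) / (1 - \<rho>)" using geometric_sum[of \<rho> k] \<rho> by (simp add: field_simps)
    also have "\<dots> \<le> 1 / (1 - \<rho>)" using \<rho> by (intro divide_right_mono) auto
    finally show ?thesis .
  qed
  have h_le: "strip_h \<theta> N n \<le> \<theta> ^ n / 2" for n
    using \<theta>1 mult_right_mono[of "1 - \<theta>" 1 "\<theta> ^ n"] by (simp add: strip_h_def)
  have h_ge: "strip_h \<theta> N n \<ge> \<theta> ^ n / 4" for n
    using \<theta>1 mult_right_mono[of "1/2" "1 - \<theta>" "\<theta> ^ n"] by (simp add: strip_h_def)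
  have h0: "strip_h \<theta> N n > 0" for n using \<theta>1 by (intro strip_h_pos) auto
  have w: "2 ^ (M + n) * strip_h \<theta> N n \<ge> 2 ^ M * \<rho> ^ n / 4" for n
    using mult_left_mono[OF h_ge[of n], of "2 ^ (M + n)"] unfolding \<theta>n by (simp add: power_add)
  have trm: "(1 / (2 ^ (M + n) * strip_h \<theta> N n)) ^ (2 * L) * (2 * strip_h \<theta> N n) \<le> 4 ^ (2 * L) * (1/2) ^ (2 * L * M) * \<rho> ^ n" for n
  proof -
    have "1 / (2 ^ (M + n) * strip_h \<theta> N n) \<le> 1 / (2 ^ M * \<rho> ^ n / 4)"
      using w[of n] \<rho> by (intro divide_left_mono) (auto intro!: mult_pos_pos h0)
    then have "(1 / (2 ^ (M + n) * strip_h \<theta> N n)) ^ (2 * L) \<le> (1 / (2 ^ M * \<rho> ^ n / 4)) ^ (2 * L)"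
      using h0[of n] by (intro power_mono) auto
    also have "\<dots> = 4 ^ (2 * L) * (1/2) ^ (2 * L * M) * 2 ^ n"
    proof -
      have "(\<rho> ^ n) ^ (2 * L) = (\<rho> ^ (2 * L)) ^ n" by (simp add: power_mult[symmetric] mult.commute)
      moreover have "((2::real) ^ M) ^ (2 * L) = 2 ^ (2 * L * M)" by (simp add: power_mult[symmetric] mult.commute)
      ultimately show ?thesis unfolding \<rho> by (simp add: power_divide power_mult_distrib)
    qed
    finally have "(1 / (2 ^ (M + n) * strip_h \<theta> N n)) ^ (2 * L) * (2 * strip_h \<theta> N n) \<le> (4 ^ (2 * L) * (1/2) ^ (2 * L * M) * 2 ^ n) * (\<theta> ^ n)"
      using h_le[of n] h0[of n] by (intro mult_mono) auto
    then show ?thesis unfolding \<theta>n by simp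
  qed
  have last: "2 * strip_h \<theta> N N \<le> (1/2) ^ (2 * L * M)"
  proof -
    have "2 * strip_h \<theta> N N = \<rho> ^ N * (1/2) ^ N" by (simp add: strip_h_def \<theta>n power_divide)
    also have "\<dots> \<le> 1 * (1/2) ^ N" using \<rho> by (intro mult_right_mono power_le_one) auto
    finally show ?thesis by (simp add: N)
  qed
  have "(\<Sum>n\<le>N. (of_bool (n = N) + K\<^sup>2 * (1 / (2 ^ (M + n) * strip_h \<theta> N n)) ^ (2 * L)) * (2 * strip_h \<theta> N n))
    = (\<Sum>n\<le>N. if n = N then 2 * strip_h \<theta> N N else 0) + K\<^sup>2 * (\<Sum>n\<le>N. (1 / (2 ^ (M + n) * strip_h \<theta> N n)) ^ (2 * L) * (2 * strip_h \<theta> N n))"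
    unfolding sum_distrib_left sum.distrib[symmetric] by (intro sum.cong refl) (auto simp: algebra_simps)
  also have "(\<Sum>n\<le>N. if n = N then 2 * strip_h \<theta> N N else 0) = 2 * strip_h \<theta> N N" by (simp add: sum.delta)
  also have "2 * strip_h \<theta> N N + K\<^sup>2 * (\<Sum>n\<le>N. (1 / (2 ^ (M + n) * strip_h \<theta> N n)) ^ (2 * L) * (2 * strip_h \<theta> N n))
    \<le> (1/2) ^ (2 * L * M) + K\<^sup>2 * (\<Sum>n\<le>N. 4 ^ (2 * L) * (1/2) ^ (2 * L * M) * \<rho> ^ n)"
    by (intro add_mono last mult_left_mono sum_mono trm) auto
  also have "\<dots> = (1/2) ^ (2 * L * M) + K\<^sup>2 * (4 ^ (2 * L) * (1/2) ^ (2 * L * M) * (\<Sum>n<Suc N. \<rho> ^ n))"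
    by (simp only: sum_distrib_left lessThan_Suc_atMost)
  also have "\<dots> \<le> (1/2) ^ (2 * L * M) + K\<^sup>2 * (4 ^ (2 * L) * (1/2) ^ (2 * L * M) * (1 / (1 - \<rho>)))"
    by (intro add_mono mult_left_mono geo order_refl) auto
  also have "\<dots> = (1 + K\<^sup>2 * 4 ^ (2 * L) / (1 - \<rho>)) * (1/2) ^ (2 * L * M)" by (simp add: algebra_simps)
  also have "\<dots> \<le> 2 * (1 + K\<^sup>2 * 4 ^ (2 * L) / (1 - \<rho>)) * (1/2) ^ (2 * L * M)"
  proof (rule mult_right_mono)
    have "0 \<le> K\<^sup>2 * 4 ^ (2 * L) / (1 - \<rho>)" using \<rho> by simp
    moreover have "0 \<le> z \<Longrightarrow> 1 + z \<le> 2 * (1 + z)" for z :: real by simp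
    ultimately show "1 + K\<^sup>2 * 4 ^ (2 * L) / (1 - \<rho>) \<le> 2 * (1 + K\<^sup>2 * 4 ^ (2 * L) / (1 - \<rho>))" by blast
  qed simp
  finally show "(\<Sum>n\<le>N. (of_bool (n = N) + K\<^sup>2 * (1 / (2 ^ (M + n) * strip_h \<theta> N n)) ^ (2 * L)) * (2 * strip_h \<theta> N n))
      \<le> 2 * (1 + K\<^sup>2 * 4 ^ (2 * L) / (1 - \<rho>)) * (1/2) ^ (2 * L * M)" .
  have "(\<Sum>n<N. 1 + 2 ^ (M + n) * strip_h \<theta> N n) \<le> (\<Sum>n<N. 1 + 2 ^ M * \<rho> ^ n)"
  proof (rule sum_mono)
    fix n
    have "2 ^ (M + n) * strip_h \<theta> N n \<le> 2 ^ (M + n) * (\<theta> ^ n / 2)" using h_le by (intro mult_left_mono) auto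
    also have "\<dots> = 2 ^ M * \<rho> ^ n / 2" unfolding \<theta>n by (simp add: power_add)
    also have "\<dots> \<le> 2 ^ M * \<rho> ^ n" using \<rho> by simp
    finally show "1 + 2 ^ (M + n) * strip_h \<theta> N n \<le> 1 + 2 ^ M * \<rho> ^ n" by simp
  qed
  also have "\<dots> = real N + 2 ^ M * (\<Sum>n<N. \<rho> ^ n)" by (simp add: sum.distrib sum_distrib_left)
  also have "\<dots> \<le> 2 * real L * 2 ^ M + 2 ^ M * (1 / (1 - \<rho>))"
  proof (intro add_mono mult_left_mono geo)
    have "real M \<le> 2 ^ M" using of_nat_less_two_power less_imp_le by blast
    then show "real N \<le> 2 * real L * 2 ^ M" unfolding N by (simp add: mult_left_mono)
  qed auto
  also have "\<dots> = (2 * real L + 1 / (1 - \<rho>)) * 2 ^ M" by (simp add: algebra_simps)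
  finally show "(\<Sum>n<N. 1 + 2 ^ (M + n) * strip_h \<theta> N n) \<le> (2 * real L + 1 / (1 - \<rho>)) * 2 ^ M" .
qed

text \<open>The outcome of the construction with \<open>2\<^sup>M\<close> cells in the middle row: \<open>p\<close> is the coefficient of the
  difference of the phases in the displacement, \<open>q\<close> its corrector, \<open>f\<close> the phase field with values
  \<open>1/2\<close> and \<open>-1/2\<close>, and \<open>D = f - 1/2\<close> on the open unit square.\<close>

abbreviation branching_data ::
  "nat \<Rightarrow> 2 \<Rightarrow> 2 \<Rightarrow> real \<Rightarrow> nat \<Rightarrow> (real \<Rightarrow> real \<Rightarrow> real) \<Rightarrow> (real \<Rightarrow> real \<Rightarrow> real) \<Rightarrow> (real \<Rightarrow> real \<Rightarrow> real) \<Rightarrow> (real \<Rightarrow> real \<Rightarrow> real) \<Rightarrow> bool" where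
  "branching_data L a b C M p q f D \<equiv> compat L a b p q \<and>
     (\<forall>s t. s \<le> 0 \<or> s > 1 \<or> t \<le> 0 \<or> t \<ge> 1 \<longrightarrow> p s t = 0 \<and> q s t = 0) \<and>
     (\<exists>B. \<forall>s t. \<bar>p s t\<bar> \<le> B \<and> \<bar>q s t\<bar> \<le> B) \<and>
     (\<forall>s t. 0 < s \<and> s < 1 \<and> 0 < t \<and> t < 1 \<longrightarrow> \<bar>f s t\<bar> = 1/2 \<and> f s t = 1/2 + D s t) \<and>
     (\<lambda>x. f (x $ a) (x $ b)) \<in> borel_measurable borel \<and> surf a b D (C * 2 ^ M) \<and>
     (\<integral>\<^sup>+x\<in>box 0 1. ennreal ((p (x $ a) (x $ b) - f (x $ a) (x $ b))\<^sup>2 + (q (x $ a) (x $ b))\<^sup>2) \<partial>lebesgue) \<le> ennreal (C * (1/2) ^ (2 * L * M))"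

lemma branching:
  assumes ab: "a \<noteq> b" and L: "L \<ge> 1"
  obtains C where "C > 0" "\<And>M. \<exists>p q f D. branching_data L a b C M p q f D"
proof -
  obtain K where K: "K \<ge> 0" "\<And>\<xi> \<tau>. \<bar>cellq L \<xi> \<tau>\<bar> \<le> K" "\<And>\<xi> \<tau>. \<bar>endq L \<xi> \<tau>\<bar> \<le> K" by (rule cellq_bounded[OF L]) (rule that)
  define \<rho> where "\<rho> = root (2 * L) (1/2)"
  have \<rho>: "0 < \<rho>" "\<rho> < 1" "\<rho> ^ (2 * L) = 1/2" using L by (auto simp: \<rho>_def real_root_pow_pos2)
  define \<theta> where "\<theta> = \<rho> / 2"
  have \<theta>: "0 < \<theta>" "\<theta> < 1" using \<rho> by (auto simp: \<theta>_def)
  define C where "C = max (2 * (1 + K\<^sup>2 * 4 ^ (2 * L) / (1 - \<rho>))) (2 ^ (L + 4) * (2 * real L + 1 / (1 - \<rho>)))"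
  have C0: "C > 0" unfolding C_def using L \<rho> by (intro max.strict_coboundedI2 mult_pos_pos add_pos_pos) auto
  show ?thesis
  proof (rule that[OF C0])
    fix M
    define N where "N = 2 * L * M"
    note sums = strip_sums(1)[OF L \<rho> \<theta>_def N_def, where K = K] strip_sums(2)[OF L \<rho> \<theta>_def N_def]
    obtain D where D: "surf a b D (2 ^ (L + 4) * (\<Sum>n<N. 1 + 2 ^ (M + n) * strip_h \<theta> N n))"
      "\<And>s t. 0 < s \<Longrightarrow> s \<le> 1 \<Longrightarrow> 0 < t \<Longrightarrow> t < 1 \<Longrightarrow> branch_f L \<theta> M N s t = 1/2 + D s t"
      by (rule surf_branch[OF ab L \<theta>]) (rule that)
    have "2 ^ (L + 4) * (\<Sum>n<N. 1 + 2 ^ (M + n) * strip_h \<theta> N n) \<le> 2 ^ (L + 4) * ((2 * real L + 1 / (1 - \<rho>)) * 2 ^ M)"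
      by (intro mult_left_mono sums) auto
    also have "\<dots> \<le> C * 2 ^ M" unfolding C_def mult.assoc[symmetric] by (intro mult_right_mono) auto
    finally have S: "surf a b D (C * 2 ^ M)" by (rule surf_mono[OF D(1)])
    note branch_energy[OF ab L \<theta> K(2,3), of M N]
    also have "ennreal (\<Sum>n\<le>N. (of_bool (n = N) + K\<^sup>2 * (1 / (2 ^ (M + n) * strip_h \<theta> N n)) ^ (2 * L)) * (2 * strip_h \<theta> N n))
      \<le> ennreal (C * (1/2) ^ (2 * L * M))"
      by (intro ennreal_leI order_trans[OF sums(1)] mult_right_mono) (auto simp: C_def)
    finally have E: "(\<integral>\<^sup>+x\<in>box 0 1. ennreal ((branch_p L \<theta> M N (x $ a) (x $ b) - branch_f L \<theta> M N (x $ a) (x $ b))\<^sup>2 + (branch_q L \<theta> M N (x $ a) (x $ b))\<^sup>2) \<partial>lebesgue)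
      \<le> ennreal (C * (1/2) ^ (2 * L * M))" .
    define B where "B = 1/2 + (\<Sum>n\<le>N. 1 + K\<^sup>2 * (1 / (2 ^ (M + n) * strip_h \<theta> N n)) ^ (2 * L)) + 1"
    have sn: "(\<Sum>n\<le>N. 1 + K\<^sup>2 * (1 / (2 ^ (M + n) * strip_h \<theta> N n)) ^ (2 * L)) \<ge> 0" by (intro sum_nonneg) simp
    have bd: "\<bar>branch_p L \<theta> M N s t\<bar> \<le> B \<and> \<bar>branch_q L \<theta> M N s t\<bar> \<le> B" for s t
    proof (cases "s \<le> 0 \<or> s > 1 \<or> t \<le> 0 \<or> t \<ge> 1")
      case True
      then show ?thesis using branch_outside[OF L \<theta> True] sn by (simp add: B_def)
    next
      case False
      then have st: "0 < s" "s \<le> 1" "0 < t" "t < 1" by auto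
      obtain n where n: "n \<le> N" "\<bar>branch_p L \<theta> M N s t\<bar> \<le> 1/2"
        "(branch_p L \<theta> M N s t - branch_f L \<theta> M N s t)\<^sup>2 + (branch_q L \<theta> M N s t)\<^sup>2 \<le> of_bool (n = N) + K\<^sup>2 * (1 / (2 ^ (M + n) * strip_h \<theta> N n)) ^ (2 * L)"
        by (rule branch_pointwise[OF L \<theta> st K(2,3)])
      have "(branch_q L \<theta> M N s t)\<^sup>2 \<le> 1 + K\<^sup>2 * (1 / (2 ^ (M + n) * strip_h \<theta> N n)) ^ (2 * L)"
        proof -
        have "0 \<le> (branch_p L \<theta> M N s t - branch_f L \<theta> M N s t)\<^sup>2" "of_bool (n = N) \<le> (1 :: real)" by simp_all
        with n(3) show ?thesis by linarith
      qed
      also have "\<dots> \<le> (\<Sum>n\<le>N. 1 + K\<^sup>2 * (1 / (2 ^ (M + n) * strip_h \<theta> N n)) ^ (2 * L))"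
        by (rule member_le_sum) (use n in auto)
      finally have q: "(branch_q L \<theta> M N s t)\<^sup>2 \<le> B - 3/2" by (simp add: B_def)
      have "\<bar>x\<bar> \<le> x\<^sup>2 + 1" for x :: real
        using zero_le_power2[of "\<bar>x\<bar> - 1"] zero_le_power2[of x] by (simp add: power2_eq_square algebra_simps)
      from this[of "branch_q L \<theta> M N s t"] show ?thesis using q n(2) sn by (simp add: B_def)
    qed
    show "\<exists>p q f D. branching_data L a b C M p q f D"
    proof (intro exI conjI)
      show "compat L a b (branch_p L \<theta> M N) (branch_q L \<theta> M N)" by (rule compat_branch[OF ab L \<theta>])
      show "\<forall>s t. s \<le> 0 \<or> s > 1 \<or> t \<le> 0 \<or> t \<ge> 1 \<longrightarrow> branch_p L \<theta> M N s t = 0 \<and> branch_q L \<theta> M N s t = 0"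
        using branch_outside[OF L \<theta>] by blast
      show "\<forall>s t. \<bar>branch_p L \<theta> M N s t\<bar> \<le> B \<and> \<bar>branch_q L \<theta> M N s t\<bar> \<le> B" using bd by blast
      show "\<forall>s t. 0 < s \<and> s < 1 \<and> 0 < t \<and> t < 1 \<longrightarrow> \<bar>branch_f L \<theta> M N s t\<bar> = 1/2 \<and> branch_f L \<theta> M N s t = 1/2 + D s t"
        using branch_f_value[OF L \<theta>] D(2) less_imp_le by blast
      have m: "(\<lambda>x :: real ^ 2. branch_p L \<theta> M N (x $ a) (x $ b)) \<in> borel_measurable borel"
        using compat_branch[OF ab L \<theta>, of M N] unfolding compat_def by (elim conjE)
      have "{x :: real ^ 2. strip_y \<theta> N \<le> max (x $ b) (1 - x $ b)} \<in> sets borel"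
        by (intro borel_closed closed_Collect_le continuous_intros)
      then show "(\<lambda>x. branch_f L \<theta> M N (x $ a) (x $ b)) \<in> borel_measurable borel"
        unfolding branch_f_def by (intro measurable_If m borel_measurable_const) simp
      show "surf a b D (C * 2 ^ M)" by (rule S)
    qed (rule E)
  qed
qed

section \<open>Admissible fields in two dimensions\<close>

lemma minus_one_power_card: "(-1) ^ card {k :: 'm::finite. P k} = (\<Prod>k\<in>UNIV. if P k then -1 else 1 :: real)"
  by (simp add: prod.If_cases)

lemma sum_UNIV_2: "a \<noteq> b \<Longrightarrow> sum f (UNIV :: 2 set) = f a + f b"
  using UNIV_2_pair[of a b] by (metis finite.emptyI finite_insert insertE empty_iff sum.empty sum.insert add.right_neutral)

text \<open>If an index pair agrees, the terms cancel in pairs.\<close>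

lemma saint_venant_equal_pair:
  fixes u :: "real ^ 'd \<Rightarrow> ('m::{finite,linorder}, 'd::finite) tensor"
  assumes "i k = j k"
  shows "saint_venant u \<phi> i j = 0"
proof -
  define g where "g S = (LINT x|lebesgue. u x $ flip S i j * partials (map (flip S j i) (sorted_list_of_set UNIV)) \<phi> x)" for S
  \<comment> \<open>Exchanging the equal entries at \<open>k\<close> changes only the sign.\<close>
  define T where "T S = (if k \<in> S then S - {k} else insert k S)" for S
  have "flip (T S) i j = flip S i j" "flip (T S) j i = flip S j i" for S
    using assms by (auto simp: flip_def T_def fun_eq_iff)
  then have g: "g (T S) = g S" for S by (simp add: g_def)
  have sgn: "(-1) ^ card (T S) = - ((-1) ^ card S :: real)" for S
  proof (cases "k \<in> S")
    case True
    have "card S = Suc (card (S - {k}))" by (rule card.remove[OF finite True])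
    moreover have "T S = S - {k}" using True by (simp add: T_def)
    ultimately show ?thesis by (metis power_Suc mult_minus1 add.inverse_inverse)
  next
    case False
    have "card (insert k S) = Suc (card S)" by (rule card_insert_disjoint[OF finite False])
    then show ?thesis using False by (simp add: T_def)
  qed
  have "bij_betw T UNIV UNIV" by (rule bij_betw_byWitness[where f' = T]) (auto simp: T_def)
  then have "(\<Sum>S\<in>UNIV. (-1) ^ card S * g S) = (\<Sum>S\<in>UNIV. (-1) ^ card (T S) * g (T S))"
    by (rule sum.reindex_bij_betw[symmetric])
  also have "\<dots> = - (\<Sum>S\<in>UNIV. (-1) ^ card S * g S)" unfolding sgn g by (simp add: sum_negf)
  finally have "(\<Sum>S\<in>UNIV. (-1) ^ card S * g S) = 0" by simp
  then show ?thesis unfolding saint_venant_eq g_def by simp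
qed

text \<open>If all index pairs are distinct, they consist of \<open>a\<close> and \<open>b\<close>, and the exchanged index \<open>i'\<close> runs through all indices.\<close>

lemma saint_venant_distinct_pairs:
  fixes u :: "real ^ 2 \<Rightarrow> ('m::{finite,linorder}, 2) tensor"
  assumes ab: "a \<noteq> b" and ij: "\<And>k. i k \<noteq> j k" and \<phi>: "\<phi> \<in> test_functions \<Omega>"
  shows "saint_venant u \<phi> i j = (1 / (-2) ^ CARD('m)) * ((-1) ^ cnt i a * (\<Sum>i'\<in>UNIV. (-1) ^ cnt i' a *
     (LINT x|lebesgue. u x $ i' * partials (replicate (cnt i' a) b) (partials (replicate (cnt i' b) a) \<phi>) x)))"
proof -
  define h where "h i' = (-1) ^ cnt i' a *
     (LINT x|lebesgue. u x $ i' * partials (replicate (cnt i' a) b) (partials (replicate (cnt i' b) a) \<phi>) x)" for i'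
  have two: "c = a \<or> c = b" for c using UNIV_2_pair[OF ab] by blast
  have sgn: "(-1) ^ card S = (-1) ^ cnt i a * ((-1) ^ cnt (flip S i j) a :: real)" for S
  proof -
    have "(-1) ^ card S = (\<Prod>k\<in>UNIV. if k \<in> S then -1 else 1 :: real)" using minus_one_power_card[of "\<lambda>k. k \<in> S"] by simp
    also have "\<dots> = (\<Prod>k\<in>UNIV. (if i k = a then -1 else 1) * (if flip S i j k = a then -1 else 1))"
    proof (rule prod.cong[OF refl])
      fix k show "(if k \<in> S then -1 else 1 :: real) = (if i k = a then -1 else 1) * (if flip S i j k = a then -1 else 1)"
        using ij[of k] two[of "i k"] two[of "j k"] ab by (auto simp: flip_def)
    qed
    finally show ?thesis by (simp add: prod.distrib cnt_def minus_one_power_card)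
  qed
  have sw: "cnt (flip S j i) a = cnt (flip S i j) b" "cnt (flip S j i) b = cnt (flip S i j) a" for S
  proof -
    have "(flip S j i k = a) = (flip S i j k = b)" "(flip S j i k = b) = (flip S i j k = a)" for k
      using ij[of k] two[of "i k"] two[of "j k"] ab by (auto simp: flip_def)
    then show "cnt (flip S j i) a = cnt (flip S i j) b" "cnt (flip S j i) b = cnt (flip S i j) a" by (simp_all add: cnt_def)
  qed
  have bij: "bij_betw (\<lambda>S. flip S i j) UNIV UNIV"
  proof (rule bij_betw_byWitness[where f' = "\<lambda>i'. {k. i' k \<noteq> i k}"])
    show "\<forall>S\<in>UNIV. {k. flip S i j k \<noteq> i k} = S" using ij by (auto simp: flip_def) (metis ij)
    show "\<forall>i'\<in>UNIV. flip {k. i' k \<noteq> i k} i j = i'"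
    proof (intro ballI ext)
      fix i' k show "flip {k. i' k \<noteq> i k} i j k = i' k"
        using ij[of k] two[of "i k"] two[of "j k"] two[of "i' k"] by (auto simp: flip_def)
    qed
  qed auto
  have srt: "partials (map (flip S j i) (sorted_list_of_set UNIV)) \<phi>
    = partials (replicate (cnt (flip S i j) a) b) (partials (replicate (cnt (flip S i j) b) a) \<phi>)" for S
    using partials_sort_2[OF ab \<phi>, of "map (flip S j i) (sorted_list_of_set UNIV)"] unfolding count_list_map_enum sw .
  have "(\<Sum>S\<in>UNIV. (-1) ^ card S * (LINT x|lebesgue. u x $ flip S i j * partials (map (flip S j i) (sorted_list_of_set UNIV)) \<phi> x))
    = (\<Sum>S\<in>UNIV. (-1) ^ cnt i a * h (flip S i j))"
    unfolding srt h_def by (intro sum.cong refl) (simp add: sgn mult.assoc)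
  also have "\<dots> = (-1) ^ cnt i a * (\<Sum>S\<in>UNIV. h (flip S i j))" by (simp add: sum_distrib_left)
  also have "(\<Sum>S\<in>UNIV. h (flip S i j)) = (\<Sum>i'\<in>UNIV. h i')" by (rule sum.reindex_bij_betw[OF bij])
  finally show ?thesis unfolding saint_venant_eq h_def by simp
qed

text \<open>The tensor all of whose indices are \<open>b\<close>.\<close>

definition pure_tensor :: "2 \<Rightarrow> ('m::finite, 2) tensor" where
  "pure_tensor b = (\<chi> i. of_bool (i = (\<lambda>k. b)))"

text \<open>The corrector enters only one component of the field, yet it balances the whole Saint-Venant tensor:
  with distinct index pairs the latter has, up to sign, a single value.\<close>

definition field ::
  "2 \<Rightarrow> 2 \<Rightarrow> ('m::finite, 2) tensor \<Rightarrow> ('m, 2) tensor \<Rightarrow> nat \<Rightarrow> (real \<Rightarrow> real \<Rightarrow> real) \<Rightarrow> (real \<Rightarrow> real \<Rightarrow> real) \<Rightarrow> real ^ 2 \<Rightarrow> ('m, 2) tensor" where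
  "field a b F D L p q x = F + p (x $ a) (x $ b) *\<^sub>R D + ((-1) ^ Suc L * q (x $ a) (x $ b)) *\<^sub>R pure_tensor b"

lemma lebesgue_integral_lborel:
  fixes f :: "'a::euclidean_space \<Rightarrow> real"
  shows "f \<in> borel_measurable borel \<Longrightarrow> (LINT x|lebesgue. f x) = (LINT x|lborel. f x)"
  by (rule integral_completion) simp

lemma saint_venant_field:
  fixes l :: "2 \<Rightarrow> nat" and F :: "('m::{finite,linorder}, 2) tensor"
  assumes ab: "a \<noteq> b" and l: "l a + l b = CARD('m)" and D: "D = sym_basis_prod l" and c: "compat (l a) a b p q"
    and \<phi>: "\<phi> \<in> test_functions UNIV"
  shows "saint_venant (field a b F D (l a) p q) \<phi> i j = 0"
proof (cases "\<exists>k. i k = j k")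
  case True
  then show ?thesis using saint_venant_equal_pair by blast
next
  case False
  let ?L = "l a" and ?u = "field a b F D (l a) p q"
  have lsum: "(\<Sum>c\<in>UNIV. l c) = CARD('m)" using l sum_UNIV_2[OF ab, of l] by simp
  define \<psi> where "\<psi> i' = partials (replicate (cnt i' a) b) (partials (replicate (cnt i' b) a) \<phi>)" for i' :: "'m \<Rightarrow> 2"
  have t\<psi>: "\<psi> i' \<in> test_functions UNIV" for i' unfolding \<psi>_def by (intro test_function_partials \<phi>)
  have ip: "integrable lborel (pairs_with a b p \<eta>)" "integrable lborel (pairs_with a b q \<eta>)" if "\<eta> \<in> test_functions UNIV" for \<eta>
    using c that unfolding compat_def by blast+
  have cntsum: "cnt i' a + cnt i' b = CARD('m)" for i' :: "'m \<Rightarrow> 2"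
    using sum_cnt[of i'] sum_UNIV_2[OF ab, of "cnt i'"] by simp
  have \<psi>0: "(LINT x|lborel. \<psi> i' x) = 0" for i'
  proof (cases "cnt i' a")
    case 0
    then have "cnt i' b \<noteq> 0" using cntsum[of i'] by (metis add_0 zero_less_card_finite less_irrefl)
    then obtain n where n: "cnt i' b = Suc n" using not0_implies_Suc by blast
    have "\<psi> i' = partial a (partials (replicate n a) \<phi>)" by (simp add: \<psi>_def 0 n partials_Cons partials_Nil)
    then show ?thesis using test_function_integral_partial[OF test_function_partials[OF \<phi>]] by simp
  next
    case (Suc n)
    have "\<psi> i' = partial b (partials (replicate n b) (partials (replicate (cnt i' b) a) \<phi>))" by (simp add: \<psi>_def Suc partials_Cons)
    then show ?thesis using test_function_integral_partial[OF test_function_partials[OF test_function_partials[OF \<phi>]]] by simp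
  qed
  define I where "I = (LINT x|lborel. pairs_with a b p (partials (replicate ?L b) (partials (replicate (l b) a) \<phi>)) x)"
  have comp: "(-1) ^ cnt i' a * (LINT x|lebesgue. ?u x $ i' * \<psi> i' x) = (-1) ^ ?L * I * D $ i' + (if i' = (\<lambda>k. b) then (-1) ^ Suc ?L * I else 0)" for i'
  proof -
    define d where "d = (of_bool (i' = (\<lambda>k. b)) :: real)"
    have eq: "?u x $ i' * \<psi> i' x = F $ i' * \<psi> i' x + D $ i' * pairs_with a b p (\<psi> i') x + ((-1) ^ Suc ?L * d) * pairs_with a b q (\<psi> i') x" for x
      by (simp add: field_def pure_tensor_def pairs_with_def d_def algebra_simps)
    have int: "integrable lborel (\<psi> i')" by (rule test_function_integrable[OF t\<psi>])
    note ip' = ip[OF t\<psi>[of i']]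
    have int3: "integrable lborel (\<lambda>x. ?u x $ i' * \<psi> i' x)" unfolding eq using int ip' by auto
    have "(LINT x|lebesgue. ?u x $ i' * \<psi> i' x) = (LINT x|lborel. ?u x $ i' * \<psi> i' x)"
      by (rule lebesgue_integral_lborel) (use borel_measurable_integrable[OF int3] in simp)
    also have "\<dots> = D $ i' * (LINT x|lborel. pairs_with a b p (\<psi> i') x) + ((-1) ^ Suc ?L * d) * (LINT x|lborel. pairs_with a b q (\<psi> i') x)"
      unfolding eq using int ip' \<psi>0[of i'] by simp
    finally have e: "(LINT x|lebesgue. ?u x $ i' * \<psi> i' x) = \<dots>" .
    have 1: "(-1) ^ cnt i' a * (D $ i' * (LINT x|lborel. pairs_with a b p (\<psi> i') x)) = (-1) ^ ?L * I * D $ i'"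
    proof (cases "D $ i' = 0")
      case False
      then have "cnt i' = l" using sym_basis_prod_nonzero[OF lsum] D by metis
      then show ?thesis by (simp add: \<psi>_def I_def)
    qed simp
    have 2: "(-1) ^ cnt i' a * (((-1) ^ Suc ?L * d) * (LINT x|lborel. pairs_with a b q (\<psi> i') x)) = (if i' = (\<lambda>k. b) then (-1) ^ Suc ?L * I else 0)"
    proof (cases "i' = (\<lambda>k. b)")
      case True
      then have cn: "cnt i' a = 0" "cnt i' b = ?L + l b" using ab l by (simp_all add: cnt_def)
      have "\<psi> i' = partials (replicate ?L a) (partials (replicate (l b) a) \<phi>)"
        unfolding \<psi>_def cn by (simp add: partials_Nil replicate_add partials_append)
      then have "(LINT x|lborel. pairs_with a b q (\<psi> i') x) = I"
        unfolding I_def using c test_function_partials[OF \<phi>, of "replicate (l b) a"] unfolding compat_def by simp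
      moreover have "cnt (\<lambda>k::'m. b) a = 0" using ab by (simp add: cnt_def)
      ultimately show ?thesis using True by (simp add: d_def)
    qed (simp add: d_def)
    show ?thesis unfolding e distrib_left 1 2 ..
  qed
  have "(\<Sum>i'\<in>UNIV. (-1) ^ cnt i' a * (LINT x|lebesgue. ?u x $ i' * \<psi> i' x)) = (-1) ^ ?L * I * (\<Sum>i'\<in>UNIV. D $ i') + (-1) ^ Suc ?L * I"
    unfolding comp sum.distrib sum_distrib_left[symmetric] by simp
  also have "\<dots> = 0" unfolding D sym_basis_prod_sum[OF lsum] by simp
  finally show ?thesis using saint_venant_distinct_pairs[OF ab _ \<phi>, of i j ?u] False unfolding \<psi>_def by simp
qed

lemma Sym_field:
  fixes F :: "('m::{finite,linorder}, 2) tensor"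
  assumes "F \<in> Sym" "D \<in> Sym" shows "field a b F D L p q x \<in> Sym"
proof -
  have "(i \<circ> \<tau> = (\<lambda>k. b)) = (i = (\<lambda>k. b))" if "\<tau> permutes UNIV" for \<tau> :: "'m \<Rightarrow> 'm" and i :: "'m \<Rightarrow> 2"
    using permutes_surj[OF that] by (metis (no_types, lifting) comp_apply ext surjD)
  then show ?thesis using assms by (simp add: Sym_def field_def pure_tensor_def)
qed

lemma bounded_L2_loc:
  fixes u :: "real ^ 'd::finite \<Rightarrow> 'a::euclidean_space"
  assumes m: "u \<in> borel_measurable borel" and B: "\<And>x. norm (u x) \<le> B"
  shows "u \<in> L2_loc"
proof -
  have um: "u \<in> borel_measurable lebesgue" by (rule measurable_completion) (simp add: m)
  have "set_integrable lebesgue K (\<lambda>x. (norm (u x))\<^sup>2)" if "compact K" for K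
  proof (rule set_integrable_bound[where f = "\<lambda>x. B\<^sup>2"])
    show "set_integrable lebesgue K (\<lambda>x. B\<^sup>2)"
      unfolding set_integrable_def using lmeasurable_compact[OF that] by (auto simp: fmeasurable_def)
    show "set_borel_measurable lebesgue K (\<lambda>x. (norm (u x))\<^sup>2)"
      unfolding set_borel_measurable_def using um lmeasurable_compact[OF that] by (auto simp: fmeasurable_def)
    show "AE x in lebesgue. x \<in> K \<longrightarrow> norm ((norm (u x))\<^sup>2) \<le> norm (B\<^sup>2)"
      using B by (auto intro!: AE_I2 power_mono)
  qed
  then show ?thesis using um by (simp add: L2_loc_def)
qed

lemma field_admissible:
  fixes l :: "2 \<Rightarrow> nat" and F :: "('m::{finite,linorder}, 2) tensor"
  assumes ab: "a \<noteq> b" and l: "l a + l b = CARD('m)" and D: "D = sym_basis_prod l" and c: "compat (l a) a b p q"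
    and S: "F \<in> Sym" "D \<in> Sym" and B: "\<And>s t. \<bar>p s t\<bar> \<le> B" "\<And>s t. \<bar>q s t\<bar> \<le> B"
    and out: "\<And>s t. s \<le> 0 \<or> s > 1 \<or> t \<le> 0 \<or> t \<ge> 1 \<Longrightarrow> p s t = 0 \<and> q s t = 0"
  shows "field a b F D (l a) p q \<in> admissible (box 0 1) F"
proof -
  let ?u = "field a b F D (l a) p q"
  have m[measurable]: "(\<lambda>x. p (x $ a) (x $ b)) \<in> borel_measurable borel" "(\<lambda>x. q (x $ a) (x $ b)) \<in> borel_measurable borel"
    using c unfolding compat_def by blast+
  have "?u \<in> borel_measurable borel" unfolding field_def[abs_def] by measurable
  moreover have "norm (?u x) \<le> norm F + B * norm D + B * norm (pure_tensor b :: ('m, 2) tensor)" for x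
    unfolding field_def
    by (intro order_trans[OF norm_triangle_ineq] add_mono order_refl) (use B in \<open>auto simp: abs_mult power_abs intro!: mult_right_mono\<close>)
  ultimately have "?u \<in> L2_loc" by (rule bounded_L2_loc)
  moreover have "?u x = F" if "x \<notin> closure (box 0 1)" for x
  proof -
    have "box (0 :: real ^ 2) 1 \<noteq> {}" by (simp add: interval_ne_empty_cart)
    then have "x \<notin> cbox 0 1" using that by (simp add: closure_box)
    then have "x $ a < 0 \<or> x $ a > 1 \<or> x $ b < 0 \<or> x $ b > 1"
      using all_2_pair[OF ab, of "\<lambda>c. 0 \<le> x $ c \<and> x $ c \<le> 1"] by (auto simp: mem_box_cart)
    then have "p (x $ a) (x $ b) = 0 \<and> q (x $ a) (x $ b) = 0" by (intro out) auto
    then show ?thesis by (simp add: field_def)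
  qed
  ultimately show ?thesis
    unfolding admissible_def using saint_venant_field[OF ab l D c] Sym_field[OF S] by (auto intro!: AE_I2)
qed

section \<open>Upper bound in two dimensions\<close>

lemma phase_field_BV:
  fixes l :: "2 \<Rightarrow> nat" and A B :: "('m::{finite,linorder}, 2) tensor"
  assumes ab: "a \<noteq> b" and l: "l a + l b = CARD('m)" and AB: "A - B = sym_basis_prod l"
    and f: "\<And>s t. 0 < s \<Longrightarrow> s < 1 \<Longrightarrow> 0 < t \<Longrightarrow> t < 1 \<Longrightarrow> \<bar>f s t\<bar> = 1/2 \<and> f s t = 1/2 + h s t"
    and m: "(\<lambda>x. f (x $ a) (x $ b)) \<in> borel_measurable borel" and h: "surf a b h P"
  defines "chi \<equiv> \<lambda>x. (1/2) *\<^sub>R A + (1/2) *\<^sub>R B + f (x $ a) (x $ b) *\<^sub>R (A - B)"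
  shows "chi \<in> BV (box 0 1) {A, B}" "total_variation (box 0 1) chi \<le> ennreal (2 * P)"
proof -
  let ?\<Omega> = "box 0 1 :: (real ^ 2) set"
  have lsum: "(\<Sum>c\<in>UNIV. l c) = CARD('m)" using l sum_UNIV_2[OF ab, of l] by simp
  have in\<Omega>: "0 < x $ a \<and> x $ a < 1 \<and> 0 < x $ b \<and> x $ b < 1" if "x \<in> ?\<Omega>" for x
    using that by (simp add: mem_box_cart)
  have chi_AB: "chi x \<in> {A, B}" if "x \<in> ?\<Omega>" for x
  proof -
    have "f (x $ a) (x $ b) = 1/2 \<or> f (x $ a) (x $ b) = -1/2" using f[of "x $ a" "x $ b"] in\<Omega>[OF that] by (auto simp: abs_if split: if_splits)
    then have "chi x = (1/2) *\<^sub>R A + (1/2) *\<^sub>R B + (1/2) *\<^sub>R (A - B) \<or> chi x = (1/2) *\<^sub>R A + (1/2) *\<^sub>R B + (-1/2) *\<^sub>R (A - B)"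
      by (auto simp: chi_def)
    then have "chi x = A \<or> chi x = B"
      by (auto simp: vec_eq_iff field_simps)
    then show ?thesis by simp
  qed
  define e where "e = (1/2) *\<^sub>R A + (1/2) *\<^sub>R B + (1/2) *\<^sub>R (A - B)"
  have chi_h: "chi x = e + h (x $ a) (x $ b) *\<^sub>R (A - B)" if "x \<in> ?\<Omega>" for x
  proof -
    have "f (x $ a) (x $ b) = 1/2 + h (x $ a) (x $ b)" using f in\<Omega>[OF that] by blast
    then show ?thesis by (simp add: chi_def e_def scaleR_add_left)
  qed
  have chim: "chi \<in> borel_measurable borel" using m unfolding chi_def by measurable
  have "set_integrable lebesgue ?\<Omega> chi"
  proof (rule set_integrable_bound[where f = "\<lambda>x. norm A + norm B"])
    have "emeasure lborel ?\<Omega> < \<infinity>" by (rule emeasure_lborel_box_finite)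
    then show "set_integrable lebesgue ?\<Omega> (\<lambda>x. norm A + norm B)"
      unfolding set_integrable_def by simp
    show "set_borel_measurable lebesgue ?\<Omega> chi"
      unfolding set_borel_measurable_def using chim by (intro borel_measurable_scaleR borel_measurable_indicator measurable_completion) auto
    show "AE x in lebesgue. x \<in> ?\<Omega> \<longrightarrow> norm (chi x) \<le> norm (norm A + norm B)"
    proof (intro AE_I2 impI)
      fix x :: "real ^ 2" assume "x \<in> ?\<Omega>"
      from chi_AB[OF this] show "norm (chi x) \<le> norm (norm A + norm B)" by auto
    qed
  qed
  moreover show tv: "total_variation ?\<Omega> chi \<le> ennreal (2 * P)"
    unfolding total_variation_def
  proof (rule SUP_least, rule ennreal_leI, clarify)
    fix \<psi> :: "real ^ 2 \<Rightarrow> (real ^ 2) ^ ('m \<Rightarrow> 2)"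
    assume t: "\<forall>i c. (\<lambda>x. \<psi> x $ i $ c) \<in> test_functions ?\<Omega>" and b: "\<forall>x. norm (\<psi> x) \<le> 1"
    define \<eta> where "\<eta> i c = (\<lambda>x. \<psi> x $ i $ c)" for i c
    have tf: "\<eta> i c \<in> test_functions ?\<Omega>" for i c using t by (simp add: \<eta>_def)
    have tf': "\<eta> i c \<in> test_functions UNIV" for i c using tf test_functions_mono[OF subset_UNIV] by blast
    have b': "\<bar>\<eta> i c x\<bar> \<le> 1" for i c x
    proof -
      have "\<bar>\<psi> x $ i $ c\<bar> \<le> norm (\<psi> x $ i)" by (rule component_le_norm_cart)
      also have "\<dots> \<le> norm (\<psi> x)" by (rule Finite_Cartesian_Product.norm_nth_le)
      finally show ?thesis using b by (auto simp: \<eta>_def intro: order_trans)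
    qed
    let ?g = "\<lambda>i c x. partial c (\<eta> i c) x"
    have ig: "integrable lborel (?g i c)" for i c by (rule test_function_integrable[OF test_function_partial[OF tf]])
    have ih: "integrable lborel (pairs_with a b h (?g i c))" for i c
      using h test_function_partial[OF tf'] unfolding surf_def by blast
    have z: "indicator ?\<Omega> x *\<^sub>R (chi x $ i * ?g i c x) = e $ i * ?g i c x + (A - B) $ i * pairs_with a b h (?g i c) x" for i c x
    proof (cases "x \<in> ?\<Omega>")
      case True
      then show ?thesis by (simp add: chi_h pairs_with_def algebra_simps)
    next
      case False
      obtain K where K: "K \<subseteq> ?\<Omega>" "\<And>x. x \<notin> K \<Longrightarrow> ?g i c x = 0"
        using test_function_support[OF test_function_partial[OF tf[of i c], of c]] by metis
      then have "?g i c x = 0" using False by blast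
      then show ?thesis by (simp add: pairs_with_def)
    qed
    have iz: "integrable lborel (\<lambda>x. e $ i * ?g i c x + (A - B) $ i * pairs_with a b h (?g i c) x)" for i c
      using ig ih by auto
    have trm: "(LINT x|lborel. e $ i * ?g i c x + (A - B) $ i * pairs_with a b h (?g i c) x) \<le> (A - B) $ i * P" for i c
    proof -
      have "(LINT x|lborel. e $ i * ?g i c x + (A - B) $ i * pairs_with a b h (?g i c) x) = (A - B) $ i * (LINT x|lborel. pairs_with a b h (?g i c) x)"
        using ig ih test_function_integral_partial[OF tf[of i c], of c] by simp
      also have "\<dots> \<le> (A - B) $ i * P"
      proof (rule mult_left_mono)
        show "0 \<le> (A - B) $ i" unfolding AB by (rule sym_basis_prod_nonneg[OF lsum])
        have "\<bar>LINT x|lborel. pairs_with a b h (?g i c) x\<bar> \<le> P" using h tf'[of i c] b'[of i c] unfolding surf_def by blast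
        then show "(LINT x|lborel. pairs_with a b h (?g i c) x) \<le> P" by linarith
      qed
      finally show ?thesis .
    qed
    have "(LINT x:?\<Omega>|lebesgue. (\<Sum>i\<in>UNIV. chi x $ i * (\<Sum>c\<in>UNIV. partial c (\<lambda>y. \<psi> y $ i $ c) x)))
      = (LINT x|lebesgue. (\<Sum>i\<in>UNIV. \<Sum>c\<in>UNIV. e $ i * ?g i c x + (A - B) $ i * pairs_with a b h (?g i c) x))"
      unfolding set_lebesgue_integral_def sum_distrib_left scaleR_sum_right z[symmetric]
      by (simp only: \<eta>_def)
    also have "\<dots> = (LINT x|lborel. (\<Sum>i\<in>UNIV. \<Sum>c\<in>UNIV. e $ i * ?g i c x + (A - B) $ i * pairs_with a b h (?g i c) x))"
      by (rule lebesgue_integral_lborel) (use borel_measurable_integrable[OF iz] in auto)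
    also have "\<dots> = (\<Sum>i\<in>UNIV. \<Sum>c\<in>UNIV. LINT x|lborel. e $ i * ?g i c x + (A - B) $ i * pairs_with a b h (?g i c) x)"
      using iz by (simp only: Bochner_Integration.integral_sum Bochner_Integration.integrable_sum)
    also have "\<dots> \<le> (\<Sum>i\<in>UNIV. \<Sum>c::2\<in>UNIV. (A - B) $ i * P)" by (intro sum_mono trm)
    also have "\<dots> = 2 * P * (\<Sum>i\<in>UNIV. (A - B) $ i)" by (simp add: sum_distrib_left algebra_simps)
    also have "\<dots> = 2 * P" unfolding AB sym_basis_prod_sum[OF lsum] by simp
    finally show "(LINT x:?\<Omega>|lebesgue. (\<Sum>i\<in>UNIV. chi x $ i * (\<Sum>c\<in>UNIV. partial c (\<lambda>y. \<psi> y $ i $ c) x))) \<le> 2 * P" .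
  qed
  moreover have "total_variation ?\<Omega> chi < \<infinity>" using tv ennreal_less_top[of "2 * P"] by (simp add: le_less_trans)
  ultimately show "chi \<in> BV ?\<Omega> {A, B}" using chi_AB by (simp add: BV_def)
qed

text \<open>\<open>D\<close> and the pure tensor have disjoint supports, and the components of \<open>D\<close> are nonnegative with sum one.\<close>

lemma field_distance:
  fixes l :: "2 \<Rightarrow> nat" and F :: "('m::{finite,linorder}, 2) tensor"
  assumes ab: "a \<noteq> b" and l: "l a + l b = CARD('m)" "l a \<ge> 1" and D: "D = sym_basis_prod l"
  shows "(norm (field a b F D (l a) p q x - (F + f *\<^sub>R D)))\<^sup>2 \<le> (p (x $ a) (x $ b) - f)\<^sup>2 + (q (x $ a) (x $ b))\<^sup>2"
proof -
  have lsum: "(\<Sum>c\<in>UNIV. l c) = CARD('m)" using l sum_UNIV_2[OF ab, of l] by simp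
  define P where "P = p (x $ a) (x $ b) - f"
  define Q where "Q = (-1) ^ Suc (l a) * q (x $ a) (x $ b)"
  define E where "E = (pure_tensor b :: ('m, 2) tensor)"
  have v: "field a b F D (l a) p q x - (F + f *\<^sub>R D) = P *\<^sub>R D + Q *\<^sub>R E"
    by (simp add: field_def P_def Q_def E_def scaleR_diff_left)
  have "cnt (\<lambda>k::'m. b) a = 0" using ab by (simp add: cnt_def)
  then have "cnt (\<lambda>k::'m. b) \<noteq> l" using l(2) by auto
  then have "D $ (\<lambda>k. b) = 0" using sym_basis_prod_nonzero[OF lsum] D by metis
  then have DE: "D $ i * E $ i = 0" for i by (auto simp: E_def pure_tensor_def)
  have D1: "0 \<le> D $ i" for i unfolding D by (rule sym_basis_prod_nonneg[OF lsum])
  have Ds: "(\<Sum>i\<in>UNIV. D $ i) = 1" unfolding D by (rule sym_basis_prod_sum[OF lsum])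
  have D2: "D $ i \<le> 1" for i using member_le_sum[of i UNIV "\<lambda>i. D $ i"] D1 Ds by simp
  have "(norm (P *\<^sub>R D + Q *\<^sub>R E))\<^sup>2 = (\<Sum>i\<in>UNIV. (P * D $ i + Q * E $ i)\<^sup>2)"
    unfolding power2_norm_eq_inner inner_vec_def by (simp add: power2_eq_square)
  also have "\<dots> = (\<Sum>i\<in>UNIV. P\<^sup>2 * (D $ i)\<^sup>2 + Q\<^sup>2 * (E $ i)\<^sup>2)"
  proof (rule sum.cong[OF refl])
    fix i
    have "(P * D $ i + Q * E $ i)\<^sup>2 = P\<^sup>2 * (D $ i)\<^sup>2 + Q\<^sup>2 * (E $ i)\<^sup>2 + 2 * P * Q * (D $ i * E $ i)"
      by (simp add: power2_eq_square algebra_simps)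
    then show "(P * D $ i + Q * E $ i)\<^sup>2 = P\<^sup>2 * (D $ i)\<^sup>2 + Q\<^sup>2 * (E $ i)\<^sup>2" by (simp add: DE)
  qed
  also have "\<dots> = P\<^sup>2 * (\<Sum>i\<in>UNIV. (D $ i)\<^sup>2) + Q\<^sup>2 * (\<Sum>i\<in>UNIV. (E $ i)\<^sup>2)" by (simp add: sum.distrib sum_distrib_left)
  also have "\<dots> \<le> P\<^sup>2 * 1 + Q\<^sup>2 * 1"
  proof (intro add_mono mult_left_mono)
    have "(\<Sum>i\<in>UNIV. (D $ i)\<^sup>2) \<le> (\<Sum>i\<in>UNIV. D $ i)"
      by (intro sum_mono) (use D1 D2 in \<open>auto simp: power2_eq_square intro: mult_left_le\<close>)
    then show "(\<Sum>i\<in>UNIV. (D $ i)\<^sup>2) \<le> 1" using Ds by simp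
    have "(E $ i)\<^sup>2 = of_bool (i = (\<lambda>k. b))" for i by (simp add: E_def pure_tensor_def)
    then show "(\<Sum>i\<in>UNIV. (E $ i)\<^sup>2) \<le> 1" by simp
  qed auto
  also have "Q\<^sup>2 = (q (x $ a) (x $ b))\<^sup>2" by (simp add: Q_def power_mult_distrib power_even_eq[symmetric] power2_eq_square)
  finally show ?thesis unfolding v P_def by simp
qed

lemma upper_bound:
  fixes l :: "2 \<Rightarrow> nat"
  assumes ab: "a \<noteq> b" and l: "l a + l b = CARD('m::{finite,linorder})" "l a \<ge> 1"
  shows "\<exists>C>0. \<forall>A\<in>Sym. \<forall>B\<in>Sym. (A :: ('m, 2) tensor) - B = sym_basis_prod l \<longrightarrow> (\<forall>eps. 0 < eps \<and> eps < 1 \<longrightarrow>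
    inf_energy (box 0 1) eps A B ((1/2) *\<^sub>R A + (1/2) *\<^sub>R B) \<le> ennreal (C * rate (l a) eps))"
proof -
  let ?\<Omega> = "box 0 1 :: (real ^ 2) set" and ?L = "l a"
  obtain C where C: "C > 0" "\<And>M. \<exists>p q f D. branching_data ?L a b C M p q f D"
    by (rule branching[OF ab l(2)]) (rule that)
  show ?thesis
  proof (intro exI[of _ "C * (4 ^ ?L + 2)"] conjI ballI impI allI)
    show "C * (4 ^ ?L + 2) > 0" using C(1) by (simp add: add_pos_pos)
    fix A B :: "('m, 2) tensor" and eps :: real
    assume AS: "A \<in> Sym" and BS: "B \<in> Sym" and AB: "A - B = sym_basis_prod l" and eps: "0 < eps \<and> eps < 1"
    define F where "F = (1/2) *\<^sub>R A + (1/2) *\<^sub>R B"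
    have FS: "F \<in> Sym" "A - B \<in> Sym" using AS BS by (simp_all add: Sym_def F_def)
    \<comment> \<open>The number \<open>2\<^sup>M\<close> of cells balances the elastic energy \<open>2\<^bsup>-2LM\<^esup>\<close> and the surface energy \<open>\<epsilon> 2\<^sup>M\<close>.\<close>
    define x where "x = eps powr (1 / (2 * real ?L + 1))"
    have x0: "0 < x" "x \<le> 1" using eps by (auto simp: x_def powr_le_one_le intro: powr_le1)
    obtain M where M: "x \<le> 1 / 2 ^ M" "1 / 2 ^ M < 2 * x" by (rule exists_dyadic[OF x0])
    have xp: "x ^ n = eps powr (real n / (2 * real ?L + 1))" for n
      using eps by (simp add: x_def powr_realpow[symmetric] powr_powr)
    have xL: "x ^ (2 * ?L) = rate ?L eps" by (simp add: xp)
    have "real (2 * ?L + 1) / (2 * real ?L + 1) = 1" by simp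
    then have "x ^ (2 * ?L + 1) = eps powr 1" using xp[of "2 * ?L + 1"] by metis
    then have xe: "x ^ (2 * ?L + 1) = eps" using eps by simp
    obtain p q f h K where c: "compat ?L a b p q"
      and out: "\<forall>s t. s \<le> 0 \<or> s > 1 \<or> t \<le> 0 \<or> t \<ge> 1 \<longrightarrow> p s t = 0 \<and> q s t = 0"
      and bd: "\<forall>s t. \<bar>p s t\<bar> \<le> K \<and> \<bar>q s t\<bar> \<le> K"
      and f: "\<forall>s t. 0 < s \<and> s < 1 \<and> 0 < t \<and> t < 1 \<longrightarrow> \<bar>f s t\<bar> = 1/2 \<and> f s t = 1/2 + h s t"
      and fm: "(\<lambda>x. f (x $ a) (x $ b)) \<in> borel_measurable borel" and h: "surf a b h (C * 2 ^ M)"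
      and en: "(\<integral>\<^sup>+x\<in>?\<Omega>. ennreal ((p (x $ a) (x $ b) - f (x $ a) (x $ b))\<^sup>2 + (q (x $ a) (x $ b))\<^sup>2) \<partial>lebesgue) \<le> ennreal (C * (1/2) ^ (2 * ?L * M))"
      using C(2)[of M] by (elim exE conjE) (rule that)
    have K: "\<And>s t. \<bar>p s t\<bar> \<le> K" "\<And>s t. \<bar>q s t\<bar> \<le> K" using bd by blast+
    define u where "u = field a b F (A - B) ?L p q"
    define chi where "chi y = F + f (y $ a) (y $ b) *\<^sub>R (A - B)" for y :: "real ^ 2"
    have u: "u \<in> admissible ?\<Omega> F"
      unfolding u_def by (rule field_admissible[OF ab l(1) AB c FS K]) (use out in blast)
    have f': "\<bar>f s t\<bar> = 1/2 \<and> f s t = 1/2 + h s t" if "0 < s" "s < 1" "0 < t" "t < 1" for s t using f that by blast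
    have chi: "chi \<in> BV ?\<Omega> {A, B}" "total_variation ?\<Omega> chi \<le> ennreal (2 * (C * 2 ^ M))"
      using phase_field_BV[OF ab l(1) AB f' fm h] unfolding chi_def[abs_def] F_def by blast+
    have "inf_energy ?\<Omega> eps A B F \<le> energy ?\<Omega> eps chi F" by (rule INF_lower[OF chi(1)])
    also have "\<dots> \<le> (\<integral>\<^sup>+x\<in>?\<Omega>. ennreal ((norm (u x - chi x))\<^sup>2) \<partial>lebesgue) + ennreal eps * total_variation ?\<Omega> chi"
      unfolding energy_def by (intro add_right_mono INF_lower u)
    also have "\<dots> \<le> ennreal (C * (1/2) ^ (2 * ?L * M)) + ennreal eps * ennreal (2 * (C * 2 ^ M))"
    proof (intro add_mono mult_left_mono chi)
      have "ennreal ((norm (u y - chi y))\<^sup>2) * indicator ?\<Omega> y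
         \<le> ennreal ((p (y $ a) (y $ b) - f (y $ a) (y $ b))\<^sup>2 + (q (y $ a) (y $ b))\<^sup>2) * indicator ?\<Omega> y" for y
        unfolding u_def chi_def by (intro mult_right_mono ennreal_leI field_distance[OF ab l AB]) simp
      then have "(\<integral>\<^sup>+x\<in>?\<Omega>. ennreal ((norm (u x - chi x))\<^sup>2) \<partial>lebesgue)
         \<le> (\<integral>\<^sup>+x\<in>?\<Omega>. ennreal ((p (x $ a) (x $ b) - f (x $ a) (x $ b))\<^sup>2 + (q (x $ a) (x $ b))\<^sup>2) \<partial>lebesgue)"
        by (rule nn_integral_mono)
      also note en
      finally show "(\<integral>\<^sup>+x\<in>?\<Omega>. ennreal ((norm (u x - chi x))\<^sup>2) \<partial>lebesgue) \<le> ennreal (C * (1/2) ^ (2 * ?L * M))" .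
    qed auto
    also have "\<dots> = ennreal (C * (1/2) ^ (2 * ?L * M) + eps * (2 * (C * 2 ^ M)))"
    proof -
      have e: "ennreal eps * ennreal (2 * (C * 2 ^ M)) = ennreal (eps * (2 * (C * 2 ^ M)))"
        using C(1) eps by (intro ennreal_mult[symmetric]) auto
      show ?thesis unfolding e using C(1) eps by (intro ennreal_plus[symmetric]) auto
    qed
    also have "\<dots> \<le> ennreal (C * (4 ^ ?L + 2) * rate ?L eps)"
    proof (rule ennreal_leI)
      have "((1::real)/2) ^ (2 * ?L * M) = (1 / 2 ^ M) ^ (2 * ?L)" by (simp add: power_one_over power_mult[symmetric] mult.commute)
      also have "\<dots> \<le> (2 * x) ^ (2 * ?L)" using M by (intro power_mono) auto
      also have "\<dots> = 4 ^ ?L * x ^ (2 * ?L)" by (simp add: power_mult_distrib power_mult)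
      finally have 1: "((1::real)/2) ^ (2 * ?L * M) \<le> 4 ^ ?L * x ^ (2 * ?L)" .
      have "x * 2 ^ M \<le> 1" using M(1) by (simp add: field_simps)
      then have "x ^ (2 * ?L) * (x * 2 ^ M) \<le> x ^ (2 * ?L) * 1" using x0 by (intro mult_left_mono) auto
      then have 2: "eps * 2 ^ M \<le> x ^ (2 * ?L)" unfolding xe[symmetric] by (simp add: mult.assoc mult.left_commute)
      have "C * (1/2) ^ (2 * ?L * M) + eps * (2 * (C * 2 ^ M)) = C * ((1/2) ^ (2 * ?L * M) + 2 * (eps * 2 ^ M))"
        by (simp add: algebra_simps)
      also have "\<dots> \<le> C * (4 ^ ?L * x ^ (2 * ?L) + 2 * x ^ (2 * ?L))" using C(1) 1 2 by (intro mult_left_mono add_mono) auto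
      finally show "C * (1/2) ^ (2 * ?L * M) + eps * (2 * (C * 2 ^ M)) \<le> C * (4 ^ ?L + 2) * rate ?L eps"
        unfolding xL[symmetric] by (simp add: algebra_simps)
    qed
    finally show "inf_energy ?\<Omega> eps A B ((1/2) *\<^sub>R A + (1/2) *\<^sub>R B) \<le> ennreal (C * (4 ^ ?L + 2) * rate ?L eps)"
      unfolding F_def .
  qed
qed

section \<open>Conclusion\<close>

lemma exponents_finite: "finite {l :: 'd::{finite,linorder} \<Rightarrow> nat. (\<Sum>c\<in>UNIV. l c) = CARD('m::{finite,linorder})}"
proof (rule finite_subset)
  show "{l. (\<Sum>c\<in>UNIV. l c) = CARD('m)} \<subseteq> range (cnt :: ('m \<Rightarrow> 'd) \<Rightarrow> _)"
  proof
    fix l :: "'d \<Rightarrow> nat" assume "l \<in> {l. (\<Sum>c\<in>UNIV. l c) = CARD('m)}"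
    then have "l = cnt (basis_indices l :: 'm \<Rightarrow> 'd)" by (intro ext cnt_basis_indices[symmetric]) simp
    then show "l \<in> range (cnt :: ('m \<Rightarrow> 'd) \<Rightarrow> _)" by (metis rangeI)
  qed
qed simp

lemma regular_unit_square: "regular_domain (box 0 1 :: (real ^ 'd::finite) set)"
  unfolding regular_domain_def
  by (auto simp: negligible_convex_frontier bounded_box interval_ne_empty_cart)

lemma lower_bound_uniform:
  fixes \<Omega> :: "(real ^ 'd::{finite,linorder}) set"
  assumes \<Omega>: "regular_domain \<Omega>" and d: "CARD('d) \<ge> 2"
  shows "\<exists>C>0. \<exists>eps0>0. \<forall>lam. 0 < lam \<and> lam < 1 \<longrightarrow> (\<forall>(A :: ('m::{finite,linorder}, 'd) tensor) B l.
    (\<Sum>c\<in>UNIV. l c) = CARD('m) \<longrightarrow> A - B = sym_basis_prod l \<longrightarrow> (\<forall>eps. 0 < eps \<and> eps < eps0 \<longrightarrow>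
      ennreal (C * (min (1 - lam) lam)\<^sup>2 * rate (Max (range l)) eps)
        \<le> inf_energy \<Omega> eps A B (lam *\<^sub>R A + (1 - lam) *\<^sub>R B)))"
proof -
  define S where "S = {l :: 'd \<Rightarrow> nat. (\<Sum>c\<in>UNIV. l c) = CARD('m)}"
  have S: "finite S" unfolding S_def by (rule exponents_finite)
  define e where "e l lam eps = (min (1 - lam) lam)\<^sup>2 * rate (Max (range l)) eps"
    for l :: "'d \<Rightarrow> nat" and lam eps :: real
  define J where "J eps lam A B = inf_energy \<Omega> eps A B (lam *\<^sub>R A + (1 - lam) *\<^sub>R B)"
    for eps lam and A B :: "('m, 'd) tensor"
  define lo where "lo l C eps0 \<longleftrightarrow> C > 0 \<and> eps0 > 0 \<and> (\<forall>lam. 0 < lam \<and> lam < 1 \<longrightarrow> (\<forall>(A :: ('m, 'd) tensor) B. A - B = sym_basis_prod l \<longrightarrow>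
      (\<forall>eps. 0 < eps \<and> eps < eps0 \<longrightarrow> ennreal (C * e l lam eps) \<le> J eps lam A B)))" for l C eps0
  have "\<exists>C>0. \<exists>eps0>0. \<forall>lam. 0 < lam \<and> lam < 1 \<longrightarrow> (\<forall>(A :: ('m, 'd) tensor) B. A - B = sym_basis_prod l \<longrightarrow>
      (\<forall>eps. 0 < eps \<and> eps < eps0 \<longrightarrow> ennreal (C * e l lam eps) \<le> J eps lam A B))" if "l \<in> S" for l
    using lower_bound[OF \<Omega> d, of l, where 'm = 'm] that unfolding S_def e_def J_def mult.assoc by simp
  then have "\<forall>l. \<exists>C eps0. l \<in> S \<longrightarrow> lo l C eps0" unfolding lo_def by blast
  then obtain c \<epsilon> where "\<And>l. l \<in> S \<Longrightarrow> lo l (c l) (\<epsilon> l)" by metis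
  then have c: "\<And>l. l \<in> S \<Longrightarrow> c l > 0" "\<And>l. l \<in> S \<Longrightarrow> \<epsilon> l > 0"
    "\<And>l lam A B eps. l \<in> S \<Longrightarrow> 0 < lam \<Longrightarrow> lam < 1 \<Longrightarrow> A - B = sym_basis_prod l \<Longrightarrow> 0 < eps \<Longrightarrow> eps < \<epsilon> l \<Longrightarrow> ennreal (c l * e l lam eps) \<le> J eps lam A B"
    unfolding lo_def by blast+
  define C where "C = Min (insert 1 (c ` S))"
  define eps0 where "eps0 = Min (insert 1 (\<epsilon> ` S))"
  have C0: "C > 0" and eps0: "eps0 > 0" unfolding C_def eps0_def using S c(1,2) by simp_all
  have Cl: "C \<le> c l" "eps0 \<le> \<epsilon> l" if "l \<in> S" for l unfolding C_def eps0_def by (rule Min_le; use S that in simp)+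
  show ?thesis
  proof (rule exI[of _ C], rule conjI[OF C0], rule exI[of _ eps0], rule conjI[OF eps0], intro allI impI)
    fix lam eps :: real and A B :: "('m, 'd) tensor" and l :: "'d \<Rightarrow> nat"
    assume lam: "0 < lam \<and> lam < 1" and l: "(\<Sum>c\<in>UNIV. l c) = CARD('m)" and AB: "A - B = sym_basis_prod l" and eps: "0 < eps \<and> eps < eps0"
    have lS: "l \<in> S" using l by (simp add: S_def)
    have "ennreal (C * e l lam eps) \<le> ennreal (c l * e l lam eps)"
      by (intro ennreal_leI mult_right_mono Cl lS) (simp add: e_def)
    also have "\<dots> \<le> J eps lam A B" using c(3)[OF lS _ _ AB] lam eps Cl(2)[OF lS] by simp
    finally show "ennreal (C * (min (1 - lam) lam)\<^sup>2 * rate (Max (range l)) eps)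
        \<le> inf_energy \<Omega> eps A B (lam *\<^sub>R A + (1 - lam) *\<^sub>R B)"
      unfolding e_def J_def mult.assoc .
  qed
qed

lemma sharp_bounds_square:
  "\<exists>C>1. \<exists>eps0>0. \<forall>(A :: ('m::{finite,linorder}, 2) tensor) B l1 l2.
    A \<in> Sym \<longrightarrow> B \<in> Sym \<longrightarrow> l1 + l2 = CARD('m) \<longrightarrow> A - B = sym_basis_prod (\<lambda>a. if a = 1 then l1 else l2) \<longrightarrow>
    (\<forall>eps. 0 < eps \<and> eps < eps0 \<longrightarrow>
      ennreal (inverse C * rate (max l1 l2) eps)
        \<le> inf_energy (box 0 1) eps A B ((1/2) *\<^sub>R A + (1/2) *\<^sub>R B) \<and>
      inf_energy (box 0 1) eps A B ((1/2) *\<^sub>R A + (1/2) *\<^sub>R B)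
        \<le> ennreal (C * rate (max l1 l2) eps))"
proof -
  let ?m = "CARD('m)"
  define l where "l k = (\<lambda>a::2. if a = 1 then k else ?m - k)" for k
  define L where "L k = max k (?m - k)" for k
  define J where "J eps A B = inf_energy (box 0 1) eps A B ((1/2) *\<^sub>R A + (1/2) *\<^sub>R B)"
    for eps and A B :: "('m, 2) tensor"
  define e where "e k eps = rate (L k) eps" for k and eps :: real
  have ne: "(1 :: 2) \<noteq> 0" by simp
  have lsum: "(\<Sum>c\<in>UNIV. l k c) = ?m" if "k \<le> ?m" for k using that by (simp add: sum_UNIV_2[OF ne] l_def)
  have "range (l k) = {l k 1, l k 0}" for k using UNIV_2_pair[OF ne] by (metis image_insert image_empty)
  then have maxl: "Max (range (l k)) = L k" for k by (simp add: L_def l_def)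
  obtain c0 \<epsilon> where c0: "c0 > 0" "\<epsilon> > 0" and low: "\<forall>lam. 0 < lam \<and> lam < 1 \<longrightarrow> (\<forall>(A :: ('m, 2) tensor) B l.
    (\<Sum>c\<in>UNIV. l c) = ?m \<longrightarrow> A - B = sym_basis_prod l \<longrightarrow> (\<forall>eps. 0 < eps \<and> eps < \<epsilon> \<longrightarrow>
      ennreal (c0 * (min (1 - lam) lam)\<^sup>2 * rate (Max (range l)) eps) \<le> inf_energy (box 0 1) eps A B (lam *\<^sub>R A + (1 - lam) *\<^sub>R B)))"
    using lower_bound_uniform[OF regular_unit_square, where 'm = 'm and 'd = 2] by (elim meta_impE exE conjE) (simp, rule that)
  define c where "c = c0 / 4"
  have c: "c > 0" using c0 by (simp add: c_def)
  have low': "ennreal (c * e k eps) \<le> J eps A B" if "k \<le> ?m" "A - B = sym_basis_prod (l k)" "0 < eps" "eps < \<epsilon>" for k A B eps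
    using low[rule_format, of "1/2" "l k" A B eps] that lsum[OF that(1)] by (simp add: maxl J_def e_def c_def power2_eq_square)
  have up: "\<exists>C>0. \<forall>A\<in>Sym. \<forall>B\<in>Sym. A - B = sym_basis_prod (l k) \<longrightarrow> (\<forall>eps. 0 < eps \<and> eps < 1 \<longrightarrow> J eps A B \<le> ennreal (C * e k eps))"
    if k: "k \<le> ?m" for k
  proof -
    define a where "a = (if ?m - k \<le> k then 1 else 0 :: 2)"
    have ab: "a \<noteq> 1 - a" by (simp add: a_def)
    have la: "l k a = L k" and l: "l k a + l k (1 - a) = ?m" using k by (auto simp: a_def l_def L_def max_def)
    have "?m \<ge> 1" using zero_less_card_finite[where 'a = 'm] by linarith
    then have "l k a \<ge> 1" unfolding la L_def by linarith
    from upper_bound[OF ab l this] show ?thesis unfolding la J_def e_def .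
  qed
  define hi where "hi k C \<longleftrightarrow> C > 0 \<and> (\<forall>A\<in>Sym. \<forall>B\<in>Sym. A - B = sym_basis_prod (l k) \<longrightarrow>
    (\<forall>eps. 0 < eps \<and> eps < 1 \<longrightarrow> J eps A B \<le> ennreal (C * e k eps)))" for k C
  have "\<forall>k. \<exists>C. k \<le> ?m \<longrightarrow> hi k C" using up unfolding hi_def by blast
  then obtain d where "\<And>k. k \<le> ?m \<Longrightarrow> hi k (d k)" by metis
  then have d: "\<And>k. k \<le> ?m \<Longrightarrow> d k > 0"
    "\<And>k A B eps. k \<le> ?m \<Longrightarrow> A \<in> Sym \<Longrightarrow> B \<in> Sym \<Longrightarrow> A - B = sym_basis_prod (l k) \<Longrightarrow> 0 < eps \<Longrightarrow> eps < 1 \<Longrightarrow> J eps A B \<le> ennreal (d k * e k eps)"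
    unfolding hi_def by blast+
  define C where "C = 1 + inverse c + (\<Sum>k\<le>?m. d k)"
  define eps0 where "eps0 = min 1 \<epsilon>"
  have dC: "0 \<le> (\<Sum>k\<le>?m. d k)" by (intro sum_nonneg) (simp add: less_imp_le[OF d(1)])
  have ic: "inverse c > 0" using c by simp
  have C1: "C > 1" and Cc: "inverse c \<le> C" unfolding C_def using dC ic by linarith+
  have eps0: "eps0 > 0" unfolding eps0_def using c0 by simp
  have cC: "inverse C \<le> c" using le_imp_inverse_le[OF Cc ic] by simp
  have dk: "d k \<le> C" if "k \<le> ?m" for k
  proof -
    have "d k \<le> (\<Sum>k\<le>?m. d k)" by (rule member_le_sum) (use that less_imp_le[OF d(1)] in auto)
    then show ?thesis unfolding C_def using ic by linarith
  qed
  show ?thesis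
  proof (rule exI[of _ C], rule conjI[OF C1], rule exI[of _ eps0], rule conjI[OF eps0], intro allI impI)
    fix A B :: "('m, 2) tensor" and l1 l2 :: nat and eps :: real
    assume AS: "A \<in> Sym" "B \<in> Sym" and l12: "l1 + l2 = ?m" and AB: "A - B = sym_basis_prod (\<lambda>a. if a = 1 then l1 else l2)"
      and eps: "0 < eps \<and> eps < eps0"
    have k: "l1 \<le> ?m" and l2: "l2 = ?m - l1" using l12 by auto
    have AB': "A - B = sym_basis_prod (l l1)" using AB unfolding l_def l2 .
    have L: "max l1 l2 = L l1" by (simp add: L_def l2)
    have e1: "eps < \<epsilon>" "eps < 1" "0 < eps" using eps by (auto simp: eps0_def)
    have e0: "e l1 eps \<ge> 0" by (simp add: e_def)
    have "ennreal (inverse C * e l1 eps) \<le> ennreal (c * e l1 eps)" by (intro ennreal_leI mult_right_mono cC e0)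
    also have "\<dots> \<le> J eps A B" by (rule low'[OF k AB' e1(3,1)])
    finally have 1: "ennreal (inverse C * e l1 eps) \<le> J eps A B" .
    have "J eps A B \<le> ennreal (d l1 * e l1 eps)" by (rule d(2)[OF k AS AB' e1(3,2)])
    also have "\<dots> \<le> ennreal (C * e l1 eps)" by (intro ennreal_leI mult_right_mono dk k e0)
    finally have "J eps A B \<le> ennreal (C * e l1 eps)" .
    with 1 show "ennreal (inverse C * rate (max l1 l2) eps)
        \<le> inf_energy (box 0 1) eps A B ((1/2) *\<^sub>R A + (1/2) *\<^sub>R B) \<and>
      inf_energy (box 0 1) eps A B ((1/2) *\<^sub>R A + (1/2) *\<^sub>R B)
        \<le> ennreal (C * rate (max l1 l2) eps)"
      unfolding L J_def e_def by blast
  qed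
qed

theorem theorem2:
  fixes \<Omega> :: "(real ^ 'd::{finite,linorder}) set"
  assumes "CARD('d) \<ge> 2" and "open \<Omega>" and "bounded \<Omega>" and "lipschitz_domain \<Omega>"
  shows
    "(\<exists>C>1. \<exists>eps\<^sub>0>0. \<forall>(A :: ('m::{finite,linorder}, 2) tensor) B l\<^sub>1 l\<^sub>2.
        A \<in> Sym \<longrightarrow> B \<in> Sym \<longrightarrow> l\<^sub>1 + l\<^sub>2 = CARD('m) \<longrightarrow>
        A - B = sym_basis_prod (\<lambda>a. if a = 1 then l\<^sub>1 else l\<^sub>2) \<longrightarrow>
        (let \<Omega>' = box 0 1; F = (1/2) *\<^sub>R A + (1/2) *\<^sub>R B; L = real (max l\<^sub>1 l\<^sub>2) in
          \<forall>eps. 0 < eps \<and> eps < eps\<^sub>0 \<longrightarrow>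
            ennreal (inverse C * eps powr (2 * L / (2 * L + 1)))
              \<le> (INF chi \<in> BV \<Omega>' {A, B}. energy \<Omega>' eps chi F) \<and>
            (INF chi \<in> BV \<Omega>' {A, B}. energy \<Omega>' eps chi F)
              \<le> ennreal (C * eps powr (2 * L / (2 * L + 1)))))
     \<and>
     (\<exists>C>0. \<forall>lam. 0 < lam \<and> lam < 1 \<longrightarrow> (\<exists>eps\<^sub>0>0. \<forall>(A :: ('m, 'd) tensor) B l.
        A \<in> Sym \<longrightarrow> B \<in> Sym \<longrightarrow> (\<Sum>j\<in>UNIV. l j) = CARD('m) \<longrightarrow>
        A - B = sym_basis_prod l \<longrightarrow>
        (let F = lam *\<^sub>R A + (1 - lam) *\<^sub>R B; L = real (Max (range l)) in
          \<forall>eps. 0 < eps \<and> eps < eps\<^sub>0 \<longrightarrow>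
            ennreal (C * (min (1 - lam) lam)\<^sup>2 * eps powr (2 * L / (2 * L + 1)))
              \<le> (INF chi \<in> BV \<Omega> {A, B}. energy \<Omega> eps chi F))))"
proof (unfold Let_def, rule conjI, goal_cases)
  case 1 show ?case by (rule sharp_bounds_square)
next
  case 2
  have "regular_domain \<Omega>"
    unfolding regular_domain_def
    using assms(2-4) negligible_frontier_lipschitz_domain[OF assms(4)] by (auto simp: lipschitz_domain_def)
  from lower_bound_uniform[OF this assms(1), where 'm = 'm]
  obtain C eps0 where C: "C > 0" "eps0 > 0" and b: "\<forall>lam. 0 < lam \<and> lam < 1 \<longrightarrow> (\<forall>(A :: ('m, 'd) tensor) B l.
    (\<Sum>c\<in>UNIV. l c) = CARD('m) \<longrightarrow> A - B = sym_basis_prod l \<longrightarrow> (\<forall>eps. 0 < eps \<and> eps < eps0 \<longrightarrow>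
      ennreal (C * (min (1 - lam) lam)\<^sup>2 * rate (Max (range l)) eps)
        \<le> inf_energy \<Omega> eps A B (lam *\<^sub>R A + (1 - lam) *\<^sub>R B)))"
    by (elim exE conjE) (rule that)
  show ?case
  proof (rule exI[of _ C], rule conjI[OF C(1)], intro allI impI, rule exI[of _ eps0], rule conjI[OF C(2)], intro allI impI)
    fix lam eps :: real and A B :: "('m, 'd) tensor" and l :: "'d \<Rightarrow> nat"
    assume "0 < lam \<and> lam < 1" "(\<Sum>j\<in>UNIV. l j) = CARD('m)" "A - B = sym_basis_prod l" "0 < eps \<and> eps < eps0"
    then show "ennreal (C * (min (1 - lam) lam)\<^sup>2 * rate (Max (range l)) eps)
              \<le> inf_energy \<Omega> eps A B (lam *\<^sub>R A + (1 - lam) *\<^sub>R B)"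
      by (rule b[rule_format])
  qed
qed

end
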